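(* Let $T$ be a complete totally transcendental theory eliminating imaginaries, $A$ a small set of parameters, $M$ a prime model over $A$, and $G$ an $A$-definable group with $G(M)=G(\mathrm{mcl}(A))$. Then: (1) the definable Galois cohomology of $G$ over $\mathrm{mcl}(A)$ is trivial: $H^1_{\mathrm{def}}(M/\mathrm{mcl}(A),G(M))=1$; (2) the natural map induced by the intermediate extension $A\subseteq\mathrm{mcl}(A)\subseteq M$ gives an isomorphism of pointed sets $H^1_{\mathrm{def}}(\mathrm{mcl}(A)/A,G(\mathrm{mcl}(A)))\cong H^1_{\mathrm{def}}(A,G)$; (3) any definable Galois extension of $A$ in $M$ relative to $G$ is contained in $\mathrm{mcl}(A)$.
   Context: $A$ lies in a monster model $\bar M$ of $T$, $M\prec\bar M$, and $\mathrm{dcl}$ is computed in $\bar M$. The minimal closure of $A$ in $M$ is $\mathrm{mcl}(A)=\bigcap_\gamma\gamma(M)$, where $\gamma$ ranges over all elementary embeddings $\gamma:M\to M$ fixing $A$ pointwise. $M$ is also prime over $\mathrm{mcl}(A)$. For an $A$-definable set $W$ and $B\subseteq M$, $W(B)$ is the set of points of $W$ with all coordinates in $B$. A set $A\subseteq B\subseteq M$ is normal (over $A$ in $M$) if for all $b\in B$, $b'\in M$ with $\mathrm{tp}(b/A)=\mathrm{tp}(b'/A)$ one has $b'\in B$; $\mathrm{mcl}(A)$ is normal. $\mathrm{Aut}(B/A)$ is the group of elementary permutations of $B$ fixing $A$ pointwise. For $B$ normal, a definable cocycle is a map $\varphi:\mathrm{Aut}(B/A)\to G(B)$ with $\varphi(\sigma\tau)=\varphi(\sigma)\sigma(\varphi(\tau))$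 for which there are a finite tuple $b$ from $B$ and an $A$-definable function $h$ with $\varphi(\sigma)=h(b,\sigma(b))$ for all $\sigma$. Cocycles $\varphi,\psi$ are cohomologous if for some $g\in G(B)$, $\varphi(\sigma)=g^{-1}\psi(\sigma)\sigma(g)$ for all $\sigma$. $H^1_{\mathrm{def}}(B/A,G(B))$ is the set of cohomology classes, pointed by the trivial class; equivalently, the pointed set of $A$-definable isomorphism classes of $A$-definable right principal homogeneous spaces for $G$ with a $B$-point. $H^1_{\mathrm{def}}(A,G)$ means $H^1_{\mathrm{def}}(M/A,G(M))$; $H^1_{\mathrm{def}}(M/\mathrm{mcl}(A),G(M))$ is defined in the same way with base $\mathrm{mcl}(A)$ in place of $A$. The natural map in (2) is induced by restriction $\mathrm{Aut}(M/A)\to\mathrm{Aut}(\mathrm{mcl}(A)/A)$ and inclusion $G(\mathrm{mcl}(A))\subseteq G(M)$. A type $p$ over $A$ is strongly internal to an $A$-definable set $X$ if $b'\in\mathrm{dcl}(A,X(\bar M),b)$ for all realizations $b,b'$ of $p$; it is weakly orthogonal to $X$ if it has a unique extension to a complete type over $\mathrm{dcl}(A,X(\bar M))$. A definable Galois extension of $A$ of finite type relative to $X$ is a set $\mathrm{dcl}(A,b)$, $b$ a finite tuple realizing a type over $A$ that is strongly internal and weakly orthogonal to $X$. A definable Galois extension of $A$ in $M$ relative to $X$ is a union of definable Galois extensions of finite type of $A$ relative to $X$ contained in $M$. In (3), $X=G$. *)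

theory Defs
  imports "HOL-Algebra.Bij"
begin

unbundle cardinal_syntax

section \<open>First-order logic\<close>

text \<open>
  A one-sorted language is given by its symbol types \<open>'f\<close>, \<open>'r\<close> (of arbitrary cardinality)
  and their arities; constants are nullary function symbols.  Variables are de Bruijn indices and
  assignments are finite tuples: \<open>wff L n \<phi>\<close> says that \<open>\<phi>\<close> is a formula of \<open>L\<close> in the free
  variables \<open>x\<^sub>0, \<dots>, x\<^sub>n\<^sub>-\<^sub>1\<close>, and only such formulas are evaluated, at tuples of length \<open>n\<close>.
\<close>

record ('f, 'r) lang =
  farity :: "'f \<Rightarrow> nat"
  rarity :: "'r \<Rightarrow> nat"

datatype 'f tm = Var nat | Fn 'f "'f tm list"

datatype ('f, 'r) fm =
    Eq "'f tm" "'f tm"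
  | Rel 'r "'f tm list"
  | Neg "('f, 'r) fm"
  | And "('f, 'r) fm" "('f, 'r) fm"
  | Ex "('f, 'r) fm"

fun wft :: "('f, 'r) lang \<Rightarrow> nat \<Rightarrow> 'f tm \<Rightarrow> bool" where
  "wft L n (Var i) \<longleftrightarrow> i < n"
| "wft L n (Fn f ts) \<longleftrightarrow> length ts = farity L f \<and> (\<forall>t\<in>set ts. wft L n t)"

fun wff :: "('f, 'r) lang \<Rightarrow> nat \<Rightarrow> ('f, 'r) fm \<Rightarrow> bool" where
  "wff L n (Eq t u) \<longleftrightarrow> wft L n t \<and> wft L n u"
| "wff L n (Rel r ts) \<longleftrightarrow> length ts = rarity L r \<and> (\<forall>t\<in>set ts. wft L n t)"
| "wff L n (Neg \<phi>) \<longleftrightarrow> wff L n \<phi>"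
| "wff L n (And \<phi> \<psi>) \<longleftrightarrow> wff L n \<phi> \<and> wff L n \<psi>"
| "wff L n (Ex \<phi>) \<longleftrightarrow> wff L (Suc n) \<phi>"

record ('f, 'r, 'm) struct =
  univ :: "'m set"
  fint :: "'f \<Rightarrow> 'm list \<Rightarrow> 'm"
  rint :: "'r \<Rightarrow> 'm list \<Rightarrow> bool"

definition tuples :: "nat \<Rightarrow> 'm set \<Rightarrow> 'm list set" where
  "tuples n B = {b. length b = n \<and> set b \<subseteq> B}"

definition structure_of :: "('f, 'r) lang \<Rightarrow> ('f, 'r, 'm) struct \<Rightarrow> bool" where
  "structure_of L S \<longleftrightarrow>
     univ S \<noteq> {} \<and> (\<forall>f. \<forall>xs\<in>tuples (farity L f) (univ S). fint S f xs \<in> univ S)"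

fun eval :: "('f, 'r, 'm) struct \<Rightarrow> 'm list \<Rightarrow> 'f tm \<Rightarrow> 'm" where
  "eval S e (Var i) = e ! i"
| "eval S e (Fn f ts) = fint S f (map (eval S e) ts)"

fun sat :: "('f, 'r, 'm) struct \<Rightarrow> 'm list \<Rightarrow> ('f, 'r) fm \<Rightarrow> bool" where
  "sat S e (Eq t u) \<longleftrightarrow> eval S e t = eval S e u"
| "sat S e (Rel r ts) \<longleftrightarrow> rint S r (map (eval S e) ts)"
| "sat S e (Neg \<phi>) \<longleftrightarrow> \<not> sat S e \<phi>"
| "sat S e (And \<phi> \<psi>) \<longleftrightarrow> sat S e \<phi> \<and> sat S e \<psi>"
| "sat S e (Ex \<phi>) \<longleftrightarrow> (\<exists>x\<in>univ S. sat S (x # e) \<phi>)"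

definition elementary_map ::
  "('f, 'r) lang \<Rightarrow> ('f, 'r, 'm) struct \<Rightarrow> ('f, 'r, 'n) struct \<Rightarrow> 'm set \<Rightarrow> ('m \<Rightarrow> 'n) \<Rightarrow> bool" where
  "elementary_map L N N' B f \<longleftrightarrow>
     B \<subseteq> univ N \<and> f ` B \<subseteq> univ N' \<and>
     (\<forall>b \<phi>. set b \<subseteq> B \<longrightarrow> wff L (length b) \<phi> \<longrightarrow> (sat N b \<phi> \<longleftrightarrow> sat N' (map f b) \<phi>))"

abbreviation substruct :: "('f, 'r, 'm) struct \<Rightarrow> 'm set \<Rightarrow> ('f, 'r, 'm) struct" where
  "substruct S M \<equiv> S\<lparr>univ := M\<rparr>"

definition elementary_substructure ::
  "('f, 'r) lang \<Rightarrow> ('f, 'r, 'm) struct \<Rightarrow> 'm set \<Rightarrow> bool" where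
  "elementary_substructure L S M \<longleftrightarrow>
     structure_of L (substruct S M) \<and> elementary_map L (substruct S M) S M (\<lambda>x. x)"

definition elementary_embedding ::
  "('f, 'r) lang \<Rightarrow> ('f, 'r, 'm) struct \<Rightarrow> ('f, 'r, 'n) struct \<Rightarrow> ('m \<Rightarrow> 'n) \<Rightarrow> bool" where
  "elementary_embedding L N N' f \<longleftrightarrow> elementary_map L N N' (univ N) f"


section \<open>Definable sets and types\<close>

text \<open>
  A formula with parameters from \<open>C\<close> in \<open>n\<close> variables is a pair of a parameter-free formula and
  the tuple of parameters substituted for its variables from \<open>x\<^sub>n\<close> on.
\<close>

definition formulas_over :: "('f, 'r) lang \<Rightarrow> 'm set \<Rightarrow> nat \<Rightarrow> (('f, 'r) fm \<times> 'm list) set" where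
  "formulas_over L C n = {(\<phi>, c). set c \<subseteq> C \<and> wff L (n + length c) \<phi>}"

definition realizes ::
  "('f, 'r, 'm) struct \<Rightarrow> (('f, 'r) fm \<times> 'm list) set \<Rightarrow> 'm list \<Rightarrow> bool" where
  "realizes S p b \<longleftrightarrow> (\<forall>(\<phi>, c)\<in>p. sat S (b @ c) \<phi>)"

definition definable ::
  "('f, 'r) lang \<Rightarrow> ('f, 'r, 'm) struct \<Rightarrow> 'm set \<Rightarrow> nat \<Rightarrow> 'm list set \<Rightarrow> bool" where
  "definable L S C n X \<longleftrightarrow>
     (\<exists>(\<phi>, c)\<in>formulas_over L C n. X = {x\<in>tuples n (univ S). sat S (x @ c) \<phi>})"

text \<open>\<open>h\<close> is a definable function with domain \<open>D\<close>; its values off \<open>D\<close> are irrelevant.\<close>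

definition definable_fun ::
  "('f, 'r) lang \<Rightarrow> ('f, 'r, 'm) struct \<Rightarrow> 'm set \<Rightarrow> nat \<Rightarrow> nat \<Rightarrow> 'm list set
     \<Rightarrow> ('m list \<Rightarrow> 'm list) \<Rightarrow> bool" where
  "definable_fun L S C k n D h \<longleftrightarrow>
     D \<subseteq> tuples k (univ S) \<and> h ` D \<subseteq> tuples n (univ S) \<and>
     definable L S C (k + n) {x @ h x | x. x \<in> D}"

definition dcl :: "('f, 'r) lang \<Rightarrow> ('f, 'r, 'm) struct \<Rightarrow> 'm set \<Rightarrow> 'm set" where
  "dcl L S C = {x. definable L S C 1 {[x]}}"

text \<open>Complete \<open>n\<close>-types over \<open>C\<close>, consistency being finite satisfiability in \<open>S\<close>.\<close>

definition complete_type ::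
  "('f, 'r) lang \<Rightarrow> ('f, 'r, 'm) struct \<Rightarrow> 'm set \<Rightarrow> nat \<Rightarrow> (('f, 'r) fm \<times> 'm list) set \<Rightarrow> bool" where
  "complete_type L S C n p \<longleftrightarrow>
     p \<subseteq> formulas_over L C n \<and>
     (\<forall>q. q \<subseteq> p \<longrightarrow> finite q \<longrightarrow> (\<exists>b\<in>tuples n (univ S). realizes S q b)) \<and>
     (\<forall>(\<phi>, c)\<in>formulas_over L C n. (\<phi>, c) \<in> p \<or> (Neg \<phi>, c) \<in> p)"

definition realizations ::
  "('f, 'r, 'm) struct \<Rightarrow> nat \<Rightarrow> (('f, 'r) fm \<times> 'm list) set \<Rightarrow> 'm list set" where
  "realizations S n p = {b\<in>tuples n (univ S). realizes S p b}"

text \<open>The points of \<open>W\<close> with all coordinates in \<open>B\<close>, and the set of all coordinates of points of \<open>W\<close>.\<close>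

definition points_in :: "'m list set \<Rightarrow> 'm set \<Rightarrow> 'm list set" where
  "points_in W B = {w\<in>W. set w \<subseteq> B}"

definition coords :: "'m list set \<Rightarrow> 'm set" where
  "coords W = (\<Union>w\<in>W. set w)"


section \<open>Theories\<close>

text \<open>
  HOL cannot quantify over all types inside a formula, so properties of a theory refer to its
  models with universe in a fixed type \<open>'m\<close>.  By Loewenheim-Skolem these detect completeness,
  total transcendence and elimination of imaginaries as soon as \<open>'m\<close> has at least as many
  elements as there are formulas; below, \<open>'m\<close> is the type carrying the monster model.
\<close>

definition model_of ::
  "('f, 'r) lang \<Rightarrow> ('f, 'r) fm set \<Rightarrow> ('f, 'r, 'm) struct \<Rightarrow> bool" where
  "model_of L T N \<longleftrightarrow> structure_of L N \<and> (\<forall>\<phi>\<in>T. sat N [] \<phi>)"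

definition complete_theory :: "'m itself \<Rightarrow> ('f, 'r) lang \<Rightarrow> ('f, 'r) fm set \<Rightarrow> bool" where
  "complete_theory _ L T \<longleftrightarrow>
     (\<forall>\<phi>\<in>T. wff L 0 \<phi>) \<and>
     (\<exists>N :: ('f, 'r, 'm) struct. model_of L T N) \<and>
     (\<forall>\<phi>. wff L 0 \<phi> \<longrightarrow>
        (\<forall>N :: ('f, 'r, 'm) struct. model_of L T N \<longrightarrow> sat N [] \<phi>) \<or>
        (\<forall>N :: ('f, 'r, 'm) struct. model_of L T N \<longrightarrow> sat N [] (Neg \<phi>)))"

text \<open>
  Tent and Ziegler, \<^emph>\<open>A Course in Model Theory\<close>, Section 5.2: no model has a binary tree of
  consistent formulas with parameters (equivalently, every formula has ordinal Morley rank).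
\<close>

definition totally_transcendental :: "'m itself \<Rightarrow> ('f, 'r) lang \<Rightarrow> ('f, 'r) fm set \<Rightarrow> bool" where
  "totally_transcendental _ L T \<longleftrightarrow>
     (\<forall>N :: ('f, 'r, 'm) struct. model_of L T N \<longrightarrow>
        \<not> (\<exists>n (X :: bool list \<Rightarrow> 'm list set). \<forall>s.
              definable L N (univ N) n (X s) \<and> X s \<noteq> {} \<and>
              X (s @ [False]) \<subseteq> X s \<and> X (s @ [True]) \<subseteq> X s \<and>
              X (s @ [False]) \<inter> X (s @ [True]) = {}))"

text \<open>
  Hodges, \<^emph>\<open>Model Theory\<close>, Section 4.4: in every model, each class of a \<open>\<emptyset>\<close>-definable equivalence
  relation on \<open>n\<close>-tuples is \<open>\<phi>(x, b)\<close> for some formula \<open>\<phi>\<close> and exactly one finite tuple \<open>b\<close>.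
\<close>

definition eliminates_imaginaries :: "'m itself \<Rightarrow> ('f, 'r) lang \<Rightarrow> ('f, 'r) fm set \<Rightarrow> bool" where
  "eliminates_imaginaries _ L T \<longleftrightarrow>
     (\<forall>N :: ('f, 'r, 'm) struct. model_of L T N \<longrightarrow>
        (\<forall>n \<epsilon>. wff L (n + n) \<epsilon> \<longrightarrow>
           equiv (tuples n (univ N))
             {(x, y). x \<in> tuples n (univ N) \<and> y \<in> tuples n (univ N) \<and> sat N (x @ y) \<epsilon>} \<longrightarrow>
           (\<forall>a\<in>tuples n (univ N). \<exists>k \<phi>. wff L (n + k) \<phi> \<and>
              (\<exists>!b. b \<in> tuples k (univ N) \<and>
                 {x\<in>tuples n (univ N). sat N (x @ b) \<phi>} =
                 {x\<in>tuples n (univ N). sat N (a @ x) \<epsilon>}))))"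


section \<open>Elementary permutations, the monster model, prime models\<close>

text \<open>
  Elements of \<open>Aut(B/A)\<close> are extensional on \<open>B\<close>, so that they are determined by their action on
  \<open>B\<close>; their product is \<open>compose B\<close>.
\<close>

definition Aut :: "('f, 'r) lang \<Rightarrow> ('f, 'r, 'm) struct \<Rightarrow> 'm set \<Rightarrow> 'm set \<Rightarrow> ('m \<Rightarrow> 'm) set" where
  "Aut L S B A = {\<sigma>\<in>Bij B. elementary_map L S S B \<sigma> \<and> (\<forall>a\<in>A. \<sigma> a = a)}"

text \<open>
  \<open>S\<close> is a monster model with respect to the cardinal \<open>\<kappa>\<close>: it is \<open>\<kappa>\<close>-saturated and strongly
  \<open>\<kappa>\<close>-homogeneous, and \<open>\<kappa>\<close> exceeds the number of formulas.  A set is small if it has fewer than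
  \<open>\<kappa>\<close> elements.
\<close>

definition monster_model ::
  "('f, 'r) lang \<Rightarrow> ('f, 'r) fm set \<Rightarrow> 'k rel \<Rightarrow> ('f, 'r, 'm) struct \<Rightarrow> bool" where
  "monster_model L T \<kappa> S \<longleftrightarrow>
     model_of L T S \<and> Card_order \<kappa> \<and> |UNIV :: ('f, 'r) fm set| <o \<kappa> \<and>
     (\<forall>C n p. C \<subseteq> univ S \<longrightarrow> |C| <o \<kappa> \<longrightarrow> complete_type L S C n p \<longrightarrow> realizations S n p \<noteq> {}) \<and>
     (\<forall>C f. |C| <o \<kappa> \<longrightarrow> elementary_map L S S C f \<longrightarrow>
        (\<exists>\<sigma>\<in>Aut L S (univ S) {}. \<forall>c\<in>C. \<sigma> c = f c))"

definition prime_over ::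
  "('f, 'r) lang \<Rightarrow> ('f, 'r, 'm) struct \<Rightarrow> 'm set \<Rightarrow> bool" where
  "prime_over L M A \<longleftrightarrow>
     A \<subseteq> univ M \<and>
     (\<forall>(N :: ('f, 'r, 'm) struct) f. structure_of L N \<longrightarrow> elementary_map L M N A f \<longrightarrow>
        (\<exists>g. elementary_embedding L M N g \<and> (\<forall>a\<in>A. g a = f a)))"

definition mcl :: "('f, 'r) lang \<Rightarrow> ('f, 'r, 'm) struct \<Rightarrow> 'm set \<Rightarrow> 'm set \<Rightarrow> 'm set" where
  "mcl L S M A =
     \<Inter> {\<gamma> ` M | \<gamma>. elementary_embedding L (substruct S M) (substruct S M) \<gamma> \<and> (\<forall>a\<in>A. \<gamma> a = a)}"


section \<open>Definable Galois cohomology\<close>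

text \<open>An \<open>A\<close>-definable group, on a set of \<open>n\<close>-tuples of the monster model.\<close>

definition definable_group ::
  "('f, 'r) lang \<Rightarrow> ('f, 'r, 'm) struct \<Rightarrow> 'm set \<Rightarrow> nat \<Rightarrow> 'm list monoid \<Rightarrow> bool" where
  "definable_group L S A n G \<longleftrightarrow>
     group G \<and> definable L S A n (carrier G) \<and>
     definable L S A (n + n + n)
       {x @ y @ (x \<otimes>\<^bsub>G\<^esub> y) | x y. x \<in> carrier G \<and> y \<in> carrier G}"

definition cocycles ::
  "('f, 'r) lang \<Rightarrow> ('f, 'r, 'm) struct \<Rightarrow> 'm set \<Rightarrow> 'm set \<Rightarrow> nat \<Rightarrow> 'm list monoid
     \<Rightarrow> (('m \<Rightarrow> 'm) \<Rightarrow> 'm list) set" where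
  "cocycles L S B A n G =
     {\<phi> \<in> Aut L S B A \<rightarrow>\<^sub>E points_in (carrier G) B.
        (\<forall>\<sigma>\<in>Aut L S B A. \<forall>\<tau>\<in>Aut L S B A.
           \<phi> (compose B \<sigma> \<tau>) = \<phi> \<sigma> \<otimes>\<^bsub>G\<^esub> map \<sigma> (\<phi> \<tau>)) \<and>
        (\<exists>b D h. set b \<subseteq> B \<and> definable_fun L S A (length b + length b) n D h \<and>
           (\<forall>\<sigma>\<in>Aut L S B A. b @ map \<sigma> b \<in> D \<and> \<phi> \<sigma> = h (b @ map \<sigma> b)))}"

definition cohomologous ::
  "('f, 'r) lang \<Rightarrow> ('f, 'r, 'm) struct \<Rightarrow> 'm set \<Rightarrow> 'm set \<Rightarrow> nat \<Rightarrow> 'm list monoid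
     \<Rightarrow> (('m \<Rightarrow> 'm) \<Rightarrow> 'm list) rel" where
  "cohomologous L S B A n G =
     {(\<phi>, \<psi>). \<phi> \<in> cocycles L S B A n G \<and> \<psi> \<in> cocycles L S B A n G \<and>
        (\<exists>g\<in>points_in (carrier G) B. \<forall>\<sigma>\<in>Aut L S B A.
           \<phi> \<sigma> = inv\<^bsub>G\<^esub> g \<otimes>\<^bsub>G\<^esub> \<psi> \<sigma> \<otimes>\<^bsub>G\<^esub> map \<sigma> g)}"

text \<open>The pointed set \<open>H\<^sup>1\<close> of \<open>B/A\<close> with coefficients \<open>G(B)\<close>, and its base point.\<close>

definition H1 ::
  "('f, 'r) lang \<Rightarrow> ('f, 'r, 'm) struct \<Rightarrow> 'm set \<Rightarrow> 'm set \<Rightarrow> nat \<Rightarrow> 'm list monoid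
     \<Rightarrow> (('m \<Rightarrow> 'm) \<Rightarrow> 'm list) set set" where
  "H1 L S B A n G = cocycles L S B A n G // cohomologous L S B A n G"

definition trivial_class ::
  "('f, 'r) lang \<Rightarrow> ('f, 'r, 'm) struct \<Rightarrow> 'm set \<Rightarrow> 'm set \<Rightarrow> nat \<Rightarrow> 'm list monoid
     \<Rightarrow> (('m \<Rightarrow> 'm) \<Rightarrow> 'm list) set" where
  "trivial_class L S B A n G = cohomologous L S B A n G `` {\<lambda>\<sigma>\<in>Aut L S B A. \<one>\<^bsub>G\<^esub>}"

text \<open>
  For \<open>A \<subseteq> B \<subseteq> M\<close>: the map on cocycles induced by restriction \<open>Aut(M/A) \<rightarrow> Aut(B/A)\<close> and the
  inclusion \<open>G(B) \<subseteq> G(M)\<close>, and the map it induces on cohomology classes.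
\<close>

definition inflate ::
  "('f, 'r) lang \<Rightarrow> ('f, 'r, 'm) struct \<Rightarrow> 'm set \<Rightarrow> 'm set \<Rightarrow> 'm set
     \<Rightarrow> (('m \<Rightarrow> 'm) \<Rightarrow> 'm list) \<Rightarrow> (('m \<Rightarrow> 'm) \<Rightarrow> 'm list)" where
  "inflate L S M B A \<phi> = (\<lambda>\<sigma>\<in>Aut L S M A. \<phi> (restrict \<sigma> B))"

definition natural_map ::
  "('f, 'r) lang \<Rightarrow> ('f, 'r, 'm) struct \<Rightarrow> 'm set \<Rightarrow> 'm set \<Rightarrow> 'm set \<Rightarrow> nat \<Rightarrow> 'm list monoid
     \<Rightarrow> (('m \<Rightarrow> 'm) \<Rightarrow> 'm list) set \<Rightarrow> (('m \<Rightarrow> 'm) \<Rightarrow> 'm list) set" where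
  "natural_map L S M B A n G c = cohomologous L S M A n G `` (inflate L S M B A ` c)"


section \<open>Definable Galois extensions\<close>

definition strongly_internal ::
  "('f, 'r) lang \<Rightarrow> ('f, 'r, 'm) struct \<Rightarrow> 'm set \<Rightarrow> 'm list set \<Rightarrow> nat
     \<Rightarrow> (('f, 'r) fm \<times> 'm list) set \<Rightarrow> bool" where
  "strongly_internal L S A X n p \<longleftrightarrow>
     (\<forall>b\<in>realizations S n p. \<forall>b'\<in>realizations S n p.
        set b' \<subseteq> dcl L S (A \<union> coords X \<union> set b))"

definition weakly_orthogonal ::
  "('f, 'r) lang \<Rightarrow> ('f, 'r, 'm) struct \<Rightarrow> 'm set \<Rightarrow> 'm list set \<Rightarrow> nat
     \<Rightarrow> (('f, 'r) fm \<times> 'm list) set \<Rightarrow> bool" where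
  "weakly_orthogonal L S A X n p \<longleftrightarrow>
     (\<exists>!q. complete_type L S (dcl L S (A \<union> coords X)) n q \<and> p \<subseteq> q)"

definition galois_extension_finite_type ::
  "('f, 'r) lang \<Rightarrow> ('f, 'r, 'm) struct \<Rightarrow> 'm set \<Rightarrow> 'm list set \<Rightarrow> 'm set \<Rightarrow> bool" where
  "galois_extension_finite_type L S A X E \<longleftrightarrow>
     (\<exists>n p b. complete_type L S A n p \<and> b \<in> realizations S n p \<and>
        strongly_internal L S A X n p \<and> weakly_orthogonal L S A X n p \<and>
        E = dcl L S (A \<union> set b))"

definition galois_extension_in ::
  "('f, 'r) lang \<Rightarrow> ('f, 'r, 'm) struct \<Rightarrow> 'm set \<Rightarrow> 'm set \<Rightarrow> 'm list set \<Rightarrow> 'm set \<Rightarrow> bool" where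
  "galois_extension_in L S M A X E \<longleftrightarrow>
     (\<exists>\<F>. (\<forall>F\<in>\<F>. galois_extension_finite_type L S A X F \<and> F \<subseteq> M) \<and> E = \<Union>\<F>)"

end

theory Submission
  imports Defs "HOL-Library.Countable_Set"
begin

text \<open>
  Over the minimal closure everything is seen from all the models \<open>\<gamma>(M)\<close> at once.  A definable cocycle
  \<open>\<sigma> \<mapsto> h(b, \<sigma> b)\<close> of \<open>M\<close> over \<open>E \<subseteq> mcl(A)\<close> gives a principal homogeneous space over \<open>E\<close>, a quotient of
  \<open>\<Theta> \<times> G\<close> where \<open>\<Theta>\<close> isolates the type of \<open>b\<close>.  It has a point in \<open>\<gamma>(M)\<close>, which differs from the class of \<open>b\<close>
  by an element of \<open>G(M) = G(mcl(A)) \<subseteq> \<gamma>(M)\<close>; hence the class of \<open>b\<close>, coded by a tuple by elimination of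
  imaginaries, lies in every \<open>\<gamma>(M)\<close>, i.e. in \<open>mcl(A)\<close>.  The same argument applies to strongly internal types.

  This needs that \<open>M\<close> is atomic and homogeneous over \<open>A\<close> and over \<open>mcl(A)\<close>.  In a totally transcendental
  theory the type of a finite tuple over any set \<open>C\<close> is definable over a finite part of \<open>C\<close>.  By primeness \<open>M\<close> embeds
  into a constructible model \<open>N\<close>; Ressayre's back-and-forth along the closed subsets of \<open>N\<close> works for
  \<open>M\<close> as well when restricted to closed sets \<open>C\<close> whose type over \<open>M\<close> is definable over \<open>C \<inter> M\<close>, and
  there are enough of them because types have finite bases.
\<close>

section \<open>Closure properties of definable sets\<close>

text \<open>Total transcendence is given by the absence of binary trees, without any ordinal rank.
  It enters only through \<open>unsplittable_set\<close>: a nonempty family of nonempty definable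
  sets has a member containing no two disjoint members. For the nonempty sets definable over
  \<open>D\<close> this gives isolated types; for the sets of unbounded local rank, finite local
  ranks; for the complement of an ideal, the atoms behind finite bases. The obstacle is that
  \<open>M\<close> is only known to sit inside a constructible \<open>N\<close>. A closed subset
  \<open>C\<close> of \<open>N\<close> may contain parameters outside \<open>M\<close>, and
  isolation over \<open>C\<close> says nothing about isolation over \<open>C \<inter> M\<close>
  until such parameters can be traded for ones in \<open>M\<close>. Over mcl(A), for which no
  closedness is available, normality does the work: an element of \<open>M\<close> with the type
  over \<open>A\<close> of an element of mcl(A) is again in mcl(A). For (2), an automorphism of
  mcl(A) is never extended to \<open>M\<close> as a whole. A definable cocycle sees only the image
  of a finite tuple, and homogeneity supplies an automorphism of \<open>M\<close> with that
  image.\<close>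

lemma tuples_append [intro]: "x \<in> tuples m B \<Longrightarrow> y \<in> tuples k B \<Longrightarrow> x @ y \<in> tuples (m + k) B"
  by (auto simp: tuples_def)

lemma tuples_add_cases:
  assumes "w \<in> tuples (m + k) B"
  obtains x y where "x \<in> tuples m B" "y \<in> tuples k B" "w = x @ y"
proof
  show "take m w \<in> tuples m B" "drop m w \<in> tuples k B"
    using assms by (auto simp: tuples_def dest: in_set_takeD in_set_dropD)
qed simp

lemma append_tuples_inject:
  "x \<in> tuples m B \<Longrightarrow> x' \<in> tuples m B' \<Longrightarrow> x @ y = x' @ y' \<longleftrightarrow> x = x' \<and> y = y'"
  by (auto simp: tuples_def)

lemma eval_cong:
  "wft L n t \<Longrightarrow> (\<And>i. i < n \<Longrightarrow> e ! i = e' ! i) \<Longrightarrow> eval S e t = eval S e' t"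
proof (induction t)
  case (Fn f ts)
  then have "map (eval S e) ts = map (eval S e') ts" by auto
  then show ?case by (metis eval.simps(2))
qed simp

lemma sat_cong:
  "wff L n \<phi> \<Longrightarrow> (\<And>i. i < n \<Longrightarrow> e ! i = e' ! i) \<Longrightarrow> sat S e \<phi> = sat S e' \<phi>"
proof (induction \<phi> arbitrary: n e e')
  case (Eq t u)
  then show ?case using eval_cong[of L n t e e' S] eval_cong[of L n u e e' S] by auto
next
  case (Rel r ts)
  then have "map (eval S e) ts = map (eval S e') ts" using eval_cong[of L n _ e e' S] by simp
  then show ?case by (metis sat.simps(2))
next
  case (Ex \<phi>)
  have "sat S (x # e) \<phi> = sat S (x # e') \<phi>" for x
    by (rule Ex.IH[of "Suc n"]) (use Ex.prems in \<open>auto simp: nth_Cons split: nat.split\<close>)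
  then show ?case by simp
next
  case (Neg \<phi>)
  have "sat S e \<phi> = sat S e' \<phi>"
    by (rule Neg.IH[of n]) (use Neg.prems(1) in simp, rule Neg.prems(2))
  then show ?case by simp
next
  case (And \<phi> \<psi>)
  have "sat S e \<phi> = sat S e' \<phi>"
    by (rule And.IH(1)[of n]) (use And.prems(1) in simp, rule And.prems(2))
  moreover have "sat S e \<psi> = sat S e' \<psi>"
    by (rule And.IH(2)[of n]) (use And.prems(1) in simp, rule And.prems(2))
  ultimately show ?case by simp
qed

lemma wff_mono: "wff L n \<phi> \<Longrightarrow> n \<le> m \<Longrightarrow> wff L m \<phi>"
proof -
  have wft_mono: "wft L n t \<Longrightarrow> n \<le> m \<Longrightarrow> wft L m t" for n m t
    by (induction t) auto
  show "wff L n \<phi> \<Longrightarrow> n \<le> m \<Longrightarrow> wff L m \<phi>"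
    by (induction \<phi> arbitrary: n m) (auto dest: wft_mono)
qed

lemma wff_Ex_pow: "wff L n ((Ex ^^ k) \<phi>) \<longleftrightarrow> wff L (k + n) \<phi>"
  by (induction k arbitrary: n) auto

lemma sat_Ex_pow: "sat S e ((Ex ^^ k) \<phi>) \<longleftrightarrow> (\<exists>y\<in>tuples k (univ S). sat S (y @ e) \<phi>)"
proof (induction k arbitrary: e)
  case (Suc k)
  have "(\<exists>x\<in>univ S. \<exists>y\<in>tuples k (univ S). sat S (y @ x # e) \<phi>) \<longleftrightarrow>
    (\<exists>y\<in>tuples (Suc k) (univ S). sat S (y @ e) \<phi>)" (is "?l \<longleftrightarrow> ?r")
  proof
    assume ?l
    then obtain x y where "x \<in> univ S" "y \<in> tuples k (univ S)" "sat S (y @ x # e) \<phi>" by blast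
    then show ?r by (intro bexI[of _ "y @ [x]"]) (auto simp: tuples_def)
  next
    assume ?r
    then obtain y where y: "y \<in> tuples (k + 1) (univ S)" "sat S (y @ e) \<phi>" by auto
    then obtain u v where "u \<in> tuples k (univ S)" "v \<in> tuples 1 (univ S)" "y = u @ v"
      by (blast elim: tuples_add_cases)
    moreover then obtain a where "v = [a]" "a \<in> univ S" by (auto simp: tuples_def length_Suc_conv)
    ultimately show ?l using y(2) by (intro bexI[of _ a] bexI[of _ u]) simp_all
  qed
  then show ?case using Suc by simp
qed (auto simp: tuples_def)

lemma sat_foldr_And:
  "sat S e (foldr (\<lambda>i. And (Eq (Var i) (Var (s i)))) is \<phi>) \<longleftrightarrow>
    (\<forall>i\<in>set is. e ! i = e ! s i) \<and> sat S e \<phi>"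
  by (induction "is") auto

lemma wff_foldr_And:
  "wff L n (foldr (\<lambda>i. And (Eq (Var i) (Var (s i)))) is \<phi>) \<longleftrightarrow>
    (\<forall>i\<in>set is. i < n \<and> s i < n) \<and> wff L n \<phi>"
  by (induction "is") auto

text \<open>
  A definable predicate on an environment \<open>e \<in> E\<close>, a nested pair of tuples flattened by \<open>v\<close>, and
  a tuple-valued term over it whose entries are entries of \<open>v e\<close> or constants from \<open>C\<close>.  The rules
  for these two notions prove definability by structural recursion on a HOL predicate.
\<close>

definition term_val :: "'m list \<Rightarrow> (nat + 'm) list \<Rightarrow> 'm list" where
  "term_val e ss = map (case_sum (\<lambda>i. e ! i) (\<lambda>c. c)) ss"

definition defpred :: "('f, 'r) lang \<Rightarrow> ('f, 'r, 'm) struct \<Rightarrow> 'm set \<Rightarrow> nat \<Rightarrow> 'e set \<Rightarrow> ('e \<Rightarrow> 'm list)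
    \<Rightarrow> ('e \<Rightarrow> bool) \<Rightarrow> bool" where
  "defpred L S C N E v P \<longleftrightarrow> v ` E \<subseteq> tuples N (univ S) \<and>
     (\<exists>X. definable L S C N X \<and> (\<forall>e\<in>E. P e \<longleftrightarrow> v e \<in> X))"

definition defterm :: "('f, 'r, 'm) struct \<Rightarrow> 'm set \<Rightarrow> nat \<Rightarrow> 'e set \<Rightarrow> ('e \<Rightarrow> 'm list) \<Rightarrow> nat
    \<Rightarrow> ('e \<Rightarrow> 'm list) \<Rightarrow> bool" where
  "defterm S C N E v k t \<longleftrightarrow> v ` E \<subseteq> tuples N (univ S) \<and>
     (\<exists>ss. length ss = k \<and> set ss \<subseteq> {..<N} <+> C \<and> (\<forall>e\<in>E. t e = term_val (v e) ss))"

lemma definableI: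
  "wff L (n + length c) \<phi> \<Longrightarrow> set c \<subseteq> C \<Longrightarrow>
    X = {x\<in>tuples n (univ S). sat S (x @ c) \<phi>} \<Longrightarrow> definable L S C n X"
  unfolding definable_def formulas_over_def by blast

lemma definableE:
  assumes "definable L S C n X"
  obtains \<phi> c where "wff L (n + length c) \<phi>" "set c \<subseteq> C" "X = {x\<in>tuples n (univ S). sat S (x @ c) \<phi>}"
  using assms unfolding definable_def formulas_over_def by blast

lemma definable_subset: "definable L S C n X \<Longrightarrow> X \<subseteq> tuples n (univ S)"
  by (auto elim: definableE)

lemma definable_mono: "definable L S C n X \<Longrightarrow> C \<subseteq> D \<Longrightarrow> definable L S D n X"
  by (elim definableE, intro definableI) auto

lemma definable_Compl:
  assumes "definable L S C n X"
  shows "definable L S C n (tuples n (univ S) - X)"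
proof -
  from assms obtain \<phi> c where "wff L (n + length c) \<phi>" "set c \<subseteq> C"
    "X = {x\<in>tuples n (univ S). sat S (x @ c) \<phi>}" by (rule definableE)
  then show ?thesis by (intro definableI[where \<phi> = "Neg \<phi>" and c = c]) auto
qed

text \<open>Substitution without a syntactic substitution operation: the \<open>K\<close> variables
  of \<phi> are quantified existentially, and each is equated with the entry of \<open>e @ p\<close>
  that it stands for. The parameters of \<phi> are treated as further constant entries, so they need
  no separate case.\<close>

lemma definable_term_vimage:
  assumes X: "definable L S C k X" and C: "C \<subseteq> univ S"
    and ss: "length ss = k" "set ss \<subseteq> {..<N} <+> C"
  shows "definable L S C N {e\<in>tuples N (univ S). term_val e ss \<in> X}"
proof -
  from X obtain \<phi> c where \<phi>: "wff L (k + length c) \<phi>" and c: "set c \<subseteq> C"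
    and Xeq: "X = {x\<in>tuples k (univ S). sat S (x @ c) \<phi>}" by (rule definableE)
  define ss' where "ss' = ss @ map Inr c"
  define p where "p = concat (map (case_sum (\<lambda>i. []) (\<lambda>c. [c])) ss')"
  define K where "K = k + length c"
  have K: "length ss' = K" using ss by (simp add: ss'_def K_def)
  have p: "set p \<subseteq> C" using ss(2) c by (fastforce simp: p_def ss'_def split: sum.splits)
  have "\<exists>i < N + length p. \<forall>e\<in>tuples N (univ S). term_val e ss' ! j = (e @ p) ! i" if j: "j < K" for j
  proof (cases "ss' ! j")
    case (Inl i)
    then have "Inl i \<in> set ss'" using j K by (metis nth_mem)
    then have "i < N" using ss(2) by (auto simp: ss'_def)
    then show ?thesis using Inl j K by (intro exI[of _ i]) (auto simp: term_val_def nth_append tuples_def)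
  next
    case (Inr d)
    then have "d \<in> set p" using j K nth_mem[of j ss'] by (force simp: p_def)
    then obtain i where "i < length p" "p ! i = d" by (auto simp: in_set_conv_nth)
    then show ?thesis using Inr j K
      by (intro exI[of _ "N + i"]) (auto simp: term_val_def nth_append tuples_def)
  qed
  then obtain s where s: "\<And>j. j < K \<Longrightarrow> s j < N + length p"
    "\<And>j e. j < K \<Longrightarrow> e \<in> tuples N (univ S) \<Longrightarrow> term_val e ss' ! j = (e @ p) ! s j" by metis
  \<comment> \<open>The quantified variables come first in the de Bruijn order, so positions in
    \<open>e @ p\<close> are shifted by \<open>K\<close>.\<close>
  define \<psi> where "\<psi> = (Ex ^^ K) (foldr (\<lambda>i. And (Eq (Var i) (Var (K + s i)))) [0..<K] \<phi>)"
  show ?thesis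
  proof (rule definableI[where \<phi> = \<psi> and c = p])
    show "wff L (N + length p) \<psi>"
      unfolding \<psi>_def wff_Ex_pow wff_foldr_And using s(1) \<phi> wff_mono[OF \<phi>] by (auto simp: K_def)
    show "set p \<subseteq> C" by fact
    have "term_val e ss \<in> X \<longleftrightarrow> sat S (e @ p) \<psi>" if e: "e \<in> tuples N (univ S)" for e
    proof -
      have tv: "term_val e ss' = term_val e ss @ c" by (simp add: ss'_def term_val_def comp_def)
      have "set (term_val e ss) \<subseteq> univ S"
        using e ss(2) C by (fastforce simp: term_val_def tuples_def dest: nth_mem split: sum.splits)
      then have tU: "term_val e ss \<in> tuples k (univ S)" "term_val e ss' \<in> tuples K (univ S)"
        using ss(1) c C by (auto simp: tv tuples_def K_def) (auto simp: term_val_def)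
      have eq: "(\<forall>i<K. (y @ e @ p) ! i = (y @ e @ p) ! (K + s i)) \<longleftrightarrow> y = term_val e ss'"
        if "y \<in> tuples K (univ S)" for y
        using that tU(2) s(2)[OF _ e] by (auto simp: tuples_def nth_append list_eq_iff_nth_eq)
      have "sat S (e @ p) \<psi> \<longleftrightarrow> (\<exists>y\<in>tuples K (univ S). y = term_val e ss' \<and> sat S (y @ e @ p) \<phi>)"
        unfolding \<psi>_def sat_Ex_pow sat_foldr_And
        by (rule bex_cong[OF refl]) (simp only: set_upt atLeastLessThan_iff le0 simp_thms Ball_def eq[unfolded Ball_def])
      also have "\<dots> \<longleftrightarrow> sat S (term_val e ss' @ e @ p) \<phi>" using tU(2) by auto
      also have "\<dots> \<longleftrightarrow> sat S (term_val e ss') \<phi>"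
        by (rule sat_cong[OF \<phi>]) (use tU(2) in \<open>auto simp: tuples_def nth_append K_def\<close>)
      also have "\<dots> \<longleftrightarrow> term_val e ss \<in> X" using tU(1) by (simp add: Xeq tv)
      finally show ?thesis by simp
    qed
    then show "{e\<in>tuples N (univ S). term_val e ss \<in> X} = {x\<in>tuples N (univ S). sat S (x @ p) \<psi>}"
      by blast
  qed
qed

text \<open>The two formulas come with different parameter tuples. The second is rewritten with a
  gap at the place of \<open>c\<close>, after which both can be evaluated at
  \<open>x @ c @ d\<close>.\<close>

lemma definable_Int:
  fixes S :: "('f, 'r, 'm) struct"
  assumes C: "C \<subseteq> univ S" and X: "definable L S C n X" and Y: "definable L S C n Y"
  shows "definable L S C n (X \<inter> Y)"
proof -
  from X obtain \<phi> c where \<phi>: "wff L (n + length c) \<phi>" "set c \<subseteq> C"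
    and Xeq: "X = {x\<in>tuples n (univ S). sat S (x @ c) \<phi>}" by (rule definableE)
  from Y obtain \<psi> d where \<psi>: "wff L (n + length d) \<psi>" "set d \<subseteq> C"
    and Yeq: "Y = {x\<in>tuples n (univ S). sat S (x @ d) \<psi>}" by (rule definableE)
  define k where "k = length c"
  define l where "l = length d"
  define ss :: "(nat + 'm) list" where "ss = map Inl ([0..<n] @ [n + k..<n + k + l])"
  have "definable L S {} (n + l) {z\<in>tuples (n + l) (univ S). sat S z \<psi>}"
    by (rule definableI[where \<phi> = \<psi> and c = "[]"]) (use \<psi> in \<open>auto simp: l_def\<close>)
  then have "definable L S {} (n + k + l)
      {e\<in>tuples (n + k + l) (univ S). term_val e ss \<in> {z\<in>tuples (n + l) (univ S). sat S z \<psi>}}"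
    by (rule definable_term_vimage) (auto simp: ss_def)
  then obtain \<psi>' where \<psi>': "wff L (n + k + l) \<psi>'"
    "{e\<in>tuples (n + k + l) (univ S). term_val e ss \<in> {z\<in>tuples (n + l) (univ S). sat S z \<psi>}} =
     {e\<in>tuples (n + k + l) (univ S). sat S e \<psi>'}" by (auto elim!: definableE)
  show ?thesis
  proof (rule definableI[where \<phi> = "And \<phi> \<psi>'" and c = "c @ d"])
    show "wff L (n + length (c @ d)) (And \<phi> \<psi>')"
      using \<phi> \<psi>' wff_mono[OF \<phi>(1)] by (simp add: k_def l_def add.assoc)
    have "(x \<in> X \<longleftrightarrow> sat S (x @ c @ d) \<phi>) \<and> (x \<in> Y \<longleftrightarrow> sat S (x @ c @ d) \<psi>')"
      if x: "x \<in> tuples n (univ S)" for x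
    proof
      have "sat S (x @ c) \<phi> = sat S (x @ c @ d) \<phi>"
        by (rule sat_cong[OF \<phi>(1)]) (use x in \<open>auto simp: nth_append tuples_def\<close>)
      then show "x \<in> X \<longleftrightarrow> sat S (x @ c @ d) \<phi>" using x by (simp add: Xeq)
      have t: "term_val (x @ c @ d) ss = x @ d"
        by (rule nth_equalityI)
          (use x in \<open>auto simp: ss_def term_val_def tuples_def k_def l_def nth_append\<close>)
      have "x @ c @ d \<in> tuples (n + k + l) (univ S)" "x @ d \<in> tuples (n + l) (univ S)"
        using x \<phi>(2) \<psi>(2) C by (auto simp: tuples_def k_def l_def)
      then have "sat S (x @ d) \<psi> \<longleftrightarrow> sat S (x @ c @ d) \<psi>'"
        using \<psi>'(2) t by (smt (verit, best) mem_Collect_eq)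
      then show "x \<in> Y \<longleftrightarrow> sat S (x @ c @ d) \<psi>'" using x by (simp add: Yeq)
    qed
    then show "X \<inter> Y = {x \<in> tuples n (univ S). sat S (x @ c @ d) (And \<phi> \<psi>')}"
      using definable_subset[OF X] by auto
  qed (use \<phi> \<psi> in auto)
qed

lemma definable_Ex:
  assumes "definable L S C (k + n) X"
  shows "definable L S C n {e\<in>tuples n (univ S). \<exists>x\<in>tuples k (univ S). x @ e \<in> X}"
proof -
  from assms obtain \<phi> c where \<phi>: "wff L (k + n + length c) \<phi>" "set c \<subseteq> C"
    and Xeq: "X = {x\<in>tuples (k + n) (univ S). sat S (x @ c) \<phi>}" by (rule definableE)
  show ?thesis
    by (rule definableI[where \<phi> = "(Ex ^^ k) \<phi>" and c = c])
      (use \<phi> in \<open>auto simp: wff_Ex_pow sat_Ex_pow Xeq add.assoc tuples_append\<close>)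
qed

lemma definable_eq:
  fixes S :: "('f, 'r, 'm) struct"
  shows "definable L S C (k + k) {z\<in>tuples (k + k) (univ S). take k z = drop k z}"
proof (rule definableI[where c = "[]"])
  \<comment> \<open>A closed formula is needed to build a tautology, because for
    \<open>k = 0\<close> there are no free variables.\<close>
  define \<chi> :: "('f, 'r) fm" where "\<chi> = Ex (Eq (Var 0) (Var 0))"
  define \<phi> :: "('f, 'r) fm" where
    "\<phi> = foldr (\<lambda>i. And (Eq (Var i) (Var (k + i)))) [0..<k] (Neg (And \<chi> (Neg \<chi>)))"
  show "wff L (k + k + length []) \<phi>"
    unfolding \<phi>_def wff_foldr_And by (auto simp: \<chi>_def)
  show "{z\<in>tuples (k + k) (univ S). take k z = drop k z} =
    {x \<in> tuples (k + k) (univ S). sat S (x @ []) \<phi>}"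
    unfolding \<phi>_def sat_foldr_And by (auto simp: tuples_def list_eq_iff_nth_eq)
qed simp

lemma definable_UNIV:
  fixes S :: "('f, 'r, 'm) struct"
  shows "definable L S C k (tuples k (univ S))"
proof (rule definableI[where c = "[]"])
  define \<chi> :: "('f, 'r) fm" where "\<chi> = Ex (Eq (Var 0) (Var 0))"
  show "wff L (k + length []) (Neg (And \<chi> (Neg \<chi>)))" by (auto simp: \<chi>_def)
qed auto

lemma term_val_append: "term_val e (s @ t) = term_val e s @ term_val e t"
  by (simp add: term_val_def)

lemma definable_terms_eq:
  assumes "C \<subseteq> univ S" "length s = k" "set s \<subseteq> {..<N} <+> C" "length t = k" "set t \<subseteq> {..<N} <+> C"
  shows "definable L S C N {e\<in>tuples N (univ S). term_val e s = term_val e t}"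
proof -
  let ?D = "{z\<in>tuples (k + k) (univ S). take k z = drop k z}"
  have "term_val e s = term_val e t \<longleftrightarrow> term_val e (s @ t) \<in> ?D" if e: "e \<in> tuples N (univ S)" for e
  proof -
    have "set (term_val e (s @ t)) \<subseteq> univ S"
      using assms e by (fastforce simp: term_val_def tuples_def dest: nth_mem split: sum.splits)
    moreover have "length (term_val e s) = k" "length (term_val e t) = k"
      using assms by (simp_all add: term_val_def)
    ultimately show ?thesis by (simp add: tuples_def term_val_append)
  qed
  then have "{e\<in>tuples N (univ S). term_val e s = term_val e t} =
    {e\<in>tuples N (univ S). term_val e (s @ t) \<in> ?D}" by blast
  moreover have "definable L S C N \<dots>"
    by (rule definable_term_vimage[OF definable_eq]) (use assms in auto)
  ultimately show ?thesis by simp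
qed

lemma defterm_id: "defterm S C N (tuples N (univ S)) (\<lambda>e. e) N (\<lambda>e. e)"
  unfolding defterm_def
  by (auto intro!: exI[of _ "map Inl [0..<N]"] nth_equalityI simp: term_val_def tuples_def)

text \<open>The newly bound tuple goes in front, matching the quantifier blocks of
  \<open>definable_Ex\<close>, which bind the first entries.\<close>

definition consE :: "('e \<Rightarrow> 'm list) \<Rightarrow> 'm list \<times> 'e \<Rightarrow> 'm list" where
  "consE v = (\<lambda>p. fst p @ v (snd p))"

definition is_env :: "('f, 'r, 'm) struct \<Rightarrow> nat \<Rightarrow> 'e set \<Rightarrow> ('e \<Rightarrow> 'm list) \<Rightarrow> bool" where
  "is_env S N E v \<longleftrightarrow> v ` E \<subseteq> tuples N (univ S)"

lemma is_env_id: "is_env S N (tuples N (univ S)) (\<lambda>e. e)"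
  by (simp add: is_env_def)

lemma is_env_cons: "is_env S N E v \<Longrightarrow> is_env S (k + N) (tuples k (univ S) \<times> E) (consE v)"
  by (auto simp: is_env_def consE_def intro!: tuples_append)

lemma defterm_fst:
  assumes "is_env S N E v"
  shows "defterm S C (k + N) (tuples k (univ S) \<times> E) (consE v) k (\<lambda>p. fst p)"
  unfolding defterm_def
proof (intro conjI exI[of _ "map Inl [0..<k]"] ballI)
  fix p assume "p \<in> tuples k (univ S) \<times> E"
  then show "fst p = term_val (consE v p) (map Inl [0..<k])"
    by (intro nth_equalityI) (auto simp: term_val_def tuples_def consE_def nth_append)
qed (use is_env_cons[OF assms] in \<open>auto simp: is_env_def\<close>)

lemma defterm_snd:
  assumes "defterm S C N E v k t"
  shows "defterm S C (j + N) (tuples j (univ S) \<times> E) (consE v) k (\<lambda>p. t (snd p))"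
proof -
  from assms obtain ss where ss: "length ss = k" "set ss \<subseteq> {..<N} <+> C"
    "\<forall>e\<in>E. t e = term_val (v e) ss" "v ` E \<subseteq> tuples N (univ S)" unfolding defterm_def by blast
  show ?thesis unfolding defterm_def
  proof (intro conjI exI[of _ "map (map_sum ((+) j) id) ss"] ballI)
    fix p assume "p \<in> tuples j (univ S) \<times> E"
    then show "t (snd p) = term_val (consE v p) (map (map_sum ((+) j) id) ss)"
      using ss(2,3) by (auto simp: term_val_def tuples_def consE_def split: sum.split)
  qed (use ss is_env_cons[of S N E v j] in \<open>auto simp: is_env_def dest!: subsetD\<close>)
qed

lemma defterm_append:
  assumes "defterm S C N E v k t" "defterm S C N E v l u"
  shows "defterm S C N E v (k + l) (\<lambda>e. t e @ u e)"
proof -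
  from assms obtain s s' where "length s = k" "set s \<subseteq> {..<N} <+> C"
    "\<forall>e\<in>E. t e = term_val (v e) s" "v ` E \<subseteq> tuples N (univ S)"
    "length s' = l" "set s' \<subseteq> {..<N} <+> C" "\<forall>e\<in>E. u e = term_val (v e) s'"
    unfolding defterm_def by blast
  then show ?thesis unfolding defterm_def
    by (auto intro!: exI[of _ "s @ s'"] simp: term_val_append)
qed

lemma defterm_const:
  "is_env S N E v \<Longrightarrow> set c \<subseteq> C \<Longrightarrow> defterm S C N E v (length c) (\<lambda>_. c)"
  unfolding defterm_def is_env_def
  by (auto intro!: exI[of _ "map Inr c"] simp: term_val_def comp_def)

lemma defpred_mem:
  assumes "C \<subseteq> univ S" "definable L S C k X" "defterm S C N E v k' t" "k' = k"
  shows "defpred L S C N E v (\<lambda>e. t e \<in> X)"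
proof -
  from assms(3,4) obtain ss where ss: "length ss = k" "set ss \<subseteq> {..<N} <+> C"
    "\<forall>e\<in>E. t e = term_val (v e) ss" "v ` E \<subseteq> tuples N (univ S)" unfolding defterm_def by blast
  from definable_term_vimage[OF assms(2,1) ss(1,2)] show ?thesis
    unfolding defpred_def using ss by (intro conjI exI) auto
qed

lemma defpred_eq:
  assumes "C \<subseteq> univ S" "defterm S C N E v k t" "defterm S C N E v k' u" "k' = k"
  shows "defpred L S C N E v (\<lambda>e. t e = u e)"
proof -
  from assms(2,3,4) obtain s s' where s: "length s = k" "set s \<subseteq> {..<N} <+> C"
    "\<forall>e\<in>E. t e = term_val (v e) s" "v ` E \<subseteq> tuples N (univ S)"
    "length s' = k" "set s' \<subseteq> {..<N} <+> C" "\<forall>e\<in>E. u e = term_val (v e) s'"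
    unfolding defterm_def by blast
  from definable_terms_eq[OF assms(1) s(1,2,5,6)] show ?thesis
    unfolding defpred_def using s by (intro conjI exI) auto
qed

lemma defpred_not: "defpred L S C N E v P \<Longrightarrow> defpred L S C N E v (\<lambda>e. \<not> P e)"
  unfolding defpred_def using definable_Compl by (smt (verit) DiffE DiffI image_subset_iff)

lemma defpred_conj:
  "C \<subseteq> univ S \<Longrightarrow> defpred L S C N E v P \<Longrightarrow> defpred L S C N E v Q \<Longrightarrow>
    defpred L S C N E v (\<lambda>e. P e \<and> Q e)"
  unfolding defpred_def by (metis IntE IntI definable_Int)

lemma defpred_disj:
  "C \<subseteq> univ S \<Longrightarrow> defpred L S C N E v P \<Longrightarrow> defpred L S C N E v Q \<Longrightarrow>
    defpred L S C N E v (\<lambda>e. P e \<or> Q e)"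
  using defpred_not[OF defpred_conj[OF _ defpred_not defpred_not], of C S L N E v P Q] by simp

lemma defpred_imp:
  "C \<subseteq> univ S \<Longrightarrow> defpred L S C N E v P \<Longrightarrow> defpred L S C N E v Q \<Longrightarrow>
    defpred L S C N E v (\<lambda>e. P e \<longrightarrow> Q e)"
  using defpred_not[OF defpred_conj[OF _ _ defpred_not], of C S L N E v P Q] by simp

lemma defpred_iff:
  "C \<subseteq> univ S \<Longrightarrow> defpred L S C N E v P \<Longrightarrow> defpred L S C N E v Q \<Longrightarrow>
    defpred L S C N E v (\<lambda>e. P e = Q e)"
  using defpred_conj[OF _ defpred_imp defpred_imp, of C S L N E v P Q Q P]
  by (simp add: iff_conv_conj_imp)

lemma defpred_bex:
  assumes C: "C \<subseteq> univ S" and W: "definable L S C k W" and E: "is_env S N E v"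
    and P: "defpred L S C (k + N) (tuples k (univ S) \<times> E) (consE v) (\<lambda>p. P (fst p) (snd p))"
  shows "defpred L S C N E v (\<lambda>e. \<exists>x\<in>W. P x e)"
proof -
  have "defpred L S C (k + N) (tuples k (univ S) \<times> E) (consE v) (\<lambda>p. fst p \<in> W \<and> P (fst p) (snd p))"
    by (intro defpred_conj[OF C] P defpred_mem[OF C W defterm_fst[OF E] refl])
  then obtain X where X: "definable L S C (k + N) X"
    "\<And>x e. x \<in> tuples k (univ S) \<Longrightarrow> e \<in> E \<Longrightarrow> x \<in> W \<and> P x e \<longleftrightarrow> x @ v e \<in> X"
    unfolding defpred_def consE_def by force
  have "(\<exists>x\<in>W. P x e) \<longleftrightarrow> v e \<in> {e\<in>tuples N (univ S). \<exists>x\<in>tuples k (univ S). x @ e \<in> X}"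
    if "e \<in> E" for e
    using that X(2)[OF _ that] definable_subset[OF W] E by (auto simp: is_env_def)
  then show ?thesis using definable_Ex[OF X(1)] E unfolding defpred_def is_env_def by blast
qed

lemma defpred_ball:
  assumes C: "C \<subseteq> univ S" and W: "definable L S C k W" and E: "is_env S N E v"
    and P: "defpred L S C (k + N) (tuples k (univ S) \<times> E) (consE v) (\<lambda>p. P (fst p) (snd p))"
  shows "defpred L S C N E v (\<lambda>e. \<forall>x\<in>W. P x e)"
  using defpred_not[OF defpred_bex[OF C W E defpred_not[OF P]]] by simp

lemma definable_Collect:
  assumes "defpred L S C N (tuples N (univ S)) (\<lambda>e. e) P"
  shows "definable L S C N {e\<in>tuples N (univ S). P e}"
proof -
  obtain X where "definable L S C N X" "\<forall>e\<in>tuples N (univ S). P e \<longleftrightarrow> e \<in> X"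
    using assms unfolding defpred_def by blast
  moreover then have "{e\<in>tuples N (univ S). P e} = X" using definable_subset by blast
  ultimately show ?thesis by simp
qed

text \<open>Elements of \<open>Z\<close> are described by their pattern \<open>x @ y\<close>, so
  that the defining predicate speaks of the pieces and never of \<open>take\<close> and
  \<open>drop\<close>.\<close>

lemma definable_Collect2:
  assumes Z: "Z \<subseteq> tuples N (univ S)" and N: "N = m + n"
    and P: "\<And>x y. x \<in> tuples m (univ S) \<Longrightarrow> y \<in> tuples n (univ S) \<Longrightarrow> x @ y \<in> Z \<longleftrightarrow> P x y"
    and dP: "defpred L S C (m + n) (tuples m (univ S) \<times> tuples n (univ S)) (consE (\<lambda>e. e))
      (\<lambda>p. P (fst p) (snd p))"
  shows "definable L S C N Z"
proof -
  obtain X where X: "definable L S C (m + n) X"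
    "\<And>x y. x \<in> tuples m (univ S) \<Longrightarrow> y \<in> tuples n (univ S) \<Longrightarrow> P x y \<longleftrightarrow> x @ y \<in> X"
    using dP unfolding defpred_def consE_def by force
  have "z \<in> Z \<longleftrightarrow> z \<in> X" if "z \<in> tuples (m + n) (univ S)" for z
    using that X(2) P by (elim tuples_add_cases) auto
  then have "Z = X" using Z N definable_subset[OF X(1)] by blast
  then show ?thesis using X N by simp
qed

lemma definable_Collect3:
  assumes Z: "Z \<subseteq> tuples N (univ S)" and N: "N = l + (m + n)"
    and P: "\<And>x y z. x \<in> tuples l (univ S) \<Longrightarrow> y \<in> tuples m (univ S) \<Longrightarrow> z \<in> tuples n (univ S) \<Longrightarrow>
      x @ y @ z \<in> Z \<longleftrightarrow> P x y z"
    and dP: "defpred L S C (l + (m + n)) (tuples l (univ S) \<times> tuples m (univ S) \<times> tuples n (univ S))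
      (consE (consE (\<lambda>e. e))) (\<lambda>p. P (fst p) (fst (snd p)) (snd (snd p)))"
  shows "definable L S C N Z"
proof -
  obtain X where X: "definable L S C (l + (m + n)) X"
    "\<And>x y z. x \<in> tuples l (univ S) \<Longrightarrow> y \<in> tuples m (univ S) \<Longrightarrow> z \<in> tuples n (univ S) \<Longrightarrow>
      P x y z \<longleftrightarrow> x @ y @ z \<in> X"
    using dP unfolding defpred_def consE_def by force
  have "z \<in> Z \<longleftrightarrow> z \<in> X" if "z \<in> tuples (l + (m + n)) (univ S)" for z
    using that X(2) P by (elim tuples_add_cases) auto
  then have "Z = X" using Z N definable_subset[OF X(1)] by blast
  then show ?thesis using X N by simp
qed

lemma definable_Collect4:
  assumes Z: "Z \<subseteq> tuples N (univ S)" and N: "N = k + (l + (m + n))"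
    and P: "\<And>w x y z. w \<in> tuples k (univ S) \<Longrightarrow> x \<in> tuples l (univ S) \<Longrightarrow> y \<in> tuples m (univ S) \<Longrightarrow>
      z \<in> tuples n (univ S) \<Longrightarrow> w @ x @ y @ z \<in> Z \<longleftrightarrow> P w x y z"
    and dP: "defpred L S C (k + (l + (m + n)))
      (tuples k (univ S) \<times> tuples l (univ S) \<times> tuples m (univ S) \<times> tuples n (univ S))
      (consE (consE (consE (\<lambda>e. e))))
      (\<lambda>p. P (fst p) (fst (snd p)) (fst (snd (snd p))) (snd (snd (snd p))))"
  shows "definable L S C N Z"
proof -
  obtain X where X: "definable L S C (k + (l + (m + n))) X"
    "\<And>w x y z. w \<in> tuples k (univ S) \<Longrightarrow> x \<in> tuples l (univ S) \<Longrightarrow> y \<in> tuples m (univ S) \<Longrightarrow>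
      z \<in> tuples n (univ S) \<Longrightarrow> P w x y z \<longleftrightarrow> w @ x @ y @ z \<in> X"
    using dP unfolding defpred_def consE_def by force
  have "z \<in> Z \<longleftrightarrow> z \<in> X" if "z \<in> tuples (k + (l + (m + n))) (univ S)" for z
    using that X(2) P by (elim tuples_add_cases) auto
  then have "Z = X" using Z N definable_subset[OF X(1)] by blast
  then show ?thesis using X N by simp
qed

lemmas defintros = defpred_conj defpred_disj defpred_imp defpred_iff defpred_not defpred_bex
  defpred_ball defterm_append defterm_fst defterm_snd defterm_id defterm_const
  is_env_cons is_env_id

lemma definable_finite_params:
  assumes "definable L S C n X"
  obtains D where "finite D" "D \<subseteq> C" "definable L S D n X"
proof -
  from assms obtain \<phi> c where "wff L (n + length c) \<phi>" "set c \<subseteq> C"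
    "X = {x\<in>tuples n (univ S). sat S (x @ c) \<phi>}" by (rule definableE)
  then have "definable L S (set c) n X" by (intro definableI[where c = c]) auto
  then show ?thesis using that[of "set c"] \<open>set c \<subseteq> C\<close> by simp
qed

text \<open>Parameters outside \<open>C\<close> become variables, which makes them available to
  quantifiers and to elementary maps, while those in \<open>C\<close> remain constants.\<close>

lemma definable_params:
  fixes S :: "('f, 'r, 'm) struct"
  assumes X: "definable L S (C \<union> D) n X" and CD: "C \<union> D \<subseteq> univ S"
  obtains d \<Phi> where "set d \<subseteq> D" "definable L S C (n + length d) \<Phi>"
    "\<And>x. x \<in> tuples n (univ S) \<Longrightarrow> x \<in> X \<longleftrightarrow> x @ d \<in> \<Phi>"
proof -
  from X obtain \<phi> c where \<phi>: "wff L (n + length c) \<phi>" "set c \<subseteq> C \<union> D"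
    and Xeq: "X = {x\<in>tuples n (univ S). sat S (x @ c) \<phi>}" by (rule definableE)
  define d where "d = filter (\<lambda>x. x \<notin> C) c"
  define idx where "idx x = (SOME j. j < length d \<and> d ! j = x)" for x
  have idx: "idx x < length d \<and> d ! idx x = x" if "x \<in> set d" for x
    unfolding idx_def by (rule someI_ex) (use that in \<open>auto simp: in_set_conv_nth\<close>)
  define ss :: "(nat + 'm) list" where
    "ss = map Inl [0..<n] @ map (\<lambda>x. if x \<in> C then Inr x else Inl (n + idx x)) c"
  define X0 where "X0 = {z\<in>tuples (n + length c) (univ S). sat S z \<phi>}"
  define \<Phi> where "\<Phi> = {e\<in>tuples (n + length d) (univ S). term_val e ss \<in> X0}"
  have d: "set d \<subseteq> D" using \<phi>(2) by (auto simp: d_def)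
  have "definable L S C (n + length c) X0"
    by (rule definableI[where \<phi> = \<phi> and c = "[]"]) (use \<phi> in \<open>auto simp: X0_def\<close>)
  then have "definable L S C (n + length d) \<Phi>"
    unfolding \<Phi>_def by (rule definable_term_vimage)
      (use CD idx in \<open>auto simp: ss_def d_def split: if_splits\<close>)
  moreover have "x \<in> X \<longleftrightarrow> x @ d \<in> \<Phi>" if x: "x \<in> tuples n (univ S)" for x
  proof -
    have "term_val (x @ d) ss = x @ c"
      by (rule nth_equalityI)
        (use x idx in \<open>auto simp: ss_def term_val_def tuples_def nth_append d_def\<close>)
    moreover have "set c \<subseteq> univ S" using \<phi>(2) CD by blast
    ultimately show ?thesis using x
      by (auto simp: \<Phi>_def X0_def Xeq tuples_def d_def)
  qed
  ultimately show ?thesis using d that by blast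
qed

lemma definable_fiber:
  assumes "definable L S C (n + length d) \<Phi>" "C \<subseteq> D" "set d \<subseteq> D" "D \<subseteq> univ S"
  shows "definable L S D n {x\<in>tuples n (univ S). x @ d \<in> \<Phi>}"
  by (rule definable_Collect)
    (rule defpred_mem[OF _ definable_mono[OF assms(1,2)]] defintros assms refl)+

lemma finite_Union_of_definables:
  assumes "finite F" "\<And>X. X \<in> F \<Longrightarrow> definable L S C n X" "C \<subseteq> univ S"
  shows "definable L S C n (\<Union>F)"
  using assms
proof (induction F rule: finite_induct)
  case empty
  then show ?case using definable_Compl[OF definable_UNIV[of L S C n]] by simp
next
  case (insert X F)
  have "definable L S C n (tuples n (univ S) - ((tuples n (univ S) - X) \<inter> (tuples n (univ S) - \<Union>F)))"
    by (intro definable_Compl definable_Int insert) auto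
  moreover have "tuples n (univ S) - ((tuples n (univ S) - X) \<inter> (tuples n (univ S) - \<Union>F)) = \<Union>(insert X F)"
    using definable_subset[OF insert.prems(1)] by blast
  ultimately show ?case by simp
qed

lemma definable_Un:
  "definable L S C n X \<Longrightarrow> definable L S C n Y \<Longrightarrow> C \<subseteq> univ S \<Longrightarrow> definable L S C n (X \<union> Y)"
  using finite_Union_of_definables[of "{X, Y}" L S C n] by auto

lemma definable_Diff:
  assumes "definable L S C n X" "definable L S C n Y" "C \<subseteq> univ S"
  shows "definable L S C n (X - Y)"
proof -
  have "X - Y = X \<inter> (tuples n (univ S) - Y)" using definable_subset[OF assms(1)] by blast
  then show ?thesis using assms by (simp add: definable_Int definable_Compl)
qed

lemma definable_empty: "definable L S C n {}"
  using definable_Compl[OF definable_UNIV[of L S C n]] by simp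

section \<open>Elementary maps and automorphisms\<close>

text \<open>One inclusion between the types is enough: applied to complements it yields the other.
  Definable sets stand in for formulas with parameters.\<close>

definition same_type :: "('f, 'r) lang \<Rightarrow> ('f, 'r, 'm) struct \<Rightarrow> 'm set \<Rightarrow> 'm list \<Rightarrow> 'm list \<Rightarrow> bool" where
  "same_type L S C b b' \<longleftrightarrow> set b \<subseteq> univ S \<and> (\<forall>X. definable L S C (length b) X \<longrightarrow> b \<in> X \<longrightarrow> b' \<in> X)"

lemma same_type_tuples:
  assumes "same_type L S C b b'"
  shows "length b' = length b" "set b' \<subseteq> univ S"
proof -
  have "b' \<in> tuples (length b) (univ S)"
    using assms definable_UNIV unfolding same_type_def tuples_def by blast
  then show "length b' = length b" "set b' \<subseteq> univ S" by (auto simp: tuples_def)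
qed

lemma same_type_iff:
  assumes "same_type L S C b b'" "definable L S C (length b) X"
  shows "b \<in> X \<longleftrightarrow> b' \<in> X"
  using assms definable_Compl[OF assms(2)] unfolding same_type_def tuples_def by blast

lemma same_type_sym: "same_type L S C b b' \<Longrightarrow> same_type L S C b' b"
  using same_type_iff same_type_tuples unfolding same_type_def by metis

lemma same_type_mono: "same_type L S C b b' \<Longrightarrow> D \<subseteq> C \<Longrightarrow> same_type L S D b b'"
  unfolding same_type_def by (meson definable_mono)

lemma elementary_mapI:
  assumes "B \<subseteq> univ S" "\<And>b. set b \<subseteq> B \<Longrightarrow> same_type L S {} b (map f b)"
  shows "elementary_map L S S B f"
  unfolding elementary_map_def
proof (intro conjI allI impI)
  show "f ` B \<subseteq> univ S"
  proof
    fix y assume "y \<in> f ` B"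
    then obtain x where "x \<in> B" "y = f x" by blast
    then show "y \<in> univ S" using same_type_tuples(2)[OF assms(2)[of "[x]"]] by simp
  qed
  fix b \<phi> assume b: "set b \<subseteq> B" and \<phi>: "wff L (length b) \<phi>"
  have "definable L S {} (length b) {x\<in>tuples (length b) (univ S). sat S x \<phi>}"
    by (rule definableI[where \<phi> = \<phi> and c = "[]"]) (use \<phi> in auto)
  from same_type_iff[OF assms(2)[OF b] this] same_type_tuples[OF assms(2)[OF b]] b assms(1)
  show "sat S b \<phi> \<longleftrightarrow> sat S (map f b) \<phi>" by (auto simp: tuples_def)
qed (fact assms(1))

lemma elementary_map_same_type:
  assumes "elementary_map L S S B f" "set b \<subseteq> B" "\<And>a. a \<in> A \<Longrightarrow> f a = a" "A \<subseteq> B"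
  shows "same_type L S A b (map f b)"
  unfolding same_type_def
proof (intro conjI allI impI)
  show "set b \<subseteq> univ S" using assms unfolding elementary_map_def by blast
  fix X assume X: "definable L S A (length b) X" and b: "b \<in> X"
  from X obtain \<phi> c where \<phi>: "wff L (length b + length c) \<phi>" "set c \<subseteq> A"
    and Xeq: "X = {x\<in>tuples (length b) (univ S). sat S (x @ c) \<phi>}" by (rule definableE)
  have "set (b @ c) \<subseteq> B" using assms \<phi> by auto
  then have "sat S (b @ c) \<phi> \<longleftrightarrow> sat S (map f (b @ c)) \<phi>"
    using assms(1) \<phi>(1) unfolding elementary_map_def by (metis length_append)
  moreover have "map f c = c" using \<phi>(2) assms(3) by (auto intro!: map_idI)
  moreover have "map f b \<in> tuples (length b) (univ S)"
    using assms(1,2) unfolding elementary_map_def tuples_def by auto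
  ultimately show "map f b \<in> X" using b by (simp add: Xeq)
qed

lemma AutD:
  assumes "\<sigma> \<in> Aut L S B A"
  shows "bij_betw \<sigma> B B" "\<sigma> \<in> extensional B" "elementary_map L S S B \<sigma>" "\<And>a. a \<in> A \<Longrightarrow> \<sigma> a = a"
    "B \<subseteq> univ S"
  using assms unfolding Aut_def Bij_def elementary_map_def by auto

lemma Aut_same_type:
  "\<sigma> \<in> Aut L S B A \<Longrightarrow> A \<subseteq> B \<Longrightarrow> set b \<subseteq> B \<Longrightarrow> same_type L S A b (map \<sigma> b)"
  using elementary_map_same_type AutD(3,4) by metis

lemma Aut_set: "\<sigma> \<in> Aut L S B A \<Longrightarrow> set b \<subseteq> B \<Longrightarrow> set (map \<sigma> b) \<subseteq> B"
  using AutD(1) by (fastforce simp: bij_betw_def)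

lemma Aut_inverse:
  assumes \<sigma>: "\<sigma> \<in> Aut L S B A" and AB: "A \<subseteq> B"
  shows "restrict (inv_into B \<sigma>) B \<in> Aut L S B A"
proof -
  let ?\<tau> = "restrict (inv_into B \<sigma>) B"
  note b = AutD(1)[OF \<sigma>]
  have t: "\<sigma> (?\<tau> x) = x" "?\<tau> x \<in> B" if "x \<in> B" for x
    using that b by (auto simp: bij_betw_def f_inv_into_f intro: inv_into_into)
  have "elementary_map L S S B ?\<tau>"
  proof (rule elementary_mapI)
    fix xs assume xs: "set xs \<subseteq> B"
    then have "map \<sigma> (map ?\<tau> xs) = xs" using t by (auto intro!: map_idI)
    moreover have "set (map ?\<tau> xs) \<subseteq> B" using xs t by auto
    ultimately have "same_type L S {} (map ?\<tau> xs) xs"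
      using elementary_map_same_type[OF AutD(3)[OF \<sigma>], of "map ?\<tau> xs" "{}"] by simp
    then show "same_type L S {} xs (map ?\<tau> xs)" by (rule same_type_sym)
  qed (fact AutD(5)[OF \<sigma>])
  moreover have "?\<tau> a = a" if "a \<in> A" for a
    using that AB AutD(4)[OF \<sigma>] b by (metis bij_betw_def inv_into_f_eq restrict_apply' subsetD)
  ultimately show ?thesis
    unfolding Aut_def using \<sigma> by (auto simp: Aut_def intro: restrict_inv_into_Bij)
qed

lemma Aut_compose:
  assumes "\<sigma> \<in> Aut L S B A" "\<tau> \<in> Aut L S B A" and AB: "A \<subseteq> B"
  shows "compose B \<sigma> \<tau> \<in> Aut L S B A"
proof -
  have "elementary_map L S S B (compose B \<sigma> \<tau>)"
  proof (rule elementary_mapI)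
    fix b assume b: "set b \<subseteq> B"
    have "same_type L S {} b (map \<tau> b)" "same_type L S {} (map \<tau> b) (map \<sigma> (map \<tau> b))"
      using elementary_map_same_type[OF AutD(3)[OF assms(1)], of "map \<tau> b" "{}"]
        elementary_map_same_type[OF AutD(3)[OF assms(2)], of b "{}"] b Aut_set[OF assms(2) b] by simp_all
    moreover have eq: "map (compose B \<sigma> \<tau>) b = map \<sigma> (map \<tau> b)" using b by (auto simp: compose_def)
    ultimately show "same_type L S {} b (map (compose B \<sigma> \<tau>) b)"
      unfolding eq by (simp add: same_type_def del: map_map)
  qed (fact AutD(5)[OF assms(1)])
  moreover have "compose B \<sigma> \<tau> \<in> Bij B"
    using assms by (intro compose_Bij) (auto simp: Aut_def)
  moreover have "\<forall>a\<in>A. compose B \<sigma> \<tau> a = a"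
    using AB AutD(4)[OF assms(1)] AutD(4)[OF assms(2)] by (auto simp: compose_def)
  ultimately show ?thesis unfolding Aut_def by blast
qed

lemma definable_Aut_image:
  assumes \<sigma>: "\<sigma> \<in> Aut L S (univ S) {}" and X: "definable L S (univ S) n X"
  shows "definable L S (univ S) n (map \<sigma> ` X)"
proof -
  obtain c \<Phi> where c: "set c \<subseteq> univ S" and \<Phi>: "definable L S {} (n + length c) \<Phi>"
    "\<And>x. x \<in> tuples n (univ S) \<Longrightarrow> x \<in> X \<longleftrightarrow> x @ c \<in> \<Phi>"
    using definable_params[of L S "{}" "univ S" n X] X by auto
  let ?\<tau> = "restrict (inv_into (univ S) \<sigma>) (univ S)"
  note \<tau> = Aut_inverse[OF \<sigma> empty_subsetI]
  have act: "x @ c \<in> \<Phi> \<longleftrightarrow> map \<sigma> x @ map \<sigma> c \<in> \<Phi>" if "x \<in> tuples n (univ S)" for x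
    using same_type_iff[OF Aut_same_type[OF \<sigma>, of "x @ c"]] \<Phi>(1) that c by (auto simp: tuples_def)
  have img: "map \<sigma> ` X = {y\<in>tuples n (univ S). y @ map \<sigma> c \<in> \<Phi>}"
  proof (intro Set.set_eqI iffI)
    fix y assume "y \<in> map \<sigma> ` X"
    then obtain x where x: "x \<in> X" "y = map \<sigma> x" by blast
    then have "x \<in> tuples n (univ S)" using definable_subset[OF X] by blast
    moreover then have "y \<in> tuples n (univ S)"
      using x Aut_set[OF \<sigma>, of x] by (simp add: tuples_def)
    ultimately show "y \<in> {y\<in>tuples n (univ S). y @ map \<sigma> c \<in> \<Phi>}"
      using x \<Phi>(2)[of x] act[of x] by simp
  next
    fix y assume y: "y \<in> {y\<in>tuples n (univ S). y @ map \<sigma> c \<in> \<Phi>}"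
    define x where "x = map ?\<tau> y"
    have "\<sigma> (?\<tau> z) = z" if "z \<in> univ S" for z
      using that AutD(1)[OF \<sigma>] by (auto simp: bij_betw_def f_inv_into_f)
    then have "map \<sigma> x = y" using y by (auto simp: x_def tuples_def intro!: map_idI)
    moreover have "x \<in> tuples n (univ S)" using y Aut_set[OF \<tau>, of y] by (auto simp: x_def tuples_def)
    ultimately show "y \<in> map \<sigma> ` X" using y \<Phi>(2)[of x] act[of x] by (intro image_eqI[of _ _ x]) auto
  qed
  show ?thesis unfolding img
    by (rule definable_fiber[of L S "{}"]) (use \<Phi>(1) Aut_set[OF \<sigma> c] in auto)
qed

section \<open>Consequences of saturation and total transcendence\<close>

locale monster =
  fixes L :: "('f, 'r) lang" and T :: "('f, 'r) fm set" and \<kappa> :: "'k rel"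
    and S :: "('f, 'r, 'm) struct"
  assumes totally_transcendental: "totally_transcendental TYPE('m) L T"
    and eliminates_imaginaries: "eliminates_imaginaries TYPE('m) L T"
    and monster_model: "monster_model L T \<kappa> S"
begin

abbreviation U :: "'m set" where "U \<equiv> univ S"
abbreviation dfn :: "'m set \<Rightarrow> nat \<Rightarrow> 'm list set \<Rightarrow> bool" where "dfn \<equiv> definable L S"

lemma model: "model_of L T S"
  using monster_model unfolding monster_model_def by blast

lemma structure_of_S: "structure_of L S"
  using model unfolding model_of_def by blast

lemma U_nonempty: "U \<noteq> {}"
  using structure_of_S unfolding structure_of_def by blast

text \<open>The cardinal exceeds the number of formulas, and iterating \<open>Ex\<close> already
  produces infinitely many of them.\<close>

lemma finite_small:
  assumes "finite C"
  shows "|C :: 'm set| <o \<kappa>"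
proof -
  have "inj (\<lambda>n. (Ex ^^ n) (Eq (Var 0) (Var 0)) :: ('f, 'r) fm)"
  proof (rule injI)
    fix m n assume "(Ex ^^ m) (Eq (Var 0) (Var 0)) = ((Ex ^^ n) (Eq (Var 0) (Var 0)) :: ('f, 'r) fm)"
    then show "m = n"
    proof (induction m arbitrary: n)
      case 0 then show ?case by (cases n) auto
    next
      case (Suc m) then show ?case by (cases n) auto
    qed
  qed
  then have "infinite (UNIV :: ('f, 'r) fm set)"
    by (metis finite_imageD infinite_UNIV_nat rev_finite_subset top_greatest)
  then have "|C| <o |UNIV :: ('f, 'r) fm set|" 
    using assms finite_ordLess_infinite[of "|C|" "|UNIV :: ('f, 'r) fm set|"]
    by (metis Field_card_of card_of_Well_order)
  then show ?thesis using monster_model unfolding monster_model_def by (meson ordLess_transitive)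
qed

text \<open>If every member of \<open>P\<close> below \<open>X0\<close> contained two disjoint
  members, choosing such pairs along all finite bit strings would build the binary tree that total
  transcendence forbids.\<close>

lemma unsplittable_set:
  assumes "X0 \<in> P" "\<And>X. X \<in> P \<Longrightarrow> dfn U n X \<and> X \<noteq> {}"
  shows "\<exists>X\<in>P. X \<subseteq> X0 \<and> \<not> (\<exists>Y\<in>P. \<exists>Z\<in>P. Y \<subseteq> X \<and> Z \<subseteq> X \<and> Y \<inter> Z = {})"
proof (rule ccontr)
  assume "\<not> ?thesis"
  then have "\<forall>X. \<exists>Y Z. X \<in> P \<and> X \<subseteq> X0 \<longrightarrow> Y \<in> P \<and> Z \<in> P \<and> Y \<subseteq> X \<and> Z \<subseteq> X \<and> Y \<inter> Z = {}" by meson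
  then obtain f g where fg: "\<And>X. X \<in> P \<Longrightarrow> X \<subseteq> X0 \<Longrightarrow>
      f X \<in> P \<and> g X \<in> P \<and> f X \<subseteq> X \<and> g X \<subseteq> X \<and> f X \<inter> g X = {}" by metis
  define t where "t s = foldl (\<lambda>X b. if b then g X else f X) X0 s" for s
  have t: "t s \<in> P \<and> t s \<subseteq> X0" for s
  proof (induction s rule: rev_induct)
    case (snoc b s)
    then show ?case using fg[of "t s"] by (auto simp: t_def)
  qed (auto simp: t_def assms)
  have "dfn U n (t s) \<and> t s \<noteq> {} \<and> t (s @ [False]) \<subseteq> t s \<and> t (s @ [True]) \<subseteq> t s \<and>
      t (s @ [False]) \<inter> t (s @ [True]) = {}" for s
    using fg[of "t s"] t[of s] assms(2) by (auto simp: t_def)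
  then show False
    using totally_transcendental model unfolding totally_transcendental_def
    by (elim allE[of _ S] impE notE) (assumption, intro exI[of _ n] exI[of _ t] allI)
qed

text \<open>Saturation speaks of complete types, whereas below only families of definable sets with
  the finite intersection property occur. A maximal such family over \<open>C\<close> decides every
  definable set, so the formulas defining its members form a complete type.\<close>

lemma saturated:
  assumes C: "finite C" "C \<subseteq> U" and F: "\<And>X. X \<in> F \<Longrightarrow> dfn C n X"
    and fip: "\<And>H. finite H \<Longrightarrow> H \<subseteq> F \<Longrightarrow> \<exists>x\<in>tuples n U. \<forall>X\<in>H. x \<in> X"
  shows "\<exists>x\<in>tuples n U. \<forall>X\<in>F. x \<in> X"
proof -
  define FIP where "FIP H \<longleftrightarrow> (\<forall>K. finite K \<longrightarrow> K \<subseteq> H \<longrightarrow> (\<exists>x\<in>tuples n U. \<forall>X\<in>K. x \<in> X))" for H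
  define \<A> where "\<A> = {H. F \<subseteq> H \<and> H \<subseteq> Collect (dfn C n) \<and> FIP H}"
  have "\<exists>H\<in>\<A>. \<forall>K\<in>\<A>. H \<subseteq> K \<longrightarrow> K = H"
  proof (rule subset_Zorn_nonempty)
    show "\<A> \<noteq> {}" using F fip by (auto simp: \<A>_def FIP_def intro!: exI[of _ F])
    fix \<C> assume ne: "\<C> \<noteq> {}" and ch: "subset.chain \<A> \<C>"
    then have sub: "\<C> \<subseteq> \<A>" by (simp add: subset.chain_def)
    have "FIP (\<Union>\<C>)" unfolding FIP_def
    proof (intro allI impI)
      fix K assume "finite K" "K \<subseteq> \<Union>\<C>"
      then obtain H where "H \<in> \<C>" "K \<subseteq> H" using finite_subset_Union_chain[OF _ _ ne ch] by blast
      then show "\<exists>x\<in>tuples n U. \<forall>X\<in>K. x \<in> X"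
        using sub \<open>finite K\<close> unfolding \<A>_def FIP_def by blast
    qed
    then show "\<Union>\<C> \<in> \<A>" using ne sub unfolding \<A>_def by blast
  qed
  then obtain H where HA: "H \<in> \<A>" and max: "\<And>K. K \<in> \<A> \<Longrightarrow> H \<subseteq> K \<Longrightarrow> K = H" by blast
  from HA have H: "F \<subseteq> H" "H \<subseteq> Collect (dfn C n)" "FIP H" by (simp_all add: \<A>_def)
  have notin: "\<exists>K. finite K \<and> K \<subseteq> H \<and> (\<forall>x\<in>tuples n U. (\<forall>Y\<in>K. x \<in> Y) \<longrightarrow> x \<notin> X)"
    if X: "dfn C n X" "X \<notin> H" for X
  proof -
    have "insert X H \<notin> \<A>" using max[of "insert X H"] X by blast
    then have "\<not> FIP (insert X H)" using H X by (auto simp: \<A>_def)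
    then obtain K where K: "finite K" "K \<subseteq> insert X H" "\<forall>x\<in>tuples n U. \<not> (\<forall>X\<in>K. x \<in> X)"
      unfolding FIP_def by blast
    then show ?thesis by (intro exI[of _ "K - {X}"]) blast
  qed
  have cases: "X \<in> H \<or> tuples n U - X \<in> H" if X: "dfn C n X" for X
  proof (rule ccontr)
    assume "\<not> ?thesis"
    then obtain K1 K2 where K: "finite K1" "K1 \<subseteq> H" "\<forall>x\<in>tuples n U. (\<forall>Y\<in>K1. x \<in> Y) \<longrightarrow> x \<notin> X"
      "finite K2" "K2 \<subseteq> H" "\<forall>x\<in>tuples n U. (\<forall>Y\<in>K2. x \<in> Y) \<longrightarrow> x \<notin> tuples n U - X"
      using notin[OF X] notin[OF definable_Compl[OF X]] by blast
    then have "\<exists>x\<in>tuples n U. \<forall>X\<in>K1 \<union> K2. x \<in> X"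
      using H(3) unfolding FIP_def by (meson finite_UnI le_sup_iff)
    then show False using K by blast
  qed
  define ext where "ext = (\<lambda>(\<phi>, c). {x\<in>tuples n U. sat S (x @ c) \<phi>})"
  define p where "p = {q \<in> formulas_over L C n. ext q \<in> H}"
  have "complete_type L S C n p" unfolding complete_type_def
  proof (intro conjI allI impI ballI)
    show "p \<subseteq> formulas_over L C n" by (auto simp: p_def)
    fix q assume "q \<subseteq> p" "finite q"
    then have "\<exists>x\<in>tuples n U. \<forall>X\<in>ext ` q. x \<in> X" using H(3) unfolding FIP_def p_def by blast
    then show "\<exists>b\<in>tuples n U. realizes S q b" by (force simp: ext_def realizes_def)
  next
    fix z assume z: "z \<in> formulas_over L C n"
    obtain \<phi> c where [simp]: "z = (\<phi>, c)" by fastforce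
    have "dfn C n (ext z)" using z by (auto simp: ext_def formulas_over_def intro!: definableI)
    moreover have "tuples n U - ext (\<phi>, c) = ext (Neg \<phi>, c)" by (auto simp: ext_def)
    ultimately have "ext (\<phi>, c) \<in> H \<or> ext (Neg \<phi>, c) \<in> H" using cases by fastforce
    then show "case z of (\<phi>, c) \<Rightarrow> (\<phi>, c) \<in> p \<or> (Neg \<phi>, c) \<in> p"
      using z by (auto simp: p_def formulas_over_def)
  qed
  then have "realizations S n p \<noteq> {}"
    using monster_model C finite_small[OF C(1)] unfolding monster_model_def by blast
  then obtain b where b: "b \<in> tuples n U" "realizes S p b" unfolding realizations_def by blast
  have "b \<in> X" if X: "X \<in> F" for X
  proof -
    from F[OF X] obtain \<phi> c where \<phi>: "wff L (n + length c) \<phi>" "set c \<subseteq> C"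
      "X = {x\<in>tuples n U. sat S (x @ c) \<phi>}" by (rule definableE)
    then have "(\<phi>, c) \<in> p" using X H(1) by (auto simp: p_def formulas_over_def ext_def)
    then show ?thesis using b \<phi>(3) unfolding realizes_def by blast
  qed
  then show ?thesis using b by blast
qed

text \<open>Since equality is definable, equal entries of \<open>b\<close> sit opposite equal
  entries of \<open>b'\<close>. Matching the entries is therefore a function on
  \<open>set b\<close>; it is elementary, and strong homogeneity extends it.\<close>

lemma homogeneous:
  assumes bb': "same_type L S {} b b'"
  shows "\<exists>\<sigma>\<in>Aut L S U {}. map \<sigma> b = b'"
proof -
  note len = same_type_tuples[OF bb']
  have b: "set b \<subseteq> U" using bb' by (simp add: same_type_def)
  have tv: "term_val b s \<in> X \<longleftrightarrow> term_val b' s \<in> X"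
    if s: "set s \<subseteq> Inl ` {..<length b}" and X: "dfn {} (length s) X" for s X
  proof -
    have "dfn {} (length b) {e\<in>tuples (length b) U. term_val e s \<in> X}"
      by (rule definable_term_vimage[OF X]) (use s in auto)
    from same_type_iff[OF bb' this] show ?thesis using b len by (auto simp: tuples_def)
  qed
  have eq: "b' ! i = b' ! j" if ij: "b ! i = b ! j" "i < length b" "j < length b" for i j
  proof -
    have "dfn {} (length b) {e\<in>tuples (length b) U. term_val e [Inl i] = term_val e [Inl j]}"
      by (rule definable_terms_eq[where k = 1]) (use ij in auto)
    from same_type_iff[OF bb' this] show ?thesis
      using b len ij by (auto simp: tuples_def term_val_def)
  qed
  define idx where "idx x = (SOME i. i < length b \<and> b ! i = x)" for x
  have idx: "idx x < length b \<and> b ! idx x = x" if "x \<in> set b" for x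
    unfolding idx_def by (rule someI_ex) (use that in \<open>auto simp: in_set_conv_nth\<close>)
  define f where "f x = b' ! idx x" for x
  have "elementary_map L S S (set b) f"
  proof (rule elementary_mapI[OF b])
    fix c assume c: "set c \<subseteq> set b"
    define s :: "(nat + 'm) list" where "s = map (Inl \<circ> idx) c"
    have "term_val b s = c" "term_val b' s = map f c"
      using c idx by (auto simp: s_def term_val_def f_def intro!: map_idI)
    moreover have "set s \<subseteq> Inl ` {..<length b}" using c idx by (auto simp: s_def)
    ultimately show "same_type L S {} c (map f c)"
      using tv[of s] c b unfolding same_type_def by (auto simp: s_def)
  qed
  then obtain \<sigma> where \<sigma>: "\<sigma> \<in> Aut L S U {}" "\<forall>c\<in>set b. \<sigma> c = f c"
    using monster_model finite_small[OF List.finite_set, of b] unfolding monster_model_def by blast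
  have "map \<sigma> b = b'"
  proof (rule nth_equalityI)
    fix i assume i: "i < length (map \<sigma> b)"
    then have "b ! i \<in> set b" by simp
    then have "b' ! idx (b ! i) = b' ! i" using eq[of "idx (b ! i)" i] idx[of "b ! i"] i by simp
    then show "map \<sigma> b ! i = b' ! i" using \<sigma>(2) i by (simp add: f_def)
  qed (simp add: len)
  then show ?thesis using \<sigma> by blast
qed

end

section \<open>Local rank and definability of types\<close>

text \<open>
  \<open>splits F I k X\<close>: the local rank of \<open>X\<close> with respect to the family \<open>F\<close> is at least \<open>k\<close>.
\<close>

primrec splits :: "('i \<Rightarrow> 'a set) \<Rightarrow> 'i set \<Rightarrow> nat \<Rightarrow> 'a set \<Rightarrow> bool" where
  "splits F I 0 X \<longleftrightarrow> X \<noteq> {}"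
| "splits F I (Suc k) X \<longleftrightarrow> (\<exists>i\<in>I. splits F I k (X \<inter> F i) \<and> splits F I k (X - F i))"

lemma splits_mono: "splits F I k X \<Longrightarrow> j \<le> k \<Longrightarrow> splits F I j X"
proof (induction k arbitrary: j X)
  case (Suc k)
  show ?case
  proof (cases j)
    case 0
    from Suc.prems(1) obtain i where "splits F I k (X \<inter> F i)" by auto
    then have "splits F I 0 (X \<inter> F i)" by (rule Suc.IH) simp
    then show ?thesis using 0 by auto
  next
    case (Suc j')
    then show ?thesis using Suc.prems Suc.IH by auto
  qed
qed simp

context monster
begin

definition fiber :: "nat \<Rightarrow> 'm list set \<Rightarrow> 'm list \<Rightarrow> 'm list set" where
  "fiber n \<Phi> y = {x\<in>tuples n U. x @ y \<in> \<Phi>}"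

text \<open>The induction has to run over all families \<Psi>: the two halves into which a fiber is
  split are fibers of a new family, whose parameter is that of the old one extended by the splitting
  parameter \<open>y\<close>.\<close>

lemma dfn_splits:
  assumes C: "C \<subseteq> U" and \<Phi>: "dfn C (n + l) \<Phi>" and \<Psi>: "dfn C (n + j) \<Psi>"
  shows "dfn C j {z\<in>tuples j U. splits (fiber n \<Phi>) (tuples l U) k (fiber n \<Psi> z)}"
  using \<Psi>
proof (induction k arbitrary: j \<Psi>)
  case 0
  have "{z\<in>tuples j U. splits (fiber n \<Phi>) (tuples l U) 0 (fiber n \<Psi> z)} =
    {z\<in>tuples j U. \<exists>x\<in>tuples n U. x @ z \<in> \<Psi>}" by (auto simp: fiber_def)
  moreover have "dfn C j \<dots>"
    by (rule definable_Collect)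
      (rule defintros C defpred_mem[OF C 0] definable_UNIV refl)+
  ultimately show ?case by simp
next
  case (Suc k)
  define \<Psi>' where "\<Psi>' V = {w\<in>tuples (n + (l + j)) U. \<exists>x\<in>tuples n U. \<exists>y\<in>tuples l U. \<exists>z\<in>tuples j U.
    w = x @ y @ z \<and> x @ z \<in> \<Psi> \<and> x @ y \<in> V}" for V
  have in\<Psi>': "x @ y @ z \<in> \<Psi>' V \<longleftrightarrow> x @ z \<in> \<Psi> \<and> x @ y \<in> V"
    if "x \<in> tuples n U" "y \<in> tuples l U" "z \<in> tuples j U" for x y z V
    using that by (auto simp: \<Psi>'_def append_tuples_inject intro!: tuples_append)
  have d\<Psi>': "dfn C (n + (l + j)) (\<Psi>' V)" if V: "dfn C (n + l) V" for V
    by (rule definable_Collect3[OF _ refl in\<Psi>'])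
      (auto simp: \<Psi>'_def, (rule defintros C defpred_mem[OF C V] defpred_mem[OF C Suc.prems] refl)+)
  define K where "K V = {z\<in>tuples (l + j) U. splits (fiber n \<Phi>) (tuples l U) k (fiber n (\<Psi>' V) z)}" for V
  have dK: "dfn C (l + j) (K V)" if "dfn C (n + l) V" for V
    unfolding K_def by (rule Suc.IH[OF d\<Psi>'[OF that]])
  have inK: "y @ z \<in> K V \<longleftrightarrow> splits (fiber n \<Phi>) (tuples l U) k (fiber n \<Psi> z \<inter> fiber n V y)"
    if "y \<in> tuples l U" "z \<in> tuples j U" for y z V
  proof -
    have "fiber n (\<Psi>' V) (y @ z) = fiber n \<Psi> z \<inter> fiber n V y"
      using that in\<Psi>' by (auto simp: fiber_def)
    then show ?thesis using that by (auto simp: K_def intro!: tuples_append)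
  qed
  let ?c = "tuples (n + l) U - \<Phi>"
  have "fiber n \<Psi> z \<inter> fiber n ?c y = fiber n \<Psi> z - fiber n \<Phi> y" if "y \<in> tuples l U" for y z
    using that by (auto simp: fiber_def intro!: tuples_append)
  then have "{z\<in>tuples j U. splits (fiber n \<Phi>) (tuples l U) (Suc k) (fiber n \<Psi> z)} =
    {z\<in>tuples j U. \<exists>y\<in>tuples l U. y @ z \<in> K \<Phi> \<and> y @ z \<in> K ?c}" using inK by auto
  moreover have "dfn C j \<dots>"
    by (rule definable_Collect)
      (rule defintros C defpred_mem[OF C dK[OF \<Phi>]] defpred_mem[OF C dK[OF definable_Compl[OF \<Phi>]]]
        definable_UNIV refl)+
  ultimately show ?case by simp
qed

lemma dfn_fiber:
  assumes "C \<subseteq> U" "dfn C (n + l) \<Phi>" "set y \<subseteq> C" "length y = l"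
  shows "dfn C n (fiber n \<Phi> y)"
  unfolding fiber_def using definable_fiber[of L S C n y \<Phi> C] assms by auto

text \<open>Otherwise some set of unbounded rank does not contain two disjoint sets of unbounded
  rank. But it can be split with both halves of rank at least \<open>k\<close>, for each
  \<open>k\<close> separately, and compactness produces one parameter that does so for all
  \<open>k\<close> at once.\<close>

lemma splits_bounded:
  assumes \<Phi>: "dfn U (n + l) \<Phi>"
  shows "\<exists>k. \<not> splits (fiber n \<Phi>) (tuples l U) k (tuples n U)"
proof (rule ccontr)
  assume contra: "\<not> ?thesis"
  let ?sp = "splits (fiber n \<Phi>) (tuples l U)"
  define P where "P = {X. dfn U n X \<and> (\<forall>k. ?sp k X)}"
  have "tuples n U \<in> P" using contra by (auto simp: P_def intro: definable_UNIV)
  moreover have "\<And>X. X \<in> P \<Longrightarrow> dfn U n X \<and> X \<noteq> {}"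
    by (auto simp: P_def) (metis splits.simps(1))
  ultimately obtain X where X: "X \<in> P"
    and uns: "\<not> (\<exists>Y\<in>P. \<exists>Z\<in>P. Y \<subseteq> X \<and> Z \<subseteq> X \<and> Y \<inter> Z = {})"
    using unsplittable_set[of "tuples n U" P n] by blast
  from X have dX: "dfn U n X" and sX: "\<And>k. ?sp k X" by (auto simp: P_def)
  obtain C1 where C1: "finite C1" "C1 \<subseteq> U" "dfn C1 n X" by (rule definable_finite_params[OF dX])
  obtain C2 where C2: "finite C2" "C2 \<subseteq> U" "dfn C2 (n + l) \<Phi>" by (rule definable_finite_params[OF \<Phi>])
  define C where "C = C1 \<union> C2"
  have C: "finite C" "C \<subseteq> U" and X': "dfn C n X" and \<Phi>': "dfn C (n + l) \<Phi>"
    using C1 C2 definable_mono[of L S _ _ _ C] by (auto simp: C_def)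
  define \<Psi> where "\<Psi> V = {w\<in>tuples (n + l) U. \<exists>x\<in>tuples n U. \<exists>y\<in>tuples l U. w = x @ y \<and> x \<in> X \<and> x @ y \<in> V}" for V
  have in\<Psi>: "x @ y \<in> \<Psi> V \<longleftrightarrow> x \<in> X \<and> x @ y \<in> V" if "x \<in> tuples n U" "y \<in> tuples l U" for x y V
    using that by (auto simp: \<Psi>_def append_tuples_inject intro!: tuples_append)
  have d\<Psi>: "dfn C (n + l) (\<Psi> V)" if V: "dfn C (n + l) V" for V
    by (rule definable_Collect2[OF _ refl in\<Psi>])
      (auto simp: \<Psi>_def, (rule defintros C defpred_mem[OF C(2) V] defpred_mem[OF C(2) X'] refl)+)
  let ?c = "tuples (n + l) U - \<Phi>"
  define Y where "Y k = {y\<in>tuples l U. ?sp k (fiber n (\<Psi> \<Phi>) y)} \<inter> {y\<in>tuples l U. ?sp k (fiber n (\<Psi> ?c) y)}" for k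
  have Y: "y \<in> Y k \<longleftrightarrow> ?sp k (X \<inter> fiber n \<Phi> y) \<and> ?sp k (X - fiber n \<Phi> y)" if y: "y \<in> tuples l U" for y k
  proof -
    have "fiber n (\<Psi> \<Phi>) y = X \<inter> fiber n \<Phi> y" "fiber n (\<Psi> ?c) y = X - fiber n \<Phi> y"
      using y in\<Psi> definable_subset[OF dX] by (auto simp: fiber_def intro!: tuples_append)
    then show ?thesis using y by (simp add: Y_def)
  qed
  have dY: "dfn C l (Y k)" for k
    unfolding Y_def by (intro definable_Int C dfn_splits \<Phi>' d\<Psi> definable_Compl)
  \<comment> \<open>The sets \<open>Y k\<close> decrease with \<open>k\<close>, so a finite
    subfamily is met by any splitting that witnesses rank \<open>Suc m\<close>, where
    \<open>m\<close> bounds its indices.\<close>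
  have "\<exists>y\<in>tuples l U. \<forall>Z\<in>range Y. y \<in> Z"
  proof (rule saturated[OF C])
    fix H assume "finite H" "H \<subseteq> range Y"
    then obtain I where I: "finite I" "H = Y ` I" using finite_subset_image by metis
    obtain m where m: "\<forall>i\<in>I. i \<le> m" using I(1) finite_nat_set_iff_bounded_le by blast
    from sX[of "Suc m"] obtain y where y: "y \<in> tuples l U" "y \<in> Y m" using Y by auto
    then have "y \<in> Y i" if "i \<in> I" for i using Y[OF y(1)] m that splits_mono by blast
    then show "\<exists>y\<in>tuples l U. \<forall>Z\<in>H. y \<in> Z" using y I by blast
  qed (use dY in blast)
  then obtain y where y: "y \<in> tuples l U" "\<And>k. y \<in> Y k" by (metis rangeI)
  have "dfn U n (fiber n \<Phi> y)" using y(1) by (intro dfn_fiber[OF _ \<Phi>]) (auto simp: tuples_def)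
  then have "X \<inter> fiber n \<Phi> y \<in> P" "X - fiber n \<Phi> y \<in> P"
    using y Y[OF y(1)] dX by (auto simp: P_def intro: definable_Int definable_Diff)
  moreover have "X \<inter> fiber n \<Phi> y \<inter> (X - fiber n \<Phi> y) = {}" by blast
  ultimately show False using uns by (meson Diff_subset inf_le1)
qed

text \<open>Definability of types. Take \<open>X\<close> in \<open>u\<close> of least rank: all
  members of \<open>u\<close> have rank at least \<open>r\<close>, but \<open>X\<close> does not
  have rank at least \<open>Suc r\<close>. A fiber is in \<open>u\<close> exactly if its
  intersection with \<open>X\<close> still has rank at least \<open>r\<close>, for otherwise both
  halves of \<open>X\<close> would have it. The latter condition is definable by
  \<open>dfn_splits\<close>.\<close>

lemma ultrafilter_definable:
  assumes \<Phi>: "dfn U (n + l) \<Phi>"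
    and u: "\<And>X. X \<in> u \<Longrightarrow> dfn U n X \<and> X \<noteq> {}" "\<And>X Y. X \<in> u \<Longrightarrow> Y \<in> u \<Longrightarrow> X \<inter> Y \<in> u"
      "\<And>X. dfn U n X \<Longrightarrow> X \<in> u \<or> tuples n U - X \<in> u"
  shows "dfn U l {y\<in>tuples l U. fiber n \<Phi> y \<in> u}"
proof -
  let ?sp = "splits (fiber n \<Phi>) (tuples l U)"
  define Q where "Q k \<longleftrightarrow> (\<exists>X\<in>u. \<not> ?sp k X)" for k
  have "tuples n U \<in> u" using u(1)[of "{}"] u(3)[OF definable_UNIV] by auto
  then have "\<exists>k. Q k" using splits_bounded[OF \<Phi>] by (auto simp: Q_def)
  then obtain r where r: "Q (Suc r)" "\<not> Q r"
    by (metis Q_def exists_least_lemma splits.simps(1) u(1))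
  then obtain X where X: "X \<in> u" "\<not> ?sp (Suc r) X" and all: "\<And>Y. Y \<in> u \<Longrightarrow> ?sp r Y"
    by (auto simp: Q_def simp del: splits.simps)
  have dX: "dfn U n X" using u(1) X by blast
  define \<Psi> where "\<Psi> = {w\<in>tuples (n + l) U. \<exists>x\<in>tuples n U. \<exists>y\<in>tuples l U. w = x @ y \<and> x \<in> X \<and> x @ y \<in> \<Phi>}"
  have in\<Psi>: "x @ y \<in> \<Psi> \<longleftrightarrow> x \<in> X \<and> x @ y \<in> \<Phi>" if "x \<in> tuples n U" "y \<in> tuples l U" for x y
    using that by (auto simp: \<Psi>_def append_tuples_inject intro!: tuples_append)
  have d\<Psi>: "dfn U (n + l) \<Psi>"
    by (rule definable_Collect2[OF _ refl in\<Psi>])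
      (auto simp: \<Psi>_def, (rule defintros order_refl defpred_mem[OF order_refl \<Phi>] defpred_mem[OF order_refl dX] refl)+)
  have "fiber n \<Phi> y \<in> u \<longleftrightarrow> ?sp r (fiber n \<Psi> y)" if y: "y \<in> tuples l U" for y
  proof -
    have eq: "fiber n \<Psi> y = X \<inter> fiber n \<Phi> y"
      using y in\<Psi> definable_subset[OF dX] by (auto simp: fiber_def)
    have df: "dfn U n (fiber n \<Phi> y)" using y by (intro dfn_fiber[OF _ \<Phi>]) (auto simp: tuples_def)
    show ?thesis
    proof
      assume "fiber n \<Phi> y \<in> u"
      then show "?sp r (fiber n \<Psi> y)" using all u(2) X eq by simp
    next
      assume sp: "?sp r (fiber n \<Psi> y)"
      show "fiber n \<Phi> y \<in> u"
      proof (rule ccontr)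
        assume "fiber n \<Phi> y \<notin> u"
        then have "X \<inter> (tuples n U - fiber n \<Phi> y) \<in> u" using u(2,3) X df by blast
        moreover have "X \<inter> (tuples n U - fiber n \<Phi> y) = X - fiber n \<Phi> y"
          using definable_subset[OF dX] by blast
        ultimately have "?sp r (X - fiber n \<Phi> y)" using all by simp
        then show False using X(2) sp y eq by auto
      qed
    qed
  qed
  then have "{y\<in>tuples l U. fiber n \<Phi> y \<in> u} = {y\<in>tuples l U. ?sp r (fiber n \<Psi> y)}" by blast
  then show ?thesis using dfn_splits[OF order_refl \<Phi> d\<Psi>] by simp
qed

lemma same_type_append_iff:
  assumes "same_type L S (set d) y y'" "set d \<subseteq> U"
  shows "same_type L S {} (y @ d) (y' @ d)"
proof -
  note y' = same_type_tuples[OF assms(1)]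
  have y: "set y \<subseteq> U" using assms by (simp add: same_type_def)
  have "y' @ d \<in> X" if X: "dfn {} (length (y @ d)) X" and yd: "y @ d \<in> X" for X
  proof -
    have "dfn (set d) (length y) {x\<in>tuples (length y) U. x @ d \<in> X}"
      by (rule definable_fiber[of L S "{}"]) (use X assms in auto)
    from same_type_iff[OF assms(1) this] show ?thesis using y y' yd by (auto simp: tuples_def)
  qed
  then show ?thesis using y assms(2) unfolding same_type_def by simp
qed

text \<open>Two compactness arguments. First, each \<open>y\<close> in \<open>D\<close> has a
  neighbourhood inside \<open>D\<close> that is definable over \<open>d\<close>; otherwise some
  point outside \<open>D\<close> has the same type over \<open>d\<close> and is the image of
  \<open>y\<close> under an automorphism fixing \<open>d\<close>. Second, finitely many of these
  neighbourhoods cover \<open>D\<close>.\<close>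

lemma invariant_definable:
  assumes D: "dfn U k D" and d: "set d \<subseteq> U"
    and inv: "\<And>\<sigma> y. \<sigma> \<in> Aut L S U {} \<Longrightarrow> map \<sigma> d = d \<Longrightarrow> y \<in> D \<Longrightarrow> map \<sigma> y \<in> D"
  shows "dfn (set d) k D"
proof -
  obtain C0 where C0: "finite C0" "C0 \<subseteq> U" "dfn C0 k D" by (rule definable_finite_params[OF D])
  define C where "C = C0 \<union> set d"
  have C: "finite C" "C \<subseteq> U" "set d \<subseteq> C" and DC: "dfn C k D"
    using C0 d definable_mono[of L S C0 k D C] by (auto simp: C_def)
  have sub: "D \<subseteq> tuples k U" using definable_subset[OF D] .
  have local: "\<exists>X. dfn (set d) k X \<and> y \<in> X \<and> X \<subseteq> D" if y: "y \<in> D" for y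
  proof (rule ccontr)
    assume contra: "\<not> ?thesis"
    define F where "F = {X. dfn (set d) k X \<and> y \<in> X}"
    have "\<exists>x\<in>tuples k U. \<forall>X\<in>insert (tuples k U - D) F. x \<in> X"
    proof (rule saturated[OF C(1,2)])
      show "dfn C k X" if "X \<in> insert (tuples k U - D) F" for X
        using that DC definable_mono[OF _ C(3)] by (auto simp: F_def intro: definable_Compl)
      fix H assume H: "finite H" "H \<subseteq> insert (tuples k U - D) F"
      define V where "V = tuples k U - \<Union>((-) (tuples k U) ` (H \<inter> F))"
      have "dfn (set d) k V" unfolding V_def
        by (intro definable_Compl finite_Union_of_definables) (use H d in \<open>auto simp: F_def intro: definable_Compl\<close>)
      moreover have "y \<in> V" using y sub by (auto simp: F_def V_def)
      ultimately have "\<not> V \<subseteq> D" using contra by metis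
      then obtain x where x: "x \<in> V" "x \<notin> D" by blast
      have "x \<in> X" if "X \<in> H" for X
        using x that H(2) by (cases "X \<in> F") (auto simp: V_def)
      then show "\<exists>x\<in>tuples k U. \<forall>X\<in>H. x \<in> X" using x(1) by (auto simp: V_def)
    qed
    then obtain y' where y'': "y' \<in> tuples k U" "\<forall>X\<in>insert (tuples k U - D) F. y' \<in> X" by blast
    then have y': "y' \<in> tuples k U" "y' \<notin> D" "\<And>X. X \<in> F \<Longrightarrow> y' \<in> X" by simp_all
    have "length y = k" "set y \<subseteq> U" using y sub by (auto simp: tuples_def)
    then have "same_type L S (set d) y y'" using y'(3) by (auto simp: same_type_def F_def)
    from homogeneous[OF same_type_append_iff[OF this d]] obtain \<sigma>
      where \<sigma>: "\<sigma> \<in> Aut L S U {}" "map \<sigma> (y @ d) = y' @ d" by blast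
    then have "map \<sigma> y = y'" "map \<sigma> d = d" using \<open>length y = k\<close> y' by (auto simp: tuples_def append_eq_append_conv)
    then show False using inv[OF \<sigma>(1) _ y] y' by simp
  qed
  define G where "G = {X. dfn (set d) k X \<and> X \<subseteq> D}"
  have "\<exists>H. finite H \<and> H \<subseteq> G \<and> D \<subseteq> \<Union>H"
  proof (rule ccontr)
    assume contra: "\<not> ?thesis"
    have "\<exists>x\<in>tuples k U. \<forall>X\<in>insert D ((-) (tuples k U) ` G). x \<in> X"
    proof (rule saturated[OF C(1,2)])
      show "dfn C k X" if "X \<in> insert D ((-) (tuples k U) ` G)" for X
        using that DC definable_Compl[OF definable_mono[OF _ C(3)]] by (auto simp: G_def)
      fix H assume H: "finite H" "H \<subseteq> insert D ((-) (tuples k U) ` G)"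
      then have "finite (H - {D})" "H - {D} \<subseteq> (-) (tuples k U) ` G" by auto
      then obtain H' where H': "finite H'" "H' \<subseteq> G" "H - {D} = (-) (tuples k U) ` H'"
        by (metis finite_subset_image)
      then obtain x where x: "x \<in> D" "x \<notin> \<Union>H'" using contra by blast
      have "x \<in> X" if "X \<in> H" for X
      proof (cases "X = D")
        case False
        then have "X \<in> (-) (tuples k U) ` H'" using that H'(3) by blast
        then show ?thesis using x sub by blast
      qed (use x in simp)
      then show "\<exists>x\<in>tuples k U. \<forall>X\<in>H. x \<in> X" using x sub by blast
    qed
    then obtain x where "\<forall>X\<in>insert D ((-) (tuples k U) ` G). x \<in> X" by blast
    then have "x \<in> D" "\<forall>X\<in>G. x \<notin> X" by auto
    then show False using local[of x] by (auto simp: G_def)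
  qed
  then obtain H where H: "finite H" "H \<subseteq> G" "D \<subseteq> \<Union>H" by blast
  then have "D = \<Union>H" by (auto simp: G_def)
  moreover have "dfn (set d) k (\<Union>H)" using H d by (intro finite_Union_of_definables) (auto simp: G_def)
  ultimately show ?thesis by simp
qed

end

section \<open>Finite bases of types\<close>

context monster
begin

text \<open>Invariance is required because the defining set of the type found below is expressed
  through the ideal; only an invariant ideal makes it definable over the parameters of \<psi>
  alone.\<close>

definition invariant_ideal :: "nat \<Rightarrow> 'm list set set \<Rightarrow> bool" where
  "invariant_ideal n I \<longleftrightarrow> I \<subseteq> Collect (dfn U n) \<and> {} \<in> I \<and> (\<forall>X\<in>I. \<forall>Y\<in>I. X \<union> Y \<in> I) \<and>
     (\<forall>X\<in>I. \<forall>Y. dfn U n Y \<longrightarrow> Y \<subseteq> X \<longrightarrow> Y \<in> I) \<and>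
     (\<forall>\<sigma>\<in>Aut L S U {}. \<forall>X\<in>I. map \<sigma> ` X \<in> I)"

lemma Aut_inverse_map:
  assumes \<sigma>: "\<sigma> \<in> Aut L S U {}"
  obtains \<tau> where "\<tau> \<in> Aut L S U {}" "\<And>x. set x \<subseteq> U \<Longrightarrow> map \<sigma> (map \<tau> x) = x"
    "\<And>x. set x \<subseteq> U \<Longrightarrow> map \<tau> (map \<sigma> x) = x"
proof (rule that[OF Aut_inverse[OF \<sigma> empty_subsetI]])
  note b = AutD(1)[OF \<sigma>]
  have inv: "restrict (inv_into U \<sigma>) U (\<sigma> z) = z" if "z \<in> U" for z
    using that b by (auto simp: bij_betw_def inv_into_f_f)
  fix x assume "set x \<subseteq> U"
  then show "map \<sigma> (map (restrict (inv_into U \<sigma>) U) x) = x"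
    using b by (auto simp: bij_betw_def f_inv_into_f intro!: map_idI)
  show "map (restrict (inv_into U \<sigma>) U) (map \<sigma> x) = x"
    using inv \<open>set x \<subseteq> U\<close> by (simp add: map_idI subset_iff)
qed

text \<open>
  For a maximal automorphism-invariant ideal \<open>I\<close> of definable sets avoiding the type of \<open>m\<close> over \<open>C\<close>, \<open>I\<close> and the atoms modulo \<open>I\<close>
  generate a larger invariant ideal, so the type contains a set \<open>\<psi>\<close> that is a finite union of atoms;
  if the number of atoms is minimal, then \<open>\<phi>\<close> is in the type iff \<open>\<psi> - \<phi> \<in> I\<close>.  (The ideal plays the
  role of the sets of smaller Morley rank.)
\<close>

lemma finite_base:
  assumes m: "m \<in> tuples n U" and C: "C \<subseteq> U"
  shows "\<exists>d. set d \<subseteq> C \<and> (\<forall>k \<Phi>. dfn {} (n + k) \<Phi> \<longrightarrow>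
    (\<exists>Y. dfn (set d) k Y \<and> (\<forall>c\<in>tuples k C. m @ c \<in> \<Phi> \<longleftrightarrow> c \<in> Y)))"
proof -
  define p where "p = {X. dfn C n X \<and> m \<in> X}"
  have pU: "dfn U n X" if "X \<in> p" for X using that C definable_mono by (auto simp: p_def)
  have pInt: "X \<inter> Y \<in> p" if "X \<in> p" "Y \<in> p" for X Y
    using that by (auto simp: p_def intro: definable_Int[OF C])
  define \<A> where "\<A> = {I. invariant_ideal n I \<and> I \<inter> p = {}}"
  have "\<exists>I\<in>\<A>. \<forall>J\<in>\<A>. I \<subseteq> J \<longrightarrow> J = I"
  proof (rule subset_Zorn_nonempty)
    have "{{}} \<in> \<A>" by (auto simp: \<A>_def invariant_ideal_def p_def definable_empty)
    then show "\<A> \<noteq> {}" by blast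
    fix \<C> assume ne: "\<C> \<noteq> {}" and ch: "subset.chain \<A> \<C>"
    then have id: "invariant_ideal n I" "I \<inter> p = {}" if "I \<in> \<C>" for I
      using that by (auto simp: subset.chain_def \<A>_def)
    have un: "X \<union> Y \<in> \<Union>\<C>" if XY: "X \<in> \<Union>\<C>" "Y \<in> \<Union>\<C>" for X Y
    proof -
      obtain I J where IJ: "I \<in> \<C>" "J \<in> \<C>" "X \<in> I" "Y \<in> J" using XY by blast
      then have "I \<subseteq> J \<or> J \<subseteq> I" using ch by (auto simp: subset.chain_def)
      then show ?thesis using IJ id(1) unfolding invariant_ideal_def by blast
    qed
    have "invariant_ideal n (\<Union>\<C>)"
      unfolding invariant_ideal_def
    proof (intro conjI ballI allI impI)
      show "\<Union>\<C> \<subseteq> Collect (dfn U n)" "{} \<in> \<Union>\<C>"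
        using id(1) ne unfolding invariant_ideal_def by blast+
    next
      fix X Y assume "X \<in> \<Union>\<C>" "Y \<in> \<Union>\<C>" then show "X \<union> Y \<in> \<Union>\<C>" by (rule un)
    next
      fix X Y assume "X \<in> \<Union>\<C>" "dfn U n Y" "Y \<subseteq> X"
      then show "Y \<in> \<Union>\<C>" using id(1) unfolding invariant_ideal_def by blast
    next
      fix \<sigma> X assume "\<sigma> \<in> Aut L S U {}" "X \<in> \<Union>\<C>"
      then show "map \<sigma> ` X \<in> \<Union>\<C>" using id(1) unfolding invariant_ideal_def by blast
    qed
    then show "\<Union>\<C> \<in> \<A>" using id(2) unfolding \<A>_def by blast
  qed
  then obtain I where IA: "I \<in> \<A>" and max: "\<And>J. J \<in> \<A> \<Longrightarrow> I \<subseteq> J \<Longrightarrow> J = I" by blast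
  from IA have Ip: "I \<inter> p = {}" and ideal: "invariant_ideal n I" by (auto simp: \<A>_def)
  have Idfn: "\<And>X. X \<in> I \<Longrightarrow> dfn U n X" and Iempty: "{} \<in> I"
    and Iun: "\<And>X Y. X \<in> I \<Longrightarrow> Y \<in> I \<Longrightarrow> X \<union> Y \<in> I"
    and Isub: "\<And>X Y. X \<in> I \<Longrightarrow> dfn U n Y \<Longrightarrow> Y \<subseteq> X \<Longrightarrow> Y \<in> I"
    and Iinv: "\<And>\<sigma> X. \<sigma> \<in> Aut L S U {} \<Longrightarrow> X \<in> I \<Longrightarrow> map \<sigma> ` X \<in> I"
    using ideal unfolding invariant_ideal_def by blast+
  have IUn: "\<Union>F \<in> I" if "finite F" "F \<subseteq> I" for F
    using that by (induction F rule: finite_induct) (auto intro: Iempty Iun)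
  define atom where "atom Z \<longleftrightarrow> dfn U n Z \<and> Z \<notin> I \<and>
    (\<forall>Y. dfn U n Y \<longrightarrow> Y \<subseteq> Z \<longrightarrow> Y \<in> I \<or> Z - Y \<in> I)" for Z
  have atom_image: "atom (map \<sigma> ` Z)" if \<sigma>: "\<sigma> \<in> Aut L S U {}" and Z: "atom Z" for \<sigma> Z
  proof -
    obtain \<tau> where \<tau>: "\<tau> \<in> Aut L S U {}" "\<And>x. set x \<subseteq> U \<Longrightarrow> map \<sigma> (map \<tau> x) = x"
      "\<And>x. set x \<subseteq> U \<Longrightarrow> map \<tau> (map \<sigma> x) = x" using Aut_inverse_map[OF \<sigma>] by blast
    have ZU: "set x \<subseteq> U" if "x \<in> Z" for x
      using that Z definable_subset[of L S U n Z] by (auto simp: atom_def tuples_def)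
    have "map \<tau> ` map \<sigma> ` Z = Z" using \<tau>(3) ZU by (force simp: image_image simp del: map_map)
    then have 1: "map \<sigma> ` Z \<notin> I" using Iinv[OF \<tau>(1)] Z by (metis atom_def)
    have 2: "Y \<in> I \<or> map \<sigma> ` Z - Y \<in> I" if Y: "dfn U n Y" "Y \<subseteq> map \<sigma> ` Z" for Y
    proof -
      have YU: "set x \<subseteq> U" if "x \<in> Y" for x
        using that definable_subset[OF Y(1)] by (auto simp: tuples_def)
      have sub: "map \<tau> ` Y \<subseteq> Z" using Y(2) \<tau>(3) ZU by (auto simp del: map_map)
      have Y': "map \<sigma> ` map \<tau> ` Y = Y" using \<tau>(2) YU by (force simp: image_image simp del: map_map)
      have "map \<tau> ` Y \<in> I \<or> Z - map \<tau> ` Y \<in> I"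
        using Z sub definable_Aut_image[OF \<tau>(1) Y(1)] by (auto simp: atom_def)
      then show ?thesis
      proof
        assume "map \<tau> ` Y \<in> I"
        then show ?thesis using Iinv[OF \<sigma>] Y' by metis
      next
        assume "Z - map \<tau> ` Y \<in> I"
        then have "map \<sigma> ` (Z - map \<tau> ` Y) \<in> I" by (rule Iinv[OF \<sigma>])
        moreover have "dfn U n (map \<sigma> ` Z - Y)"
          using Z Y(1) definable_Aut_image[OF \<sigma>] by (auto simp: atom_def intro: definable_Diff)
        moreover have "map \<sigma> ` Z - Y \<subseteq> map \<sigma> ` (Z - map \<tau> ` Y)" using Y' by blast
        ultimately show ?thesis using Isub by blast
      qed
    qed
    show ?thesis using 1 2 Z definable_Aut_image[OF \<sigma>] by (auto simp: atom_def)
  qed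
  define J where "J = {X. dfn U n X \<and> (\<exists>i\<in>I. \<exists>F. finite F \<and> F \<subseteq> Collect atom \<and> X \<subseteq> i \<union> \<Union>F)}"
  have "tuples n U \<in> p" using m by (simp add: p_def definable_UNIV)
  then have "tuples n U \<notin> I" using Ip by blast
  \<comment> \<open>An unsplittable set outside \<open>I\<close> is an atom modulo \<open>I\<close>.
    It lies in \<open>J\<close> but not in \<open>I\<close>, so by maximality of \<open>I\<close>
    the ideal \<open>J\<close> must meet the type.\<close>
  define Q where "Q = {X. dfn U n X \<and> X \<notin> I}"
  have "\<exists>Z\<in>Q. Z \<subseteq> tuples n U \<and> \<not> (\<exists>Y\<in>Q. \<exists>W\<in>Q. Y \<subseteq> Z \<and> W \<subseteq> Z \<and> Y \<inter> W = {})"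
    using \<open>tuples n U \<notin> I\<close> by (intro unsplittable_set) (auto simp: definable_UNIV Iempty Q_def)
  then obtain Z where ZQ: "Z \<in> Q" and "\<not> (\<exists>Y\<in>Q. \<exists>W\<in>Q. Y \<subseteq> Z \<and> W \<subseteq> Z \<and> Y \<inter> W = {})" by blast
  then have uns: "Y \<inter> W \<noteq> {}" if "Y \<in> Q" "W \<in> Q" "Y \<subseteq> Z" "W \<subseteq> Z" for Y W using that by blast
  have Z: "dfn U n Z" "Z \<notin> I" using ZQ by (auto simp: Q_def)
  have "atom Z" unfolding atom_def
  proof (intro conjI allI impI)
    fix Y assume Y: "dfn U n Y" "Y \<subseteq> Z"
    show "Y \<in> I \<or> Z - Y \<in> I"
      using uns[of Y "Z - Y"] Y definable_Diff[OF Z(1) Y(1)] by (auto simp: Q_def)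
  qed (use Z in auto)
  then have ZJ: "Z \<in> J" using Z(1) Iempty unfolding J_def by (auto intro!: exI[of _ "{Z}"])
  have IJ: "I \<subseteq> J" using Idfn by (auto simp: J_def intro!: exI[of _ "{}"])
  have "invariant_ideal n J"
    unfolding invariant_ideal_def
  proof (intro conjI ballI allI impI)
    show "J \<subseteq> Collect (dfn U n)" "{} \<in> J" using IJ Iempty by (auto simp: J_def)
  next
    fix X Y assume "X \<in> J" "Y \<in> J"
    then obtain i j F G where *: "dfn U n X" "dfn U n Y" "i \<in> I" "j \<in> I" "finite F" "finite G"
      "F \<subseteq> Collect atom" "G \<subseteq> Collect atom" "X \<subseteq> i \<union> \<Union>F" "Y \<subseteq> j \<union> \<Union>G"
      unfolding J_def by blast
    then have "X \<union> Y \<subseteq> (i \<union> j) \<union> \<Union>(F \<union> G)" by blast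
    moreover have "dfn U n (X \<union> Y)" using * by (intro definable_Un) auto
    ultimately show "X \<union> Y \<in> J" using * Iun unfolding J_def
      by (intro CollectI conjI bexI[of _ "i \<union> j"] exI[of _ "F \<union> G"]) auto
  next
    fix X Y assume XY: "X \<in> J" "dfn U n Y" "Y \<subseteq> X"
    then obtain i F where "i \<in> I" "finite F" "F \<subseteq> Collect atom" "X \<subseteq> i \<union> \<Union>F"
      unfolding J_def by blast
    then show "Y \<in> J" using XY(2,3) unfolding J_def
      by (intro CollectI conjI bexI[of _ i] exI[of _ F]) auto
  next
    fix \<sigma> X assume \<sigma>: "\<sigma> \<in> Aut L S U {}" and "X \<in> J"
    then obtain i F where *: "dfn U n X" "i \<in> I" "finite F" "F \<subseteq> Collect atom" "X \<subseteq> i \<union> \<Union>F"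
      unfolding J_def by blast
    have "map \<sigma> ` X \<subseteq> map \<sigma> ` i \<union> \<Union>((`) (map \<sigma>) ` F)"
      using image_mono[OF *(5), of "map \<sigma>"] by (simp add: image_Un image_Union)
    then show "map \<sigma> ` X \<in> J" using * \<sigma> Iinv atom_image definable_Aut_image[OF \<sigma>] unfolding J_def
      by (intro CollectI conjI bexI[of _ "map \<sigma> ` i"] exI[of _ "(`) (map \<sigma>) ` F"]) auto
  qed
  then have "J \<inter> p \<noteq> {}" using max[of J] IJ ZJ Z(2) by (auto simp: \<A>_def)
  then obtain \<psi>0 where \<psi>0: "\<psi>0 \<in> J" "\<psi>0 \<in> p" by blast
  define covers where "covers \<psi> i F \<longleftrightarrow> i \<in> I \<and> finite F \<and> F \<subseteq> Collect atom \<and> \<psi> \<subseteq> i \<union> \<Union>F" for \<psi> i F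
  have "\<exists>F. \<exists>\<psi>\<in>p. \<exists>i. covers \<psi> i F" using \<psi>0 unfolding J_def covers_def by blast
  then obtain F where "\<exists>\<psi>\<in>p. \<exists>i. covers \<psi> i F"
    and least: "\<And>F'. \<exists>\<psi>\<in>p. \<exists>i. covers \<psi> i F' \<Longrightarrow> card F \<le> card F'"
    using ex_has_least_nat[of "\<lambda>F. \<exists>\<psi>\<in>p. \<exists>i. covers \<psi> i F" _ card] by metis
  then obtain \<psi> i where \<psi>: "\<psi> \<in> p" and cov: "covers \<psi> i F" by blast
  have i: "i \<in> I" and F: "finite F" "F \<subseteq> Collect atom" "\<psi> \<subseteq> i \<union> \<Union>F" using cov by (auto simp: covers_def)
  have \<psi>U: "dfn U n \<psi>" using pU \<psi> .
  have diffI: "X \<in> I" if X: "dfn U n X" "X \<subseteq> \<psi>" and Zs: "\<And>Z. Z \<in> F \<Longrightarrow> Z \<inter> X \<in> I" for X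
  proof -
    have "i \<union> \<Union>((\<lambda>Z. Z \<inter> X) ` F) \<in> I" using i F Zs by (intro Iun IUn) auto
    moreover have "X \<subseteq> i \<union> \<Union>((\<lambda>Z. Z \<inter> X) ` F)" using X F(3) by blast
    ultimately show ?thesis using Isub X(1) by blast
  qed
  \<comment> \<open>If \<psi> - \<phi> were not in \<open>I\<close>, some atom \<open>Z\<close>
    would meet it outside \<open>I\<close>. The rest of \<open>Z\<close> would then belong to
    \<open>I\<close>, and \<psi> \<inter> \<phi>, which is in the type, could be covered without
    \<open>Z\<close>.\<close>
  have small: "\<psi> - \<phi> \<in> I" if \<phi>: "\<phi> \<in> p" for \<phi>
  proof (rule ccontr)
    assume not: "\<psi> - \<phi> \<notin> I"
    have d: "dfn U n (\<psi> - \<phi>)" using \<psi>U pU[OF \<phi>] by (intro definable_Diff) auto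
    obtain Z where Z: "Z \<in> F" "Z \<inter> (\<psi> - \<phi>) \<notin> I" using not diffI[OF d] by blast
    then have "Z - Z \<inter> (\<psi> - \<phi>) \<in> I"
      using F(2) d definable_Int[OF order_refl _ d, of Z] unfolding atom_def by blast
    then have "i \<union> (Z - Z \<inter> (\<psi> - \<phi>)) \<in> I" using i Iun by blast
    moreover have "\<psi> \<inter> \<phi> \<subseteq> (i \<union> (Z - Z \<inter> (\<psi> - \<phi>))) \<union> \<Union>(F - {Z})" using F(3) by blast
    ultimately have "covers (\<psi> \<inter> \<phi>) (i \<union> (Z - Z \<inter> (\<psi> - \<phi>))) (F - {Z})"
      using F(1,2) by (auto simp: covers_def)
    then have "card F \<le> card (F - {Z})" using least pInt[OF \<psi> \<phi>] by blast
    then show False using card_Diff1_less[OF F(1) Z(1)] by simp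
  qed
  obtain D where D: "finite D" "D \<subseteq> C" "dfn D n \<psi>"
    using \<psi> by (auto simp: p_def elim: definable_finite_params)
  obtain d where d: "set d = D" using finite_list[OF D(1)] by blast
  have dU: "set d \<subseteq> U" using d D C by blast
  have "\<exists>Y. dfn (set d) k Y \<and> (\<forall>c\<in>tuples k C. m @ c \<in> \<Phi> \<longleftrightarrow> c \<in> Y)"
    if \<Phi>: "dfn {} (n + k) \<Phi>" for k \<Phi>
  proof (intro exI conjI ballI)
    have \<Phi>U: "dfn U (n + k) \<Phi>" using \<Phi> definable_mono by blast
    define Y where "Y = {y\<in>tuples k U. \<psi> - fiber n \<Phi> y \<in> I}"
    have fU: "dfn U n (fiber n \<Phi> y)" if "y \<in> tuples k U" for y
      using that by (intro dfn_fiber[OF _ \<Phi>U]) (auto simp: tuples_def)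
    \<comment> \<open>Modulo \<open>I\<close>, an atom \<open>Z\<close> with
      \<open>Z \<inter> \<psi>\<close> outside \<open>I\<close> is an ultrafilter
      \<open>u Z\<close>, so \<open>ultrafilter_definable\<close> applies to it. There are finitely
      many such atoms, and \<open>Y\<close> is the intersection of the definable sets so
      obtained.\<close>
    define u where "u Z = {X. dfn U n X \<and> Z \<inter> \<psi> - X \<in> I}" for Z
    define F' where "F' = {Z\<in>F. Z \<inter> \<psi> \<notin> I}"
    have dZ: "dfn U n (Z \<inter> \<psi>)" if "Z \<in> F" for Z
      using that F(2) definable_Int[OF order_refl _ \<psi>U] unfolding atom_def by blast
    have uZ: "dfn U k {y\<in>tuples k U. fiber n \<Phi> y \<in> u Z}" if Z: "Z \<in> F'" for Z
    proof (rule ultrafilter_definable[OF \<Phi>U])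
      have ZF: "Z \<in> F" and ZI: "Z \<inter> \<psi> \<notin> I" using Z by (auto simp: F'_def)
      show "dfn U n X \<and> X \<noteq> {}" if "X \<in> u Z" for X using that ZI by (auto simp: u_def)
      show "X \<inter> X' \<in> u Z" if X: "X \<in> u Z" "X' \<in> u Z" for X X'
      proof -
        have "Z \<inter> \<psi> - X \<inter> X' = (Z \<inter> \<psi> - X) \<union> (Z \<inter> \<psi> - X')" by blast
        then show ?thesis using X Iun by (auto simp: u_def intro: definable_Int)
      qed
      show "X \<in> u Z \<or> tuples n U - X \<in> u Z" if X: "dfn U n X" for X
      proof -
        have "Z \<inter> \<psi> \<inter> X \<in> I \<or> Z - Z \<inter> \<psi> \<inter> X \<in> I"
          using ZF F(2) definable_Int[OF order_refl dZ[OF ZF] X] unfolding atom_def by blast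
        then show ?thesis
        proof
          assume "Z \<inter> \<psi> \<inter> X \<in> I"
          moreover have "Z \<inter> \<psi> - (tuples n U - X) = Z \<inter> \<psi> \<inter> X"
            using definable_subset[OF X] definable_subset[OF \<psi>U] by blast
          ultimately show ?thesis using X by (auto simp: u_def intro: definable_Compl)
        next
          assume "Z - Z \<inter> \<psi> \<inter> X \<in> I"
          then have "Z \<inter> \<psi> - X \<in> I"
            by (rule Isub) (use dZ[OF ZF] X in \<open>auto intro: definable_Diff\<close>)
          then show ?thesis using X by (auto simp: u_def)
        qed
      qed
    qed
    have Yeq: "Y = tuples k U - \<Union>((\<lambda>Z. tuples k U - {y\<in>tuples k U. fiber n \<Phi> y \<in> u Z}) ` F')"
    proof -
      have "\<psi> - fiber n \<Phi> y \<in> I \<longleftrightarrow> (\<forall>Z\<in>F'. fiber n \<Phi> y \<in> u Z)" if y: "y \<in> tuples k U" for y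
      proof
        assume a: "\<psi> - fiber n \<Phi> y \<in> I"
        have "Z \<inter> \<psi> - fiber n \<Phi> y \<in> I" if "Z \<in> F'" for Z
          by (rule Isub[OF a]) (use that dZ fU[OF y] in \<open>auto simp: F'_def intro: definable_Diff\<close>)
        then show "\<forall>Z\<in>F'. fiber n \<Phi> y \<in> u Z" using fU[OF y] by (auto simp: u_def)
      next
        assume a: "\<forall>Z\<in>F'. fiber n \<Phi> y \<in> u Z"
        show "\<psi> - fiber n \<Phi> y \<in> I"
        proof (rule diffI)
          show "dfn U n (\<psi> - fiber n \<Phi> y)" using \<psi>U fU[OF y] by (intro definable_Diff) auto
          fix Z assume ZF: "Z \<in> F"
          have eq: "Z \<inter> (\<psi> - fiber n \<Phi> y) = Z \<inter> \<psi> - fiber n \<Phi> y" by blast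
          show "Z \<inter> (\<psi> - fiber n \<Phi> y) \<in> I"
          proof (cases "Z \<in> F'")
            case True then show ?thesis using a eq by (auto simp: u_def)
          next
            case False
            then have "Z \<inter> \<psi> \<in> I" using ZF by (auto simp: F'_def)
            then show ?thesis unfolding eq
              by (rule Isub) (use dZ[OF ZF] fU[OF y] in \<open>auto intro: definable_Diff\<close>)
          qed
        qed auto
      qed
      then show ?thesis unfolding Y_def by blast
    qed
    have dY: "dfn U k Y"
      unfolding Yeq using F(1) uZ
      by (intro definable_Compl finite_Union_of_definables) (auto simp: F'_def intro: definable_Compl)
    \<comment> \<open>So far the parameters of \<open>Y\<close> are arbitrary. But \<open>Y\<close>
      is determined by \<Phi>, \<psi> and \<open>I\<close>, all of which are preserved by
      automorphisms fixing \<open>d\<close>.\<close>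
    show "dfn (set d) k Y"
    proof (rule invariant_definable[OF dY dU])
      fix \<sigma> y assume \<sigma>: "\<sigma> \<in> Aut L S U {}" and fix_d: "map \<sigma> d = d" and y: "y \<in> Y"
      obtain \<tau> where \<tau>: "\<tau> \<in> Aut L S U {}" "\<And>x. set x \<subseteq> U \<Longrightarrow> map \<sigma> (map \<tau> x) = x"
        "\<And>x. set x \<subseteq> U \<Longrightarrow> map \<tau> (map \<sigma> x) = x" using Aut_inverse_map[OF \<sigma>] by blast
      have yU: "set y \<subseteq> U" "length y = k" "y \<in> tuples k U" using y by (auto simp: Y_def tuples_def)
      have \<sigma>y: "map \<sigma> y \<in> tuples k U" using Aut_set[OF \<sigma> yU(1)] yU by (simp add: tuples_def)
      have "map \<tau> d = d" using \<tau>(3)[OF dU] fix_d by simp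
      then have fixd: "\<tau> a = a" if "a \<in> set d" for a using that by (metis map_eq_conv map_ident)
      have "\<psi> - fiber n \<Phi> (map \<sigma> y) \<subseteq> map \<sigma> ` (\<psi> - fiber n \<Phi> y)"
      proof
        fix x assume x: "x \<in> \<psi> - fiber n \<Phi> (map \<sigma> y)"
        then have xt: "x \<in> tuples n U" using definable_subset[OF \<psi>U] by blast
        then have xU: "set x \<subseteq> U" "length x = n" by (auto simp: tuples_def)
        have "same_type L S (set d) x (map \<tau> x)"
          by (rule elementary_map_same_type[OF AutD(3)[OF \<tau>(1)]]) (use xU fixd dU in auto)
        then have "map \<tau> x \<in> \<psi>" using x D(3) d xU by (auto simp: same_type_def)
        moreover have "map \<tau> x \<notin> fiber n \<Phi> y"
        proof
          assume "map \<tau> x \<in> fiber n \<Phi> y"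
          then have "map \<tau> (x @ map \<sigma> y) \<in> \<Phi>" using \<tau>(3)[OF yU(1)] by (simp add: fiber_def)
          moreover have "same_type L S {} (x @ map \<sigma> y) (map \<tau> (x @ map \<sigma> y))"
            by (rule elementary_map_same_type[OF AutD(3)[OF \<tau>(1)]]) (use xU \<sigma>y in \<open>auto simp: tuples_def\<close>)
          ultimately have "x @ map \<sigma> y \<in> \<Phi>" using \<Phi> xU yU by (simp add: same_type_iff)
          then show False using x xt by (auto simp: fiber_def)
        qed
        ultimately show "x \<in> map \<sigma> ` (\<psi> - fiber n \<Phi> y)"
          using \<tau>(2)[OF xU(1)] by (metis DiffI imageI)
      qed
      moreover have "map \<sigma> ` (\<psi> - fiber n \<Phi> y) \<in> I" using Iinv[OF \<sigma>] y by (auto simp: Y_def)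
      moreover have "dfn U n (\<psi> - fiber n \<Phi> (map \<sigma> y))" using \<psi>U fU[OF \<sigma>y] by (intro definable_Diff) auto
      ultimately show "map \<sigma> y \<in> Y" using Isub \<sigma>y by (auto simp: Y_def)
    qed
    fix c assume c: "c \<in> tuples k C"
    then have cU: "c \<in> tuples k U" using C by (auto simp: tuples_def)
    have fC: "dfn C n (fiber n \<Phi> c)"
      by (rule dfn_fiber[OF C definable_mono[OF \<Phi>]]) (use c in \<open>auto simp: tuples_def\<close>)
    show "m @ c \<in> \<Phi> \<longleftrightarrow> c \<in> Y"
    proof
      assume "m @ c \<in> \<Phi>"
      then have "fiber n \<Phi> c \<in> p" using fC m by (auto simp: p_def fiber_def)
      then show "c \<in> Y" using small cU by (auto simp: Y_def)
    next
      assume cY: "c \<in> Y"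
      show "m @ c \<in> \<Phi>"
      proof (rule ccontr)
        assume "m @ c \<notin> \<Phi>"
        then have "tuples n U - fiber n \<Phi> c \<in> p"
          using fC m by (auto simp: p_def fiber_def intro: definable_Compl)
        then have "\<psi> - (tuples n U - fiber n \<Phi> c) \<in> I" by (rule small)
        then have "(\<psi> - (tuples n U - fiber n \<Phi> c)) \<union> (\<psi> - fiber n \<Phi> c) \<in> I"
          using cY Iun by (auto simp: Y_def)
        then have "\<psi> \<in> I" by (rule Isub[OF _ \<psi>U]) blast
        then show False using Ip \<psi> by blast
      qed
    qed
  qed
  then show ?thesis using D d by blast
qed

end

section \<open>Isolated types\<close>

lemma defterm_reindex:
  assumes "defterm S C N E v k t" "set is \<subseteq> {..<k}"
  shows "defterm S C N E v (length is) (\<lambda>e. map (\<lambda>i. t e ! i) is)"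
proof -
  from assms obtain ss where ss: "length ss = k" "set ss \<subseteq> {..<N} <+> C"
    "\<forall>e\<in>E. t e = term_val (v e) ss" "v ` E \<subseteq> tuples N (univ S)" unfolding defterm_def by blast
  show ?thesis unfolding defterm_def
  proof (intro conjI exI[of _ "map (\<lambda>i. ss ! i) is"] ballI)
    show "set (map ((!) ss) is) \<subseteq> {..<N} <+> C" using ss assms(2) nth_mem by fastforce
    fix e assume "e \<in> E"
    then show "map ((!) (t e)) is = term_val (v e) (map ((!) ss) is)"
      using ss assms(2) by (auto simp: term_val_def)
  qed (use ss in auto)
qed

lemma obtain_indices:
  assumes "set d \<subseteq> set a"
  obtains "is" where "length is = length d" "set is \<subseteq> {..<length a}" "map ((!) a) is = d"
proof -
  have "\<forall>x\<in>set d. \<exists>i<length a. a ! i = x" using assms by (auto simp: in_set_conv_nth subset_iff)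
  then obtain f where f: "\<And>x. x \<in> set d \<Longrightarrow> f x < length a \<and> a ! f x = x" by metis
  show ?thesis by (rule that[of "map f d"]) (use f in \<open>auto intro!: map_idI\<close>)
qed

text \<open>In contrast to \<open>definable_params\<close>, the tuple of parameters is prescribed:
  the parameters that occur are picked out of \<open>a\<close> by their positions.\<close>

lemma definable_params_list:
  assumes X: "definable L S (C \<union> set a) n X" and C: "C \<union> set a \<subseteq> univ S"
  obtains \<Phi> where "definable L S C (n + length a) \<Phi>"
    "\<And>x. x \<in> tuples n (univ S) \<Longrightarrow> x \<in> X \<longleftrightarrow> x @ a \<in> \<Phi>"
proof -
  have CU: "C \<subseteq> univ S" using C by blast
  obtain d \<Phi> where d: "set d \<subseteq> set a" and \<Phi>: "definable L S C (n + length d) \<Phi>"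
    "\<And>x. x \<in> tuples n (univ S) \<Longrightarrow> x \<in> X \<longleftrightarrow> x @ d \<in> \<Phi>"
    using definable_params[OF X C] by blast
  obtain "is" where "is": "length is = length d" "set is \<subseteq> {..<length a}" "map ((!) a) is = d"
    by (rule obtain_indices[OF d])
  define \<Psi> where "\<Psi> = {w\<in>tuples (n + length a) (univ S). \<exists>x\<in>tuples n (univ S).
    \<exists>y\<in>tuples (length a) (univ S). w = x @ y \<and> x @ map ((!) y) is \<in> \<Phi>}"
  have in\<Psi>: "x @ y \<in> \<Psi> \<longleftrightarrow> x @ map ((!) y) is \<in> \<Phi>"
    if "x \<in> tuples n (univ S)" "y \<in> tuples (length a) (univ S)" for x y
    using that by (auto simp: \<Psi>_def append_tuples_inject intro!: tuples_append)
  have "definable L S C (n + length a) \<Psi>"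
    by (rule definable_Collect2[OF _ refl in\<Psi>])
      (auto simp: \<Psi>_def, (rule defpred_mem[OF CU \<Phi>(1)] defterm_append defterm_reindex
        defterm_fst defterm_snd defterm_id is_env_cons is_env_id "is"(2) | simp add: "is"(1))+)
  moreover have "x \<in> X \<longleftrightarrow> x @ a \<in> \<Psi>" if "x \<in> tuples n (univ S)" for x
    using in\<Psi>[OF that, of a] \<Phi>(2)[OF that] "is"(3) C by (simp add: tuples_def)
  ultimately show ?thesis using that by blast
qed

context monster
begin

definition isolates :: "'m set \<Rightarrow> nat \<Rightarrow> 'm list set \<Rightarrow> 'm list \<Rightarrow> bool" where
  "isolates D n W m \<longleftrightarrow> dfn D n W \<and> m \<in> W \<and> (\<forall>Z. dfn D n Z \<longrightarrow> m \<in> Z \<longrightarrow> W \<subseteq> Z)"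

definition isolated :: "'m set \<Rightarrow> 'm list \<Rightarrow> bool" where
  "isolated D m \<longleftrightarrow> (\<exists>W. isolates D (length m) W m)"

lemma isolates_dfn: "isolates D n W m \<Longrightarrow> dfn D n W" "isolates D n W m \<Longrightarrow> m \<in> W"
  and isolates_sub: "isolates D n W m \<Longrightarrow> dfn D n Z \<Longrightarrow> m \<in> Z \<Longrightarrow> W \<subseteq> Z"
  by (auto simp: isolates_def)

lemma isolates_tuples: "isolates D n W m \<Longrightarrow> m \<in> tuples n U"
  using definable_subset[of L S D n W] unfolding isolates_def by blast

lemma isolated_set: "isolated D m \<Longrightarrow> set m \<subseteq> U"
  using isolates_tuples[of D _ _ m] by (auto simp: isolated_def tuples_def)

lemma isolates_same_type: "isolates D n W m \<Longrightarrow> m' \<in> W \<Longrightarrow> same_type L S D m m'"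
  using isolates_tuples[of D n W m] unfolding same_type_def isolates_def tuples_def by blast

lemma isolates_base:
  "isolates D n W m \<Longrightarrow> dfn E n W \<Longrightarrow> E \<subseteq> D \<Longrightarrow> isolates E n W m"
  unfolding isolates_def using definable_mono by blast

text \<open>An unsplittable nonempty set is an atom of the Boolean algebra of sets definable over
  \<open>D\<close>, so it isolates the type of each of its points.\<close>

lemma isolated_dense:
  assumes X: "dfn D n X" "X \<noteq> {}" and D: "D \<subseteq> U"
  shows "\<exists>m W. isolates D n W m \<and> W \<subseteq> X"
proof -
  define Q where "Q = {X. dfn D n X \<and> X \<noteq> {}}"
  have "\<exists>W\<in>Q. W \<subseteq> X \<and> \<not> (\<exists>Y\<in>Q. \<exists>Z\<in>Q. Y \<subseteq> W \<and> Z \<subseteq> W \<and> Y \<inter> Z = {})"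
    by (rule unsplittable_set) (use X definable_mono[OF _ D] in \<open>auto simp: Q_def\<close>)
  then obtain W where WQ: "W \<in> Q" "W \<subseteq> X"
    and uns: "\<not> (\<exists>Y\<in>Q. \<exists>Z\<in>Q. Y \<subseteq> W \<and> Z \<subseteq> W \<and> Y \<inter> Z = {})" by blast
  have W: "dfn D n W" "W \<noteq> {}" using WQ by (auto simp: Q_def)
  obtain m where m: "m \<in> W" using W by blast
  have "W \<subseteq> Z" if Z: "dfn D n Z" "m \<in> Z" for Z
  proof -
    have "W \<inter> Z \<in> Q"
      using m Z definable_Int[OF D W(1) Z(1)] by (auto simp: Q_def)
    moreover have "W \<inter> Z \<inter> (W - Z) = {}" by blast
    ultimately have "W - Z \<notin> Q" using uns by (meson Diff_subset inf_le1)
    then show ?thesis using definable_Diff[OF W(1) Z(1) D] by (auto simp: Q_def)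
  qed
  then have "isolates D n W m" using W m by (simp add: isolates_def)
  then show ?thesis using WQ(2) by blast
qed

text \<open>Suppose \<open>Z\<close> contains \<open>a @ b\<close>. That all \<open>y\<close>
  related to \<open>x\<close> as \<open>V\<close> relates \<open>b\<close> to \<open>a\<close>
  satisfy \<open>x @ y \<in> Z\<close> is then a property of \<open>x\<close> over \<open>D\<close>.
  It holds at \<open>a\<close>, hence on all of \<open>W\<close>.\<close>

lemma isolates_append:
  assumes W: "isolates D n W a" and V: "isolates (D \<union> set a) k V b" and D: "D \<subseteq> U"
  shows "isolated D (a @ b)"
proof -
  have a: "a \<in> tuples n U" and b: "b \<in> tuples k U" using isolates_tuples W V by auto
  have Da: "D \<union> set a \<subseteq> U" using D a by (auto simp: tuples_def)
  obtain V0 where V0: "dfn D (k + length a) V0" "\<And>y. y \<in> tuples k U \<Longrightarrow> y \<in> V \<longleftrightarrow> y @ a \<in> V0"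
    using definable_params_list[OF isolates_dfn(1)[OF V] Da] by blast
  have la: "length a = n" using a by (simp add: tuples_def)
  define W' where "W' = {w\<in>tuples (n + k) U. \<exists>x\<in>tuples n U. \<exists>y\<in>tuples k U. w = x @ y \<and> x \<in> W \<and> y @ x \<in> V0}"
  have inW': "x @ y \<in> W' \<longleftrightarrow> x \<in> W \<and> y @ x \<in> V0" if "x \<in> tuples n U" "y \<in> tuples k U" for x y
    using that by (auto simp: W'_def append_tuples_inject intro!: tuples_append)
  have dW': "dfn D (n + k) W'"
    by (rule definable_Collect2[OF _ refl inW'])
      (auto simp: W'_def, (rule defintros D defpred_mem[OF D isolates_dfn(1)[OF W]]
        defpred_mem[OF D V0(1)] refl | simp add: la)+)
  have "isolates D (n + k) W' (a @ b)"
    unfolding isolates_def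
  proof (intro conjI allI impI)
    show "a @ b \<in> W'" using inW'[OF a b] V0(2)[OF b] isolates_dfn(2)[OF W] isolates_dfn(2)[OF V] by simp
    fix Z assume Z: "dfn D (n + k) Z" "a @ b \<in> Z"
    define Y where "Y = {x\<in>tuples n U. \<forall>y\<in>tuples k U. y @ x \<in> V0 \<longrightarrow> x @ y \<in> Z}"
    have "dfn D n Y" unfolding Y_def
      by (rule definable_Collect)
        (rule defintros D defpred_mem[OF D Z(1)] defpred_mem[OF D V0(1)] definable_UNIV refl | simp add: la)+
    moreover have "a \<in> Y"
    proof -
      define Z' where "Z' = {y\<in>tuples k U. a @ y \<in> Z}"
      have "dfn (D \<union> set a) k Z'" unfolding Z'_def
        by (rule definable_Collect)
          (rule defpred_mem[OF Da definable_mono[OF Z(1)]] defintros Da refl | simp add: la)+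
      moreover have "b \<in> Z'" using Z b by (simp add: Z'_def)
      ultimately have "V \<subseteq> Z'" by (rule isolates_sub[OF V])
      then show ?thesis using V0(2) a by (auto simp: Y_def Z'_def)
    qed
    ultimately have "W \<subseteq> Y" by (rule isolates_sub[OF W])
    then show "W' \<subseteq> Z" by (auto simp: W'_def Y_def)
  qed (fact dW')
  then show ?thesis using a b by (auto simp: isolated_def tuples_def)
qed

text \<open>The image of an isolating set under a coordinate map is isolating. Repetitions and
  permutations are allowed, so only the set of entries of the tuple matters.\<close>

lemma isolated_reindex:
  assumes m: "isolated D m" and t: "set t \<subseteq> set m" and D: "D \<subseteq> U"
  shows "isolated D t"
proof -
  obtain W where W: "isolates D (length m) W m" using m by (auto simp: isolated_def)
  obtain "is" where "is": "length is = length t" "set is \<subseteq> {..<length m}" "map ((!) m) is = t"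
    by (rule obtain_indices[OF t])
  have mU: "m \<in> tuples (length m) U" using isolates_tuples[OF W] .
  have tU: "t \<in> tuples (length t) U" using t mU by (auto simp: tuples_def)
  define W' where "W' = {y\<in>tuples (length t) U. \<exists>x\<in>W. y = map ((!) x) is}"
  have "isolates D (length t) W' t" unfolding isolates_def
  proof (intro conjI allI impI)
    show "dfn D (length t) W'" unfolding W'_def
      by (rule definable_Collect)
        (rule defpred_bex defpred_eq defterm_reindex defterm_fst defterm_snd defterm_id is_env_cons is_env_id
          isolates_dfn(1)[OF W] D "is"(2) | simp add: "is"(1))+
    show "t \<in> W'" using tU isolates_dfn(2)[OF W] "is"(3) by (auto simp: W'_def)
    fix Z assume Z: "dfn D (length t) Z" "t \<in> Z"
    define Y where "Y = {x\<in>tuples (length m) U. map ((!) x) is \<in> Z}"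
    have "dfn D (length m) Y" unfolding Y_def
      by (rule definable_Collect)
        (rule defpred_mem[OF D Z(1)] defterm_reindex defterm_id "is"(2) | simp add: "is"(1))+
    moreover have "m \<in> Y" using mU Z "is"(3) by (simp add: Y_def)
    ultimately have "W \<subseteq> Y" by (rule isolates_sub[OF W])
    then show "W' \<subseteq> Z" by (auto simp: W'_def Y_def)
  qed
  then show ?thesis by (auto simp: isolated_def)
qed

lemma isolated_append_params:
  assumes m: "isolated D m" and c: "set c \<subseteq> D" and D: "D \<subseteq> U"
  shows "isolated D (m @ c)"
proof -
  obtain W where W: "isolates D (length m) W m" using m by (auto simp: isolated_def)
  have cU: "c \<in> tuples (length c) U" using c D by (auto simp: tuples_def)
  have "isolates (D \<union> set m) (length c) {y\<in>tuples (length c) U. y = c} c"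
    unfolding isolates_def
  proof (intro conjI allI impI)
    have Dm: "D \<union> set m \<subseteq> U" using D isolated_set[OF m] by blast
    show "dfn (D \<union> set m) (length c) {y\<in>tuples (length c) U. y = c}"
      by (rule definable_Collect) (rule defpred_eq Dm defintros refl | use c in blast)+
  qed (use cU in auto)
  then show ?thesis by (rule isolates_append[OF W _ D])
qed

lemma isolated_fiber:
  assumes ab: "isolated D (a @ b)" and D: "D \<subseteq> U"
  shows "\<exists>W \<Phi>. isolates (D \<union> set b) (length a) W a \<and> dfn D (length a + length b) \<Phi> \<and>
    (\<forall>x\<in>tuples (length a) U. x \<in> W \<longleftrightarrow> x @ b \<in> \<Phi>)"
proof -
  obtain V where V: "isolates D (length (a @ b)) V (a @ b)" using ab by (auto simp: isolated_def)
  have U: "set a \<subseteq> U" "set b \<subseteq> U" using isolated_set[OF ab] by auto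
  then have Db: "D \<union> set b \<subseteq> U" using D by blast
  have dV: "dfn D (length a + length b) V" using isolates_dfn(1)[OF V] by simp
  define W where "W = {x\<in>tuples (length a) U. x @ b \<in> V}"
  have "isolates (D \<union> set b) (length a) W a" unfolding isolates_def
  proof (intro conjI allI impI)
    show "dfn (D \<union> set b) (length a) W"
      unfolding W_def by (rule definable_fiber[OF dV]) (use Db in auto)
    show "a \<in> W" using U isolates_dfn(2)[OF V] by (auto simp: W_def tuples_def)
    fix Z assume Z: "dfn (D \<union> set b) (length a) Z" "a \<in> Z"
    obtain Z0 where Z0: "dfn D (length a + length b) Z0"
      "\<And>x. x \<in> tuples (length a) U \<Longrightarrow> x \<in> Z \<longleftrightarrow> x @ b \<in> Z0"
      using definable_params_list[OF Z(1) Db] by blast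
    have "a @ b \<in> Z0" using Z(2) Z0(2) U by (auto simp: tuples_def)
    then have "V \<subseteq> Z0" using isolates_sub[OF V] Z0(1) by simp
    then show "W \<subseteq> Z" using Z0(2) by (auto simp: W_def)
  qed
  then show ?thesis using dV by (intro exI[of _ W] exI[of _ V]) (auto simp: W_def)
qed

lemma isolated_over_params:
  assumes "isolated D (a @ b)" and "D \<subseteq> U"
  shows "isolated (D \<union> set b) a"
  using isolated_fiber[OF assms] unfolding isolated_def by blast

end

section \<open>Elementary substructures and constructible sets\<close>

lemma eval_substruct: "eval (substruct S M) e t = eval S e t"
proof (induction t)
  case (Fn f ts)
  then have "map (eval (substruct S M) e) ts = map (eval S e) ts" by simp
  then show ?case by (metis (no_types, lifting) eval.simps(2) select_convs(2) surjective update_convs(1))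
qed simp

context monster
begin

text \<open>The Tarski-Vaught criterion for tuples. In this form it needs no satisfaction inside
  \<open>M\<close> and can be carried along elementary maps.\<close>

definition meets_definable :: "'m set \<Rightarrow> bool" where
  "meets_definable M \<longleftrightarrow> M \<subseteq> U \<and> (\<forall>n X. dfn M n X \<longrightarrow> X \<noteq> {} \<longrightarrow> (\<exists>x\<in>X. set x \<subseteq> M))"

lemma meets_definable_subset: "meets_definable M \<Longrightarrow> M \<subseteq> U"
  by (simp add: meets_definable_def)

lemma meets_definable_point:
  assumes "meets_definable M" "dfn C n X" "C \<subseteq> M" "X \<noteq> {}"
  obtains x where "x \<in> X" "set x \<subseteq> M"
  using assms definable_mono[OF assms(2,3)] unfolding meets_definable_def by blast

lemma elementary_meets_definable:
  assumes M: "elementary_substructure L S M"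
  shows "meets_definable M"
proof -
  have elem: "sat (substruct S M) b \<phi> \<longleftrightarrow> sat S b \<phi>" if "set b \<subseteq> M" "wff L (length b) \<phi>" for b \<phi>
    using M that unfolding elementary_substructure_def elementary_map_def by (metis list.map_ident)
  have MU: "M \<subseteq> U"
    using M unfolding elementary_substructure_def elementary_map_def by auto
  have "\<exists>x\<in>X. set x \<subseteq> M" if X: "dfn M n X" "X \<noteq> {}" for n X
  proof -
    from X(1) obtain \<phi> c where \<phi>: "wff L (n + length c) \<phi>" "set c \<subseteq> M"
      and Xeq: "X = {x\<in>tuples n U. sat S (x @ c) \<phi>}" by (rule definableE)
    have "sat S c ((Ex ^^ n) \<phi>)" using X(2) by (auto simp: Xeq sat_Ex_pow)
    then have "sat (substruct S M) c ((Ex ^^ n) \<phi>)" using elem \<phi> by (simp add: wff_Ex_pow)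
    then obtain x where x: "x \<in> tuples n M" "sat (substruct S M) (x @ c) \<phi>" by (auto simp: sat_Ex_pow)
    then have "sat S (x @ c) \<phi>" using elem[of "x @ c"] \<phi> by (simp add: tuples_def)
    then show ?thesis using x MU by (auto simp: Xeq tuples_def)
  qed
  then show ?thesis using MU by (simp add: meets_definable_def)
qed

text \<open>The Tarski-Vaught test. Closure under function symbols is an instance of its hypothesis,
  because the singleton of a value is definable from the arguments.\<close>

lemma elementary_substructureI:
  assumes MU: "M \<subseteq> U" and tv: "\<And>X. dfn M 1 X \<Longrightarrow> X \<noteq> {} \<Longrightarrow> \<exists>x\<in>M. [x] \<in> X"
  shows "elementary_substructure L S M"
proof -
  have "tuples 1 U \<noteq> {}" using U_nonempty by (auto simp: tuples_def length_Suc_conv)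
  then have "M \<noteq> {}" using tv[OF definable_UNIV] by blast
  moreover have "fint S f xs \<in> M" if xs: "xs \<in> tuples (farity L f) M" for f xs
  proof -
    let ?\<phi> = "Eq (Var 0) (Fn f (map Var [1..<Suc (length xs)])) :: ('f, 'r) fm"
    have sat: "sat S (x @ xs) ?\<phi> \<longleftrightarrow> x = [fint S f xs]" if x: "x \<in> tuples 1 U" for x
    proof -
      obtain a where a: "x = [a]" using x by (auto simp: tuples_def length_Suc_conv)
      have "map (eval S (x @ xs)) (map Var [1..<Suc (length xs)]) = xs"
        by (rule nth_equalityI) (auto simp: a simp del: upt_Suc)
      then show ?thesis using a by (simp del: upt_Suc map_map)
    qed
    have "fint S f xs \<in> U"
      using structure_of_S xs MU unfolding structure_of_def by (auto simp: tuples_def)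
    then have in_U: "[fint S f xs] \<in> tuples 1 U" by (simp add: tuples_def)
    have "dfn M 1 {[fint S f xs]}"
    proof (rule definableI[where \<phi> = ?\<phi> and c = xs])
      show "{[fint S f xs]} = {x\<in>tuples 1 U. sat S (x @ xs) ?\<phi>}" using sat in_U by blast
    qed (use xs in \<open>auto simp: tuples_def\<close>)
    from tv[OF this] show ?thesis by auto
  qed
  ultimately have str: "structure_of L (substruct S M)" by (auto simp: structure_of_def)
  have "sat (substruct S M) e \<phi> \<longleftrightarrow> sat S e \<phi>" if "set e \<subseteq> M" "wff L (length e) \<phi>" for e \<phi>
    using that
  proof (induction \<phi> arbitrary: e)
    case (Rel r ts)
    have "eval (substruct S M) e = eval S e" by (rule ext) (rule eval_substruct)
    then show ?case by simp
  next
    case (Ex \<phi>)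
    have IH: "sat (substruct S M) (x # e) \<phi> \<longleftrightarrow> sat S (x # e) \<phi>" if "x \<in> M" for x
      using Ex.IH[of "x # e"] Ex.prems that by simp
    have "dfn M 1 {x\<in>tuples 1 U. sat S (x @ e) \<phi>}"
      using Ex.prems by (intro definableI[where \<phi> = \<phi> and c = e]) auto
    note tv' = tv[OF this]
    have "\<exists>y\<in>M. sat S (y # e) \<phi>" if "x \<in> U" "sat S (x # e) \<phi>" for x
    proof -
      have "[x] \<in> {x\<in>tuples 1 U. sat S (x @ e) \<phi>}" using that by (simp add: tuples_def)
      then have "{x\<in>tuples 1 U. sat S (x @ e) \<phi>} \<noteq> {}" by blast
      from tv'[OF this] show ?thesis by auto
    qed
    then show ?case using IH MU by auto
  qed (auto simp: eval_substruct)
  then show ?thesis using str MU by (auto simp: elementary_substructure_def elementary_map_def)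
qed

section \<open>Constructible models\<close>

definition construction :: "'m set \<Rightarrow> 'm set \<Rightarrow> 'm rel \<Rightarrow> bool" where
  "construction A N s \<longleftrightarrow> A \<subseteq> N \<and> N \<subseteq> U \<and> wf s \<and> trans s \<and> s \<subseteq> (N - A) \<times> (N - A) \<and>
     total_on (N - A) s \<and> (\<forall>a\<in>N - A. isolated (A \<union> s\<inverse> `` {a}) [a])"

text \<open>
  The construction is by recursion along a well-order of \<open>'m set\<close>, which is too long to be
  embedded into \<open>'m\<close>; hence the recursion has to stop.
\<close>

lemma constructible_model_exists:
  assumes A: "A \<subseteq> U"
  shows "\<exists>N s. construction A N s \<and> elementary_substructure L S N"
proof -
  obtain r0 :: "'m set rel" where r0: "Well_order r0" "Field r0 = UNIV"
    by (metis well_ordering)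
  define r where "r = r0 - Id"
  have wf: "wf r" using r0 by (simp add: r_def well_order_on_def)
  have tot: "i = j \<or> (i, j) \<in> r \<or> (j, i) \<in> r" for i j
    using r0 by (auto simp: r_def well_order_on_def linear_order_on_def total_on_def)
  have trans: "trans r"
    using r0 by (auto simp: r_def well_order_on_def linear_order_on_def partial_order_on_def
        preorder_on_def intro: trans_diff_Id)
  \<comment> \<open>Only elements outside \<open>B\<close> count as new, so the recursion is
    injective for as long as it can continue.\<close>
  define new where "new B a \<longleftrightarrow> a \<in> U \<and> a \<notin> B \<and> isolated B [a]" for B a
  define f where "f = wfrec r (\<lambda>f i. SOME a. new (A \<union> f ` (r\<inverse> `` {i})) a)"
  have f: "f i = (SOME a. new (A \<union> f ` (r\<inverse> `` {i})) a)" for i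
  proof -
    have "f i = (SOME a. new (A \<union> cut f r i ` (r\<inverse> `` {i})) a)"
      unfolding f_def by (subst wfrec[OF wf]) simp
    moreover have "cut f r i ` (r\<inverse> `` {i}) = f ` (r\<inverse> `` {i})" by (auto simp: cut_def)
    ultimately show ?thesis by simp
  qed
  define B where "B i = A \<union> f ` (r\<inverse> `` {i})" for i
  have stop: "\<exists>i. \<not> (\<exists>a. new (B i) a)"
  proof (rule ccontr)
    assume "\<not> ?thesis"
    then have fi: "new (B i) (f i)" for i using f[of i] by (metis B_def someI_ex)
    have "inj f"
    proof (rule injI)
      fix i j assume eq: "f i = f j"
      have "f i \<noteq> f j" if "(i, j) \<in> r" for i j
      proof -
        have "f i \<in> B j" using that by (auto simp: B_def)
        then show ?thesis using fi[of j] by (auto simp: new_def)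
      qed
      then show "i = j" using tot[of i j] eq by metis
    qed
    then have "inv_into UNIV f ` UNIV = Pow UNIV" using inj_imp_surj_inv by auto
    then show False using Cantors_theorem by blast
  qed
  define Q where "Q = {i. \<not> (\<exists>a. new (B i) a)}"
  obtain i0 where "i0 \<in> Q" and "\<And>i. (i, i0) \<in> r \<Longrightarrow> i \<notin> Q"
  proof -
    obtain j where "j \<in> Q" using stop by (auto simp: Q_def)
    then show ?thesis using that by (rule wfE_min[OF wf])
  qed
  then have i0: "\<not> (\<exists>a. new (B i0) a)" and min: "\<And>i. (i, i0) \<in> r \<Longrightarrow> \<exists>a. new (B i) a"
    by (auto simp: Q_def)
  \<comment> \<open>At \<open>i0\<close> there is nothing left to choose and the value of
    \<open>f\<close> is arbitrary; only the initial segment below \<open>i0\<close> is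
    retained.\<close>
  define I where "I = r\<inverse> `` {i0}"
  have fI: "new (B i) (f i)" if "i \<in> I" for i
    using min[of i] that f[of i] by (auto simp: I_def B_def intro: someI_ex)
  have inj: "i = j" if "i \<in> I" "j \<in> I" "f i = f j" for i j
  proof -
    have "f i \<noteq> f j" if "(i, j) \<in> r" "j \<in> I" for i j
    proof -
      have "f i \<in> B j" using that by (auto simp: B_def)
      then show ?thesis using fI[OF that(2)] by (auto simp: new_def)
    qed
    then show ?thesis using tot[of i j] that by metis
  qed
  have IA: "f i \<notin> A" "f i \<in> U" if "i \<in> I" for i using fI[OF that] by (auto simp: new_def B_def)
  define N where "N = A \<union> f ` I"
  have NA: "N - A = f ` I" using IA by (auto simp: N_def)
  define s where "s = {(f i, f j) |i j. i \<in> I \<and> j \<in> I \<and> (i, j) \<in> r}"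
  define g where "g = inv_into I f"
  have g: "g (f i) = i" if "i \<in> I" for i using that inj by (simp add: g_def inj_on_def inv_into_f_f)
  have Idown: "i \<in> I" if "(i, j) \<in> r" "j \<in> I" for i j using that trans by (auto simp: I_def trans_def)
  have "construction A N s" unfolding construction_def
  proof (intro conjI ballI)
    show "A \<subseteq> N" "N \<subseteq> U" using A IA by (auto simp: N_def)
    show "wf s" by (rule wf_subset[OF wf_inv_image[OF wf, of g]]) (auto simp: s_def inv_image_def g)
    show "trans s"
    proof (rule transI)
      fix x y z assume "(x, y) \<in> s" "(y, z) \<in> s"
      then obtain i j j' k where "x = f i" "y = f j" "y = f j'" "z = f k" "i \<in> I" "j \<in> I" "j' \<in> I" "k \<in> I"
        "(i, j) \<in> r" "(j', k) \<in> r" unfolding s_def by blast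
      moreover then have "j' = j" using inj by metis
      ultimately show "(x, z) \<in> s" using trans unfolding s_def trans_def by blast
    qed
    show "s \<subseteq> (N - A) \<times> (N - A)" unfolding NA by (auto simp: s_def)
    show "total_on (N - A) s" unfolding NA
    proof (rule total_onI)
      fix x y assume "x \<in> f ` I" "y \<in> f ` I" "x \<noteq> y"
      then obtain i j where "x = f i" "y = f j" "i \<in> I" "j \<in> I" "i \<noteq> j" by blast
      then show "(x, y) \<in> s \<or> (y, x) \<in> s" using tot[of i j] by (auto simp: s_def)
    qed
    fix a assume "a \<in> N - A"
    then obtain i where i: "i \<in> I" "a = f i" unfolding NA by blast
    have "s\<inverse> `` {a} = f ` (r\<inverse> `` {i})"
    proof (intro equalityI subsetI)
      fix x assume "x \<in> s\<inverse> `` {a}"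
      then obtain k j where k: "x = f k" "a = f j" "(k, j) \<in> r" "j \<in> I" by (auto simp: s_def)
      have "j = i" by (rule inj) (use k i in simp_all)
      then show "x \<in> f ` (r\<inverse> `` {i})" using k by blast
    next
      fix x assume "x \<in> f ` (r\<inverse> `` {i})"
      then obtain k where k: "x = f k" "(k, i) \<in> r" by blast
      have "k \<in> I" by (rule Idown[OF k(2) i(1)])
      then have "(x, a) \<in> s" using k i unfolding s_def by blast
      then show "x \<in> s\<inverse> `` {a}" by blast
    qed
    then show "isolated (A \<union> s\<inverse> `` {a}) [a]" using fI[OF i(1)] i by (simp add: new_def B_def)
  qed
  moreover have "elementary_substructure L S N"
  proof (rule elementary_substructureI)
    show NU: "N \<subseteq> U" using A IA by (auto simp: N_def)
    fix X assume X: "dfn N 1 X" "X \<noteq> {}"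
    \<comment> \<open>Isolated types over \<open>N\<close> are dense, and an element outside
      \<open>N\<close> realizing one would still be new at \<open>i0\<close>. So the point found
      here already belongs to \<open>N\<close>.\<close>
    obtain m W where m: "isolates N 1 W m" "W \<subseteq> X" using isolated_dense[OF X NU] by blast
    obtain a where a: "m = [a]" "a \<in> U"
      using isolates_tuples[OF m(1)] by (auto simp: tuples_def length_Suc_conv)
    have "isolated N [a]" using m(1) a by (auto simp: isolated_def)
    moreover have "B i0 = N" by (simp add: B_def N_def I_def)
    ultimately have "a \<in> N" using i0 a by (auto simp: new_def)
    then show "\<exists>x\<in>N. [x] \<in> X" using m a isolates_dfn(2)[OF m(1)] by blast
  qed
  ultimately show ?thesis by blast
qed

end

locale constructible = monster L T \<kappa> S
  for L :: "('f, 'r) lang" and T :: "('f, 'r) fm set" and \<kappa> :: "'k rel"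
    and S :: "('f, 'r, 'm) struct" +
  fixes A N :: "'m set" and s :: "'m rel"
  assumes construction: "construction A N s"
begin

lemma AN: "A \<subseteq> N" and NU: "N \<subseteq> U" and wf_s: "wf s" and trans_s: "trans s"
  and total_s: "total_on (N - A) s" and s_sub: "s \<subseteq> (N - A) \<times> (N - A)"
  using construction unfolding construction_def by blast+

definition pre :: "'m \<Rightarrow> 'm set" where "pre a = s\<inverse> `` {a}"

lemma pre_sub: "pre a \<subseteq> N - A" using s_sub by (auto simp: pre_def)

lemma pre_trans: "b \<in> pre a \<Longrightarrow> pre b \<subseteq> pre a" using trans_s by (auto simp: pre_def trans_def)

lemma pre_irrefl: "a \<notin> pre a" using wf_s by (auto simp: pre_def)

lemma pre_cases: "a \<in> N - A \<Longrightarrow> b \<in> N - A \<Longrightarrow> a = b \<or> a \<in> pre b \<or> b \<in> pre a"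
  using total_s by (auto simp: pre_def total_on_def)

lemma supports_exist:
  "\<exists>F W. \<forall>a\<in>N - A. finite (F a) \<and> F a \<subseteq> A \<union> pre a \<and> isolates (A \<union> pre a) 1 (W a) [a] \<and> dfn (F a) 1 (W a)"
proof -
  have "\<exists>E W. finite E \<and> E \<subseteq> A \<union> pre a \<and> isolates (A \<union> pre a) 1 W [a] \<and> dfn E 1 W" if "a \<in> N - A" for a
  proof -
    have "isolated (A \<union> pre a) [a]"
      using construction that unfolding construction_def pre_def by (elim conjE) (rule bspec)
    then obtain W where W: "isolates (A \<union> pre a) 1 W [a]" by (auto simp: isolated_def)
    then obtain E where "finite E" "E \<subseteq> A \<union> pre a" "dfn E 1 W"
      using definable_finite_params[OF isolates_dfn(1)[OF W]] by blast
    then show ?thesis using W by blast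
  qed
  then have "\<forall>a\<in>N - A. \<exists>E W. finite E \<and> E \<subseteq> A \<union> pre a \<and> isolates (A \<union> pre a) 1 W [a] \<and> dfn E 1 W"
    by blast
  then show ?thesis unfolding bchoice_iff .
qed

text \<open>The second component \<open>W\<close> picks isolating sets over the predecessors, the
  first component \<open>F\<close> finitely many parameters defining them. They are chosen once and
  for all because closedness refers to the chosen \<open>F\<close>.\<close>

definition supports :: "('m \<Rightarrow> 'm set) \<times> ('m \<Rightarrow> 'm list set)" where
  "supports = (SOME p. \<forall>a\<in>N - A. finite (fst p a) \<and> fst p a \<subseteq> A \<union> pre a \<and>
     isolates (A \<union> pre a) 1 (snd p a) [a] \<and> dfn (fst p a) 1 (snd p a))"

definition F :: "'m \<Rightarrow> 'm set" where "F = fst supports"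

definition W :: "'m \<Rightarrow> 'm list set" where "W = snd supports"

lemma F: "a \<in> N - A \<Longrightarrow> finite (F a)" "a \<in> N - A \<Longrightarrow> F a \<subseteq> A \<union> pre a"
  and W: "a \<in> N - A \<Longrightarrow> isolates (A \<union> pre a) 1 (W a) [a]" "a \<in> N - A \<Longrightarrow> dfn (F a) 1 (W a)"
proof -
  have *: "\<forall>a\<in>N - A. finite (F a) \<and> F a \<subseteq> A \<union> pre a \<and>
     isolates (A \<union> pre a) 1 (W a) [a] \<and> dfn (F a) 1 (W a)"
    unfolding F_def W_def supports_def by (rule someI_ex) (use supports_exist in auto)
  show "a \<in> N - A \<Longrightarrow> finite (F a)" "a \<in> N - A \<Longrightarrow> F a \<subseteq> A \<union> pre a"
    "a \<in> N - A \<Longrightarrow> isolates (A \<union> pre a) 1 (W a) [a]" "a \<in> N - A \<Longrightarrow> dfn (F a) 1 (W a)"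
    using * by blast+
qed

definition closed :: "'m set \<Rightarrow> bool" where
  "closed C \<longleftrightarrow> A \<subseteq> C \<and> C \<subseteq> N \<and> (\<forall>a\<in>C - A. F a \<subseteq> C)"

lemma finite_max:
  assumes "finite E" "E \<noteq> {}" "E \<subseteq> N - A"
  shows "\<exists>c\<in>E. \<forall>e\<in>E. e = c \<or> e \<in> pre c"
  using assms
proof (induction E rule: finite_ne_induct)
  case (insert x E)
  then obtain c where c: "c \<in> E" "\<forall>e\<in>E. e = c \<or> e \<in> pre c" by auto
  have "x = c \<or> x \<in> pre c \<or> c \<in> pre x" using insert.prems c(1) by (intro pre_cases) auto
  then show ?case
  proof (elim disjE)
    assume "c \<in> pre x"
    then have "\<forall>e\<in>insert x E. e = x \<or> e \<in> pre x" using c(2) pre_trans[of c x] by auto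
    then show ?thesis by (intro bexI[of _ x]) auto
  next
    assume "x = c" then show ?thesis using c by (intro bexI[of _ c]) auto
  next
    assume "x \<in> pre c" then show ?thesis using c by (intro bexI[of _ c]) auto
  qed
qed simp

text \<open>A definable set has finitely many parameters, so those from \<open>C\<close> have a last
  element \<open>c\<close>. This reduces isolation over all of \<open>C\<close> to initial segments
  of \<open>C\<close> and makes induction along the construction possible.\<close>

lemma finite_pre_bound:
  assumes E: "finite E" "E \<subseteq> A \<union> pre a \<union> C" and C: "C \<subseteq> N"
  shows "E \<subseteq> A \<union> pre a \<or> (\<exists>c\<in>(C - A) \<inter> E. E \<subseteq> A \<union> pre a \<union> (C \<inter> ({c} \<union> pre c)))"
proof (cases "E \<inter> (C - A) = {}")
  case False
  obtain c where c: "c \<in> E \<inter> (C - A)" "\<forall>e\<in>E \<inter> (C - A). e = c \<or> e \<in> pre c"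
    using finite_max[of "E \<inter> (C - A)"] E(1) C False by blast
  then have "E \<subseteq> A \<union> pre a \<union> (C \<inter> ({c} \<union> pre c))" using E(2) by blast
  then show ?thesis using c(1) by blast
qed (use E in blast)

text \<open>
  The elements of \<open>C\<close> are added to the base one after the other: the type of \<open>c\<close> over its
  predecessors is isolated without using \<open>a\<close>.
\<close>

lemma isolates_closed:
  assumes C: "closed C" and a: "a \<in> N - C"
  shows "isolates (A \<union> pre a \<union> C) 1 (W a) [a]"
proof -
  have CN: "C \<subseteq> N" and AC: "A \<subseteq> C" and CF: "\<And>c. c \<in> C - A \<Longrightarrow> F c \<subseteq> C" using C by (auto simp: closed_def)
  have aN: "a \<in> N - A" using a AC by blast
  note Wa = W(1)[OF aN]
  have dWa: "dfn D 1 (W a)" if "A \<union> pre a \<subseteq> D" for D using definable_mono[OF isolates_dfn(1)[OF Wa] that] .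
  have preU: "A \<union> pre a \<subseteq> U" using pre_sub[of a] AN NU by blast
  have step: "isolates (A \<union> pre a \<union> (C \<inter> ({c} \<union> pre c))) 1 (W a) [a]" if "c \<in> N - A" for c
    using wf_s that
  proof (induction c rule: wf_induct_rule)
    case (less c)
    define D where "D = A \<union> pre a \<union> (C \<inter> pre c)"
    have DU: "D \<subseteq> U" using preU CN NU by (auto simp: D_def)
    have D: "isolates D 1 (W a) [a]" unfolding isolates_def
    proof (intro conjI allI impI)
      fix Z assume Z: "dfn D 1 Z" "[a] \<in> Z"
      obtain E where E: "finite E" "E \<subseteq> D" "dfn E 1 Z" by (rule definable_finite_params[OF Z(1)])
      consider "E \<subseteq> A \<union> pre a"
        | c' where "c' \<in> (C \<inter> pre c - A) \<inter> E" "E \<subseteq> A \<union> pre a \<union> (C \<inter> pre c \<inter> ({c'} \<union> pre c'))"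
        using finite_pre_bound[OF E(1), of a "C \<inter> pre c"] E(2) CN unfolding D_def by blast
      then show "W a \<subseteq> Z"
      proof cases
        case 1
        show ?thesis by (rule isolates_sub[OF Wa definable_mono[OF E(3) 1] Z(2)])
      next
        case 2
        then have c': "(c', c) \<in> s" "c' \<in> N - A" using s_sub by (auto simp: pre_def)
        show ?thesis by (rule isolates_sub[OF less.IH[OF c'] definable_mono[OF E(3)] Z(2)]) (use 2 in blast)
      qed
    next
      show "dfn D 1 (W a)" by (rule dWa) (simp add: D_def)
    qed (rule isolates_dfn(2)[OF Wa])
    show ?case
    proof (cases "c \<in> C \<and> c \<notin> pre a")
      case False
      then have "A \<union> pre a \<union> (C \<inter> ({c} \<union> pre c)) = D" by (auto simp: D_def)
      then show ?thesis using D by simp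
    next
      case True
      have eq: "A \<union> pre a \<union> (C \<inter> ({c} \<union> pre c)) = D \<union> set [c]" using True by (auto simp: D_def)
      \<comment> \<open>Since \<open>c\<close> comes after \<open>a\<close>, its type over
        \<open>D\<close> and \<open>a\<close> is isolated by \<open>W c\<close>, which by closedness
        is defined over \<open>D\<close>. Hence a condition on the pair of \<open>a\<close> and
        \<open>c\<close> amounts to the condition \<open>Y\<close> on \<open>a\<close> over
        \<open>D\<close>, to which isolation over \<open>D\<close> applies.\<close>
      have "a \<in> pre c" using pre_cases[OF aN less.prems] True a by blast
      then have sub: "D \<union> {a} \<subseteq> A \<union> pre c" using pre_trans by (auto simp: D_def)
      have dWc: "dfn D 1 (W c)"
        by (rule definable_mono[OF W(2)[OF less.prems]])
          (use CF[of c] F(2)[OF less.prems] True less.prems in \<open>auto simp: D_def\<close>)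
      have DcU: "D \<union> set [c] \<subseteq> U" "D \<union> {a} \<subseteq> U" using DU less.prems NU aN by auto
      have Wa1: "[a] \<in> tuples 1 U" "length [a] = 1" "length [c] = 1" using aN NU by (auto simp: tuples_def)
      show ?thesis unfolding eq isolates_def
      proof (intro conjI allI impI)
        show "dfn (D \<union> set [c]) 1 (W a)" by (rule dWa) (auto simp: D_def)
        show "[a] \<in> W a" by (rule isolates_dfn(2)[OF Wa])
        fix Z assume Z: "dfn (D \<union> set [c]) 1 Z" "[a] \<in> Z"
        obtain Z0 where "dfn D (1 + length [c]) Z0" and
          Z0: "\<And>x. x \<in> tuples 1 U \<Longrightarrow> x \<in> Z \<longleftrightarrow> x @ [c] \<in> Z0"
          using definable_params_list[OF Z(1) DcU(1)] by blast
        then have dZ0: "dfn D (1 + 1) Z0" by simp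
        have dZ0': "dfn (D \<union> {a}) (1 + 1) Z0" by (rule definable_mono[OF dZ0]) blast
        define V where "V = {y\<in>tuples 1 U. [a] @ y \<in> Z0}"
        have dV: "dfn (D \<union> {a}) 1 V" unfolding V_def
          by (rule definable_Collect)
            (rule defpred_mem[OF DcU(2) dZ0'] defterm_append defterm_id is_env_id
              defterm_const | simp)+
        have c1: "[c] \<in> tuples 1 U" using less.prems NU by (auto simp: tuples_def)
        have "[c] \<in> V" using Z(2) Z0[OF Wa1(1)] c1 by (simp add: V_def)
        then have WV: "W c \<subseteq> V"
          using isolates_sub[OF W(1)[OF less.prems] definable_mono[OF dV sub]] by blast
        define Y where "Y = {x\<in>tuples 1 U. \<forall>y\<in>W c. x @ y \<in> Z0}"
        have "dfn D 1 Y" unfolding Y_def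
          by (rule definable_Collect) (rule defintros DU defpred_mem[OF DU dZ0] dWc refl)+
        moreover have "[a] \<in> Y" using WV Wa1(1) by (auto simp: Y_def V_def)
        ultimately have "W a \<subseteq> Y" by (rule isolates_sub[OF D])
        moreover have "[c] \<in> W c" by (rule isolates_dfn(2)[OF W(1)[OF less.prems]])
        ultimately show "W a \<subseteq> Z" using Z0 by (auto simp: Y_def)
      qed
    qed
  qed
  show ?thesis unfolding isolates_def
  proof (intro conjI allI impI)
    fix Z assume Z: "dfn (A \<union> pre a \<union> C) 1 Z" "[a] \<in> Z"
    obtain E where E: "finite E" "E \<subseteq> A \<union> pre a \<union> C" "dfn E 1 Z" by (rule definable_finite_params[OF Z(1)])
    consider "E \<subseteq> A \<union> pre a"
      | c where "c \<in> (C - A) \<inter> E" "E \<subseteq> A \<union> pre a \<union> (C \<inter> ({c} \<union> pre c))"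
      using finite_pre_bound[OF E(1,2) CN] by blast
    then show "W a \<subseteq> Z"
    proof cases
      case 1
      show ?thesis by (rule isolates_sub[OF Wa definable_mono[OF E(3) 1] Z(2)])
    next
      case 2
      then have "c \<in> N - A" using CN by blast
      then show ?thesis by (rule isolates_sub[OF step definable_mono[OF E(3) 2(2)] Z(2)])
    qed
  next
    show "dfn (A \<union> pre a \<union> C) 1 (W a)" by (rule dWa) simp
  qed (rule isolates_dfn(2)[OF Wa])
qed

text \<open>Supports are finite and consist of base elements and earlier elements. By well-founded
  induction the closure of \<open>a\<close> is \<open>a\<close> together with finitely many finite
  closures.\<close>

lemma finite_closure:
  assumes "finite E" "E \<subseteq> N - A"
  shows "\<exists>E'. finite E' \<and> E \<subseteq> E' \<and> E' \<subseteq> N - A \<and> (\<forall>b\<in>E'. F b \<subseteq> A \<union> E')"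
proof -
  have "a \<in> N - A \<longrightarrow> (\<exists>E'. finite E' \<and> a \<in> E' \<and> E' \<subseteq> N - A \<and> (\<forall>b\<in>E'. F b \<subseteq> A \<union> E'))" for a
    using wf_s
  proof (induction a rule: wf_induct_rule)
    case (less a)
    show ?case
    proof
      assume a: "a \<in> N - A"
      have "\<exists>E'. finite E' \<and> b \<in> E' \<and> E' \<subseteq> N - A \<and> (\<forall>c\<in>E'. F c \<subseteq> A \<union> E')" if "b \<in> F a - A" for b
        using less.IH[of b] F(2)[OF a] pre_sub[of a] that by (auto simp: pre_def)
      then obtain h where h: "\<And>b. b \<in> F a - A \<Longrightarrow> finite (h b) \<and> b \<in> h b \<and> h b \<subseteq> N - A \<and> (\<forall>c\<in>h b. F c \<subseteq> A \<union> h b)"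
        by metis
      let ?E = "insert a (\<Union>(h ` (F a - A)))"
      have "F a \<subseteq> A \<union> ?E" using h by blast
      moreover have "F b \<subseteq> A \<union> ?E" if "b \<in> h c" "c \<in> F a - A" for b c using h[OF that(2)] that by blast
      ultimately have "\<forall>b\<in>?E. F b \<subseteq> A \<union> ?E" by blast
      moreover have "finite ?E" "?E \<subseteq> N - A" using h a F(1)[OF a] by blast+
      ultimately show "\<exists>E'. finite E' \<and> a \<in> E' \<and> E' \<subseteq> N - A \<and> (\<forall>b\<in>E'. F b \<subseteq> A \<union> E')" by blast
    qed
  qed
  then obtain h where h: "\<And>a. a \<in> N - A \<Longrightarrow> finite (h a) \<and> a \<in> h a \<and> h a \<subseteq> N - A \<and> (\<forall>b\<in>h a. F b \<subseteq> A \<union> h a)"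
    by metis
  have "\<forall>b\<in>\<Union>(h ` E). F b \<subseteq> A \<union> \<Union>(h ` E)"
  proof
    fix b assume "b \<in> \<Union>(h ` E)"
    then obtain a where "a \<in> E" "b \<in> h a" by blast
    then show "F b \<subseteq> A \<union> \<Union>(h ` E)" using h[of a] assms(2) by blast
  qed
  moreover have "finite (\<Union>(h ` E))" "E \<subseteq> \<Union>(h ` E)" "\<Union>(h ` E) \<subseteq> N - A" using h assms by blast+
  ultimately show ?thesis by blast
qed

text \<open>The tuple is enlarged to a finite set containing its own supports up to
  \<open>A\<close>. Its last element \<open>c\<close> supports none of the others, so the rest still
  contains its supports and, added to \<open>C\<close>, gives a closed set. Unless \<open>c\<close>
  is in \<open>C\<close>, it is isolated over that set by \<open>W c\<close>, whose parameters are
  available; the induction is then closed by \<open>isolates_append\<close>.\<close>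

theorem closed_atomic:
  assumes C: "closed C" and m: "set m \<subseteq> N"
  shows "isolated C m"
proof -
  have CN: "C \<subseteq> N" and AC: "A \<subseteq> C" using C by (auto simp: closed_def)
  have CU: "C \<subseteq> U" using CN NU by blast
  have *: "\<exists>e. set e = E \<and> isolated C e" if "finite E" "E \<subseteq> N - A" "\<forall>b\<in>E. F b \<subseteq> A \<union> E" for E
    using that
  proof (induction "card E" arbitrary: E)
    case 0
    then have "E = {}" by simp
    moreover have "isolates C 0 (tuples 0 U) []"
      unfolding isolates_def by (auto simp: definable_UNIV) (simp_all add: tuples_def)
    ultimately show ?case by (intro exI[of _ "[]"]) (auto simp: isolated_def)
  next
    case (Suc k)
    then have "E \<noteq> {}" by auto
    then obtain c where c: "c \<in> E" "\<forall>e\<in>E. e = c \<or> e \<in> pre c" using finite_max[of E] Suc.prems(1,2) by auto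
    define E' where "E' = E - {c}"
    have E'F: "F b \<subseteq> A \<union> E'" if b: "b \<in> E'" for b
    proof -
      have "b \<in> pre c" using b c by (auto simp: E'_def)
      then have "c \<notin> pre b" using pre_trans pre_irrefl by blast
      moreover have "b \<in> N - A" "c \<in> N - A" using b c Suc.prems by (auto simp: E'_def)
      ultimately have "c \<notin> F b" using F(2)[of b] by blast
      then show ?thesis using Suc.prems(3) b by (auto simp: E'_def)
    qed
    have "card E' = k" using Suc c by (simp add: E'_def)
    then obtain e where e: "set e = E'" "isolated C e"
      using Suc.hyps(1)[of E'] E'F Suc.prems by (auto simp: E'_def)
    show ?case
    proof (cases "c \<in> C")
      case True
      then have "isolated C (e @ [c])" using isolated_append_params[OF e(2) _ CU, of "[c]"] by simp
      then show ?thesis using e c by (intro exI[of _ "e @ [c]"]) (auto simp: E'_def)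
    next
      case False
      have cN: "c \<in> N - A" using c Suc.prems by blast
      have cl: "closed (C \<union> E')"
        using C E'F Suc.prems(2) unfolding closed_def by (auto simp: E'_def)
      have "isolates (A \<union> pre c \<union> (C \<union> E')) 1 (W c) [c]"
        by (rule isolates_closed[OF cl]) (use cN False in \<open>auto simp: E'_def\<close>)
      moreover have "F c \<subseteq> C \<union> set e"
        using F(2)[OF cN] pre_irrefl[of c] Suc.prems(3) c(1) AC cN e(1) unfolding E'_def by blast
      then have "dfn (C \<union> set e) 1 (W c)" using definable_mono[OF W(2)[OF cN]] by blast
      ultimately have "isolates (C \<union> set e) 1 (W c) [c]"
        by (rule isolates_base) (use e in auto)
      moreover obtain V where "isolates C (length e) V e" using e(2) by (auto simp: isolated_def)
      ultimately have "isolated C (e @ [c])" using isolates_append CU by blast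
      then show ?thesis using e c by (intro exI[of _ "e @ [c]"]) (auto simp: E'_def)
    qed
  qed
  obtain E where E: "finite E" "set m - A \<subseteq> E" "E \<subseteq> N - A" "\<forall>b\<in>E. F b \<subseteq> A \<union> E"
    using finite_closure[of "set m - A"] Diff_mono[OF m order_refl, of A] by auto
  obtain e where e: "set e = E" "isolated C e" using *[OF E(1,3,4)] by blast
  have "isolated C (e @ filter (\<lambda>x. x \<in> A) m)"
    by (rule isolated_append_params[OF e(2) _ CU]) (use AC in auto)
  then show ?thesis by (rule isolated_reindex[OF _ _ CU]) (use e E in auto)
qed

lemma closed_Union: "\<K> \<noteq> {} \<Longrightarrow> (\<And>C. C \<in> \<K> \<Longrightarrow> closed C) \<Longrightarrow> closed (\<Union>\<K>)"
  unfolding closed_def by blast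

lemma closed_A: "closed A"
  using AN by (auto simp: closed_def)

end

section \<open>Traces of closed sets on a submodel\<close>

lemma definable_swap:
  assumes \<Phi>: "definable L S C (n + k) \<Phi>" and C: "C \<subseteq> univ S"
  obtains \<Psi> where "definable L S C (k + n) \<Psi>"
    "\<And>x y. x \<in> tuples n (univ S) \<Longrightarrow> y \<in> tuples k (univ S) \<Longrightarrow> y @ x \<in> \<Psi> \<longleftrightarrow> x @ y \<in> \<Phi>"
proof -
  define \<Psi> where "\<Psi> = {w\<in>tuples (k + n) (univ S). \<exists>y\<in>tuples k (univ S). \<exists>x\<in>tuples n (univ S).
    w = y @ x \<and> x @ y \<in> \<Phi>}"
  have in\<Psi>: "y @ x \<in> \<Psi> \<longleftrightarrow> x @ y \<in> \<Phi>" if "y \<in> tuples k (univ S)" "x \<in> tuples n (univ S)" for x y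
    using that by (auto simp: \<Psi>_def append_tuples_inject intro!: tuples_append)
  have "definable L S C (k + n) \<Psi>"
    by (rule definable_Collect2[OF _ refl in\<Psi>])
      (auto simp: \<Psi>_def, (rule defintros C defpred_mem[OF C \<Phi>] refl)+)
  then show ?thesis using in\<Psi> that by blast
qed

lemma same_type_reindex:
  assumes bb': "same_type L S C b b'" and "is": "set is \<subseteq> {..<length b}" and C: "C \<subseteq> univ S"
  shows "same_type L S C (map ((!) b) is) (map ((!) b') is)"
  unfolding same_type_def
proof (intro conjI allI impI)
  have b: "b \<in> tuples (length b) (univ S)" using bb' by (auto simp: same_type_def tuples_def)
  show "set (map ((!) b) is) \<subseteq> univ S" using b "is" nth_mem by (fastforce simp: tuples_def)
  fix X assume X: "definable L S C (length (map ((!) b) is)) X" "map ((!) b) is \<in> X"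
  define Y where "Y = {x\<in>tuples (length b) (univ S). map ((!) x) is \<in> X}"
  have "definable L S C (length b) Y" unfolding Y_def
    by (rule definable_Collect) (rule defpred_mem[OF C X(1)] defterm_reindex defterm_id "is" | simp)+
  from same_type_iff[OF bb' this] show "map ((!) b') is \<in> X" using b X(2) by (simp add: Y_def)
qed

lemma same_type_nth:
  "same_type L S C b b' \<Longrightarrow> i < length b \<Longrightarrow> C \<subseteq> univ S \<Longrightarrow> same_type L S C [b ! i] [b' ! i]"
  using same_type_reindex[of L S C b b' "[i]"] by simp

lemma definable_singleton: "set c \<subseteq> C \<Longrightarrow> C \<subseteq> univ S \<Longrightarrow> definable L S C (length c) {c}"
proof -
  assume c: "set c \<subseteq> C" and C: "C \<subseteq> univ S"
  have "{c} = {x\<in>tuples (length c) (univ S). x = c}" using c C by (auto simp: tuples_def)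
  moreover have "definable L S C (length c) {x\<in>tuples (length c) (univ S). x = c}"
    by (rule definable_Collect) (rule defpred_eq C defintros refl c)+
  ultimately show ?thesis by simp
qed

lemma same_type_params:
  assumes "same_type L S C b b'" "set b \<subseteq> C" "C \<subseteq> univ S"
  shows "b' = b"
  using definable_singleton[OF assms(2,3)] assms(1) by (auto simp: same_type_def)

lemma split_list_by_set:
  obtains c f "is" where "set c \<subseteq> set e \<inter> C" "set f \<subseteq> set e - C" "length is = length e"
    "set is \<subseteq> {..<length c + length f}" "map ((!) (c @ f)) is = e"
proof -
  define c f where "c = filter (\<lambda>x. x \<in> C) e" and "f = filter (\<lambda>x. x \<notin> C) e"
  have "set e \<subseteq> set (c @ f)" by (auto simp: c_def f_def)
  then obtain "is" where "length is = length e" "set is \<subseteq> {..<length (c @ f)}" "map ((!) (c @ f)) is = e"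
    by (rule obtain_indices)
  then show ?thesis by (intro that[of c f "is"]) (auto simp: c_def f_def)
qed

definition normal_over :: "('f, 'r) lang \<Rightarrow> ('f, 'r, 'm) struct \<Rightarrow> 'm set \<Rightarrow> 'm set \<Rightarrow> 'm set \<Rightarrow> bool" where
  "normal_over L S A M B \<longleftrightarrow> A \<subseteq> B \<and> B \<subseteq> M \<and>
     (\<forall>b\<in>B. \<forall>b'\<in>M. same_type L S A [b] [b'] \<longrightarrow> b' \<in> B)"

locale constructible_submodel = constructible L T \<kappa> S A N s
  for L :: "('f, 'r) lang" and T :: "('f, 'r) fm set" and \<kappa> :: "'k rel"
    and S :: "('f, 'r, 'm) struct" and A N :: "'m set" and s :: "'m rel" +
  fixes M :: "'m set"
  assumes AM: "A \<subseteq> M" and MN: "M \<subseteq> N" and tvM: "meets_definable M"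
begin

lemma MU: "M \<subseteq> U" using meets_definable_subset[OF tvM] .

text \<open>On \<open>M\<close>, the set \<open>Y\<close> replaces the condition imposed by \<Phi>
  with the parameter tuple \<open>c\<close> from \<open>C\<close>. Taking \<Phi> without parameters
  loses nothing, since further parameters may be put into \<open>c\<close> or
  \<open>m\<close>.\<close>

definition good :: "'m set \<Rightarrow> bool" where
  "good C \<longleftrightarrow> closed C \<and> (\<forall>k c \<Phi>. set c \<subseteq> C \<longrightarrow> dfn {} (length c + k) \<Phi> \<longrightarrow>
     (\<exists>Y. dfn (C \<inter> M) k Y \<and> (\<forall>m\<in>tuples k M. c @ m \<in> \<Phi> \<longleftrightarrow> m \<in> Y)))"

lemma good_closed: "good C \<Longrightarrow> closed C" and good_A_sub: "good C \<Longrightarrow> A \<subseteq> C"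
  and good_N: "good C \<Longrightarrow> C \<subseteq> N"
  by (auto simp: good_def closed_def)

lemma good_trace:
  assumes "good C" "set c \<subseteq> C" "dfn {} (length c + k) \<Phi>"
  obtains Y where "dfn (C \<inter> M) k Y" "\<And>m. m \<in> tuples k M \<Longrightarrow> c @ m \<in> \<Phi> \<longleftrightarrow> m \<in> Y"
proof -
  have "\<exists>Y. dfn (C \<inter> M) k Y \<and> (\<forall>m\<in>tuples k M. c @ m \<in> \<Phi> \<longleftrightarrow> m \<in> Y)"
    using assms unfolding good_def by blast
  then obtain Y where "dfn (C \<inter> M) k Y" "\<forall>m\<in>tuples k M. c @ m \<in> \<Phi> \<longleftrightarrow> m \<in> Y" by blast
  then show ?thesis by (intro that[of Y]) auto
qed

lemma good_A: "good A"
proof -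
  have AU: "A \<subseteq> U" using AM MU by blast
  have "\<exists>Y. dfn (A \<inter> M) k Y \<and> (\<forall>m\<in>tuples k M. c @ m \<in> \<Phi> \<longleftrightarrow> m \<in> Y)"
    if c: "set c \<subseteq> A" and \<Phi>: "dfn {} (length c + k) \<Phi>" for k c \<Phi>
  proof (intro exI conjI ballI)
    have \<Phi>A: "dfn A (length c + k) \<Phi>" using definable_mono[OF \<Phi>] by blast
    have "dfn A k {y\<in>tuples k U. c @ y \<in> \<Phi>}"
      by (rule definable_Collect) (rule defpred_mem[OF AU \<Phi>A] defintros refl c)+
    then show "dfn (A \<inter> M) k {y\<in>tuples k U. c @ y \<in> \<Phi>}" using AM by (simp add: Int_absorb2)
  qed (use MU in \<open>auto simp: tuples_def\<close>)
  then show ?thesis using closed_A by (auto simp: good_def)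
qed

lemma good_Union:
  assumes ne: "\<K> \<noteq> {}" and good: "\<And>C. C \<in> \<K> \<Longrightarrow> good C" and chain: "subset.chain UNIV \<K>"
  shows "good (\<Union>\<K>)"
  unfolding good_def
proof (intro conjI allI impI)
  show "closed (\<Union>\<K>)" using closed_Union[OF ne] good good_closed by blast
  fix k c \<Phi> assume "set c \<subseteq> \<Union>\<K>" and \<Phi>: "dfn {} (length c + k) \<Phi>"
  then obtain C where C: "C \<in> \<K>" "set c \<subseteq> C" using finite_subset_Union_chain[OF List.finite_set _ ne chain] by metis
  obtain Y where "dfn (C \<inter> M) k Y" "\<And>m. m \<in> tuples k M \<Longrightarrow> c @ m \<in> \<Phi> \<longleftrightarrow> m \<in> Y"
    using good_trace[OF good[OF C(1)] C(2) \<Phi>] by blast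
  then show "\<exists>Y. dfn (\<Union>\<K> \<inter> M) k Y \<and> (\<forall>m\<in>tuples k M. c @ m \<in> \<Phi> \<longleftrightarrow> m \<in> Y)"
    using C(1) definable_mono[of L S "C \<inter> M" k Y "\<Union>\<K> \<inter> M"] by blast
qed

text \<open>In \<open>N\<close> the type of \<open>m\<close> over \<open>C\<close> is isolated. The
  trace of the isolating set on \<open>M\<close> has parameters in \<open>C \<inter> M\<close>, and
  it is still isolating: a difference from another set over \<open>C \<inter> M\<close> would, if
  nonempty, have a point in \<open>M\<close>.\<close>

lemma good_atomic:
  assumes C: "good C" and m: "set m \<subseteq> M"
  shows "isolated (C \<inter> M) m"
proof -
  have CU: "C \<subseteq> U" using good_N[OF C] NU by blast
  obtain X where X: "isolates C (length m) X m"
    using closed_atomic[OF good_closed[OF C]] m MN unfolding isolated_def by blast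
  obtain c \<Phi> where c: "set c \<subseteq> C" and \<Phi>: "dfn {} (length m + length c) \<Phi>"
    and X\<Phi>: "\<And>x. x \<in> tuples (length m) U \<Longrightarrow> x \<in> X \<longleftrightarrow> x @ c \<in> \<Phi>"
    using definable_params[of L S "{}" C _ X] isolates_dfn(1)[OF X] CU by auto
  obtain \<Psi> where \<Psi>: "dfn {} (length c + length m) \<Psi>"
    and sw: "\<And>x y. x \<in> tuples (length m) U \<Longrightarrow> y \<in> tuples (length c) U \<Longrightarrow> y @ x \<in> \<Psi> \<longleftrightarrow> x @ y \<in> \<Phi>"
    using definable_swap[OF \<Phi>] by blast
  obtain Y where Y: "dfn (C \<inter> M) (length m) Y" "\<And>x. x \<in> tuples (length m) M \<Longrightarrow> c @ x \<in> \<Psi> \<longleftrightarrow> x \<in> Y"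
    using good_trace[OF C c \<Psi>] by blast
  have XY: "x \<in> X \<longleftrightarrow> x \<in> Y" if "x \<in> tuples (length m) M" for x
  proof -
    have "x \<in> tuples (length m) U" "c \<in> tuples (length c) U" using that c CU MU by (auto simp: tuples_def)
    then show ?thesis using X\<Phi> sw Y(2)[OF that] by blast
  qed
  have "isolates (C \<inter> M) (length m) Y m" unfolding isolates_def
  proof (intro conjI allI impI)
    show "m \<in> Y" using XY[of m] m isolates_dfn(2)[OF X] by (simp add: tuples_def)
    fix Z assume Z: "dfn (C \<inter> M) (length m) Z" "m \<in> Z"
    have XZ: "X \<subseteq> Z" using isolates_sub[OF X definable_mono[OF Z(1)] Z(2)] by blast
    have d: "dfn (C \<inter> M) (length m) (Y - Z)" using Y(1) Z(1) CU by (intro definable_Diff) auto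
    show "Y \<subseteq> Z"
    proof (rule ccontr)
      assume "\<not> Y \<subseteq> Z"
      then have "Y - Z \<noteq> {}" by blast
      then obtain x where x: "x \<in> Y - Z" "set x \<subseteq> M"
        using meets_definable_point[OF tvM d] by blast
      then have "x \<in> tuples (length m) M" using definable_subset[OF Y(1)] by (auto simp: tuples_def)
      then show False using XY x XZ by blast
    qed
  qed (rule Y(1))
  then show ?thesis by (auto simp: isolated_def)
qed

text \<open>The type of \<open>m\<close> over \<open>B \<union> D\<close> has a finite base
  \<open>d\<close>, and \<open>X\<close> isolates the type of \<open>m\<close> over \<open>D\<close>
  and \<open>d\<close>. To see that \<open>X\<close> suffices for a condition with parameters
  \<open>t\<close> in \<open>B \<union> D\<close>, let \<Theta> isolate the type of \<open>t\<close>
  over \<open>D\<close>. By normality every point of \<Theta> in \<open>M\<close> has its entries in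
  \<open>B \<union> D\<close>, where the base decides the condition at \<open>m\<close>. The set
  \<open>Z'\<close> says that it holds for all \<open>y\<close> in \<Theta> for which the base
  predicts it; this is a property over \<open>D\<close> and \<open>d\<close>, so it spreads from
  \<open>m\<close> to \<open>X\<close>.\<close>

lemma good_normal_atomic:
  assumes C: "good C" and B: "normal_over L S A M B" and m: "set m \<subseteq> M"
  shows "isolated (B \<union> (C \<inter> M)) m"
proof -
  define D where "D = C \<inter> M"
  define n where "n = length m"
  have DM: "D \<subseteq> M" and DU: "D \<subseteq> U" and AD: "A \<subseteq> D"
    using MU AM good_A_sub[OF C] by (auto simp: D_def)
  have BM: "B \<subseteq> M" and Bn: "\<And>b b'. b \<in> B \<Longrightarrow> b' \<in> M \<Longrightarrow> same_type L S A [b] [b'] \<Longrightarrow> b' \<in> B"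
    using B by (auto simp: normal_over_def)
  have BDU: "B \<union> D \<subseteq> U" using BM DM MU by blast
  have mU: "m \<in> tuples n U" using m MU by (auto simp: tuples_def n_def)
  obtain d where d: "set d \<subseteq> B \<union> D" and base: "\<And>k \<Phi>. dfn {} (n + k) \<Phi> \<Longrightarrow>
    \<exists>Y. dfn (set d) k Y \<and> (\<forall>c\<in>tuples k (B \<union> D). m @ c \<in> \<Phi> \<longleftrightarrow> c \<in> Y)"
    using finite_base[OF mU BDU] by blast
  have dM: "set d \<subseteq> M" using d BM DM by blast
  have md: "isolated D (m @ d)" unfolding D_def by (rule good_atomic[OF C]) (use m dM in auto)
  obtain X where X: "isolates (D \<union> set d) n X m"
    using isolated_over_params[OF md DU] by (auto simp: isolated_def n_def)
  have "isolates (B \<union> D) n X m" unfolding isolates_def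
  proof (intro conjI allI impI)
    show "dfn (B \<union> D) n X" using definable_mono[OF isolates_dfn(1)[OF X]] d by blast
    show "m \<in> X" using isolates_dfn(2)[OF X] .
    fix Z assume Z: "dfn (B \<union> D) n Z" "m \<in> Z"
    obtain t \<Phi> where t: "set t \<subseteq> B \<union> D" and \<Phi>: "dfn {} (n + length t) \<Phi>"
      and Z\<Phi>: "\<And>x. x \<in> tuples n U \<Longrightarrow> x \<in> Z \<longleftrightarrow> x @ t \<in> \<Phi>"
      using definable_params[of L S "{}" "B \<union> D" n Z] Z(1) BDU by auto
    define k where "k = length t"
    obtain Y where Y: "dfn (set d) k Y" "\<And>c. c \<in> tuples k (B \<union> D) \<Longrightarrow> m @ c \<in> \<Phi> \<longleftrightarrow> c \<in> Y"
      using base[OF \<Phi>] unfolding k_def by blast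
    obtain Y0 where Y0: "dfn {} (k + length d) Y0" "\<And>y. y \<in> tuples k U \<Longrightarrow> y \<in> Y \<longleftrightarrow> y @ d \<in> Y0"
      using definable_params_list[of L S "{}" d k Y] Y(1) dM MU by auto
    have tM: "set t \<subseteq> M" using t BM DM by blast
    obtain \<Theta> where \<Theta>: "isolates D k \<Theta> t"
      using good_atomic[OF C tM] by (auto simp: isolated_def D_def k_def)
    have \<Theta>BD: "t' \<in> tuples k (B \<union> D)" if t': "t' \<in> \<Theta>" "set t' \<subseteq> M" for t'
    proof -
      have st: "same_type L S D t t'" using isolates_same_type[OF \<Theta> t'(1)] .
      have len: "length t' = length t" using same_type_tuples(1)[OF st] .
      have "t' ! i \<in> B \<union> D" if i: "i < length t" for i
      proof (cases "t ! i \<in> D")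
        case True
        then have "[t' ! i] = [t ! i]" using same_type_params[OF same_type_nth[OF st i DU] _ DU] by simp
        then show ?thesis using True by simp
      next
        case False
        then have "t ! i \<in> B" using t i nth_mem by blast
        moreover have "t' ! i \<in> M" using t'(2) i len by (metis nth_mem subsetD)
        moreover have "same_type L S A [t ! i] [t' ! i]"
          using same_type_mono[OF same_type_nth[OF st i DU] AD] .
        ultimately show ?thesis using Bn by blast
      qed
      then have "set t' \<subseteq> B \<union> D" using len by (metis in_set_conv_nth subsetI)
      then show ?thesis using len by (simp add: tuples_def k_def)
    qed
    have \<Phi>': "dfn E (n + k) \<Phi>" for E using \<Phi> definable_mono by (simp add: k_def) blast
    have Y0': "dfn E (k + length d) Y0" for E using Y0(1) definable_mono by blast
    define Z' where "Z' = {x\<in>tuples n U. \<forall>y\<in>\<Theta>. y @ d \<in> Y0 \<longrightarrow> x @ y \<in> \<Phi>}"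
    have Dd: "D \<union> set d \<subseteq> U" using DU dM MU by blast
    have d\<Theta>: "dfn E k \<Theta>" if "D \<subseteq> E" for E using definable_mono[OF isolates_dfn(1)[OF \<Theta>] that] .
    have dD: "set d \<subseteq> D \<union> set d" by blast
    have "dfn (D \<union> set d) n Z'" unfolding Z'_def
      by (rule definable_Collect)
        (rule defintros Dd defpred_mem[OF Dd \<Phi>'] defpred_mem[OF Dd Y0'] d\<Theta> refl Un_upper1 dD)+
    moreover have "m \<in> Z'"
    proof -
      \<comment> \<open>The base speaks only of tuples from \<open>B \<union> D\<close>, while
        \<open>Z'\<close> quantifies over the monster. The set \<open>Q\<close> of counterexamples
        is definable over \<open>M\<close> and has no point in \<open>M\<close>, hence it is
        empty.\<close>
      define Q where "Q = {y\<in>tuples k U. y \<in> \<Theta> \<and> y @ d \<in> Y0 \<and> m @ y \<notin> \<Phi>}"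
      have DdM: "D \<union> set d \<union> set m \<subseteq> U" and d': "set d \<subseteq> D \<union> set d \<union> set m"
        and m': "set m \<subseteq> D \<union> set d \<union> set m" and D': "D \<subseteq> D \<union> set d \<union> set m"
        using Dd m MU by auto
      have "dfn (D \<union> set d \<union> set m) k Q" unfolding Q_def
        by (rule definable_Collect)
          (rule defintros DdM defpred_mem[OF DdM \<Phi>'] defpred_mem[OF DdM Y0'] defpred_mem[OF DdM d\<Theta>] refl d' m' D'
            | simp add: n_def)+
      moreover have "D \<union> set d \<union> set m \<subseteq> M" using DM dM m by blast
      moreover have False if y: "y \<in> Q" "set y \<subseteq> M" for y
        using y \<Theta>BD[of y] Y(2)[of y] Y0(2)[of y] by (auto simp: Q_def)
      ultimately have "Q = {}" using meets_definable_point[OF tvM] by blast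
      then show ?thesis using mU definable_subset[OF isolates_dfn(1)[OF \<Theta>]] by (auto simp: Z'_def Q_def)
    qed
    ultimately have XZ': "X \<subseteq> Z'" by (rule isolates_sub[OF X])
    have tU: "t \<in> tuples k U" "t \<in> tuples k (B \<union> D)" using t BDU by (auto simp: tuples_def k_def)
    have "t @ d \<in> Y0" using Z(2) Z\<Phi>[OF mU] Y(2)[OF tU(2)] Y0(2)[OF tU(1)] by simp
    then show "X \<subseteq> Z" using XZ' Z\<Phi> isolates_dfn(2)[OF \<Theta>] by (auto simp: Z'_def)
  qed
  then show ?thesis by (auto simp: isolated_def D_def n_def)
qed

text \<open>A new element is harmless once its support and a base of its type over
  \<open>M \<union> C\<close> have been added. Both are finite, so closing off in countably many
  rounds adds only countably many elements; the back-and-forth relies on this to proceed in steps of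
  length \<omega>.\<close>

lemma good_extend:
  assumes C: "good C" and X: "countable X" "X \<subseteq> N"
  shows "\<exists>C'. good C' \<and> C \<union> X \<subseteq> C' \<and> countable (C' - C)"
proof -
  have CN: "C \<subseteq> N" and CU: "C \<subseteq> U" using good_N[OF C] NU by auto
  have MCU: "M \<union> C \<subseteq> U" using CU MU by blast
  have "\<exists>e. set e \<subseteq> M \<union> C \<and> (\<forall>k \<Phi>. dfn {} (length f + k) \<Phi> \<longrightarrow>
    (\<exists>Y. dfn (set e) k Y \<and> (\<forall>c\<in>tuples k (M \<union> C). f @ c \<in> \<Phi> \<longleftrightarrow> c \<in> Y)))" if "set f \<subseteq> U" for f
    using that by (intro finite_base[OF _ MCU]) (simp add: tuples_def)
  then obtain \<beta> where \<beta>: "\<And>f. set f \<subseteq> U \<Longrightarrow> set (\<beta> f) \<subseteq> M \<union> C"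
    and base: "\<And>f k \<Phi>. set f \<subseteq> U \<Longrightarrow> dfn {} (length f + k) \<Phi> \<Longrightarrow>
    \<exists>Y. dfn (set (\<beta> f)) k Y \<and> (\<forall>c\<in>tuples k (M \<union> C). f @ c \<in> \<Phi> \<longleftrightarrow> c \<in> Y)" by metis
  \<comment> \<open>One closing round: supports for closedness, bases of all finite lists for
    goodness. A countable set has only countably many finite lists.\<close>
  define H where "H Y = Y \<union> \<Union>(F ` (Y - A)) \<union> (\<Union>f\<in>lists Y. set (\<beta> f))" for Y
  define G where "G i = (H ^^ i) X" for i
  have GS: "G (Suc i) = H (G i)" for i by (simp add: G_def)
  have G: "countable (G i) \<and> G i \<subseteq> N" for i
  proof (induction i)
    case (Suc i)
    have "countable (F a)" if "a \<in> G i - A" for a using F(1)[of a] Suc that countable_finite by blast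
    then have "countable (H (G i))" using Suc unfolding H_def
      by (intro countable_Un countable_UN countable_lists countable_finite[OF List.finite_set]) auto
    moreover have "F a \<subseteq> N" if "a \<in> G i - A" for a using F(2)[of a] pre_sub[of a] AN Suc that by blast
    moreover have "set (\<beta> f) \<subseteq> N" if "f \<in> lists (G i)" for f
      using \<beta>[of f] that Suc NU MN CN by (auto simp: in_lists_conv_set) blast
    ultimately show ?case using Suc unfolding GS H_def by blast
  qed (use X in \<open>auto simp: G_def\<close>)
  have Gmono: "G i \<subseteq> G j" if "i \<le> j" for i j
    by (rule lift_Suc_mono_le[OF _ that]) (auto simp: GS H_def)
  define C' where "C' = C \<union> (\<Union>i. G i)"
  have "closed C'" unfolding closed_def
  proof (intro conjI ballI)
    show "A \<subseteq> C'" "C' \<subseteq> N" using good_A_sub[OF C] CN G by (auto simp: C'_def)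
    fix a assume a: "a \<in> C' - A"
    show "F a \<subseteq> C'"
    proof (cases "a \<in> C")
      case True
      then show ?thesis using good_closed[OF C] a by (auto simp: closed_def C'_def)
    next
      case False
      then obtain i where "a \<in> G i" using a by (auto simp: C'_def)
      then have "F a \<subseteq> G (Suc i)" using a by (auto simp: GS H_def)
      then show ?thesis by (auto simp: C'_def)
    qed
  qed
  moreover have "\<exists>Y. dfn (C' \<inter> M) k Y \<and> (\<forall>m\<in>tuples k M. c0 @ m \<in> \<Phi> \<longleftrightarrow> m \<in> Y)"
    if c0: "set c0 \<subseteq> C'" and \<Phi>: "dfn {} (length c0 + k) \<Phi>" for k c0 \<Phi>
  proof -
    obtain c f "is" where c: "set c \<subseteq> set c0 \<inter> C" and f: "set f \<subseteq> set c0 - C"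
      and "is": "length is = length c0" "set is \<subseteq> {..<length c + length f}" "map ((!) (c @ f)) is = c0"
      by (rule split_list_by_set[of c0 C])
    have cC: "set c \<subseteq> C" using c by blast
    have "\<exists>i. set f \<subseteq> G i"
    proof -
      have "\<forall>x\<in>set f. \<exists>i. x \<in> G i" using f c0 by (auto simp: C'_def)
      then obtain g where g: "\<And>x. x \<in> set f \<Longrightarrow> x \<in> G (g x)" by metis
      have "g x \<le> Max (g ` set f)" if "x \<in> set f" for x using that by simp
      then show ?thesis using g Gmono by blast
    qed
    then obtain i where i: "set f \<subseteq> G i" by blast
    have fU: "set f \<subseteq> U" using i G[of i] NU by blast
    \<comment> \<open>Parameters are traded in two stages. The new elements \<open>f\<close> are
      replaced by their base \<open>e\<close>, which splits into \<open>c1\<close> in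
      \<open>C\<close> and \<open>m1\<close> in \<open>M\<close>. Then \<open>c\<close> and
      \<open>c1\<close> are replaced by parameters in \<open>C \<inter> M\<close>, as
      \<open>C\<close> is good, whereas \<open>m1\<close> is kept: it lies in \<open>C'\<close>
      because \<open>H\<close> adds bases.\<close>
    define e where "e = \<beta> f"
    have "set e \<subseteq> H (G i)" using i unfolding e_def H_def by (auto simp: in_lists_conv_set)
    then have e: "set e \<subseteq> M \<union> C" "set e \<subseteq> G (Suc i)" using \<beta>[OF fU] by (auto simp: e_def GS)
    define p q r where "p = length c" and "q = length f" and "r = length c0"
    define \<Psi> where "\<Psi> = {w\<in>tuples (q + (p + k)) U. \<exists>f'\<in>tuples q U. \<exists>c'\<in>tuples p U. \<exists>m'\<in>tuples k U.
      w = f' @ c' @ m' \<and> map ((!) (c' @ f')) is @ m' \<in> \<Phi>}"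
    have in\<Psi>: "f' @ c' @ m' \<in> \<Psi> \<longleftrightarrow> map ((!) (c' @ f')) is @ m' \<in> \<Phi>"
      if "f' \<in> tuples q U" "c' \<in> tuples p U" "m' \<in> tuples k U" for f' c' m'
      using that by (auto simp: \<Psi>_def append_tuples_inject intro!: tuples_append)
    have "dfn {} (q + (p + k)) \<Psi>"
      by (rule definable_Collect3[OF _ refl in\<Psi>])
        (auto simp: \<Psi>_def, (rule defpred_mem[OF empty_subsetI \<Phi>] defterm_append defterm_reindex
          defterm_fst defterm_snd defterm_id is_env_cons is_env_id
          | simp add: "is"(1) "is"(2) p_def q_def)+)
    then obtain Y where Y: "dfn (set e) (p + k) Y" "\<And>w. w \<in> tuples (p + k) (M \<union> C) \<Longrightarrow> f @ w \<in> \<Psi> \<longleftrightarrow> w \<in> Y"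
      using base[OF fU] unfolding e_def q_def by blast
    obtain Y0 where Y0: "dfn {} (p + k + length e) Y0"
      "\<And>w. w \<in> tuples (p + k) U \<Longrightarrow> w \<in> Y \<longleftrightarrow> w @ e \<in> Y0"
    proof -
      have "{} \<union> set e \<subseteq> U" "dfn ({} \<union> set e) (p + k) Y" using e(1) MCU Y(1) by auto
      from definable_params_list[OF this(2,1)] show ?thesis using that by blast
    qed
    obtain c1 m1 js where c1: "set c1 \<subseteq> set e \<inter> C" and m1: "set m1 \<subseteq> set e - C"
      and js: "length js = length e" "set js \<subseteq> {..<length c1 + length m1}" "map ((!) (c1 @ m1)) js = e"
      by (rule split_list_by_set[of e C])
    have m1M: "set m1 \<subseteq> M" "set m1 \<subseteq> C'" using m1 e by (auto simp: C'_def)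
    define p1 q1 where "p1 = length c1" and "q1 = length m1"
    define \<Psi>2 where "\<Psi>2 = {w\<in>tuples (p + (p1 + (k + q1))) U. \<exists>c'\<in>tuples p U. \<exists>c''\<in>tuples p1 U.
      \<exists>m'\<in>tuples k U. \<exists>m''\<in>tuples q1 U.
      w = c' @ c'' @ m' @ m'' \<and> c' @ m' @ map ((!) (c'' @ m'')) js \<in> Y0}"
    have in\<Psi>2: "c' @ c'' @ m' @ m'' \<in> \<Psi>2 \<longleftrightarrow> c' @ m' @ map ((!) (c'' @ m'')) js \<in> Y0"
      if "c' \<in> tuples p U" "c'' \<in> tuples p1 U" "m' \<in> tuples k U" "m'' \<in> tuples q1 U" for c' c'' m' m''
      using that by (auto simp: \<Psi>2_def append_tuples_inject intro!: tuples_append)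
    have "dfn {} (p + (p1 + (k + q1))) \<Psi>2"
      by (rule definable_Collect4[OF _ refl in\<Psi>2])
        (auto simp: \<Psi>2_def, (rule defpred_mem[OF empty_subsetI Y0(1)] defterm_append defterm_reindex
          defterm_fst defterm_snd defterm_id is_env_cons is_env_id
          | simp add: js(1) js(2) p1_def q1_def)+)
    then have d\<Psi>2: "dfn {} (length (c @ c1) + (k + q1)) \<Psi>2" by (simp add: p_def p1_def add.assoc)
    have cc1: "set (c @ c1) \<subseteq> C" using cC c1 by auto
    obtain Y2 where Y2: "dfn (C \<inter> M) (k + q1) Y2"
      "\<And>w. w \<in> tuples (k + q1) M \<Longrightarrow> (c @ c1) @ w \<in> \<Psi>2 \<longleftrightarrow> w \<in> Y2"
      using good_trace[OF C cc1 d\<Psi>2] by blast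
    define Y3 where "Y3 = {m'\<in>tuples k U. m' @ m1 \<in> Y2}"
    have "dfn (C' \<inter> M) k Y3" unfolding Y3_def
      by (rule definable_fiber[of L S "C \<inter> M"]) (use Y2(1) m1M MU in \<open>auto simp: q1_def C'_def\<close>)
    moreover have "c0 @ m \<in> \<Phi> \<longleftrightarrow> m \<in> Y3" if m: "m \<in> tuples k M" for m
    proof -
      have tt: "f \<in> tuples q U" "c \<in> tuples p U" "m \<in> tuples k U" "c1 \<in> tuples p1 U" "m1 \<in> tuples q1 U"
        using m fU cC CU MU c1 m1M
        by (auto simp: tuples_def p_def q_def p1_def q1_def)
      have cm: "c @ m \<in> tuples (p + k) (M \<union> C)" "c @ m \<in> tuples (p + k) U" "m @ m1 \<in> tuples (k + q1) M"
        using m cC m1M CU MU by (auto simp: tuples_def p_def q1_def)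
      have "c0 @ m \<in> \<Phi> \<longleftrightarrow> f @ c @ m \<in> \<Psi>" using in\<Psi>[OF tt(1-3)] "is"(3) by simp
      also have "\<dots> \<longleftrightarrow> (c @ m) @ e \<in> Y0" using Y(2)[OF cm(1)] Y0(2)[OF cm(2)] by simp
      also have "\<dots> \<longleftrightarrow> (c @ c1) @ m @ m1 \<in> \<Psi>2" using in\<Psi>2[OF tt(2,4,3,5)] js(3) by simp
      also have "\<dots> \<longleftrightarrow> m \<in> Y3" using Y2(2)[OF cm(3)] tt by (simp add: Y3_def)
      finally show ?thesis .
    qed
    ultimately show ?thesis by blast
  qed
  ultimately have "good C'" unfolding good_def by blast
  moreover have "C' - C \<subseteq> (\<Union>i. G i)" "C \<union> X \<subseteq> C'" by (auto simp: C'_def G_def intro!: exI[of _ 0])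
      (metis funpow_0)
  moreover have "countable (\<Union>i. G i)" using G by blast
  ultimately show ?thesis using countable_subset by blast
qed

end

section \<open>Back and forth\<close>

lemma same_type_trans: "same_type L S C a b \<Longrightarrow> same_type L S C b c \<Longrightarrow> same_type L S C a c"
  using same_type_tuples(1)[of L S C a b] by (auto simp: same_type_def)

lemma same_type_eq_nth:
  fixes S :: "('f, 'r, 'm) struct"
  assumes st: "same_type L S C b b'" and ij: "b ! i = b ! j" "i < length b" "j < length b" and C: "C \<subseteq> univ S"
  shows "b' ! i = b' ! j"
proof -
  have "definable L S C (length b) {e\<in>tuples (length b) (univ S). term_val e [Inl i] = term_val e [Inl j]}"
    by (rule definable_terms_eq[OF C, where k = 1]) (use ij in auto)
  from same_type_iff[OF st this] show ?thesis
    using st ij by (auto simp: tuples_def term_val_def same_type_def)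
qed

context monster
begin

text \<open>Partial elementary maps are kept as relations, so that the back direction is the forth
  direction for the converse. That such a relation is an injective function follows, equality being
  definable.\<close>

definition elementary_rel :: "('m \<times> 'm) set \<Rightarrow> bool" where
  "elementary_rel f \<longleftrightarrow> (\<forall>ps. set ps \<subseteq> f \<longrightarrow> same_type L S {} (map fst ps) (map snd ps))"

lemma elementary_relD: "elementary_rel f \<Longrightarrow> set ps \<subseteq> f \<Longrightarrow> same_type L S {} (map fst ps) (map snd ps)"
  by (simp add: elementary_rel_def)

lemma elementary_rel_subset: "elementary_rel f \<Longrightarrow> g \<subseteq> f \<Longrightarrow> elementary_rel g"
  by (auto simp: elementary_rel_def)

lemma elementary_rel_converse: "elementary_rel f \<Longrightarrow> elementary_rel (f\<inverse>)"
  unfolding elementary_rel_def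
proof (intro allI impI)
  fix ps assume f: "\<forall>ps. set ps \<subseteq> f \<longrightarrow> same_type L S {} (map fst ps) (map snd ps)" and ps: "set ps \<subseteq> f\<inverse>"
  have "set (map prod.swap ps) \<subseteq> f" using ps by auto
  from f[rule_format, OF this] have "same_type L S {} (map snd ps) (map fst ps)" by (simp add: comp_def)
  then show "same_type L S {} (map fst ps) (map snd ps)" by (rule same_type_sym)
qed

lemma elementary_rel_extendI:
  assumes "\<And>t. set t \<subseteq> f \<Longrightarrow> same_type L S {} (map fst ps @ map fst t) (map snd ps @ map snd t)"
  shows "elementary_rel (f \<union> set ps)"
  unfolding elementary_rel_def
proof (intro allI impI)
  fix qs assume qs: "set qs \<subseteq> f \<union> set ps"
  define t where "t = filter (\<lambda>q. q \<in> f) qs"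
  have t: "set t \<subseteq> f" by (auto simp: t_def)
  have "set qs \<subseteq> set (ps @ t)" using qs by (auto simp: t_def)
  then obtain "is" where "is": "set is \<subseteq> {..<length (ps @ t)}" "map ((!) (ps @ t)) is = qs"
    by (rule obtain_indices)
  have "same_type L S {} (map ((!) (map fst ps @ map fst t)) is) (map ((!) (map snd ps @ map snd t)) is)"
    by (rule same_type_reindex[OF assms[OF t]]) (use "is"(1) in auto)
  moreover have "map ((!) (map fst ps @ map fst t)) is = map fst qs"
    "map ((!) (map snd ps @ map snd t)) is = map snd qs"
  proof -
    have "map fst (ps @ t) ! i = fst ((ps @ t) ! i)" "map snd (ps @ t) ! i = snd ((ps @ t) ! i)"
      if "i \<in> set is" for i
    proof -
      have "i < length (ps @ t)" using that "is"(1) by blast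
      then show "map fst (ps @ t) ! i = fst ((ps @ t) ! i)" "map snd (ps @ t) ! i = snd ((ps @ t) ! i)"
        by (rule nth_map)+
    qed
    then show "map ((!) (map fst ps @ map fst t)) is = map fst qs"
      "map ((!) (map snd ps @ map snd t)) is = map snd qs"
      unfolding "is"(2)[symmetric] by (simp_all flip: map_append)
  qed
  ultimately show "same_type L S {} (map fst qs) (map snd qs)" by simp
qed

lemma elementary_rel_Union:
  assumes "\<F> \<noteq> {}" "subset.chain UNIV \<F>" "\<And>f. f \<in> \<F> \<Longrightarrow> elementary_rel f"
  shows "elementary_rel (\<Union>\<F>)"
  unfolding elementary_rel_def
proof (intro allI impI)
  fix ps assume "set ps \<subseteq> \<Union>\<F>"
  then obtain f where "f \<in> \<F>" "set ps \<subseteq> f"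
    using finite_subset_Union_chain[OF List.finite_set _ assms(1,2)] by metis
  then show "same_type L S {} (map fst ps) (map snd ps)" using elementary_relD assms(3) by blast
qed

text \<open>Atomicity is available over the domain of \<open>f\<close> only, not over that of the
  finite extension \<open>ps\<close>. Hence the type isolated is that of \<open>a\<close> together
  with the whole tuple \<open>p1\<close>. Transporting the parameters \<open>d\<close> of the
  isolating set along \<open>f\<close> and putting \<open>p2\<close> for \<open>p1\<close> gives a
  nonempty condition on \<open>a'\<close>, which has a solution in \<open>M\<close>.\<close>

lemma forth_step:
  assumes M: "meets_definable M" and f: "f \<subseteq> M \<times> M"
    and iso: "\<And>m. set m \<subseteq> M \<Longrightarrow> isolated (Domain f) m"
    and ps: "set ps \<subseteq> M \<times> M" "elementary_rel (f \<union> set ps)" and a: "a \<in> M"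
  shows "\<exists>a'\<in>M. elementary_rel (f \<union> set ((a, a') # ps))"
proof -
  have MU: "M \<subseteq> U" using meets_definable_subset[OF M] .
  define p1 p2 k where "p1 = map fst ps" and "p2 = map snd ps" and "k = length ps"
  have p: "p1 \<in> tuples k M" "p2 \<in> tuples k M" using ps(1) by (auto simp: p1_def p2_def k_def tuples_def)
  have pU: "p1 \<in> tuples k U" "p2 \<in> tuples k U" using p MU by (auto simp: tuples_def)
  have DU: "Domain f \<subseteq> U" using f MU by auto
  have a1: "[a] @ p1 \<in> tuples (1 + k) U" using a MU pU by (auto simp: tuples_def)
  have "set ([a] @ p1) \<subseteq> M" using a p by (auto simp: tuples_def)
  from iso[OF this] obtain W where W: "isolates (Domain f) (1 + k) W ([a] @ p1)"
    using p by (auto simp: isolated_def tuples_def)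
  obtain d \<Phi> where d: "set d \<subseteq> Domain f" and \<Phi>: "dfn {} (1 + k + length d) \<Phi>"
    and W\<Phi>: "\<And>x. x \<in> tuples (1 + k) U \<Longrightarrow> x \<in> W \<longleftrightarrow> x @ d \<in> \<Phi>"
    using definable_params[of L S "{}" "Domain f" "1 + k" W] isolates_dfn(1)[OF W] DU by auto
  have "\<forall>x\<in>set d. \<exists>y. (x, y) \<in> f" using d by auto
  then obtain g where g: "\<And>x. x \<in> set d \<Longrightarrow> (x, g x) \<in> f" by metis
  define t0 d' l where "t0 = map (\<lambda>x. (x, g x)) d" and "d' = map g d" and "l = length d"
  have t0: "set t0 \<subseteq> f" "map fst t0 = d" "map snd t0 = d'" using g by (auto simp: t0_def d'_def comp_def)
  have "g x \<in> M" if "x \<in> set d" for x using g[OF that] f by blast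
  then have dU: "d \<in> tuples l U" "d' \<in> tuples l U" "set d' \<subseteq> M"
    using d DU MU by (auto simp: tuples_def l_def d'_def)
  define Q where "Q = {z\<in>tuples (k + l) U. \<exists>y\<in>tuples 1 U. y @ z \<in> \<Phi>}"
  have \<Phi>': "dfn E (1 + (k + l)) \<Phi>" for E using \<Phi> definable_mono[of L S "{}" _ \<Phi> E] by (simp add: l_def add.assoc)
  have dQ: "dfn {} (k + l) Q" unfolding Q_def
    by (rule definable_Collect) (rule defintros defpred_mem[OF _ \<Phi>'] definable_UNIV empty_subsetI refl)+
  have "p1 @ d \<in> Q"
    using isolates_dfn(2)[OF W] W\<Phi>[OF a1] a MU pU dU by (auto simp: Q_def tuples_def intro!: exI[of _ "[a]"])
  moreover have "same_type L S {} (p1 @ d) (p2 @ d')"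
    using elementary_relD[OF ps(2), of "ps @ t0"] t0 by (auto simp: p1_def p2_def)
  ultimately have "p2 @ d' \<in> Q" using dQ pU dU by (auto simp: same_type_def tuples_def)
  then have ne: "{y\<in>tuples 1 U. y @ p2 @ d' \<in> \<Phi>} \<noteq> {}" by (auto simp: Q_def)
  have "dfn M 1 {y\<in>tuples 1 U. y @ p2 @ d' \<in> \<Phi>}"
    by (rule definable_fiber[of L S "{}"]) (use \<Phi>' p dU MU in \<open>auto simp: tuples_def\<close>)
  from meets_definable_point[OF M this order_refl ne]
  obtain y where "y \<in> {y\<in>tuples 1 U. y @ p2 @ d' \<in> \<Phi>}" "set y \<subseteq> M" .
  then have y: "y \<in> tuples 1 U" "y @ p2 @ d' \<in> \<Phi>" "set y \<subseteq> M" by simp_all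
  then obtain a' where a': "y = [a']" "a' \<in> M" by (auto simp: tuples_def length_Suc_conv)
  have a2: "[a'] @ p2 \<in> tuples (1 + k) U" using a' MU pU by (auto simp: tuples_def)
  have "elementary_rel (f \<union> set ((a, a') # ps))"
  proof (rule elementary_rel_extendI)
    fix t assume t: "set t \<subseteq> f"
    define j where "j = length t"
    have tU: "map fst t \<in> tuples j U" "map snd t \<in> tuples j U" "set (map fst t) \<subseteq> Domain f"
    proof -
      have "set t \<subseteq> M \<times> M" using t f by blast
      then show "map fst t \<in> tuples j U" "map snd t \<in> tuples j U"
        using MU by (auto simp: tuples_def j_def)
      show "set (map fst t) \<subseteq> Domain f" using t by (auto simp: Domain_fst)
    qed
    have "([a'] @ p2) @ map snd t \<in> X" if X: "dfn {} (1 + k + j) X" "([a] @ p1) @ map fst t \<in> X" for X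
    proof -
      \<comment> \<open>\<open>V\<close> expresses that \<Phi> with parameters \<open>u\<close>
        implies \<open>X\<close> with parameters \<open>v\<close>. It is parameter-free, so
        \<open>f\<close> carries it from \<open>d\<close> and the first components of
        \<open>t\<close> to their images.\<close>
      define V where "V = {w\<in>tuples (l + j) U. \<exists>u\<in>tuples l U. \<exists>v\<in>tuples j U. w = u @ v \<and>
        (\<forall>x\<in>tuples (1 + k) U. x @ u \<in> \<Phi> \<longrightarrow> x @ v \<in> X)}"
      have inV: "u @ v \<in> V \<longleftrightarrow> (\<forall>x\<in>tuples (1 + k) U. x @ u \<in> \<Phi> \<longrightarrow> x @ v \<in> X)"
        if "u \<in> tuples l U" "v \<in> tuples j U" for u v
        using that by (auto simp: V_def append_tuples_inject intro!: tuples_append)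
      have dV: "dfn {} (l + j) V"
        by (rule definable_Collect2[OF _ refl inV])
          (auto simp: V_def, (rule defintros defpred_mem[OF _ X(1)] defpred_mem[OF _ \<Phi>] definable_UNIV
            empty_subsetI refl | simp add: l_def)+)
      have dX: "dfn (Domain f) (1 + k) {x\<in>tuples (1 + k) U. x @ map fst t \<in> X}"
        by (rule definable_fiber[of L S "{}"]) (use X tU DU in \<open>auto simp: j_def\<close>)
      have "W \<subseteq> {x\<in>tuples (1 + k) U. x @ map fst t \<in> X}"
        by (rule isolates_sub[OF W dX]) (use X a1 in auto)
      then have "d @ map fst t \<in> V" using inV[OF dU(1) tU(1)] W\<Phi> by auto
      moreover have "same_type L S {} (d @ map fst t) (d' @ map snd t)"
        using elementary_relD[OF ps(2), of "t0 @ t"] t0 t by auto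
      ultimately have "d' @ map snd t \<in> V" using dV dU tU by (auto simp: same_type_def tuples_def)
      then show ?thesis using inV[OF dU(2) tU(2)] a2 y(2) a'(1) by auto
    qed
    then show "same_type L S {} (map fst ((a, a') # ps) @ map fst t) (map snd ((a, a') # ps) @ map snd t)"
      using tU a1 by (auto simp: same_type_def p1_def p2_def k_def j_def tuples_def)
  qed
  then show ?thesis using a' by blast
qed

lemma back_step:
  assumes M: "meets_definable M" and f: "f \<subseteq> M \<times> M"
    and iso: "\<And>m. set m \<subseteq> M \<Longrightarrow> isolated (Range f) m"
    and ps: "set ps \<subseteq> M \<times> M" "elementary_rel (f \<union> set ps)" and b: "b \<in> M"
  shows "\<exists>a\<in>M. elementary_rel (f \<union> set ((a, b) # ps))"
proof -
  have eq: "f\<inverse> \<union> set (map prod.swap qs) = (f \<union> set qs)\<inverse>" for qs :: "('m \<times> 'm) list" by auto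
  have "\<exists>a\<in>M. elementary_rel (f\<inverse> \<union> set ((b, a) # map prod.swap ps))"
    by (rule forth_step[OF M]) (use f iso ps b elementary_rel_converse[OF ps(2)] eq in auto)
  then obtain a where a: "a \<in> M" "elementary_rel ((f \<union> set ((a, b) # ps))\<inverse>)"
    using eq[of "(_, b) # ps"] by auto
  show ?thesis using elementary_rel_converse[OF a(2)] a(1) by auto
qed

end

text \<open>The input of Ressayre's argument in abstract form. Only the traces
  \<open>B \<union> (C \<inter> M)\<close> serve as domains and ranges; the sets \<open>C\<close>
  themselves may leave \<open>M\<close>. The family is closed under unions of chains and admits
  countable enlargements.\<close>

locale atomic_family = monster L T \<kappa> S
  for L :: "('f, 'r) lang" and T :: "('f, 'r) fm set" and \<kappa> :: "'k rel"
    and S :: "('f, 'r, 'm) struct" +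
  fixes M B :: "'m set" and \<C> :: "'m set set"
  assumes tvM: "meets_definable M" and BM: "B \<subseteq> M"
    and atomic: "C \<in> \<C> \<Longrightarrow> set m \<subseteq> M \<Longrightarrow> isolated (B \<union> (C \<inter> M)) m"
    and Union_closed: "\<K> \<noteq> {} \<Longrightarrow> \<K> \<subseteq> \<C> \<Longrightarrow> subset.chain UNIV \<K> \<Longrightarrow> \<Union>\<K> \<in> \<C>"
    and extendible: "C \<in> \<C> \<Longrightarrow> countable X \<Longrightarrow> X \<subseteq> M \<Longrightarrow> \<exists>C'\<in>\<C>. C \<union> X \<subseteq> C' \<and> countable (C' - C)"
begin

definition approx :: "'m set \<Rightarrow> 'm set \<Rightarrow> ('m \<times> 'm) set \<Rightarrow> bool" where
  "approx C1 C2 f \<longleftrightarrow> C1 \<in> \<C> \<and> C2 \<in> \<C> \<and> elementary_rel f \<and> Id_on B \<subseteq> f \<and>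
     Domain f = B \<union> (C1 \<inter> M) \<and> Range f = B \<union> (C2 \<inter> M)"

text \<open>The new domain and range must again be traces of members of the family, but enlarging
  one side creates new images on the other, and these force further enlargements. So
  \<open>K1\<close> and \<open>K2\<close> are first made large enough to contain every point that
  any finite sequence of forth and back moves over them can produce. Only then is one such sequence
  of length \<omega> run through.\<close>

lemma approx_extend:
  assumes f: "approx C1 C2 f" and ps0: "set ps0 \<subseteq> M \<times> M" "elementary_rel (f \<union> set ps0)"
    and X: "countable X" "X \<subseteq> M"
  shows "\<exists>K1 K2 g. approx K1 K2 g \<and> C1 \<union> X \<subseteq> K1 \<and> C2 \<union> X \<subseteq> K2 \<and> f \<union> set ps0 \<subseteq> g"
proof -
  have C: "C1 \<in> \<C>" "C2 \<in> \<C>" and dom: "Domain f = B \<union> (C1 \<inter> M)" and ran: "Range f = B \<union> (C2 \<inter> M)"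
    and fB: "Id_on B \<subseteq> f" using f by (auto simp: approx_def)
  have fM: "f \<subseteq> M \<times> M"
  proof
    fix p assume "p \<in> f"
    then have "fst p \<in> Domain f" by (metis DomainI prod.collapse)
    moreover have "snd p \<in> Range f" using \<open>p \<in> f\<close> by (metis RangeI prod.collapse)
    ultimately have "fst p \<in> M" "snd p \<in> M" using dom ran BM by auto
    then show "p \<in> M \<times> M" by (cases p) simp
  qed
  define P where "P ps \<longleftrightarrow> set ps \<subseteq> M \<times> M \<and> elementary_rel (f \<union> set ps)" for ps
  have "\<exists>a'\<in>M. P ((a, a') # ps)" if "P ps" "a \<in> M" for ps a
    using forth_step[OF tvM fM, of ps a] atomic[OF C(1)] dom that by (auto simp: P_def)
  then obtain fo where fo: "\<And>ps a. P ps \<Longrightarrow> a \<in> M \<Longrightarrow> P ((a, fo ps a) # ps)" by metis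
  have "\<exists>a\<in>M. P ((a, b) # ps)" if "P ps" "b \<in> M" for ps b
    using back_step[OF tvM fM, of ps b] atomic[OF C(2)] ran that by (auto simp: P_def)
  then obtain ba where ba: "\<And>ps b. P ps \<Longrightarrow> b \<in> M \<Longrightarrow> P ((ba ps b, b) # ps)" by metis
  have "\<forall>Y C. \<exists>C'. C \<in> \<C> \<longrightarrow> countable Y \<longrightarrow> Y \<subseteq> M \<longrightarrow> C' \<in> \<C> \<and> C \<union> Y \<subseteq> C' \<and> countable (C' - C)"
    using extendible by meson
  then obtain E where E: "\<And>Y C. C \<in> \<C> \<Longrightarrow> countable Y \<Longrightarrow> Y \<subseteq> M \<Longrightarrow>
    E Y C \<in> \<C> \<and> C \<union> Y \<subseteq> E Y C \<and> countable (E Y C - C)" by metis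
  define fsts snds where "fsts Q = (\<Union>ps\<in>Q. fst ` set ps)" and "snds Q = (\<Union>ps\<in>Q. snd ` set ps)"
    for Q :: "('m \<times> 'm) list set"
  \<comment> \<open>All continuations of all finite extensions found so far by one move, forth from
    \<open>K1\<close> or back from \<open>K2\<close>, are recorded. The sets stay countable because
    only the points outside \<open>C1\<close> and \<open>C2\<close> are used.\<close>
  define stepQ where "stepQ Q K1 K2 = Q \<union> (\<lambda>(ps, a). (a, fo ps a) # ps) ` (Q \<times> (K1 \<inter> M - C1))
    \<union> (\<lambda>(ps, b). (ba ps b, b) # ps) ` (Q \<times> (K2 \<inter> M - C2))" for Q K1 K2
  define G where "G = rec_nat ({ps0}, E X C1, E X C2)
    (\<lambda>_ (Q, K1, K2). (stepQ Q K1 K2, E (fsts Q) K1, E (snds Q) K2))"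
  define Q where "Q i = fst (G i)" for i
  define D1 where "D1 i = fst (snd (G i))" for i
  define D2 where "D2 i = snd (snd (G i))" for i
  have G0: "Q 0 = {ps0}" "D1 0 = E X C1" "D2 0 = E X C2" by (simp_all add: Q_def D1_def D2_def G_def)
  have GS: "Q (Suc i) = stepQ (Q i) (D1 i) (D2 i)" "D1 (Suc i) = E (fsts (Q i)) (D1 i)"
    "D2 (Suc i) = E (snds (Q i)) (D2 i)" for i
    by (simp_all add: Q_def D1_def D2_def G_def case_prod_beta)
  have countable_fs: "countable (fsts Q) \<and> countable (snds Q)" if "countable Q" for Q
    using that unfolding fsts_def snds_def
    by (intro conjI countable_UN) (auto intro: countable_finite)
  have fs_M: "fsts Q \<subseteq> M \<and> snds Q \<subseteq> M" if "\<And>ps. ps \<in> Q \<Longrightarrow> P ps" for Q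
    using that by (fastforce simp: fsts_def snds_def P_def)
  have inv: "countable (Q i) \<and> (\<forall>ps\<in>Q i. P ps) \<and> D1 i \<in> \<C> \<and> D2 i \<in> \<C> \<and> C1 \<union> X \<subseteq> D1 i \<and> C2 \<union> X \<subseteq> D2 i \<and>
    countable (D1 i - C1) \<and> countable (D2 i - C2)" for i
  proof (induction i)
    case 0
    show ?case using E[OF C(1) X] E[OF C(2) X] ps0 by (simp add: G0 P_def)
  next
    case (Suc i)
    have fs: "countable (fsts (Q i))" "countable (snds (Q i))" "fsts (Q i) \<subseteq> M" "snds (Q i) \<subseteq> M"
      using countable_fs[of "Q i"] fs_M[of "Q i"] Suc by blast+
    have e1: "D1 (Suc i) \<in> \<C>" "D1 i \<subseteq> D1 (Suc i)" "countable (D1 (Suc i) - D1 i)"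
      using E[of "D1 i" "fsts (Q i)"] Suc fs by (auto simp: GS)
    have e2: "D2 (Suc i) \<in> \<C>" "D2 i \<subseteq> D2 (Suc i)" "countable (D2 (Suc i) - D2 i)"
      using E[of "D2 i" "snds (Q i)"] Suc fs by (auto simp: GS)
    have c: "countable (D1 i - C1)" "countable (D2 i - C2)" using Suc by blast+
    have "countable (D1 (Suc i) - C1)"
      by (rule countable_subset[OF _ countable_Un[OF e1(3) c(1)]]) blast
    moreover have "countable (D2 (Suc i) - C2)"
      by (rule countable_subset[OF _ countable_Un[OF e2(3) c(2)]]) blast
    moreover have "countable (D1 i \<inter> M - C1)" "countable (D2 i \<inter> M - C2)"
      by (rule countable_subset[OF _ c(1)], blast, rule countable_subset[OF _ c(2)], blast)
    then have "countable (Q (Suc i))" using Suc unfolding GS stepQ_def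
      by (intro countable_Un countable_image countable_SIGMA) auto
    moreover have "\<forall>ps\<in>Q (Suc i). P ps" using Suc fo ba by (auto simp: GS stepQ_def)
    ultimately show ?case using e1 e2 Suc by blast
  qed
  have mono: "Q i \<subseteq> Q (Suc i)" "D1 i \<subseteq> D1 (Suc i)" "D2 i \<subseteq> D2 (Suc i)"
    "fsts (Q i) \<subseteq> D1 (Suc i)" "snds (Q i) \<subseteq> D2 (Suc i)" for i
  proof -
    have fs: "countable (fsts (Q i))" "countable (snds (Q i))" "fsts (Q i) \<subseteq> M" "snds (Q i) \<subseteq> M"
      using countable_fs[of "Q i"] fs_M[of "Q i"] inv[of i] by blast+
    show "Q i \<subseteq> Q (Suc i)" "D1 i \<subseteq> D1 (Suc i)" "D2 i \<subseteq> D2 (Suc i)"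
      "fsts (Q i) \<subseteq> D1 (Suc i)" "snds (Q i) \<subseteq> D2 (Suc i)"
      using E[of "D1 i" "fsts (Q i)"] E[of "D2 i" "snds (Q i)"] inv[of i] fs by (auto simp: GS stepQ_def)
  qed
  have monoQ: "Q i \<subseteq> Q j" and monoD1: "D1 i \<subseteq> D1 j" and monoD2: "D2 i \<subseteq> D2 j" if "i \<le> j" for i j
    using lift_Suc_mono_le[of Q, OF mono(1) that] lift_Suc_mono_le[of D1, OF mono(2) that]
      lift_Suc_mono_le[of D2, OF mono(3) that] by auto
  define Qs K1 K2 where "Qs = (\<Union>i. Q i)" and "K1 = (\<Union>i. D1 i)" and "K2 = (\<Union>i. D2 i)"
  define A1 A2 where "A1 = K1 \<inter> M - C1" and "A2 = K2 \<inter> M - C2"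
  have chain: "subset.chain UNIV (range h)" if "\<And>i j. i \<le> j \<Longrightarrow> h i \<subseteq> h j" for h :: "nat \<Rightarrow> 'z set"
  proof -
    have "h i \<subseteq> h j \<or> h j \<subseteq> h i" for i j using that nat_le_linear by blast
    then show ?thesis unfolding subset.chain_def by auto
  qed
  have K1: "K1 \<in> \<C>" "C1 \<union> X \<subseteq> K1" and K2: "K2 \<in> \<C>" "C2 \<union> X \<subseteq> K2"
    using Union_closed[of "range D1"] Union_closed[of "range D2"] inv chain[of D1] chain[of D2] monoD1 monoD2
    unfolding K1_def K2_def by blast+
  have "K1 - C1 = (\<Union>i. D1 i - C1)" "K2 - C2 = (\<Union>i. D2 i - C2)" by (auto simp: K1_def K2_def)
  moreover have "countable (\<Union>i. D1 i - C1)" "countable (\<Union>i. D2 i - C2)"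
    using inv by (intro countable_UN; blast)+
  ultimately have "countable (K1 - C1)" "countable (K2 - C2)" by simp_all
  then have cA: "countable A1" "countable A2"
    using countable_subset[of A1 "K1 - C1"] countable_subset[of A2 "K2 - C2"] by (auto simp: A1_def A2_def)
  have Qs: "P ps" "fst ` set ps \<subseteq> K1" "snd ` set ps \<subseteq> K2" if ps: "ps \<in> Qs" for ps
  proof -
    obtain i where i: "ps \<in> Q i" using ps by (auto simp: Qs_def)
    then show "P ps" using inv by blast
    have "fst ` set ps \<subseteq> fsts (Q i)" "snd ` set ps \<subseteq> snds (Q i)" using i by (auto simp: fsts_def snds_def)
    then show "fst ` set ps \<subseteq> K1" "snd ` set ps \<subseteq> K2"
      using mono(4)[of i] mono(5)[of i] unfolding K1_def K2_def by blast+
  qed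
  have Qs_fo: "(a, fo ps a) # ps \<in> Qs" if ps: "ps \<in> Qs" and a: "a \<in> A1" for ps a
  proof -
    obtain i j where "ps \<in> Q i" "a \<in> D1 j" using ps a by (auto simp: Qs_def A1_def K1_def)
    then have "ps \<in> Q (max i j)" "a \<in> D1 (max i j) \<inter> M - C1"
      using monoQ[of i "max i j"] monoD1[of j "max i j"] a by (auto simp: A1_def)
    then have "(a, fo ps a) # ps \<in> Q (Suc (max i j))" unfolding GS stepQ_def by force
    then show ?thesis by (auto simp: Qs_def)
  qed
  have Qs_ba: "(ba ps b, b) # ps \<in> Qs" if ps: "ps \<in> Qs" and b: "b \<in> A2" for ps b
  proof -
    obtain i j where "ps \<in> Q i" "b \<in> D2 j" using ps b by (auto simp: Qs_def A2_def K2_def)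
    then have "ps \<in> Q (max i j)" "b \<in> D2 (max i j) \<inter> M - C2"
      using monoQ[of i "max i j"] monoD2[of j "max i j"] b by (auto simp: A2_def)
    then have "(ba ps b, b) # ps \<in> Q (Suc (max i j))" unfolding GS stepQ_def by force
    then show ?thesis by (auto simp: Qs_def)
  qed
  \<comment> \<open>The sets \<open>A1\<close> and \<open>A2\<close> may be empty, in which case
    \<open>from_nat_into\<close> returns an arbitrary value; hence the membership tests.\<close>
  define add1 where "add1 ps a = (if a \<in> A1 then (a, fo ps a) # ps else ps)" for ps a
  define add2 where "add2 ps b = (if b \<in> A2 then (ba ps b, b) # ps else ps)" for ps b
  \<comment> \<open>A single back-and-forth along enumerations of \<open>A1\<close> and
    \<open>A2\<close>. Its moves are those of \<open>fo\<close> and \<open>ba\<close>, so it never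
    leaves \<open>Qs\<close>, and all its points lie in \<open>K1\<close> and
    \<open>K2\<close>.\<close>
  define H where "H = rec_nat ps0 (\<lambda>i ps. add2 (add1 ps (from_nat_into A1 i)) (from_nat_into A2 i))"
  have HS: "H (Suc i) = add2 (add1 (H i) (from_nat_into A1 i)) (from_nat_into A2 i)" for i by (simp add: H_def)
  have HQ: "H i \<in> Qs" for i
  proof (induction i)
    case 0
    show ?case using G0(1) by (auto simp: H_def Qs_def)
  next
    case (Suc i)
    then have "add1 (H i) (from_nat_into A1 i) \<in> Qs" using Qs_fo by (simp add: add1_def)
    then show ?case using Qs_ba by (simp add: HS add2_def)
  qed
  have Hmono: "set (H i) \<subseteq> set (H j)" if "i \<le> j" for i j
    by (rule lift_Suc_mono_le[OF _ that]) (auto simp: HS add1_def add2_def)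
  define g where "g = f \<union> (\<Union>i. set (H i))"
  have g: "g = \<Union>(range (\<lambda>i. f \<union> set (H i)))" by (auto simp: g_def)
  have "elementary_rel g" unfolding g
  proof (rule elementary_rel_Union)
    show "subset.chain UNIV (range (\<lambda>i. f \<union> set (H i)))" by (rule chain) (use Hmono in blast)
    show "elementary_rel h" if "h \<in> range (\<lambda>i. f \<union> set (H i))" for h
      using that Qs(1)[OF HQ] by (auto simp: P_def)
  qed simp
  moreover have "Domain g = B \<union> (K1 \<inter> M)"
  proof (intro equalityI subsetI)
    fix x assume "x \<in> Domain g"
    then obtain y where "(x, y) \<in> f \<or> (\<exists>i. (x, y) \<in> set (H i))" by (auto simp: g_def)
    then show "x \<in> B \<union> (K1 \<inter> M)"
    proof
      assume "(x, y) \<in> f"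
      then have "x \<in> Domain f" by blast
      then show ?thesis using dom K1(2) by auto
    next
      assume "\<exists>i. (x, y) \<in> set (H i)"
      then obtain i where i: "(x, y) \<in> set (H i)" by blast
      then show ?thesis using Qs(1,2)[OF HQ[of i]] by (force simp: P_def)
    qed
  next
    fix x assume x: "x \<in> B \<union> (K1 \<inter> M)"
    show "x \<in> Domain g"
    proof (cases "x \<in> Domain f")
      case False
      then have "x \<in> A1" using x dom by (auto simp: A1_def)
      then obtain i where "from_nat_into A1 i = x" using from_nat_into_surj[OF cA(1)] by blast
      then have "(x, fo (H i) x) \<in> set (H (Suc i))" using \<open>x \<in> A1\<close> by (simp add: HS add1_def add2_def)
      then show ?thesis by (auto simp: g_def)
    qed (auto simp: g_def)
  qed
  moreover have "Range g = B \<union> (K2 \<inter> M)"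
  proof (intro equalityI subsetI)
    fix x assume "x \<in> Range g"
    then obtain y where "(y, x) \<in> f \<or> (\<exists>i. (y, x) \<in> set (H i))" by (auto simp: g_def)
    then show "x \<in> B \<union> (K2 \<inter> M)"
    proof
      assume "(y, x) \<in> f"
      then have "x \<in> Range f" by blast
      then show ?thesis using ran K2(2) by auto
    next
      assume "\<exists>i. (y, x) \<in> set (H i)"
      then obtain i where i: "(y, x) \<in> set (H i)" by blast
      then show ?thesis using Qs(1,3)[OF HQ[of i]] by (force simp: P_def)
    qed
  next
    fix x assume x: "x \<in> B \<union> (K2 \<inter> M)"
    show "x \<in> Range g"
    proof (cases "x \<in> Range f")
      case False
      then have "x \<in> A2" using x ran by (auto simp: A2_def)
      then obtain i where "from_nat_into A2 i = x" using from_nat_into_surj[OF cA(2)] by blast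
      then have "(ba (add1 (H i) (from_nat_into A1 i)) x, x) \<in> set (H (Suc i))"
        using \<open>x \<in> A2\<close> by (simp add: HS add2_def)
      then show ?thesis by (auto simp: g_def)
    qed (auto simp: g_def)
  qed
  ultimately have "approx K1 K2 g" using K1 K2 fB by (auto simp: approx_def g_def)
  moreover have "set (H 0) \<subseteq> g" unfolding g_def by blast
  then have "set ps0 \<subseteq> g" by (simp add: H_def)
  ultimately show ?thesis using K1(2) K2(2) by (intro exI[of _ K1] exI[of _ K2] exI[of _ g]) (auto simp: g_def)
qed

text \<open>The identity on \<open>B\<close>, extended by the pairs from \<open>b\<close> and
  \<open>b'\<close>, starts an approximation. A maximal one has domain and range \<open>M\<close>,
  because \<open>approx_extend\<close> would add any missing point on both sides.\<close>

theorem automorphism_extends: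
  assumes C0: "C0 \<in> \<C>" "C0 \<inter> M \<subseteq> B"
    and b: "set b \<subseteq> M" "set b' \<subseteq> M" "same_type L S B b b'"
  shows "\<exists>\<sigma>\<in>Aut L S M B. map \<sigma> b = b'"
proof -
  have MU: "M \<subseteq> U" using meets_definable_subset[OF tvM] .
  have len: "length b' = length b" using same_type_tuples(1)[OF b(3)] .
  define ps0 where "ps0 = zip b b'"
  have ps0: "set ps0 \<subseteq> M \<times> M" "map fst ps0 = b" "map snd ps0 = b'"
    using b len by (auto simp: ps0_def dest: set_zip_leftD set_zip_rightD)
  have "elementary_rel (Id_on B \<union> set ps0)"
  proof (rule elementary_rel_extendI)
    fix t assume t: "set t \<subseteq> Id_on B"
    then have tt: "map fst t = map snd t" "set (map fst t) \<subseteq> B" by auto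
    have "same_type L S {} (b @ map fst t) (b' @ map fst t)"
      by (rule same_type_append_iff[OF same_type_mono[OF b(3) tt(2)]]) (use tt BM MU in blast)
    then show "same_type L S {} (map fst ps0 @ map fst t) (map snd ps0 @ map snd t)"
      unfolding ps0 tt(1)[symmetric] .
  qed
  moreover then have "approx C0 C0 (Id_on B)"
    using C0 elementary_rel_subset[of "Id_on B \<union> set ps0" "Id_on B"] by (auto simp: approx_def)
  ultimately obtain K1 K2 g where start: "approx K1 K2 g" "set ps0 \<subseteq> g"
    using approx_extend[of C0 C0 "Id_on B" ps0 "{}"] ps0(1) by auto
  \<comment> \<open>Triples of two sets and a relation are coded as subsets of a sum type, so that
    Zorn's lemma for inclusion applies to their componentwise order.\<close>
  define dec1 dec2 dec3 where "dec1 Z = Inl -` Z" and "dec2 Z = Inl -` (Inr -` Z)" and "dec3 Z = Inr -` (Inr -` Z)"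
    for Z :: "('m + 'm + 'm \<times> 'm) set"
  define enc :: "'m set \<Rightarrow> 'm set \<Rightarrow> ('m \<times> 'm) set \<Rightarrow> ('m + 'm + 'm \<times> 'm) set"
    where "enc C D f = Inl ` C \<union> Inr ` (Inl ` D \<union> Inr ` f)" for C D f
  have dec_enc: "dec1 (enc C D f) = C" "dec2 (enc C D f) = D" "dec3 (enc C D f) = f" for C D f
    by (auto simp: dec1_def dec2_def dec3_def enc_def)
  have enc_mono: "enc C D f \<subseteq> enc C' D' f'" if "C \<subseteq> C'" "D \<subseteq> D'" "f \<subseteq> f'" for C D f C' D' f'
    using that by (auto simp: enc_def)
  have enc_dec: "enc (dec1 Z) (dec2 Z) (dec3 Z) = Z" for Z
  proof (intro Set.set_eqI)
    fix z show "z \<in> enc (dec1 Z) (dec2 Z) (dec3 Z) \<longleftrightarrow> z \<in> Z"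
      by (cases z; cases "projr z") (auto simp: enc_def dec1_def dec2_def dec3_def)
  qed
  define \<T> where "\<T> = {Z. approx (dec1 Z) (dec2 Z) (dec3 Z) \<and> set ps0 \<subseteq> dec3 Z}"
  have "\<exists>Z\<in>\<T>. \<forall>Y\<in>\<T>. Z \<subseteq> Y \<longrightarrow> Y = Z"
  proof (rule subset_Zorn_nonempty)
    have "enc K1 K2 g \<in> \<T>" using start by (simp add: \<T>_def dec_enc)
    then show "\<T> \<noteq> {}" by blast
    fix \<K> assume ne: "\<K> \<noteq> {}" and ch: "subset.chain \<T> \<K>"
    then have sub: "\<K> \<subseteq> \<T>" and lin: "\<And>Y Z. Y \<in> \<K> \<Longrightarrow> Z \<in> \<K> \<Longrightarrow> Y \<subseteq> Z \<or> Z \<subseteq> Y"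
      by (auto simp: subset.chain_def)
    have ap: "approx (dec1 Z) (dec2 Z) (dec3 Z)" "set ps0 \<subseteq> dec3 Z" if "Z \<in> \<K>" for Z
      using that sub by (auto simp: \<T>_def)
    have decU: "dec1 (\<Union>\<K>) = \<Union>(dec1 ` \<K>)" "dec2 (\<Union>\<K>) = \<Union>(dec2 ` \<K>)" "dec3 (\<Union>\<K>) = \<Union>(dec3 ` \<K>)"
      by (auto simp: dec1_def dec2_def dec3_def)
    have chain1: "subset.chain UNIV (dec1 ` \<K>)"
      unfolding subset.chain_def dec1_def using lin by (fastforce simp: vimage_def)
    have chain2: "subset.chain UNIV (dec2 ` \<K>)"
      unfolding subset.chain_def dec2_def using lin by (fastforce simp: vimage_def)
    have chain3: "subset.chain UNIV (dec3 ` \<K>)"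
      unfolding subset.chain_def dec3_def using lin by (fastforce simp: vimage_def)
    have "approx (dec1 (\<Union>\<K>)) (dec2 (\<Union>\<K>)) (dec3 (\<Union>\<K>))"
      unfolding approx_def
    proof (intro conjI)
      show "dec1 (\<Union>\<K>) \<in> \<C>" unfolding decU
        by (rule Union_closed[OF _ _ chain1]) (use ne ap in \<open>auto simp: approx_def\<close>)
      show "dec2 (\<Union>\<K>) \<in> \<C>" unfolding decU
        by (rule Union_closed[OF _ _ chain2]) (use ne ap in \<open>auto simp: approx_def\<close>)
      show "elementary_rel (dec3 (\<Union>\<K>))" unfolding decU
        by (rule elementary_rel_Union[OF _ chain3]) (use ne ap in \<open>auto simp: approx_def\<close>)
      show "Id_on B \<subseteq> dec3 (\<Union>\<K>)" using ne ap(1) unfolding decU approx_def by blast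
      have D: "Domain (dec3 Z) = B \<union> (dec1 Z \<inter> M)" "Range (dec3 Z) = B \<union> (dec2 Z \<inter> M)" if "Z \<in> \<K>" for Z
        using ap(1)[OF that] by (auto simp: approx_def)
      have "Domain (dec3 (\<Union>\<K>)) = (\<Union>Z\<in>\<K>. Domain (dec3 Z))" unfolding decU by blast
      also have "\<dots> = (\<Union>Z\<in>\<K>. B \<union> (dec1 Z \<inter> M))" using D(1) by simp
      also have "\<dots> = B \<union> (dec1 (\<Union>\<K>) \<inter> M)" unfolding decU using ne by blast
      finally show "Domain (dec3 (\<Union>\<K>)) = B \<union> (dec1 (\<Union>\<K>) \<inter> M)" .
      have "Range (dec3 (\<Union>\<K>)) = (\<Union>Z\<in>\<K>. Range (dec3 Z))" unfolding decU by blast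
      also have "\<dots> = (\<Union>Z\<in>\<K>. B \<union> (dec2 Z \<inter> M))" using D(2) by simp
      also have "\<dots> = B \<union> (dec2 (\<Union>\<K>) \<inter> M)" unfolding decU using ne by blast
      finally show "Range (dec3 (\<Union>\<K>)) = B \<union> (dec2 (\<Union>\<K>) \<inter> M)" .
    qed
    moreover have "set ps0 \<subseteq> dec3 (\<Union>\<K>)" using ne ap(2) unfolding decU by blast
    ultimately show "\<Union>\<K> \<in> \<T>" by (simp add: \<T>_def)
  qed
  then obtain Z where ZT: "Z \<in> \<T>" and max: "\<And>Y. Y \<in> \<T> \<Longrightarrow> Z \<subseteq> Y \<Longrightarrow> Y = Z" by blast
  define f where "f = dec3 Z"
  have ap: "approx (dec1 Z) (dec2 Z) f" and psf: "set ps0 \<subseteq> f" using ZT by (auto simp: \<T>_def f_def)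
  have f: "elementary_rel f" "Id_on B \<subseteq> f" "Domain f = B \<union> (dec1 Z \<inter> M)" "Range f = B \<union> (dec2 Z \<inter> M)"
    using ap by (auto simp: approx_def)
  have full: "a \<in> dec1 Z \<and> a \<in> dec2 Z" if a: "a \<in> M" for a
  proof -
    obtain J1 J2 h where h: "approx J1 J2 h" "dec1 Z \<union> {a} \<subseteq> J1" "dec2 Z \<union> {a} \<subseteq> J2" "f \<subseteq> h"
      using approx_extend[OF ap, of "[]" "{a}"] f(1) a by auto
    have "enc J1 J2 h \<in> \<T>" using h psf by (auto simp: \<T>_def dec_enc)
    moreover have "Z \<subseteq> enc J1 J2 h"
      using enc_mono[of "dec1 Z" J1 "dec2 Z" J2 "dec3 Z" h] h unfolding enc_dec f_def by blast
    ultimately have "enc J1 J2 h = Z" by (rule max)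
    then have "dec1 Z = J1" "dec2 Z = J2" using dec_enc by metis+
    then show ?thesis using h(2,3) by blast
  qed
  then have dom: "Domain f = M" and ran: "Range f = M" using f BM by auto
  have fun_f: "y = y'" if "(x, y) \<in> f" "(x, y') \<in> f" for x y y'
    using same_type_eq_nth[OF elementary_relD[OF f(1), of "[(x, y), (x, y')]"], of 0 1] that by auto
  have inj_f: "x = x'" if "(x, y) \<in> f" "(x', y) \<in> f" for x x' y
    using same_type_eq_nth[OF elementary_relD[OF elementary_rel_converse[OF f(1)], of "[(y, x), (y, x')]"], of 0 1]
      that by auto
  define \<sigma> where "\<sigma> = (\<lambda>x\<in>M. THE y. (x, y) \<in> f)"
  have \<sigma>: "(x, \<sigma> x) \<in> f" if "x \<in> M" for x
  proof -
    have "\<exists>!y. (x, y) \<in> f" using that dom fun_f by blast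
    then show ?thesis using that by (simp add: \<sigma>_def) (rule theI')
  qed
  have \<sigma>eq: "\<sigma> x = y" if "(x, y) \<in> f" for x y using \<sigma>[of x] fun_f that dom by blast
  have "bij_betw \<sigma> M M"
  proof (rule bij_betwI')
    show "\<sigma> x = \<sigma> y \<longleftrightarrow> x = y" if "x \<in> M" "y \<in> M" for x y using \<sigma>[OF that(1)] \<sigma>[OF that(2)] inj_f by metis
    show "\<sigma> x \<in> M" if "x \<in> M" for x using \<sigma>[OF that] ran by blast
    show "\<exists>x\<in>M. y = \<sigma> x" if "y \<in> M" for y using that ran dom \<sigma>eq by blast
  qed
  then have "\<sigma> \<in> Bij M" by (simp add: Bij_def \<sigma>_def)
  moreover have "elementary_map L S S M \<sigma>"
  proof (rule elementary_mapI[OF MU])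
    fix c assume c: "set c \<subseteq> M"
    then show "same_type L S {} c (map \<sigma> c)"
      using elementary_relD[OF f(1), of "map (\<lambda>x. (x, \<sigma> x)) c"] \<sigma> by (auto simp: comp_def)
  qed
  moreover have "\<forall>a\<in>B. \<sigma> a = a" using f(2) \<sigma>eq by blast
  ultimately have "\<sigma> \<in> Aut L S M B" by (simp add: Aut_def)
  moreover have "map \<sigma> b = b'"
  proof -
    have "map \<sigma> (map fst ps0) = map snd ps0" using psf \<sigma>eq by auto
    then show ?thesis using ps0 by simp
  qed
  ultimately show ?thesis by blast
qed

end

context constructible_submodel
begin

theorem homogeneous_over_normal:
  assumes B: "normal_over L S A M B" and b: "set b \<subseteq> M" "set b' \<subseteq> M" "same_type L S B b b'"
  shows "\<exists>\<sigma>\<in>Aut L S M B. map \<sigma> b = b'"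
proof -
  interpret atomic_family L T \<kappa> S M B "Collect good"
  proof
    show "meets_definable M" "B \<subseteq> M" using tvM B by (auto simp: normal_over_def)
    show "isolated (B \<union> (C \<inter> M)) m" if "C \<in> Collect good" "set m \<subseteq> M" for C m
      using good_normal_atomic[OF _ B] that by blast
    show "\<Union>\<K> \<in> Collect good" if "\<K> \<noteq> {}" "\<K> \<subseteq> Collect good" "subset.chain UNIV \<K>" for \<K>
      using good_Union[of \<K>] that by blast
    show "\<exists>C'\<in>Collect good. C \<union> X \<subseteq> C' \<and> countable (C' - C)"
      if "C \<in> Collect good" "countable X" "X \<subseteq> M" for C X
      using good_extend[OF _ that(2) subset_trans[OF that(3) MN], of C] that(1) by (auto simp: Bex_def)
  qed
  show ?thesis
    by (rule automorphism_extends[OF _ _ b, of A]) (use good_A B in \<open>auto simp: normal_over_def\<close>)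
qed

end

section \<open>Prime models and the minimal closure\<close>

lemma elementary_substructure_sat:
  assumes "elementary_substructure L S M" "set b \<subseteq> M" "wff L (length b) \<phi>"
  shows "sat (substruct S M) b \<phi> \<longleftrightarrow> sat S b \<phi>"
  using assms unfolding elementary_substructure_def elementary_map_def by (metis list.map_ident select_convs(1) surjective update_convs(1))

lemma elementary_embedding_map:
  assumes M: "elementary_substructure L S M" and N: "elementary_substructure L S N"
    and MU: "M \<subseteq> univ S" and NU: "N \<subseteq> univ S"
  shows "elementary_embedding L (substruct S M) (substruct S N) g \<longleftrightarrow>
    elementary_map L S S M g \<and> g ` M \<subseteq> N" (is "?l \<longleftrightarrow> ?r")
proof -
  have sat: "(sat (substruct S M) b \<phi> \<longleftrightarrow> sat (substruct S N) (map g b) \<phi>) \<longleftrightarrow> (sat S b \<phi> \<longleftrightarrow> sat S (map g b) \<phi>)"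
    if "g ` M \<subseteq> N" "set b \<subseteq> M" "wff L (length b) \<phi>" for b \<phi>
  proof -
    have "set (map g b) \<subseteq> N" "wff L (length (map g b)) \<phi>" using that by auto
    then show ?thesis
      using elementary_substructure_sat[OF M that(2,3)] elementary_substructure_sat[OF N, of "map g b" \<phi>] by simp
  qed
  show ?thesis
  proof
    assume ?l
    then have *: "g ` M \<subseteq> N" "\<And>b \<phi>. set b \<subseteq> M \<Longrightarrow> wff L (length b) \<phi> \<Longrightarrow>
      (sat (substruct S M) b \<phi> \<longleftrightarrow> sat (substruct S N) (map g b) \<phi>)"
      unfolding elementary_embedding_def elementary_map_def by auto
    then show ?r using sat MU NU unfolding elementary_map_def by blast
  next
    assume ?r
    then have "g ` M \<subseteq> N" "\<And>b \<phi>. set b \<subseteq> M \<Longrightarrow> wff L (length b) \<phi> \<Longrightarrow> (sat S b \<phi> \<longleftrightarrow> sat S (map g b) \<phi>)"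
      unfolding elementary_map_def by auto
    then show ?l using sat unfolding elementary_embedding_def elementary_map_def by simp
  qed
qed

lemma elementary_map_type:
  "elementary_map L S S M g \<Longrightarrow> set b \<subseteq> M \<Longrightarrow> same_type L S {} b (map g b)"
  using elementary_map_same_type[of L S M g b "{}"] by simp

lemma elementary_map_dfn_iff:
  "elementary_map L S S M g \<Longrightarrow> set b \<subseteq> M \<Longrightarrow> definable L S {} n X \<Longrightarrow> length b = n \<Longrightarrow>
    b \<in> X \<longleftrightarrow> map g b \<in> X"
  using same_type_iff[OF elementary_map_type] by blast

context monster
begin

lemma elementary_map_meets_definable:
  assumes M: "meets_definable M" and g: "elementary_map L S S M g"
  shows "meets_definable (g ` M)"
proof -
  have MU: "M \<subseteq> U" and gU: "g ` M \<subseteq> U" using meets_definable_subset[OF M] g by (auto simp: elementary_map_def)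
  have "\<exists>x\<in>X. set x \<subseteq> g ` M" if X: "dfn (g ` M) n X" "X \<noteq> {}" for n X
  proof -
    have "{} \<union> g ` M \<subseteq> U" "dfn ({} \<union> g ` M) n X" using gU X by auto
    from definable_params[OF this(2,1)] obtain c \<Phi> where c: "set c \<subseteq> g ` M"
      and \<Phi>: "dfn {} (n + length c) \<Phi>" "\<And>x. x \<in> tuples n U \<Longrightarrow> x \<in> X \<longleftrightarrow> x @ c \<in> \<Phi>" by blast
    have "c \<in> lists (g ` M)" using c by (simp add: in_lists_conv_set subset_iff)
    then obtain d where d: "set d \<subseteq> M" "c = map g d" unfolding lists_image by (auto simp: in_lists_conv_set)
    define l where "l = length d"
    have \<Phi>': "dfn {} (n + l) \<Phi>" using \<Phi> d by (simp add: l_def)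
    define Q where "Q = {z\<in>tuples l U. \<exists>x\<in>tuples n U. x @ z \<in> \<Phi>}"
    have dQ: "dfn {} l Q" unfolding Q_def
      by (rule definable_Collect) (rule defintros defpred_mem[OF _ \<Phi>'] definable_UNIV empty_subsetI refl)+
    obtain x where x: "x \<in> X" using X by blast
    then have "x \<in> tuples n U" using definable_subset[OF X(1)] by blast
    then have "map g d \<in> Q" using x \<Phi>(2)[of x] c gU d by (auto simp: Q_def tuples_def l_def)
    then have "d \<in> Q" using elementary_map_dfn_iff[OF g d(1) dQ] by (simp add: l_def)
    then have ne: "{x\<in>tuples n U. x @ d \<in> \<Phi>} \<noteq> {}" by (auto simp: Q_def)
    have "dfn M n {x\<in>tuples n U. x @ d \<in> \<Phi>}"
      by (rule definable_fiber[of L S "{}"]) (use \<Phi>' d MU in \<open>auto simp: l_def\<close>)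
    from meets_definable_point[OF M this order_refl ne]
    obtain y where "y \<in> {x\<in>tuples n U. x @ d \<in> \<Phi>}" "set y \<subseteq> M" .
    then have y: "y \<in> tuples n U" "y @ d \<in> \<Phi>" "set y \<subseteq> M" by simp_all
    have gy: "map g y \<in> tuples n U" "set (map g y) \<subseteq> g ` M" using y gU by (auto simp: tuples_def)
    have "map g (y @ d) \<in> \<Phi>"
      using elementary_map_dfn_iff[OF g, of "y @ d"] \<Phi>' y d by (simp add: tuples_def l_def)
    then have "map g y \<in> X" using \<Phi>(2)[OF gy(1)] d by simp
    then show ?thesis using gy by blast
  qed
  then show ?thesis using gU by (simp add: meets_definable_def)
qed

lemma meets_definable_dcl:
  assumes "meets_definable M" "dfn M n {x}"
  shows "set x \<subseteq> M"
  using meets_definable_point[OF assms order_refl] by blast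

end

locale prime_model = monster L T \<kappa> S
  for L :: "('f, 'r) lang" and T :: "('f, 'r) fm set" and \<kappa> :: "'k rel"
    and S :: "('f, 'r, 'm) struct" +
  fixes A M :: "'m set"
  assumes elemM: "elementary_substructure L S M" and prime: "prime_over L (substruct S M) A"
begin

lemma tvM: "meets_definable M" and MU: "M \<subseteq> U" and AM: "A \<subseteq> M" and AU: "A \<subseteq> U"
proof -
  show tv: "meets_definable M" using elementary_meets_definable[OF elemM] .
  show "M \<subseteq> U" using meets_definable_subset[OF tv] .
  show "A \<subseteq> M" using prime by (simp add: prime_over_def)
  then show "A \<subseteq> U" using \<open>M \<subseteq> U\<close> by blast
qed

lemma embeds_in_constructible:
  "\<exists>N s g. constructible_submodel L T \<kappa> S A N s (g ` M) \<and> elementary_map L S S M g \<and> (\<forall>a\<in>A. g a = a)"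
proof -
  obtain N s where N: "construction A N s" "elementary_substructure L S N"
    using constructible_model_exists[OF AU] by blast
  have NU: "N \<subseteq> U" and AN: "A \<subseteq> N" using N by (auto simp: construction_def)
  have "structure_of L (substruct S N)" using N(2) by (simp add: elementary_substructure_def)
  moreover have "elementary_map L (substruct S M) (substruct S N) A (\<lambda>x. x)"
    unfolding elementary_map_def
    using AM AN elementary_substructure_sat[OF elemM] elementary_substructure_sat[OF N(2)] by auto
  ultimately obtain g where "elementary_embedding L (substruct S M) (substruct S N) g" "\<forall>a\<in>A. g a = a"
    using prime unfolding prime_over_def by blast
  then have g: "elementary_map L S S M g" "g ` M \<subseteq> N" "\<forall>a\<in>A. g a = a"
    using elementary_embedding_map[OF elemM N(2) MU NU] by auto
  have "constructible_submodel L T \<kappa> S A N s (g ` M)"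
  proof
    show "construction A N s" "g ` M \<subseteq> N" by fact+
    show "A \<subseteq> g ` M" using g(3) AM by (metis image_iff subset_iff)
    show "meets_definable (g ` M)" by (rule elementary_map_meets_definable[OF tvM g(1)])
  qed
  then show ?thesis using g by blast
qed

lemma elementary_map_inj:
  assumes g: "elementary_map L S S M g" and xy: "x \<in> M" "y \<in> M" "g x = g y"
  shows "x = y"
proof -
  have "same_type L S {} [g x, g y] [x, y]"
    using elementary_map_type[OF g, of "[x, y]"] xy same_type_sym by fastforce
  from same_type_eq_nth[OF this, of 0 1] show ?thesis using xy by simp
qed

lemma normal_image:
  assumes g: "elementary_map L S S M g" "\<forall>a\<in>A. g a = a" and B: "normal_over L S A M B"
  shows "normal_over L S A (g ` M) (g ` B)"
proof -
  have AB: "A \<subseteq> B" and BM: "B \<subseteq> M" using B by (auto simp: normal_over_def)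
  have st: "same_type L S A [x] [g x]" if "x \<in> M" for x
    using elementary_map_same_type[OF g(1), of "[x]" A] g(2) AM that by simp
  have "g y \<in> g ` B" if "x \<in> B" "y \<in> M" "same_type L S A [g x] [g y]" for x y
  proof -
    have "same_type L S A [x] [y]"
      using st[of x] st[of y] that BM same_type_trans same_type_sym by (metis subsetD)
    then show ?thesis using B that by (auto simp: normal_over_def)
  qed
  moreover have "A \<subseteq> g ` B" using AB g(2) by (metis image_iff subset_iff)
  ultimately show ?thesis using BM unfolding normal_over_def by blast
qed

lemma params_over:
  assumes "dfn B n X" "B \<subseteq> U"
  obtains c \<Phi> where "set c \<subseteq> B" "dfn {} (n + length c) \<Phi>" "\<And>x. x \<in> tuples n U \<Longrightarrow> x \<in> X \<longleftrightarrow> x @ c \<in> \<Phi>"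
proof -
  have "dfn ({} \<union> B) n X" "{} \<union> B \<subseteq> U" using assms by auto
  from definable_params[OF this] show ?thesis using that by blast
qed

text \<open>Isolation is pulled back along the embedding \<open>g\<close>. The isolating set has
  parameters in the image of \<open>B\<close>, and that one formula implies another is a
  parameter-free condition on their parameters, which \<open>g\<close> reflects.\<close>

lemma atomic_over_normal:
  assumes B: "normal_over L S A M B" and m: "set m \<subseteq> M"
  shows "isolated B m"
proof -
  obtain N s g where sub: "constructible_submodel L T \<kappa> S A N s (g ` M)"
    and g: "elementary_map L S S M g" "\<forall>a\<in>A. g a = a" using embeds_in_constructible by blast
  interpret C: constructible_submodel L T \<kappa> S A N s "g ` M" by (rule sub)
  have BM: "B \<subseteq> M" and AB: "A \<subseteq> B" using B by (auto simp: normal_over_def)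
  have BU: "B \<subseteq> U" using BM MU by blast
  have gMU: "g ` M \<subseteq> U" using g(1) by (simp add: elementary_map_def)
  then have gBU: "g ` B \<subseteq> U" using BM by blast
  define n where "n = length m"
  have "isolated (g ` B \<union> (A \<inter> g ` M)) (map g m)"
    by (rule C.good_normal_atomic[OF C.good_A normal_image[OF g B]]) (use m in auto)
  moreover have "A \<subseteq> g ` B" using AB g(2) by (metis image_iff subset_iff)
  then have "g ` B \<union> (A \<inter> g ` M) = g ` B" by blast
  ultimately obtain W where W: "isolates (g ` B) n W (map g m)" by (auto simp: isolated_def n_def)
  obtain c \<Phi> where c: "set c \<subseteq> g ` B" and \<Phi>: "dfn {} (n + length c) \<Phi>"
    and W\<Phi>: "\<And>x. x \<in> tuples n U \<Longrightarrow> x \<in> W \<longleftrightarrow> x @ c \<in> \<Phi>"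
    using params_over[OF isolates_dfn(1)[OF W] gBU] by blast
  have "c \<in> lists (g ` B)" using c by (simp add: in_lists_conv_set subset_iff)
  then obtain d where d: "set d \<subseteq> B" "c = map g d" unfolding lists_image by (auto simp: in_lists_conv_set)
  define l where "l = length d"
  have \<Phi>': "dfn {} (n + l) \<Phi>" using \<Phi> d by (simp add: l_def)
  define V where "V = {x\<in>tuples n U. x @ d \<in> \<Phi>}"
  have mU: "m \<in> tuples n U" "map g m \<in> tuples n U"
    using m MU gMU by (auto simp: n_def tuples_def)
  have dM: "set d \<subseteq> M" using d BM by blast
  have "isolates B n V m" unfolding isolates_def
  proof (intro conjI allI impI)
    show "dfn B n V" unfolding V_def
      by (rule definable_fiber[of L S "{}"]) (use \<Phi>' d BU in \<open>auto simp: l_def\<close>)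
    have "map g m @ map g d \<in> \<Phi>" using W\<Phi>[OF mU(2)] isolates_dfn(2)[OF W] d by simp
    then have "m @ d \<in> \<Phi>" using elementary_map_dfn_iff[OF g(1), of "m @ d"] \<Phi>' m dM by (simp add: n_def l_def)
    then show "m \<in> V" using mU by (simp add: V_def)
    fix Z assume Z: "dfn B n Z" "m \<in> Z"
    obtain u \<Psi> where u: "set u \<subseteq> B" and \<Psi>0: "dfn {} (n + length u) \<Psi>"
      and Z\<Psi>: "\<And>x. x \<in> tuples n U \<Longrightarrow> x \<in> Z \<longleftrightarrow> x @ u \<in> \<Psi>"
      using params_over[OF Z(1) BU] by blast
    define j where "j = length u"
    have \<Psi>: "dfn {} (n + j) \<Psi>" using \<Psi>0 by (simp add: j_def)
    have uM: "set u \<subseteq> M" using u BM by blast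
    define Q where "Q = {w\<in>tuples (l + j) U. \<exists>v\<in>tuples l U. \<exists>v'\<in>tuples j U. w = v @ v' \<and>
      (\<forall>x\<in>tuples n U. x @ v \<in> \<Phi> \<longrightarrow> x @ v' \<in> \<Psi>)}"
    have inQ: "v @ v' \<in> Q \<longleftrightarrow> (\<forall>x\<in>tuples n U. x @ v \<in> \<Phi> \<longrightarrow> x @ v' \<in> \<Psi>)"
      if "v \<in> tuples l U" "v' \<in> tuples j U" for v v'
      using that by (auto simp: Q_def append_tuples_inject intro!: tuples_append)
    have dQ: "dfn {} (l + j) Q"
      by (rule definable_Collect2[OF _ refl inQ])
        (auto simp: Q_def, (rule defintros defpred_mem[OF _ \<Phi>'] defpred_mem[OF _ \<Psi>] definable_UNIV empty_subsetI refl)+)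
    have tt: "d \<in> tuples l U" "u \<in> tuples j U" "map g d \<in> tuples l U" "map g u \<in> tuples j U"
      using dM uM MU subset_trans[OF image_mono[OF dM] gMU] subset_trans[OF image_mono[OF uM] gMU]
      by (simp_all add: tuples_def l_def j_def)
    have "map g m @ map g u \<in> \<Psi>"
      using elementary_map_dfn_iff[OF g(1), of "m @ u"] \<Psi> m uM Z Z\<Psi>[OF mU(1)] by (simp add: n_def j_def)
    moreover have "dfn (g ` B) n {x\<in>tuples n U. x @ map g u \<in> \<Psi>}"
      by (rule definable_fiber[of L S "{}"]) (use \<Psi> u gBU in \<open>auto simp: j_def\<close>)
    ultimately have "W \<subseteq> {x\<in>tuples n U. x @ map g u \<in> \<Psi>}"
      using isolates_sub[OF W] mU by simp
    then have "map g d @ map g u \<in> Q" using inQ[OF tt(3,4)] W\<Phi> d by auto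
    then have "d @ u \<in> Q" using elementary_map_dfn_iff[OF g(1), of "d @ u" "l + j" Q] dQ dM uM by (simp add: l_def j_def)
    then show "V \<subseteq> Z" using inQ[OF tt(1,2)] Z\<Psi> by (auto simp: V_def)
  qed
  then show ?thesis by (auto simp: isolated_def n_def)
qed

text \<open>Homogeneity is available for the image of \<open>M\<close> under \<open>g\<close> in a
  constructible model. The automorphism found there is conjugated back by \<open>g\<close>.\<close>

theorem homogeneous_over_normal:
  assumes B: "normal_over L S A M B" and b: "set b \<subseteq> M" "set b' \<subseteq> M" "same_type L S B b b'"
  shows "\<exists>\<sigma>\<in>Aut L S M B. map \<sigma> b = b'"
proof -
  obtain N s g where sub: "constructible_submodel L T \<kappa> S A N s (g ` M)"
    and g: "elementary_map L S S M g" "\<forall>a\<in>A. g a = a" using embeds_in_constructible by blast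
  interpret C: constructible_submodel L T \<kappa> S A N s "g ` M" by (rule sub)
  have BM: "B \<subseteq> M" and BU: "B \<subseteq> U" using B MU by (auto simp: normal_over_def)
  have gMU: "g ` M \<subseteq> U" using g(1) by (simp add: elementary_map_def)
  then have gBU: "g ` B \<subseteq> U" using BM by blast
  have len: "length b' = length b" using same_type_tuples(1)[OF b(3)] .
  have "same_type L S (g ` B) (map g b) (map g b')" unfolding same_type_def
  proof (intro conjI allI impI)
    show "set (map g b) \<subseteq> U" using b gMU by auto
    fix X assume X: "dfn (g ` B) (length (map g b)) X" "map g b \<in> X"
    obtain c \<Phi> where c: "set c \<subseteq> g ` B" and \<Phi>: "dfn {} (length b + length c) \<Phi>"
      and X\<Phi>: "\<And>x. x \<in> tuples (length b) U \<Longrightarrow> x \<in> X \<longleftrightarrow> x @ c \<in> \<Phi>"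
      using params_over[OF X(1) gBU] by auto
    have "c \<in> lists (g ` B)" using c by (simp add: in_lists_conv_set subset_iff)
    then obtain d where d: "set d \<subseteq> B" "c = map g d" unfolding lists_image by (auto simp: in_lists_conv_set)
    have tt: "map g b \<in> tuples (length b) U" "map g b' \<in> tuples (length b) U" "set d \<subseteq> M"
      using b gMU len d BM by (auto simp: tuples_def)
    have "map g (b @ d) \<in> \<Phi>" using X\<Phi>[OF tt(1)] X d by simp
    then have "b @ d \<in> \<Phi>"
      using elementary_map_dfn_iff[OF g(1), of "b @ d"] \<Phi> b d tt by simp
    moreover have "same_type L S {} (b @ d) (b' @ d)"
      by (rule same_type_append_iff[OF same_type_mono[OF b(3) d(1)]]) (use tt MU in blast)
    ultimately have "b' @ d \<in> \<Phi>" using \<Phi> d by (auto simp: same_type_def)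
    then have "map g (b' @ d) \<in> \<Phi>"
      using elementary_map_dfn_iff[OF g(1), of "b' @ d"] \<Phi> b d tt len by simp
    then show "map g b' \<in> X" using X\<Phi>[OF tt(2)] d by simp
  qed
  then obtain \<sigma>1 where \<sigma>1: "\<sigma>1 \<in> Aut L S (g ` M) (g ` B)" "map \<sigma>1 (map g b) = map g b'"
    using C.homogeneous_over_normal[OF normal_image[OF g B], of "map g b" "map g b'"] b by auto
  define h where "h = inv_into M g"
  have inj: "inj_on g M" using elementary_map_inj[OF g(1)] by (auto intro: inj_onI)
  have h: "h (g x) = x" if "x \<in> M" for x using inj that by (simp add: h_def)
  define \<sigma> where "\<sigma> = (\<lambda>x\<in>M. h (\<sigma>1 (g x)))"
  have gM: "bij_betw g M (g ` M)" using inj by (simp add: bij_betw_def)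
  have s1: "bij_betw \<sigma>1 (g ` M) (g ` M)" using AutD(1)[OF \<sigma>1(1)] .
  have g\<sigma>: "g (\<sigma> x) = \<sigma>1 (g x)" if "x \<in> M" for x
  proof -
    have "\<sigma>1 (g x) \<in> g ` M" using s1 that by (auto simp: bij_betw_def)
    then show ?thesis using that h by (auto simp: \<sigma>_def)
  qed
  have "bij_betw (h \<circ> (\<sigma>1 \<circ> g)) M M"
    using bij_betw_trans[OF bij_betw_trans[OF gM s1] bij_betw_inv_into[OF gM]] by (simp add: h_def)
  then have bij: "bij_betw \<sigma> M M" by (rule bij_betw_cong[THEN iffD1, rotated]) (simp add: \<sigma>_def)
  then have \<sigma>M: "\<sigma> x \<in> M" if "x \<in> M" for x using that by (auto simp: bij_betw_def)
  have "elementary_map L S S M \<sigma>"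
  proof (rule elementary_mapI[OF MU])
    fix c assume c: "set c \<subseteq> M"
    have "same_type L S {} c (map g c)" by (rule elementary_map_type[OF g(1) c])
    moreover have "same_type L S {} (map g c) (map \<sigma>1 (map g c))"
      by (rule elementary_map_type[OF AutD(3)[OF \<sigma>1(1)]]) (use c in auto)
    moreover have "map \<sigma>1 (map g c) = map g (map \<sigma> c)" using g\<sigma> c by auto
    moreover have "same_type L S {} (map g (map \<sigma> c)) (map \<sigma> c)"
      by (rule same_type_sym[OF elementary_map_type[OF g(1)]]) (use c \<sigma>M in auto)
    ultimately show "same_type L S {} c (map \<sigma> c)" using same_type_trans by metis
  qed
  moreover have "\<sigma> a = a" if "a \<in> B" for a
    using AutD(4)[OF \<sigma>1(1), of "g a"] that BM h by (auto simp: \<sigma>_def)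
  ultimately have "\<sigma> \<in> Aut L S M B" using bij by (auto simp: Aut_def Bij_def \<sigma>_def)
  moreover have "map \<sigma> b = b'"
  proof -
    have "map g (map \<sigma> b) = map \<sigma>1 (map g b)" using g\<sigma> b(1) by auto
    from trans[OF this \<sigma>1(2)] have "map g (map \<sigma> b) = map g b'" .
    moreover have "set (map \<sigma> b) \<subseteq> M" using b \<sigma>M by auto
    ultimately show ?thesis using inj b(2) by (metis inj_on_map_eq_map inj_on_subset le_sup_iff)
  qed
  ultimately show ?thesis by blast
qed

lemma normal_A: "normal_over L S A M A"
  unfolding normal_over_def
proof (intro conjI ballI impI)
  fix b b' assume "b \<in> A" "same_type L S A [b] [b']"
  then show "b' \<in> A" using same_type_params[of L S A "[b]" "[b']"] AU by auto
qed (use AM in auto)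

definition embeddings :: "('m \<Rightarrow> 'm) set" where
  "embeddings = {\<gamma>. elementary_map L S S M \<gamma> \<and> \<gamma> ` M \<subseteq> M \<and> (\<forall>a\<in>A. \<gamma> a = a)}"

abbreviation B :: "'m set" where "B \<equiv> mcl L S M A"

lemma mcl_eq: "B = (\<Inter>\<gamma>\<in>embeddings. \<gamma> ` M)"
proof -
  have "{\<gamma> ` M |\<gamma>. elementary_embedding L (substruct S M) (substruct S M) \<gamma> \<and> (\<forall>a\<in>A. \<gamma> a = a)} =
    (\<lambda>\<gamma>. \<gamma> ` M) ` embeddings"
    unfolding elementary_embedding_map[OF elemM elemM MU MU] embeddings_def by auto
  then show ?thesis unfolding mcl_def by simp
qed

lemma embeddings_meets_definable: "\<gamma> \<in> embeddings \<Longrightarrow> meets_definable (\<gamma> ` M)"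
  using elementary_map_meets_definable[OF tvM] by (auto simp: embeddings_def)

lemma mcl_sub_image: "\<gamma> \<in> embeddings \<Longrightarrow> B \<subseteq> \<gamma> ` M"
  by (auto simp: mcl_eq)

lemma embeddings_id: "(\<lambda>x. x) \<in> embeddings"
  unfolding embeddings_def using MU by (auto simp: elementary_map_def)

lemma BM: "B \<subseteq> M" and AB: "A \<subseteq> B" and BU: "B \<subseteq> U"
proof -
  show "B \<subseteq> M" using mcl_sub_image[OF embeddings_id] by simp
  then show "B \<subseteq> U" using MU by blast
  show "A \<subseteq> B" unfolding mcl_eq
  proof (intro INT_greatest subsetI)
    fix \<gamma> a assume "\<gamma> \<in> embeddings" "a \<in> A"
    then show "a \<in> \<gamma> ` M" using AM by (intro image_eqI[of _ _ a]) (auto simp: embeddings_def)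
  qed
qed

text \<open>The image of an embedding satisfies the Tarski-Vaught criterion in the monster, so it
  contains every tuple definable over it. Membership in mcl(A) is thereby reduced to definability
  over each image.\<close>

lemma mclI: "(\<And>\<gamma>. \<gamma> \<in> embeddings \<Longrightarrow> dfn (\<gamma> ` M) n {x}) \<Longrightarrow> set x \<subseteq> B"
  unfolding mcl_eq using meets_definable_dcl embeddings_meets_definable by blast

lemma mcl_dcl: "dfn B n {x} \<Longrightarrow> set x \<subseteq> B"
  using mclI definable_mono mcl_sub_image by metis

lemma Aut_comp_embedding:
  assumes \<sigma>: "\<sigma> \<in> Aut L S M A" and \<gamma>: "\<gamma> \<in> embeddings"
  shows "\<sigma> \<circ> \<gamma> \<in> embeddings"
proof -
  have g: "elementary_map L S S M \<gamma>" "\<gamma> ` M \<subseteq> M" "\<forall>a\<in>A. \<gamma> a = a" using \<gamma> by (auto simp: embeddings_def)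
  have "elementary_map L S S M (\<sigma> \<circ> \<gamma>)"
  proof (rule elementary_mapI[OF MU])
    fix b assume b: "set b \<subseteq> M"
    have "set (map \<gamma> b) \<subseteq> M" using b g(2) by auto
    from same_type_trans[OF elementary_map_type[OF g(1) b] elementary_map_type[OF AutD(3)[OF \<sigma>] this]]
    show "same_type L S {} b (map (\<sigma> \<circ> \<gamma>) b)" by simp
  qed
  moreover have "(\<sigma> \<circ> \<gamma>) ` M \<subseteq> M" using g(2) AutD(1)[OF \<sigma>] by (auto simp: bij_betw_def)
  ultimately show ?thesis using g(3) AutD(4)[OF \<sigma>] by (auto simp: embeddings_def)
qed

text \<open>Homogeneity over \<open>A\<close> gives \<sigma> with \<sigma> b = b'. Composing
  \<gamma> with the inverse of \<sigma> is again an embedding, so \<open>b\<close> lies in its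
  image, and applying \<sigma> puts \<open>b'\<close> into the image of \<gamma>.\<close>

lemma normal_mcl: "normal_over L S A M B"
  unfolding normal_over_def
proof (intro conjI ballI impI)
  show "A \<subseteq> B" "B \<subseteq> M" by (fact AB BM)+
  fix b b' assume b: "b \<in> B" "b' \<in> M" "same_type L S A [b] [b']"
  obtain \<sigma> where \<sigma>: "\<sigma> \<in> Aut L S M A" "\<sigma> b = b'"
    using homogeneous_over_normal[OF normal_A, of "[b]" "[b']"] b BM by auto
  let ?\<tau> = "restrict (inv_into M \<sigma>) M"
  have \<tau>: "?\<tau> \<in> Aut L S M A" by (rule Aut_inverse[OF \<sigma>(1) AM])
  show "b' \<in> B" unfolding mcl_eq
  proof
    fix \<gamma> assume \<gamma>: "\<gamma> \<in> embeddings"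
    then have "b \<in> (?\<tau> \<circ> \<gamma>) ` M" using mcl_sub_image[OF Aut_comp_embedding[OF \<tau> \<gamma>]] b by blast
    then obtain x where x: "x \<in> M" "b = ?\<tau> (\<gamma> x)" by auto
    have "\<gamma> x \<in> M" using \<gamma> x by (auto simp: embeddings_def)
    then have "\<sigma> b = \<gamma> x" using x AutD(1)[OF \<sigma>(1)] by (simp add: bij_betw_def f_inv_into_f)
    then show "b' \<in> \<gamma> ` M" using \<sigma>(2) x by blast
  qed
qed

text \<open>Normality makes both \<sigma> and its inverse map \<open>E\<close> into itself, hence
  \<sigma> maps it onto itself.\<close>

lemma restrict_Aut:
  assumes \<sigma>: "\<sigma> \<in> Aut L S M A" and E: "normal_over L S A M E"
  shows "restrict \<sigma> E \<in> Aut L S E A"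
proof -
  have AE: "A \<subseteq> E" and EM: "E \<subseteq> M" and nE: "\<And>b b'. b \<in> E \<Longrightarrow> b' \<in> M \<Longrightarrow> same_type L S A [b] [b'] \<Longrightarrow> b' \<in> E"
    using E by (auto simp: normal_over_def)
  have sub: "\<tau> b \<in> E" if "\<tau> \<in> Aut L S M A" "b \<in> E" for \<tau> b
    using nE[OF that(2), of "\<tau> b"] Aut_same_type[OF that(1) AM, of "[b]"] Aut_set[OF that(1), of "[b]"] that(2) EM by auto
  have "bij_betw \<sigma> E E"
  proof -
    have bM: "bij_betw \<sigma> M M" using AutD(1)[OF \<sigma>] .
    have "E \<subseteq> \<sigma> ` E"
    proof
      fix b assume b: "b \<in> E"
      let ?x = "restrict (inv_into M \<sigma>) M b"
      have "?x \<in> E" by (rule sub[OF Aut_inverse[OF \<sigma> AM] b])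
      moreover have "\<sigma> ?x = b" using b EM bM by (auto simp: bij_betw_def f_inv_into_f)
      ultimately show "b \<in> \<sigma> ` E" by (metis imageI)
    qed
    then show ?thesis using sub[OF \<sigma>] bM EM by (auto simp: bij_betw_def intro: inj_on_subset)
  qed
  then have "bij_betw (restrict \<sigma> E) E E" by (rule bij_betw_cong[THEN iffD1, rotated]) simp
  moreover have "elementary_map L S S E (restrict \<sigma> E)"
  proof (rule elementary_mapI)
    show "E \<subseteq> U" using EM MU by blast
    fix b assume b: "set b \<subseteq> E"
    then have eq: "map (restrict \<sigma> E) b = map \<sigma> b" by auto
    have "same_type L S {} b (map \<sigma> b)"
      by (rule elementary_map_type[OF AutD(3)[OF \<sigma>]]) (use b EM in blast)
    then show "same_type L S {} b (map (restrict \<sigma> E) b)" unfolding eq .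
  qed
  ultimately show ?thesis using AE AutD(4)[OF \<sigma>] by (auto simp: Aut_def Bij_def)
qed

end

section \<open>Elimination of imaginaries\<close>

context monster
begin

text \<open>
  The parameters \<open>u\<close> of \<open>R\<close> become part of the
  tuples on which the \<open>\<emptyset>\<close>-definable equivalence relation \<open>\<epsilon>\<close> lives.
\<close>

lemma definable_quotient:
  assumes E: "E \<subseteq> U" and \<Theta>: "isolates E k \<Theta> b" and R: "dfn E (k + k) R"
    and R\<Theta>: "\<And>c c'. c \<in> tuples k U \<Longrightarrow> c' \<in> tuples k U \<Longrightarrow> c @ c' \<in> R \<Longrightarrow> c \<in> \<Theta> \<and> c' \<in> \<Theta>"
    and refl_R: "\<And>c. c \<in> \<Theta> \<Longrightarrow> c @ c \<in> R"
    and sym_R: "\<And>c c'. c \<in> \<Theta> \<Longrightarrow> c' \<in> \<Theta> \<Longrightarrow> c @ c' \<in> R \<Longrightarrow> c' @ c \<in> R"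
    and trans_R: "\<And>c c' c''. c \<in> \<Theta> \<Longrightarrow> c' \<in> \<Theta> \<Longrightarrow> c'' \<in> \<Theta> \<Longrightarrow> c @ c' \<in> R \<Longrightarrow> c' @ c'' \<in> R \<Longrightarrow> c @ c'' \<in> R"
  shows "\<exists>l F. dfn E (k + l) F \<and> (\<forall>c\<in>\<Theta>. \<exists>!e. e \<in> tuples l U \<and> c @ e \<in> F) \<and>
    (\<forall>c\<in>\<Theta>. \<forall>c'\<in>\<Theta>. \<forall>e\<in>tuples l U. c @ e \<in> F \<longrightarrow> (c' @ e \<in> F \<longleftrightarrow> c @ c' \<in> R))"
proof -
  have \<Theta>k: "c \<in> tuples k U" if "c \<in> \<Theta>" for c using definable_subset[OF isolates_dfn(1)[OF \<Theta>]] that by blast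
  have "{} \<union> E \<subseteq> U" "dfn ({} \<union> E) (k + k) R" using E R by auto
  from definable_params[OF this(2,1)] obtain u R0 where u: "set u \<subseteq> E"
    and R00: "dfn {} (k + k + length u) R0" and RR0: "\<And>w. w \<in> tuples (k + k) U \<Longrightarrow> w \<in> R \<longleftrightarrow> w @ u \<in> R0"
    by blast
  define s where "s = length u"
  have uU: "u \<in> tuples s U" using u E by (auto simp: tuples_def s_def)
  have R0: "dfn {} (k + (k + s)) R0" using R00 by (simp add: s_def add.assoc)
  have RR: "c @ c' \<in> R \<longleftrightarrow> c @ c' @ u \<in> R0" if "c \<in> tuples k U" "c' \<in> tuples k U" for c c'
    using RR0[of "c @ c'"] that by (simp add: tuples_append)
  \<comment> \<open>For other values \<open>v\<close> of the parameters the relation may fail to be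
    symmetric or transitive. Where \<open>ok v\<close> fails it is replaced by equality, and tuples
    with different parameters are never identified; so \<epsilon> is an equivalence relation on all
    tuples.\<close>
  define ok where "ok v \<longleftrightarrow> (\<forall>c\<in>tuples k U. \<forall>c'\<in>tuples k U. c @ c' @ v \<in> R0 \<longrightarrow> c' @ c @ v \<in> R0) \<and>
    (\<forall>c\<in>tuples k U. \<forall>c'\<in>tuples k U. \<forall>c''\<in>tuples k U.
      c @ c' @ v \<in> R0 \<and> c' @ c'' @ v \<in> R0 \<longrightarrow> c @ c'' @ v \<in> R0)" for v
  define eqv where "eqv c v c' v' \<longleftrightarrow> (c = c' \<and> v = v') \<or> (v = v' \<and> ok v \<and> c @ c' @ v \<in> R0)" for c v c' v'
  define m where "m = k + s"
  define \<epsilon> where "\<epsilon> = {w\<in>tuples (m + m) U. \<exists>c\<in>tuples k U. \<exists>v\<in>tuples s U. \<exists>c'\<in>tuples k U. \<exists>v'\<in>tuples s U.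
    w = c @ v @ c' @ v' \<and> eqv c v c' v'}"
  have in\<epsilon>: "c @ v @ c' @ v' \<in> \<epsilon> \<longleftrightarrow> eqv c v c' v'"
    if "c \<in> tuples k U" "v \<in> tuples s U" "c' \<in> tuples k U" "v' \<in> tuples s U" for c v c' v'
  proof -
    have "c @ v @ c' @ v' \<in> tuples (m + m) U" using that by (auto simp: tuples_def m_def)
    then show ?thesis using that by (auto simp: \<epsilon>_def append_tuples_inject)
  qed
  have d\<epsilon>: "dfn {} (m + m) \<epsilon>"
    by (rule definable_Collect4[OF _ _ in\<epsilon>])
      (auto simp: \<epsilon>_def m_def, (unfold eqv_def ok_def, (rule defintros defpred_mem[OF _ R0] defpred_eq
        definable_UNIV empty_subsetI refl)+)?)
  from d\<epsilon> obtain \<phi> where \<phi>: "wff L (m + m) \<phi>" and \<epsilon>\<phi>: "\<epsilon> = {x\<in>tuples (m + m) U. sat S x \<phi>}"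
    by (auto elim!: definableE)
  define r where "r = {(x, y). x \<in> tuples m U \<and> y \<in> tuples m U \<and> sat S (x @ y) \<phi>}"
  have r: "(x, y) \<in> r \<longleftrightarrow> x @ y \<in> \<epsilon>" if "x \<in> tuples m U" "y \<in> tuples m U" for x y
    using that by (auto simp: r_def \<epsilon>\<phi> tuples_append)
  have split: "\<exists>c\<in>tuples k U. \<exists>v\<in>tuples s U. x = c @ v" if "x \<in> tuples m U" for x
    using that unfolding m_def by (elim tuples_add_cases) blast
  have join: "c @ v \<in> tuples m U" if "c \<in> tuples k U" "v \<in> tuples s U" for c v
    using that by (auto simp: m_def tuples_append)
  have reqv: "(c @ v, c' @ v') \<in> r \<longleftrightarrow> eqv c v c' v'"
    if "c \<in> tuples k U" "v \<in> tuples s U" "c' \<in> tuples k U" "v' \<in> tuples s U" for c v c' v'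
    using r[OF join[OF that(1,2)] join[OF that(3,4)]] in\<epsilon>[OF that] by simp
  have equiv: "equiv (tuples m U) r"
  proof (rule equivI)
    show "r \<subseteq> tuples m U \<times> tuples m U" by (auto simp: r_def)
    show "refl_on (tuples m U) r"
    proof (rule refl_onI)
      fix x assume "x \<in> tuples m U"
      then obtain c v where "c \<in> tuples k U" "v \<in> tuples s U" "x = c @ v" using split by blast
      then show "(x, x) \<in> r" using reqv by (simp add: eqv_def)
    qed
    show "sym r"
    proof (rule symI)
      fix x y assume xy: "(x, y) \<in> r"
      then obtain c v c' v' where *: "c \<in> tuples k U" "v \<in> tuples s U" "x = c @ v"
        "c' \<in> tuples k U" "v' \<in> tuples s U" "y = c' @ v'" using split[of x] split[of y] by (auto simp: r_def)
      then have "eqv c v c' v'" using xy reqv by simp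
      then have "eqv c' v' c v" using * unfolding eqv_def ok_def by blast
      then show "(y, x) \<in> r" using * reqv by simp
    qed
    show "trans r"
    proof (rule transI)
      fix x y z assume xyz: "(x, y) \<in> r" "(y, z) \<in> r"
      then obtain c v c' v' c'' v'' where *: "c \<in> tuples k U" "v \<in> tuples s U" "x = c @ v"
        "c' \<in> tuples k U" "v' \<in> tuples s U" "y = c' @ v'" "c'' \<in> tuples k U" "v'' \<in> tuples s U" "z = c'' @ v''"
        using split[of x] split[of y] split[of z] by (auto simp: r_def)
      then have e: "eqv c v c' v'" "eqv c' v' c'' v''" using xyz reqv by simp_all
      have "eqv c v c'' v''"
      proof (cases "c = c' \<or> c' = c''")
        case False
        then have "v = v'" "v' = v''" "ok v" "c @ c' @ v \<in> R0" "c' @ c'' @ v \<in> R0" using e by (auto simp: eqv_def)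
        then show ?thesis using * unfolding eqv_def ok_def by blast
      qed (use e in \<open>auto simp: eqv_def\<close>)
      then show "(x, z) \<in> r" using * reqv by simp
    qed
  qed
  have b\<Theta>: "b \<in> \<Theta>" using isolates_dfn(2)[OF \<Theta>] .
  define a where "a = b @ u"
  have a: "a \<in> tuples m U" using join[OF \<Theta>k[OF b\<Theta>] uU] by (simp add: a_def)
  obtain l \<psi> where \<psi>: "wff L (m + l) \<psi>" and ex: "\<exists>!e. e \<in> tuples l U \<and>
    {x\<in>tuples m U. sat S (x @ e) \<psi>} = {x\<in>tuples m U. sat S (a @ x) \<phi>}"
    using eliminates_imaginaries model \<phi> equiv[unfolded r_def] a
    unfolding eliminates_imaginaries_def by meson
  define \<Psi> where "\<Psi> = {w\<in>tuples (m + l) U. sat S w \<psi>}"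
  have "dfn {} (m + l) \<Psi>" by (rule definableI[where \<phi> = \<psi> and c = "[]"]) (use \<psi> in \<open>auto simp: \<Psi>_def\<close>)
  then have d\<Psi>: "dfn E (m + l) \<Psi>" using definable_mono by blast
  have d\<epsilon>E: "dfn E (m + m) \<epsilon>" using definable_mono[OF d\<epsilon>] by blast
  define F where "F = {w\<in>tuples (k + l) U. \<exists>c\<in>tuples k U. \<exists>e\<in>tuples l U. w = c @ e \<and>
    (\<forall>x\<in>tuples m U. x @ e \<in> \<Psi> \<longleftrightarrow> c @ u @ x \<in> \<epsilon>)}"
  have inF: "c @ e \<in> F \<longleftrightarrow> (\<forall>x\<in>tuples m U. x @ e \<in> \<Psi> \<longleftrightarrow> c @ u @ x \<in> \<epsilon>)"
    if "c \<in> tuples k U" "e \<in> tuples l U" for c e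
    using that by (auto simp: F_def append_tuples_inject tuples_append)
  have dF: "dfn E (k + l) F"
    by (rule definable_Collect2[OF _ refl inF])
      (auto simp: F_def, (rule defintros defpred_mem[OF _ d\<Psi>] defpred_mem[OF _ d\<epsilon>E] definable_UNIV E u refl
        | simp add: m_def s_def)+)
  have FF: "c @ e \<in> F \<longleftrightarrow> {x\<in>tuples m U. sat S (x @ e) \<psi>} = {x\<in>tuples m U. (c @ u, x) \<in> r}"
    if "c \<in> tuples k U" "e \<in> tuples l U" for c e
  proof -
    have "x @ e \<in> \<Psi> \<longleftrightarrow> sat S (x @ e) \<psi>" if "x \<in> tuples m U" for x
      using that \<open>e \<in> tuples l U\<close> by (simp add: \<Psi>_def tuples_append)
    moreover have "c @ u @ x \<in> \<epsilon> \<longleftrightarrow> (c @ u, x) \<in> r" if "x \<in> tuples m U" for x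
      using r[OF join[OF \<open>c \<in> tuples k U\<close> uU] that] by simp
    ultimately show ?thesis using inF[OF that] by auto
  qed
  \<comment> \<open>Elimination of imaginaries yields the length \<open>l\<close> and the formula
    \<psi> for the class of \<open>b\<close> only. Having exactly one code is a property over
    \<open>E\<close>, so it passes from \<open>b\<close> to all of \<Theta>.\<close>
  define V where "V = {c\<in>tuples k U. \<exists>e\<in>tuples l U. c @ e \<in> F \<and> (\<forall>e'\<in>tuples l U. c @ e' \<in> F \<longrightarrow> e' = e)}"
  have dV: "dfn E k V" unfolding V_def
    by (rule definable_Collect) (rule defintros defpred_mem[OF _ dF] defpred_eq definable_UNIV E refl)+
  have "{x\<in>tuples m U. sat S (a @ x) \<phi>} = {x\<in>tuples m U. (b @ u, x) \<in> r}"
    using a by (auto simp: r_def a_def)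
  then have "\<exists>!e. e \<in> tuples l U \<and> b @ e \<in> F" using ex FF[OF \<Theta>k[OF b\<Theta>]] by (metis (no_types, lifting))
  then have "b \<in> V" using \<Theta>k[OF b\<Theta>] by (auto simp: V_def)
  then have \<Theta>V: "\<Theta> \<subseteq> V" by (rule isolates_sub[OF \<Theta> dV])
  have oku: "ok u" unfolding ok_def
  proof (intro conjI ballI impI)
    fix c c' assume c: "c \<in> tuples k U" "c' \<in> tuples k U" "c @ c' @ u \<in> R0"
    then have "c @ c' \<in> R" using RR by blast
    then have "c' @ c \<in> R" using sym_R R\<Theta> c by blast
    then show "c' @ c @ u \<in> R0" using RR c by blast
  next
    fix c c' c'' assume c: "c \<in> tuples k U" "c' \<in> tuples k U" "c'' \<in> tuples k U"
      "c @ c' @ u \<in> R0 \<and> c' @ c'' @ u \<in> R0"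
    then have R2: "c @ c' \<in> R" "c' @ c'' \<in> R" using RR by blast+
    then have "c \<in> \<Theta>" "c' \<in> \<Theta>" "c'' \<in> \<Theta>" using R\<Theta> c by blast+
    then have "c @ c'' \<in> R" using trans_R R2 by blast
    then show "c @ c'' @ u \<in> R0" using RR c by blast
  qed
  have "\<exists>!e. e \<in> tuples l U \<and> c @ e \<in> F" if "c \<in> \<Theta>" for c
    using subsetD[OF \<Theta>V that] unfolding V_def by blast
  moreover have "c' @ e \<in> F \<longleftrightarrow> c @ c' \<in> R" if c: "c \<in> \<Theta>" "c' \<in> \<Theta>" "e \<in> tuples l U" "c @ e \<in> F" for c c' e
  proof -
    note ck = \<Theta>k[OF c(1)] \<Theta>k[OF c(2)]
    have "c' @ e \<in> F \<longleftrightarrow> {x\<in>tuples m U. (c @ u, x) \<in> r} = {x\<in>tuples m U. (c' @ u, x) \<in> r}"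
      using FF[OF ck(1) c(3)] FF[OF ck(2) c(3)] c(4) by simp
    also have "\<dots> \<longleftrightarrow> r `` {c @ u} = r `` {c' @ u}" by (auto simp: r_def)
    also have "\<dots> \<longleftrightarrow> (c @ u, c' @ u) \<in> r"
      using eq_equiv_class_iff[OF equiv join[OF ck(1) uU] join[OF ck(2) uU]] .
    also have "\<dots> \<longleftrightarrow> c @ c' \<in> R"
      using reqv[OF ck(1) uU ck(2) uU] RR[OF ck] oku refl_R[OF c(1)] by (auto simp: eqv_def)
    finally show ?thesis .
  qed
  ultimately show ?thesis using dF by blast
qed

end

section \<open>Definable cocycles\<close>

locale prime_model_group = prime_model L T \<kappa> S A M
  for L :: "('f, 'r) lang" and T :: "('f, 'r) fm set" and \<kappa> :: "'k rel"
    and S :: "('f, 'r, 'm) struct" and A M :: "'m set" +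
  fixes n :: nat and G :: "'m list monoid"
  assumes definable_group: "definable_group L S A n G"
    and points: "points_in (carrier G) M = points_in (carrier G) (mcl L S M A)"
begin

lemma group_G: "group G" and dfn_carrier: "dfn A n (carrier G)"
  using definable_group by (auto simp: definable_group_def)

interpretation G: group G by (rule group_G)

abbreviation \<Gamma> :: "'m list set" where "\<Gamma> \<equiv> carrier G"

definition Mul :: "'m list set" where
  "Mul = {x @ y @ (x \<otimes>\<^bsub>G\<^esub> y) |x y. x \<in> \<Gamma> \<and> y \<in> \<Gamma>}"

lemma dfn_Mul: "dfn A (n + n + n) Mul"
  using definable_group by (simp add: definable_group_def Mul_def)

lemma carrier_tuples: "x \<in> \<Gamma> \<Longrightarrow> x \<in> tuples n U"
  using definable_subset[OF dfn_carrier] by blast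

lemma in_Mul:
  assumes "x \<in> tuples n U" "y \<in> tuples n U"
  shows "x @ y @ z \<in> Mul \<longleftrightarrow> x \<in> \<Gamma> \<and> y \<in> \<Gamma> \<and> z = x \<otimes>\<^bsub>G\<^esub> y"
proof
  assume "x @ y @ z \<in> Mul"
  then obtain x' y' where x': "x @ y @ z = x' @ y' @ (x' \<otimes>\<^bsub>G\<^esub> y')" "x' \<in> \<Gamma>" "y' \<in> \<Gamma>" by (auto simp: Mul_def)
  then have "x = x'" "y = y'" "z = x' \<otimes>\<^bsub>G\<^esub> y'"
    using assms carrier_tuples[of x'] carrier_tuples[of y'] by (auto simp: append_tuples_inject)
  then show "x \<in> \<Gamma> \<and> y \<in> \<Gamma> \<and> z = x \<otimes>\<^bsub>G\<^esub> y" using x' by simp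
qed (auto simp: Mul_def)

lemma one_iff: "x \<in> tuples n U \<Longrightarrow> x @ x @ x \<in> Mul \<longleftrightarrow> x = \<one>\<^bsub>G\<^esub>"
  using in_Mul[of x x x] G.r_cancel_one[of x x] by auto

text \<open>The common feature of \<open>M\<close> and mcl(A) that lets the points of the group over
  either set be treated alike: they form a subgroup on which the automorphisms act.\<close>

definition dcl_closed :: "'m set \<Rightarrow> bool" where
  "dcl_closed K \<longleftrightarrow> A \<subseteq> K \<and> K \<subseteq> U \<and> (\<forall>k x. dfn K k {x} \<longrightarrow> set x \<subseteq> K)"

lemma dcl_closed_M: "dcl_closed M"
  using AM MU meets_definable_dcl[OF tvM] by (auto simp: dcl_closed_def)

lemma dcl_closed_mcl: "dcl_closed B"
  using AB BU mcl_dcl by (auto simp: dcl_closed_def)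

lemma dcl_closedD: "dcl_closed K \<Longrightarrow> dfn K k {x} \<Longrightarrow> set x \<subseteq> K"
  by (auto simp: dcl_closed_def)

lemma dfn_Mul_over: "dcl_closed K \<Longrightarrow> dfn K (n + n + n) Mul"
  using definable_mono[OF dfn_Mul] by (auto simp: dcl_closed_def)

lemma one_points:
  assumes K: "dcl_closed K"
  shows "\<one>\<^bsub>G\<^esub> \<in> points_in \<Gamma> K"
proof -
  have KU: "K \<subseteq> U" using K by (simp add: dcl_closed_def)
  have "dfn K n {x\<in>tuples n U. x @ x @ x \<in> Mul}"
    by (rule definable_Collect) (rule defintros defpred_mem[OF _ dfn_Mul_over[OF K]] KU | simp)+
  moreover have "{x\<in>tuples n U. x @ x @ x \<in> Mul} = {\<one>\<^bsub>G\<^esub>}"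
    using one_iff carrier_tuples[OF G.one_closed] by blast
  ultimately show ?thesis using dcl_closedD[OF K] by (auto simp: points_in_def)
qed

lemma mult_points:
  assumes K: "dcl_closed K" and x: "x \<in> points_in \<Gamma> K" and y: "y \<in> points_in \<Gamma> K"
  shows "x \<otimes>\<^bsub>G\<^esub> y \<in> points_in \<Gamma> K"
proof -
  have KU: "K \<subseteq> U" using K by (simp add: dcl_closed_def)
  have xy: "x \<in> \<Gamma>" "y \<in> \<Gamma>" "set x \<subseteq> K" "set y \<subseteq> K" using x y by (auto simp: points_in_def)
  note t = carrier_tuples[OF xy(1)] carrier_tuples[OF xy(2)]
  have len: "length x = n" "length y = n" using t by (auto simp: tuples_def)
  have "dfn K n {z\<in>tuples n U. x @ y @ z \<in> Mul}"
    by (rule definable_Collect) (rule defintros defpred_mem[OF _ dfn_Mul_over[OF K]] KU xy | simp add: len)+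
  moreover have "{z\<in>tuples n U. x @ y @ z \<in> Mul} = {x \<otimes>\<^bsub>G\<^esub> y}"
    using in_Mul[OF t] xy carrier_tuples[OF G.m_closed[OF xy(1,2)]] by auto
  ultimately show ?thesis using dcl_closedD[OF K] xy by (auto simp: points_in_def)
qed

lemma inv_points:
  assumes K: "dcl_closed K" and x: "x \<in> points_in \<Gamma> K"
  shows "inv\<^bsub>G\<^esub> x \<in> points_in \<Gamma> K"
proof -
  have KU: "K \<subseteq> U" using K by (simp add: dcl_closed_def)
  have xG: "x \<in> \<Gamma>" "set x \<subseteq> K" using x by (auto simp: points_in_def)
  have one: "\<one>\<^bsub>G\<^esub> \<in> \<Gamma>" "set \<one>\<^bsub>G\<^esub> \<subseteq> K" using one_points[OF K] by (auto simp: points_in_def)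
  note t = carrier_tuples[OF xG(1)] carrier_tuples[OF one(1)]
  have len: "length x = n" "length \<one>\<^bsub>G\<^esub> = n" using t by (auto simp: tuples_def)
  have "dfn K n {z\<in>tuples n U. x @ z @ \<one>\<^bsub>G\<^esub> \<in> Mul}"
    by (rule definable_Collect) (rule defintros defpred_mem[OF _ dfn_Mul_over[OF K]] KU xG one | simp add: len)+
  moreover have "x @ z @ \<one>\<^bsub>G\<^esub> \<in> Mul \<longleftrightarrow> z = inv\<^bsub>G\<^esub> x" if "z \<in> tuples n U" for z
    using in_Mul[OF t(1) that] xG G.inv_equality[of x z] G.inv_solve_left'[of z x "\<one>\<^bsub>G\<^esub>"]
    by (metis G.inv_closed G.inv_equality G.inv_inv G.r_inv)
  then have "{z\<in>tuples n U. x @ z @ \<one>\<^bsub>G\<^esub> \<in> Mul} = {inv\<^bsub>G\<^esub> x}"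
    using carrier_tuples[OF G.inv_closed[OF xG(1)]] by auto
  ultimately show ?thesis using dcl_closedD[OF K] xG by (auto simp: points_in_def)
qed

lemma Aut_mono: "E \<subseteq> E' \<Longrightarrow> Aut L S K E' \<subseteq> Aut L S K E"
  by (auto simp: Aut_def)

lemma Aut_points:
  assumes \<sigma>: "\<sigma> \<in> Aut L S K A" and K: "dcl_closed K" and x: "x \<in> points_in \<Gamma> K"
  shows "map \<sigma> x \<in> points_in \<Gamma> K"
proof -
  have AK: "A \<subseteq> K" using K by (simp add: dcl_closed_def)
  have xG: "x \<in> \<Gamma>" "set x \<subseteq> K" using x by (auto simp: points_in_def)
  have "dfn A (length x) \<Gamma>" using dfn_carrier carrier_tuples[OF xG(1)] by (simp add: tuples_def)
  then have "map \<sigma> x \<in> \<Gamma>" using Aut_same_type[OF \<sigma> AK xG(2)] xG(1) by (auto simp: same_type_def)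
  then show ?thesis using Aut_set[OF \<sigma> xG(2)] by (auto simp: points_in_def)
qed

lemma Aut_mult:
  assumes \<sigma>: "\<sigma> \<in> Aut L S K A" and K: "dcl_closed K" and x: "x \<in> points_in \<Gamma> K" and y: "y \<in> points_in \<Gamma> K"
  shows "map \<sigma> (x \<otimes>\<^bsub>G\<^esub> y) = map \<sigma> x \<otimes>\<^bsub>G\<^esub> map \<sigma> y"
proof -
  have AK: "A \<subseteq> K" using K by (simp add: dcl_closed_def)
  define z where "z = x \<otimes>\<^bsub>G\<^esub> y"
  have z: "z \<in> points_in \<Gamma> K" unfolding z_def by (rule mult_points[OF K x y])
  have sub: "set (x @ y @ z) \<subseteq> K" using x y z by (auto simp: points_in_def)
  have t: "x \<in> tuples n U" "y \<in> tuples n U" "z \<in> tuples n U" "map \<sigma> x \<in> tuples n U" "map \<sigma> y \<in> tuples n U"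
    using x y z Aut_points[OF \<sigma> K x] Aut_points[OF \<sigma> K y] by (auto simp: points_in_def intro: carrier_tuples)
  have "dfn A (length (x @ y @ z)) Mul" using dfn_Mul t by (simp add: tuples_def add.assoc)
  moreover have "x @ y @ z \<in> Mul" using in_Mul[OF t(1,2)] x y by (simp add: z_def points_in_def)
  ultimately have "map \<sigma> (x @ y @ z) \<in> Mul" using Aut_same_type[OF \<sigma> AK sub] by (auto simp: same_type_def)
  then show ?thesis using in_Mul[OF t(4,5)] by (simp add: z_def)
qed

lemma Aut_one:
  assumes \<sigma>: "\<sigma> \<in> Aut L S K A" and K: "dcl_closed K"
  shows "map \<sigma> \<one>\<^bsub>G\<^esub> = \<one>\<^bsub>G\<^esub>"
proof -
  note one = one_points[OF K]
  have "map \<sigma> \<one>\<^bsub>G\<^esub> \<in> \<Gamma>" using Aut_points[OF \<sigma> K one] by (simp add: points_in_def)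
  moreover have "map \<sigma> \<one>\<^bsub>G\<^esub> \<otimes>\<^bsub>G\<^esub> map \<sigma> \<one>\<^bsub>G\<^esub> = map \<sigma> \<one>\<^bsub>G\<^esub>" using Aut_mult[OF \<sigma> K one one] by simp
  ultimately show ?thesis by simp
qed

lemma Aut_inv:
  assumes \<sigma>: "\<sigma> \<in> Aut L S K A" and K: "dcl_closed K" and x: "x \<in> points_in \<Gamma> K"
  shows "map \<sigma> (inv\<^bsub>G\<^esub> x) = inv\<^bsub>G\<^esub> (map \<sigma> x)"
proof -
  note i = inv_points[OF K x]
  have in_G: "map \<sigma> x \<in> \<Gamma>" "map \<sigma> (inv\<^bsub>G\<^esub> x) \<in> \<Gamma>" "x \<in> \<Gamma>"
    using Aut_points[OF \<sigma> K x] Aut_points[OF \<sigma> K i] x by (auto simp: points_in_def)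
  have "map \<sigma> (inv\<^bsub>G\<^esub> x) \<otimes>\<^bsub>G\<^esub> map \<sigma> x = \<one>\<^bsub>G\<^esub>"
    using Aut_mult[OF \<sigma> K i x] Aut_one[OF \<sigma> K] in_G by simp
  then show ?thesis using G.inv_equality[OF _ in_G(1,2)] by simp
qed

lemma cocyclesD:
  assumes "\<phi> \<in> cocycles L S K E n G"
  shows "\<phi> \<in> extensional (Aut L S K E)" "\<sigma> \<in> Aut L S K E \<Longrightarrow> \<phi> \<sigma> \<in> points_in \<Gamma> K"
    "\<sigma> \<in> Aut L S K E \<Longrightarrow> \<tau> \<in> Aut L S K E \<Longrightarrow> \<phi> (compose K \<sigma> \<tau>) = \<phi> \<sigma> \<otimes>\<^bsub>G\<^esub> map \<sigma> (\<phi> \<tau>)"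
    "\<exists>b D h. set b \<subseteq> K \<and> definable_fun L S E (length b + length b) n D h \<and>
       (\<forall>\<sigma>\<in>Aut L S K E. b @ map \<sigma> b \<in> D \<and> \<phi> \<sigma> = h (b @ map \<sigma> b))"
  using assms unfolding cocycles_def by (auto simp: PiE_def)

lemma trivial_cocycle:
  assumes K: "dcl_closed K" and E: "A \<subseteq> E" "E \<subseteq> K"
  shows "(\<lambda>\<sigma>\<in>Aut L S K E. \<one>\<^bsub>G\<^esub>) \<in> cocycles L S K E n G"
  unfolding cocycles_def
proof (intro CollectI conjI ballI exI)
  have EU: "E \<subseteq> U" using E K by (auto simp: dcl_closed_def)
  note one = one_points[OF K]
  have one_tup: "\<one>\<^bsub>G\<^esub> \<in> tuples n U" by (rule carrier_tuples) simp
  show "(\<lambda>\<sigma>\<in>Aut L S K E. \<one>\<^bsub>G\<^esub>) \<in> Aut L S K E \<rightarrow>\<^sub>E points_in \<Gamma> K" using one by auto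
  fix \<sigma> \<tau> assume s: "\<sigma> \<in> Aut L S K E" "\<tau> \<in> Aut L S K E"
  have "\<sigma> \<in> Aut L S K A" using Aut_mono[OF E(1)] s(1) by blast
  from Aut_one[OF this K]
  show "(\<lambda>\<sigma>\<in>Aut L S K E. \<one>\<^bsub>G\<^esub>) (compose K \<sigma> \<tau>) =
    (\<lambda>\<sigma>\<in>Aut L S K E. \<one>\<^bsub>G\<^esub>) \<sigma> \<otimes>\<^bsub>G\<^esub> map \<sigma> ((\<lambda>\<sigma>\<in>Aut L S K E. \<one>\<^bsub>G\<^esub>) \<tau>)"
    using s Aut_compose[OF s E(2)] by simp
next
  have one_tup: "\<one>\<^bsub>G\<^esub> \<in> tuples n U" by (rule carrier_tuples) simp
  have "dfn A n {x\<in>tuples n U. x @ x @ x \<in> Mul}"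
    by (rule definable_Collect) (rule defintros defpred_mem[OF _ dfn_Mul] AU | simp)+
  moreover have "{x\<in>tuples n U. x @ x @ x \<in> Mul} = {\<one>\<^bsub>G\<^esub>}" using one_iff one_tup by blast
  ultimately have "dfn E n {\<one>\<^bsub>G\<^esub>}" using definable_mono[OF _ E(1)] by simp
  \<comment> \<open>The constant function is presented with the empty tuple, so its graph is the
    singleton of the unit.\<close>
  then show "definable_fun L S E (length [] + length []) n {[]} (\<lambda>_. \<one>\<^bsub>G\<^esub>)"
    using one_tup by (simp add: definable_fun_def tuples_def)
qed auto

lemma cohomologous_equiv:
  assumes K: "dcl_closed K" and E: "A \<subseteq> E" "E \<subseteq> K"
  shows "equiv (cocycles L S K E n G) (cohomologous L S K E n G)"
proof (rule equivI)
  have Aut: "\<sigma> \<in> Aut L S K A" if "\<sigma> \<in> Aut L S K E" for \<sigma> using Aut_mono[OF E(1)] that by blast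
  have in_G: "x \<in> \<Gamma>" if "x \<in> points_in \<Gamma> K" for x using that by (simp add: points_in_def)
  show "cohomologous L S K E n G \<subseteq> cocycles L S K E n G \<times> cocycles L S K E n G"
    by (auto simp: cohomologous_def)
  show "refl_on (cocycles L S K E n G) (cohomologous L S K E n G)"
  proof (rule refl_onI)
    fix \<phi> assume \<phi>: "\<phi> \<in> cocycles L S K E n G"
    have "\<phi> \<sigma> = inv\<^bsub>G\<^esub> \<one>\<^bsub>G\<^esub> \<otimes>\<^bsub>G\<^esub> \<phi> \<sigma> \<otimes>\<^bsub>G\<^esub> map \<sigma> \<one>\<^bsub>G\<^esub>" if "\<sigma> \<in> Aut L S K E" for \<sigma>
      using Aut_one[OF Aut[OF that] K] in_G[OF cocyclesD(2)[OF \<phi> that]] by simp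
    then show "(\<phi>, \<phi>) \<in> cohomologous L S K E n G"
      using \<phi> one_points[OF K] unfolding cohomologous_def by blast
  qed
  show "sym (cohomologous L S K E n G)"
  proof (rule symI)
    fix \<phi> \<psi> assume "(\<phi>, \<psi>) \<in> cohomologous L S K E n G"
    then obtain g where c: "\<phi> \<in> cocycles L S K E n G" "\<psi> \<in> cocycles L S K E n G" and g: "g \<in> points_in \<Gamma> K"
      and eq: "\<And>\<sigma>. \<sigma> \<in> Aut L S K E \<Longrightarrow> \<phi> \<sigma> = inv\<^bsub>G\<^esub> g \<otimes>\<^bsub>G\<^esub> \<psi> \<sigma> \<otimes>\<^bsub>G\<^esub> map \<sigma> g"
      unfolding cohomologous_def by blast
    have "\<psi> \<sigma> = inv\<^bsub>G\<^esub> (inv\<^bsub>G\<^esub> g) \<otimes>\<^bsub>G\<^esub> \<phi> \<sigma> \<otimes>\<^bsub>G\<^esub> map \<sigma> (inv\<^bsub>G\<^esub> g)" if s: "\<sigma> \<in> Aut L S K E" for \<sigma>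
    proof -
      note ps = in_G[OF cocyclesD(2)[OF c(2) s]] in_G[OF g] in_G[OF Aut_points[OF Aut[OF s] K g]]
      have "inv\<^bsub>G\<^esub> (inv\<^bsub>G\<^esub> g) \<otimes>\<^bsub>G\<^esub> \<phi> \<sigma> \<otimes>\<^bsub>G\<^esub> map \<sigma> (inv\<^bsub>G\<^esub> g) =
        g \<otimes>\<^bsub>G\<^esub> (inv\<^bsub>G\<^esub> g \<otimes>\<^bsub>G\<^esub> \<psi> \<sigma> \<otimes>\<^bsub>G\<^esub> map \<sigma> g) \<otimes>\<^bsub>G\<^esub> inv\<^bsub>G\<^esub> (map \<sigma> g)"
        using ps by (simp add: eq[OF s] Aut_inv[OF Aut[OF s] K g])
      also have "\<dots> = \<psi> \<sigma>" using ps by (simp add: G.m_assoc) (simp flip: G.m_assoc)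
      finally show ?thesis by simp
    qed
    then show "(\<psi>, \<phi>) \<in> cohomologous L S K E n G"
      using c inv_points[OF K g] unfolding cohomologous_def by blast
  qed
  show "trans (cohomologous L S K E n G)"
  proof (rule transI)
    fix \<phi> \<psi> \<chi> assume a: "(\<phi>, \<psi>) \<in> cohomologous L S K E n G" and b: "(\<psi>, \<chi>) \<in> cohomologous L S K E n G"
    from a obtain g where c1: "\<phi> \<in> cocycles L S K E n G" and g: "g \<in> points_in \<Gamma> K"
      and eq: "\<And>\<sigma>. \<sigma> \<in> Aut L S K E \<Longrightarrow> \<phi> \<sigma> = inv\<^bsub>G\<^esub> g \<otimes>\<^bsub>G\<^esub> \<psi> \<sigma> \<otimes>\<^bsub>G\<^esub> map \<sigma> g"
      unfolding cohomologous_def by blast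
    from b obtain h where c2: "\<chi> \<in> cocycles L S K E n G" and h: "h \<in> points_in \<Gamma> K"
      and eq2: "\<And>\<sigma>. \<sigma> \<in> Aut L S K E \<Longrightarrow> \<psi> \<sigma> = inv\<^bsub>G\<^esub> h \<otimes>\<^bsub>G\<^esub> \<chi> \<sigma> \<otimes>\<^bsub>G\<^esub> map \<sigma> h"
      unfolding cohomologous_def by blast
    have "\<phi> \<sigma> = inv\<^bsub>G\<^esub> (h \<otimes>\<^bsub>G\<^esub> g) \<otimes>\<^bsub>G\<^esub> \<chi> \<sigma> \<otimes>\<^bsub>G\<^esub> map \<sigma> (h \<otimes>\<^bsub>G\<^esub> g)" if s: "\<sigma> \<in> Aut L S K E" for \<sigma>
    proof -
      note ps = in_G[OF cocyclesD(2)[OF c2 s]] in_G[OF g] in_G[OF h] in_G[OF Aut_points[OF Aut[OF s] K g]]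
        in_G[OF Aut_points[OF Aut[OF s] K h]]
      show ?thesis using ps
        by (simp add: eq[OF s] eq2[OF s] Aut_mult[OF Aut[OF s] K h g] G.inv_mult_group G.m_assoc)
    qed
    then show "(\<phi>, \<chi>) \<in> cohomologous L S K E n G"
      using c1 c2 mult_points[OF K h g] unfolding cohomologous_def by blast
  qed
qed

text \<open>
  A cocycle \<open>\<phi> \<sigma> = h b (\<sigma> b)\<close> makes \<open>h\<close> a cocycle on the realizations \<open>\<Theta>\<close> of the type of \<open>b\<close>, and
  \<open>h c c' = 1\<close> is an equivalence relation, the kernel of \<open>f\<close>.  The point \<open>f b\<close> of the principal
  homogeneous space of \<open>\<phi>\<close> is definable over any \<open>\<gamma>(M)\<close>: the space has a point in \<open>\<gamma>(M)\<close>, and the two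
  differ by a point of \<open>G(M) = G(mcl(A))\<close>.
\<close>

lemma torsor:
  assumes E: "normal_over L S A M E" "E \<subseteq> B" and \<phi>: "\<phi> \<in> cocycles L S M E n G"
  obtains b k \<Theta> h f l where "set b \<subseteq> M" "isolates E k \<Theta> b" "h ` (\<Theta> \<times> \<Theta>) \<subseteq> \<Gamma>"
    "dfn E (k + (k + n)) {c @ c' @ h (c, c') |c c'. c \<in> \<Theta> \<and> c' \<in> \<Theta>}"
    "\<forall>\<sigma>\<in>Aut L S M E. map \<sigma> b \<in> \<Theta> \<and> \<phi> \<sigma> = h (b, map \<sigma> b)"
    "\<forall>a\<in>\<Theta>. \<forall>c\<in>\<Theta>. \<forall>c'\<in>\<Theta>. h (a, c') = h (a, c) \<otimes>\<^bsub>G\<^esub> h (c, c')"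
    "f ` \<Theta> \<subseteq> tuples l U" "dfn E (k + l) {c @ f c |c. c \<in> \<Theta>}"
    "\<forall>c\<in>\<Theta>. \<forall>c'\<in>\<Theta>. f c = f c' \<longleftrightarrow> h (c, c') = \<one>\<^bsub>G\<^esub>"
    "set (f b) \<subseteq> B"
proof -
  have AE: "A \<subseteq> E" and EM: "E \<subseteq> M" and EU: "E \<subseteq> U" using E MU by (auto simp: normal_over_def)
  obtain b D h0 where b: "set b \<subseteq> M" and h0: "definable_fun L S E (length b + length b) n D h0"
    and \<phi>h: "\<And>\<sigma>. \<sigma> \<in> Aut L S M E \<Longrightarrow> b @ map \<sigma> b \<in> D \<and> \<phi> \<sigma> = h0 (b @ map \<sigma> b)"
    using cocyclesD(4)[OF \<phi>] by blast
  define k where "k = length b"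
  define Gr where "Gr = {x @ h0 x |x. x \<in> D}"
  have D: "D \<subseteq> tuples (k + k) U" and dGr: "dfn E (k + k + n) Gr"
    using h0 by (auto simp: definable_fun_def k_def Gr_def)
  have inGr: "c @ c' @ g \<in> Gr \<longleftrightarrow> c @ c' \<in> D \<and> g = h0 (c @ c')" if c: "c \<in> tuples k U" "c' \<in> tuples k U" for c c' g
  proof
    assume "c @ c' @ g \<in> Gr"
    then obtain x where x: "(c @ c') @ g = x @ h0 x" "x \<in> D" by (auto simp: Gr_def)
    then have "c @ c' = x" "g = h0 x"
      using append_tuples_inject[OF tuples_append[OF c], of x U g "h0 x"] D by auto
    then show "c @ c' \<in> D \<and> g = h0 (c @ c')" using x by simp
  next
    assume "c @ c' \<in> D \<and> g = h0 (c @ c')"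
    then have "(c @ c') @ g \<in> Gr" unfolding Gr_def by blast
    then show "c @ c' @ g \<in> Gr" by simp
  qed
  obtain \<Theta> where \<Theta>: "isolates E k \<Theta> b"
    using atomic_over_normal[OF E(1) b] by (auto simp: isolated_def k_def)
  have d\<Theta>: "dfn E k \<Theta>" and b\<Theta>: "b \<in> \<Theta>" using isolates_dfn[OF \<Theta>] by auto
  have \<Theta>k: "c \<in> tuples k U" if "c \<in> \<Theta>" for c using definable_subset[OF d\<Theta>] that by blast
  have \<Theta>inj: "c @ x = c' @ y \<longleftrightarrow> c = c' \<and> x = y" if "c \<in> tuples k U" "c' \<in> \<Theta>" for c c' x y
    using append_tuples_inject[OF that(1) \<Theta>k[OF that(2)]] .
  have Aut\<Theta>: "map \<sigma> b \<in> \<Theta>" if "\<sigma> \<in> Aut L S M E" for \<sigma>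
    using Aut_same_type[OF that EM b] d\<Theta> b\<Theta> by (auto simp: same_type_def k_def)
  have Aut_ex: "\<exists>\<sigma>\<in>Aut L S M E. map \<sigma> b = c" if "c \<in> \<Theta>" "set c \<subseteq> M" for c
    by (rule homogeneous_over_normal[OF E(1) b that(2) isolates_same_type[OF \<Theta> that(1)]])
  \<comment> \<open>The identity h(x, c') = h(x, c) h(c, c'), including the existence of all three
    values in the group. Written through the graph \<open>Gr\<close> it is a definable
    condition.\<close>
  define ok where "ok x c c' \<longleftrightarrow> (\<exists>g\<in>\<Gamma>. \<exists>g'\<in>\<Gamma>. \<exists>g''\<in>\<Gamma>. x @ c' @ g \<in> Gr \<and> x @ c @ g' \<in> Gr \<and>
    c @ c' @ g'' \<in> Gr \<and> g' @ g'' @ g \<in> Mul)" for x c c'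
  \<comment> \<open>By homogeneity \<open>c\<close> = \<sigma> b and \<open>c'\<close> = \<rho> b.
    With \<tau> = \<sigma>^{-1} \<rho>, the cocycle equation for \<sigma> \<tau> = \<rho> is the
    required identity, because \<sigma> maps h(b, \<tau> b) to h(c, c').\<close>
  have okM: "ok b c c'" if c: "c \<in> \<Theta>" "c' \<in> \<Theta>" "set c \<subseteq> M" "set c' \<subseteq> M" for c c'
  proof -
    obtain \<sigma> \<rho> where \<sigma>: "\<sigma> \<in> Aut L S M E" "map \<sigma> b = c" and \<rho>: "\<rho> \<in> Aut L S M E" "map \<rho> b = c'"
      using Aut_ex c by blast
    define \<tau> where "\<tau> = compose M (restrict (inv_into M \<sigma>) M) \<rho>"
    have \<tau>: "\<tau> \<in> Aut L S M E" unfolding \<tau>_def by (rule Aut_compose[OF Aut_inverse[OF \<sigma>(1) EM] \<rho>(1) EM])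
    have \<rho>\<tau>: "compose M \<sigma> \<tau> = \<rho>"
    proof
      fix x show "compose M \<sigma> \<tau> x = \<rho> x"
        using AutD(1)[OF \<sigma>(1)] AutD(1,2)[OF \<rho>(1)]
        by (cases "x \<in> M") (auto simp: compose_def \<tau>_def bij_betw_def f_inv_into_f extensional_def)
    qed
    have \<sigma>A: "\<sigma> \<in> Aut L S M A" using Aut_mono[OF AE] \<sigma>(1) by blast
    define g g' g0 where "g = \<phi> \<rho>" and "g' = \<phi> \<sigma>" and "g0 = \<phi> \<tau>"
    have gM: "g \<in> points_in \<Gamma> M" "g' \<in> points_in \<Gamma> M" "g0 \<in> points_in \<Gamma> M" "map \<sigma> g0 \<in> points_in \<Gamma> M"
      using cocyclesD(2)[OF \<phi>] \<rho> \<sigma> \<tau> Aut_points[OF \<sigma>A dcl_closed_M] by (auto simp: g_def g'_def g0_def)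
    have gG: "g \<in> \<Gamma>" "g' \<in> \<Gamma>" "map \<sigma> g0 \<in> \<Gamma>" using gM by (auto simp: points_in_def)
    have g: "g = g' \<otimes>\<^bsub>G\<^esub> map \<sigma> g0" using cocyclesD(3)[OF \<phi> \<sigma>(1) \<tau>] by (simp add: \<rho>\<tau> g_def g'_def g0_def)
    have bk: "b \<in> tuples k U" using \<Theta>k[OF b\<Theta>] .
    have 1: "b @ c' @ g \<in> Gr" "b @ c @ g' \<in> Gr"
      using inGr[OF bk \<Theta>k[OF c(2)]] inGr[OF bk \<Theta>k[OF c(1)]] \<phi>h[OF \<rho>(1)] \<phi>h[OF \<sigma>(1)] \<rho>(2) \<sigma>(2)
      by (auto simp: g_def g'_def)
    have "b @ map \<tau> b @ g0 \<in> Gr"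
      using inGr[OF bk \<Theta>k[OF Aut\<Theta>[OF \<tau>]]] \<phi>h[OF \<tau>] by (simp add: g0_def)
    moreover have sub: "set (b @ map \<tau> b @ g0) \<subseteq> M" using b Aut_set[OF \<tau> b] gM by (auto simp: points_in_def)
    moreover have "dfn E (length (b @ map \<tau> b @ g0)) Gr"
      using dGr gM carrier_tuples[of g0] by (simp add: k_def points_in_def tuples_def add.assoc)
    ultimately have "map \<sigma> (b @ map \<tau> b @ g0) \<in> Gr"
      using Aut_same_type[OF \<sigma>(1) EM sub] by (auto simp: same_type_def)
    moreover have "map \<sigma> (map \<tau> b) = map \<rho> b" using b \<rho>\<tau> by (auto simp: compose_def dest: fun_cong)
    ultimately have "c @ c' @ map \<sigma> g0 \<in> Gr" using \<sigma>(2) \<rho>(2) by (simp del: map_map)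
    moreover have "g' @ map \<sigma> g0 @ g \<in> Mul" using in_Mul[OF carrier_tuples carrier_tuples] gG g by blast
    ultimately show ?thesis unfolding ok_def using 1 gG by blast
  qed
  have dGr': "dfn K (k + k + n) Gr" if "E \<subseteq> K" for K using definable_mono[OF dGr that] .
  have dMul': "dfn K (n + n + n) Mul" "dfn K n \<Gamma>" if "E \<subseteq> K" for K
    using definable_mono[OF dfn_Mul] definable_mono[OF dfn_carrier] AE that by blast+
  have Eb: "E \<union> set b \<subseteq> U" "set b \<subseteq> E \<union> set b" "E \<union> set b \<subseteq> M" "E \<subseteq> E \<union> set b" using EM b MU by auto
  \<comment> \<open>The identity passes from points in \<open>M\<close> to all \<open>c\<close> and
    \<open>c'\<close> in \<Theta>, since \<open>bad\<close> is definable over \<open>M\<close> and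
    has no point there. Afterwards the first argument \<open>b\<close> is replaced by any element of
    \<Theta>, because \<Theta> isolates its type.\<close>
  define bad where "bad = {w\<in>tuples (k + k) U. \<exists>c\<in>\<Theta>. \<exists>c'\<in>\<Theta>. w = c @ c' \<and> \<not> ok b c c'}"
  have inbad: "c @ c' \<in> bad \<longleftrightarrow> c \<in> \<Theta> \<and> c' \<in> \<Theta> \<and> \<not> ok b c c'" if "c \<in> tuples k U" "c' \<in> tuples k U" for c c'
    using that \<Theta>k by (auto simp: bad_def \<Theta>inj tuples_append)
  have dbad: "dfn (E \<union> set b) (k + k) bad"
    by (rule definable_Collect2[OF _ refl inbad])
      (auto simp: bad_def, (unfold ok_def, (rule defintros defpred_mem[OF _ dGr'] defpred_mem[OF _ dMul'(1)]
        defpred_mem[OF _ definable_mono[OF d\<Theta> Eb(4)]] dMul'(2) Eb | simp add: k_def)+)?)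
  have "bad = {}"
  proof (rule ccontr)
    assume ne: "bad \<noteq> {}"
    obtain w where w: "w \<in> bad" "set w \<subseteq> M" using meets_definable_point[OF tvM dbad Eb(3) ne] .
    then obtain c c' where "w = c @ c'" "c \<in> \<Theta>" "c' \<in> \<Theta>" "\<not> ok b c c'" by (auto simp: bad_def)
    then show False using okM w(2) by auto
  qed
  then have okb: "ok b c c'" if "c \<in> \<Theta>" "c' \<in> \<Theta>" for c c' using inbad[OF \<Theta>k \<Theta>k] that by blast
  define Y where "Y = {x\<in>tuples k U. \<forall>c\<in>\<Theta>. \<forall>c'\<in>\<Theta>. ok x c c'}"
  have dY: "dfn E k Y" unfolding Y_def
    by (rule definable_Collect) (unfold ok_def, (rule defintros defpred_mem[OF _ dGr'] defpred_mem[OF _ dMul'(1)]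
        d\<Theta> dMul'(2) EU order_refl | simp)+)
  have "b \<in> Y" using okb \<Theta>k[OF b\<Theta>] by (simp add: Y_def)
  then have "\<Theta> \<subseteq> Y" by (rule isolates_sub[OF \<Theta> dY])
  then have ok\<Theta>: "ok a c c'" if "a \<in> \<Theta>" "c \<in> \<Theta>" "c' \<in> \<Theta>" for a c c' using that by (auto simp: Y_def)
  define h where "h = (\<lambda>(c, c'). h0 (c @ c'))"
  have Gr_h: "c @ c' @ g \<in> Gr \<longleftrightarrow> g = h (c, c')" if c: "c \<in> \<Theta>" "c' \<in> \<Theta>" for c c' g
  proof -
    have "c @ c' \<in> D" using ok\<Theta>[OF c(1,2,2)] inGr[OF \<Theta>k[OF c(1)] \<Theta>k[OF c(2)]] by (auto simp: ok_def)
    then show ?thesis using inGr[OF \<Theta>k[OF c(1)] \<Theta>k[OF c(2)]] by (simp add: h_def)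
  qed
  have h\<Gamma>: "h (c, c') \<in> \<Gamma>" if "c \<in> \<Theta>" "c' \<in> \<Theta>" for c c'
    using ok\<Theta>[OF that(1,2,2)] Gr_h[OF that] by (auto simp: ok_def)
  have hmul: "h (a, c') = h (a, c) \<otimes>\<^bsub>G\<^esub> h (c, c')" if "a \<in> \<Theta>" "c \<in> \<Theta>" "c' \<in> \<Theta>" for a c c'
    using ok\<Theta>[OF that] Gr_h that in_Mul[OF carrier_tuples carrier_tuples] by (auto simp: ok_def)
  define Hg where "Hg = {c @ c' @ h (c, c') |c c'. c \<in> \<Theta> \<and> c' \<in> \<Theta>}"
  have inHg: "c @ c' @ g \<in> Hg \<longleftrightarrow> c \<in> \<Theta> \<and> c' \<in> \<Theta> \<and> c @ c' @ g \<in> Gr"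
    if "c \<in> tuples k U" "c' \<in> tuples k U" "g \<in> tuples n U" for c c' g
    using that \<Theta>k Gr_h by (auto simp: Hg_def \<Theta>inj) blast
  have dHg: "dfn E (k + (k + n)) Hg"
  proof (rule definable_Collect3[OF _ refl inHg])
    show "Hg \<subseteq> tuples (k + (k + n)) U"
      using \<Theta>k h\<Gamma> carrier_tuples by (auto simp: Hg_def intro!: tuples_append)
  qed (rule defintros defpred_mem[OF _ dGr'] defpred_mem[OF _ d\<Theta>] EU order_refl | simp)+
  have hh: "h (c, c) = \<one>\<^bsub>G\<^esub>" if "c \<in> \<Theta>" for c using hmul[OF that that that] h\<Gamma>[OF that that] by simp
  define R where "R = {w\<in>tuples (k + k) U. \<exists>c\<in>\<Theta>. \<exists>c'\<in>\<Theta>. w = c @ c' \<and> h (c, c') = \<one>\<^bsub>G\<^esub>}"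
  have inR': "c @ c' \<in> R \<longleftrightarrow> c \<in> \<Theta> \<and> c' \<in> \<Theta> \<and> h (c, c') = \<one>\<^bsub>G\<^esub>" if "c \<in> tuples k U" "c' \<in> tuples k U" for c c'
    using that \<Theta>k by (auto simp: R_def \<Theta>inj tuples_append)
  have inR: "c @ c' \<in> R \<longleftrightarrow> c \<in> \<Theta> \<and> c' \<in> \<Theta> \<and> (\<exists>g\<in>\<Gamma>. c @ c' @ g \<in> Gr \<and> g @ g @ g \<in> Mul)"
    if "c \<in> tuples k U" "c' \<in> tuples k U" for c c'
    using inR'[OF that] Gr_h one_iff carrier_tuples h\<Gamma> by (metis G.one_closed)
  have dR: "dfn E (k + k) R"
    by (rule definable_Collect2[OF _ refl inR])
      (auto simp: R_def, (rule defintros defpred_mem[OF _ dGr'] defpred_mem[OF _ dMul'(1)]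
        defpred_mem[OF _ d\<Theta>] dMul'(2) EU order_refl | simp)+)
  have hinv: "h (c', c) = inv\<^bsub>G\<^esub> (h (c, c'))" if "c \<in> \<Theta>" "c' \<in> \<Theta>" for c c'
    using hmul[OF that(2,1,2)] hh[OF that(2)] h\<Gamma> that G.inv_equality by metis
  have "\<exists>l F. dfn E (k + l) F \<and> (\<forall>c\<in>\<Theta>. \<exists>!e. e \<in> tuples l U \<and> c @ e \<in> F) \<and>
    (\<forall>c\<in>\<Theta>. \<forall>c'\<in>\<Theta>. \<forall>e\<in>tuples l U. c @ e \<in> F \<longrightarrow> (c' @ e \<in> F \<longleftrightarrow> c @ c' \<in> R))"
  proof (rule definable_quotient[OF EU \<Theta> dR])
    show "c \<in> \<Theta> \<and> c' \<in> \<Theta>" if "c \<in> tuples k U" "c' \<in> tuples k U" "c @ c' \<in> R" for c c' using inR' that by blast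
    show "c @ c \<in> R" if "c \<in> \<Theta>" for c using inR'[OF \<Theta>k \<Theta>k] hh that by blast
    show "c' @ c \<in> R" if "c \<in> \<Theta>" "c' \<in> \<Theta>" "c @ c' \<in> R" for c c'
      using inR'[OF \<Theta>k \<Theta>k] hinv[of c c'] that by simp
    show "c @ c'' \<in> R" if "c \<in> \<Theta>" "c' \<in> \<Theta>" "c'' \<in> \<Theta>" "c @ c' \<in> R" "c' @ c'' \<in> R" for c c' c''
      using inR'[OF \<Theta>k \<Theta>k] hmul[of c c' c''] that by simp
  qed
  then obtain l F where dF: "dfn E (k + l) F" and F': "\<forall>c\<in>\<Theta>. \<exists>!e. e \<in> tuples l U \<and> c @ e \<in> F"
    and FR': "\<forall>c\<in>\<Theta>. \<forall>c'\<in>\<Theta>. \<forall>e\<in>tuples l U. c @ e \<in> F \<longrightarrow> (c' @ e \<in> F \<longleftrightarrow> c @ c' \<in> R)"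
    by (elim exE conjE) (rule that)
  note F = F'[rule_format] and FR = FR'[rule_format]
  define f where "f c = (THE e. e \<in> tuples l U \<and> c @ e \<in> F)" for c
  have f: "f c \<in> tuples l U" "c @ f c \<in> F" if "c \<in> \<Theta>" for c using theI'[OF F[OF that]] by (auto simp: f_def)
  have f_eq: "e = f c" if "c \<in> \<Theta>" "e \<in> tuples l U" "c @ e \<in> F" for c e using F[OF that(1)] f[OF that(1)] that by blast
  have fh: "f c = f c' \<longleftrightarrow> h (c, c') = \<one>\<^bsub>G\<^esub>" if c: "c \<in> \<Theta>" "c' \<in> \<Theta>" for c c'
    using FR[OF c f[OF c(1)]] inR'[OF \<Theta>k[OF c(1)] \<Theta>k[OF c(2)]] c f[OF c(2)] f_eq[OF c(2) f(1)[OF c(1)]] by metis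
  define Fg where "Fg = {c @ f c |c. c \<in> \<Theta>}"
  have inFg: "c @ e \<in> Fg \<longleftrightarrow> c \<in> \<Theta> \<and> c @ e \<in> F" if "c \<in> tuples k U" "e \<in> tuples l U" for c e
  proof
    assume "c @ e \<in> Fg"
    then show "c \<in> \<Theta> \<and> c @ e \<in> F" using that f by (auto simp: Fg_def \<Theta>inj)
  next
    assume "c \<in> \<Theta> \<and> c @ e \<in> F"
    then show "c @ e \<in> Fg" using f_eq[of c e] that unfolding Fg_def by blast
  qed
  have dFg: "dfn E (k + l) Fg"
  proof (rule definable_Collect2[OF _ refl inFg])
    show "Fg \<subseteq> tuples (k + l) U" using \<Theta>k f(1) by (auto simp: Fg_def intro!: tuples_append)
  qed (rule defintros defpred_mem[OF _ dF] defpred_mem[OF _ d\<Theta>] EU refl | simp)+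
  have "set (f b) \<subseteq> B"
  proof (rule mclI)
    fix \<gamma> assume \<gamma>: "\<gamma> \<in> embeddings"
    define M' where "M' = \<gamma> ` M"
    have tv: "meets_definable M'" and M'U: "M' \<subseteq> U"
      using embeddings_meets_definable[OF \<gamma>] meets_definable_subset by (auto simp: M'_def)
    have M'M: "M' \<subseteq> M" using \<gamma> by (auto simp: M'_def embeddings_def)
    have BM': "B \<subseteq> M'" using mcl_sub_image[OF \<gamma>] by (simp add: M'_def)
    then have EM': "E \<subseteq> M'" using E(2) by blast
    have ne: "\<Theta> \<noteq> {}" using b\<Theta> by blast
    obtain c where c: "c \<in> \<Theta>" "set c \<subseteq> M'" using meets_definable_point[OF tv d\<Theta> EM' ne] .
    define g where "g = h (c, b)"
    have g\<Gamma>: "g \<in> \<Gamma>" using h\<Gamma>[OF c(1) b\<Theta>] by (simp add: g_def)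
    have lens: "length c = k" "length b = k" "length g = n"
      using \<Theta>k[OF c(1)] carrier_tuples[OF g\<Gamma>] by (auto simp: tuples_def k_def)
    have cM: "set c \<subseteq> M" using c M'M by blast
    have "dfn M n {x\<in>tuples n U. c @ b @ x \<in> Gr}"
      by (rule definable_Collect) (rule defintros defpred_mem[OF _ dGr'[OF EM]] MU cM b | simp add: lens)+
    moreover have "{x\<in>tuples n U. c @ b @ x \<in> Gr} = {g}"
      using Gr_h[OF c(1) b\<Theta>] carrier_tuples[OF g\<Gamma>] by (auto simp: g_def)
    ultimately have "set g \<subseteq> M" using meets_definable_dcl[OF tvM] by simp
    then have "g \<in> points_in \<Gamma> B" using g\<Gamma> points by (auto simp: points_in_def)
    then have gM': "set g \<subseteq> M'" using BM' by (auto simp: points_in_def)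
    \<comment> \<open>The \<open>x\<close> in \<Theta> with h(c, x) = g are exactly those with h(b,
      x) = 1, i.e. the class of \<open>b\<close>. So \<open>c\<close> and \<open>g\<close>, both
      with entries in \<open>M'\<close>, define the code \<open>f b\<close> over
      \<open>M'\<close>.\<close>
    have "dfn M' l {e\<in>tuples l U. \<exists>x\<in>\<Theta>. c @ x @ g \<in> Gr \<and> x @ e \<in> F}"
      by (rule definable_Collect)
        (rule defintros defpred_mem[OF _ dGr'[OF EM']] defpred_mem[OF _ definable_mono[OF dF EM']]
          definable_mono[OF d\<Theta> EM'] M'U c gM' | simp add: lens)+
    moreover have "{e\<in>tuples l U. \<exists>x\<in>\<Theta>. c @ x @ g \<in> Gr \<and> x @ e \<in> F} = {f b}"
    proof (intro equalityI subsetI)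
      fix e assume "e \<in> {e\<in>tuples l U. \<exists>x\<in>\<Theta>. c @ x @ g \<in> Gr \<and> x @ e \<in> F}"
      then obtain x where x: "x \<in> \<Theta>" "c @ x @ g \<in> Gr" "x @ e \<in> F" and e: "e \<in> tuples l U" by blast
      have "h (c, x) = h (c, b)" using Gr_h[OF c(1) x(1)] x(2) by (simp add: g_def)
      then have "h (b, x) = \<one>\<^bsub>G\<^esub>"
        using hmul[OF b\<Theta> c(1) x(1)] hmul[OF b\<Theta> c(1) b\<Theta>] hh[OF b\<Theta>] by simp
      then have "f b = f x" using fh[OF b\<Theta> x(1)] by simp
      then show "e \<in> {f b}" using f_eq[OF x(1) e x(3)] by simp
    next
      fix e assume "e \<in> {f b}"
      then show "e \<in> {e\<in>tuples l U. \<exists>x\<in>\<Theta>. c @ x @ g \<in> Gr \<and> x @ e \<in> F}"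
        using f[OF b\<Theta>] b\<Theta> Gr_h[OF c(1) b\<Theta>] by (auto simp: g_def)
    qed
    ultimately show "dfn (\<gamma> ` M) l {f b}" by (simp add: M'_def)
  qed
  show ?thesis
  proof (rule that[of b k \<Theta> h f l])
    show "h ` (\<Theta> \<times> \<Theta>) \<subseteq> \<Gamma>" using h\<Gamma> by auto
    show "\<forall>\<sigma>\<in>Aut L S M E. map \<sigma> b \<in> \<Theta> \<and> \<phi> \<sigma> = h (b, map \<sigma> b)"
      using Aut\<Theta> \<phi>h by (simp add: h_def)
    show "\<forall>a\<in>\<Theta>. \<forall>c\<in>\<Theta>. \<forall>c'\<in>\<Theta>. h (a, c') = h (a, c) \<otimes>\<^bsub>G\<^esub> h (c, c')"
      by (intro ballI hmul)
    show "\<forall>c\<in>\<Theta>. \<forall>c'\<in>\<Theta>. f c = f c' \<longleftrightarrow> h (c, c') = \<one>\<^bsub>G\<^esub>"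
      by (intro ballI fh)
    show "f ` \<Theta> \<subseteq> tuples l U" using f(1) by blast
    show "dfn E (k + (k + n)) {c @ c' @ h (c, c') |c c'. c \<in> \<Theta> \<and> c' \<in> \<Theta>}" using dHg by (simp add: Hg_def)
    show "dfn E (k + l) {c @ f c |c. c \<in> \<Theta>}" using dFg by (simp add: Fg_def)
  qed (fact b \<Theta> \<open>set (f b) \<subseteq> B\<close>)+
qed

end

section \<open>Cohomology over the minimal closure and the comparison map\<close>

context prime_model_group
begin

interpretation G: group G by (rule group_G)

text \<open>The code \<open>f b\<close> has its entries in mcl(A), so every \<sigma> fixing mcl(A)
  satisfies f(\<sigma> b) = f b, which means h(b, \<sigma> b) = 1. Thus every definable cocycle over
  mcl(A) is equal to the trivial one, not merely cohomologous to it.\<close>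

lemma H1_mcl_trivial: "H1 L S M B n G = {trivial_class L S M B n G}"
proof -
  have sub: "B \<subseteq> M" "A \<subseteq> B" by (fact BM AB)+
  let ?triv = "\<lambda>\<sigma>\<in>Aut L S M B. \<one>\<^bsub>G\<^esub>"
  have "\<phi> = ?triv" if \<phi>: "\<phi> \<in> cocycles L S M B n G" for \<phi>
  proof
    fix \<sigma>
    show "\<phi> \<sigma> = ?triv \<sigma>"
    proof (cases "\<sigma> \<in> Aut L S M B")
      case True
      obtain b k \<Theta> h f l where b: "set b \<subseteq> M" and \<Theta>: "isolates B k \<Theta> b" and h\<Gamma>: "h ` (\<Theta> \<times> \<Theta>) \<subseteq> \<Gamma>"
        and dh: "dfn B (k + (k + n)) {c @ c' @ h (c, c') |c c'. c \<in> \<Theta> \<and> c' \<in> \<Theta>}"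
        and \<phi>h': "\<forall>\<sigma>\<in>Aut L S M B. map \<sigma> b \<in> \<Theta> \<and> \<phi> \<sigma> = h (b, map \<sigma> b)"
        and hmul': "\<forall>a\<in>\<Theta>. \<forall>c\<in>\<Theta>. \<forall>c'\<in>\<Theta>. h (a, c') = h (a, c) \<otimes>\<^bsub>G\<^esub> h (c, c')"
        and f: "f ` \<Theta> \<subseteq> tuples l U" and df: "dfn B (k + l) {c @ f c |c. c \<in> \<Theta>}"
        and fh': "\<forall>c\<in>\<Theta>. \<forall>c'\<in>\<Theta>. f c = f c' \<longleftrightarrow> h (c, c') = \<one>\<^bsub>G\<^esub>"
        and fB: "set (f b) \<subseteq> B"
        using torsor[OF normal_mcl order_refl \<phi>] .
      note \<phi>h = \<phi>h'[rule_format] and fh = fh'[rule_format]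
      have b\<Theta>: "b \<in> \<Theta>" by (rule isolates_dfn(2)[OF \<Theta>])
      have \<Theta>k: "c \<in> tuples k U" if "c \<in> \<Theta>" for c
        using definable_subset[OF isolates_dfn(1)[OF \<Theta>]] that by blast
      have \<sigma>\<Theta>: "map \<sigma> b \<in> \<Theta>" using \<phi>h[OF True] by blast
      have sub: "set (b @ f b) \<subseteq> M" using b fB BM by auto
      have "length (b @ f b) = k + l" using f b\<Theta> \<Theta>k[OF b\<Theta>] by (auto simp: tuples_def image_subset_iff)
      then have "dfn B (length (b @ f b)) {c @ f c |c. c \<in> \<Theta>}" using df by simp
      from same_type_iff[OF Aut_same_type[OF True BM sub] this]
      have "map \<sigma> (b @ f b) \<in> {c @ f c |c. c \<in> \<Theta>}" using b\<Theta> by blast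
      then obtain c where c: "c \<in> \<Theta>" "map \<sigma> b @ map \<sigma> (f b) = c @ f c" by auto
      then have "map \<sigma> b = c" "map \<sigma> (f b) = f c"
        using append_tuples_inject[OF \<Theta>k[OF \<sigma>\<Theta>] \<Theta>k[OF c(1)]] by auto
      moreover have "map \<sigma> (f b) = f b" using AutD(4)[OF True] fB by (auto intro!: map_idI)
      ultimately have "h (b, map \<sigma> b) = \<one>\<^bsub>G\<^esub>" using fh[OF b\<Theta> \<sigma>\<Theta>] by simp
      then show ?thesis using \<phi>h[OF True] True by simp
    next
      case False
      then show ?thesis using cocyclesD(1)[OF \<phi>] by (simp add: extensional_def)
    qed
  qed
  then have coc: "cocycles L S M B n G = {?triv}" using trivial_cocycle[OF dcl_closed_M sub(2,1)] by blast
  have "?triv \<in> cohomologous L S M B n G `` {?triv}"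
    by (rule equiv_class_self[OF cohomologous_equiv[OF dcl_closed_M sub(2,1)]]) (simp add: coc)
  moreover have "cohomologous L S M B n G \<subseteq> {?triv} \<times> {?triv}"
    unfolding coc[symmetric] cohomologous_def by blast
  ultimately have "cohomologous L S M B n G `` {?triv} = {?triv}" by blast
  then show ?thesis by (simp add: H1_def coc quotient_def trivial_class_def)
qed

text \<open>Agreement on a finite tuple is all that is required in the sequel, since the value of a
  definable cocycle depends only on the image of one finite tuple.\<close>

lemma mcl_Aut_extends:
  assumes \<sigma>: "\<sigma> \<in> Aut L S B A" and c: "set c \<subseteq> B"
  obtains \<tau> where "\<tau> \<in> Aut L S M A" "map \<tau> c = map \<sigma> c"
proof -
  have "set (map \<sigma> c) \<subseteq> M" "set c \<subseteq> M" using Aut_set[OF \<sigma> c] c BM by auto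
  then show ?thesis
    using homogeneous_over_normal[OF normal_A _ _ Aut_same_type[OF \<sigma> AB c]] that by blast
qed

lemma restrict_map: "set c \<subseteq> B \<Longrightarrow> map (restrict \<tau> B) c = map \<tau> c"
  by auto

lemma points_subset: "x \<in> points_in \<Gamma> B \<Longrightarrow> x \<in> points_in \<Gamma> M"
  using points by simp

lemma inflate_cocycle:
  assumes \<phi>: "\<phi> \<in> cocycles L S B A n G"
  shows "inflate L S M B A \<phi> \<in> cocycles L S M A n G"
proof -
  have r: "restrict \<sigma> B \<in> Aut L S B A" if "\<sigma> \<in> Aut L S M A" for \<sigma> using restrict_Aut[OF that normal_mcl] .
  have comp: "compose B (restrict \<sigma> B) (restrict \<tau> B) = restrict (compose M \<sigma> \<tau>) B"
    if "\<tau> \<in> Aut L S M A" for \<sigma> \<tau>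
  proof
    fix x show "compose B (restrict \<sigma> B) (restrict \<tau> B) x = restrict (compose M \<sigma> \<tau>) B x"
      using AutD(1)[OF r[OF that]] BM by (auto simp: compose_def bij_betw_def)
  qed
  obtain b D h where b: "set b \<subseteq> B" "definable_fun L S A (length b + length b) n D h"
    "\<forall>\<sigma>\<in>Aut L S B A. b @ map \<sigma> b \<in> D \<and> \<phi> \<sigma> = h (b @ map \<sigma> b)"
    using cocyclesD(4)[OF \<phi>] by blast
  show ?thesis unfolding cocycles_def
  proof (intro CollectI conjI ballI)
    show "inflate L S M B A \<phi> \<in> Aut L S M A \<rightarrow>\<^sub>E points_in \<Gamma> M"
      using cocyclesD(2)[OF \<phi> r] points_subset by (auto simp: inflate_def)
    fix \<sigma> \<tau> assume s: "\<sigma> \<in> Aut L S M A" "\<tau> \<in> Aut L S M A"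
    have eq: "map (restrict \<sigma> B) (\<phi> (restrict \<tau> B)) = map \<sigma> (\<phi> (restrict \<tau> B))"
      by (rule restrict_map) (use cocyclesD(2)[OF \<phi> r[OF s(2)]] in \<open>simp add: points_in_def\<close>)
    from cocyclesD(3)[OF \<phi> r[OF s(1)] r[OF s(2)]] show "inflate L S M B A \<phi> (compose M \<sigma> \<tau>) =
      inflate L S M B A \<phi> \<sigma> \<otimes>\<^bsub>G\<^esub> map \<sigma> (inflate L S M B A \<phi> \<tau>)"
      unfolding eq comp[OF s(2)] using s Aut_compose[OF s AM] by (simp add: inflate_def)
  next
    show "\<exists>b D h. set b \<subseteq> M \<and> definable_fun L S A (length b + length b) n D h \<and>
      (\<forall>\<sigma>\<in>Aut L S M A. b @ map \<sigma> b \<in> D \<and> inflate L S M B A \<phi> \<sigma> = h (b @ map \<sigma> b))"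
    proof (intro exI conjI ballI)
      show "set b \<subseteq> M" using b BM by blast
      fix \<sigma> assume s: "\<sigma> \<in> Aut L S M A"
      show "b @ map \<sigma> b \<in> D" "inflate L S M B A \<phi> \<sigma> = h (b @ map \<sigma> b)"
        using b(3)[rule_format, OF r[OF s]] s unfolding restrict_map[OF b(1)] by (simp_all add: inflate_def)
    qed (rule b(2))
  qed
qed

lemma inflate_cohomologous:
  assumes c: "(\<phi>, \<psi>) \<in> cohomologous L S B A n G"
  shows "(inflate L S M B A \<phi>, inflate L S M B A \<psi>) \<in> cohomologous L S M A n G"
proof -
  from c obtain g where \<phi>\<psi>: "\<phi> \<in> cocycles L S B A n G" "\<psi> \<in> cocycles L S B A n G"
    and g: "g \<in> points_in \<Gamma> B"
    and eq: "\<And>\<sigma>. \<sigma> \<in> Aut L S B A \<Longrightarrow> \<phi> \<sigma> = inv\<^bsub>G\<^esub> g \<otimes>\<^bsub>G\<^esub> \<psi> \<sigma> \<otimes>\<^bsub>G\<^esub> map \<sigma> g"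
    unfolding cohomologous_def by blast
  have "inflate L S M B A \<phi> \<sigma> = inv\<^bsub>G\<^esub> g \<otimes>\<^bsub>G\<^esub> inflate L S M B A \<psi> \<sigma> \<otimes>\<^bsub>G\<^esub> map \<sigma> g" if s: "\<sigma> \<in> Aut L S M A" for \<sigma>
  proof -
    have gB: "set g \<subseteq> B" using g by (simp add: points_in_def)
    from eq[OF restrict_Aut[OF s normal_mcl]] show ?thesis
      unfolding restrict_map[OF gB] using s by (simp add: inflate_def)
  qed
  then show ?thesis
    using inflate_cocycle[OF \<phi>\<psi>(1)] inflate_cocycle[OF \<phi>\<psi>(2)] points_subset[OF g]
    unfolding cohomologous_def by blast
qed

text \<open>The element \<open>g\<close> making the inflated cocycles cohomologous is a point of
  G(M), which is G(mcl(A)). The equation at \<sigma> involves only its values on \<open>b\<close>,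
  \<open>b'\<close> and \<open>g\<close>, so \<sigma> may be replaced by an automorphism of
  \<open>M\<close> that agrees with it there.\<close>

lemma inflate_cohomologous_inj:
  assumes \<phi>: "\<phi> \<in> cocycles L S B A n G" and \<psi>: "\<psi> \<in> cocycles L S B A n G"
    and c: "(inflate L S M B A \<phi>, inflate L S M B A \<psi>) \<in> cohomologous L S M A n G"
  shows "(\<phi>, \<psi>) \<in> cohomologous L S B A n G"
proof -
  from c obtain g where g: "g \<in> points_in \<Gamma> B"
    and eq: "\<And>\<sigma>. \<sigma> \<in> Aut L S M A \<Longrightarrow> inflate L S M B A \<phi> \<sigma> =
      inv\<^bsub>G\<^esub> g \<otimes>\<^bsub>G\<^esub> inflate L S M B A \<psi> \<sigma> \<otimes>\<^bsub>G\<^esub> map \<sigma> g"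
    unfolding cohomologous_def points by blast
  obtain b D h where b: "set b \<subseteq> B" "\<forall>\<sigma>\<in>Aut L S B A. b @ map \<sigma> b \<in> D \<and> \<phi> \<sigma> = h (b @ map \<sigma> b)"
    using cocyclesD(4)[OF \<phi>] by blast
  obtain b' D' h' where b': "set b' \<subseteq> B" "\<forall>\<sigma>\<in>Aut L S B A. b' @ map \<sigma> b' \<in> D' \<and> \<psi> \<sigma> = h' (b' @ map \<sigma> b')"
    using cocyclesD(4)[OF \<psi>] by blast
  have gB: "set g \<subseteq> B" using g by (simp add: points_in_def)
  have "\<phi> \<sigma> = inv\<^bsub>G\<^esub> g \<otimes>\<^bsub>G\<^esub> \<psi> \<sigma> \<otimes>\<^bsub>G\<^esub> map \<sigma> g" if s: "\<sigma> \<in> Aut L S B A" for \<sigma>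
  proof -
    have sub: "set (b @ b' @ g) \<subseteq> B" using b b' gB by auto
    obtain \<tau> where \<tau>: "\<tau> \<in> Aut L S M A" "map \<tau> (b @ b' @ g) = map \<sigma> (b @ b' @ g)"
      by (rule mcl_Aut_extends[OF s sub])
    then have m: "map \<tau> b = map \<sigma> b" "map \<tau> b' = map \<sigma> b'" "map \<tau> g = map \<sigma> g" by auto
    have r: "restrict \<tau> B \<in> Aut L S B A" by (rule restrict_Aut[OF \<tau>(1) normal_mcl])
    have "\<phi> (restrict \<tau> B) = h (b @ map (restrict \<tau> B) b)" "\<psi> (restrict \<tau> B) = h' (b' @ map (restrict \<tau> B) b')"
      using b(2) b'(2) r by blast+
    then have "\<phi> (restrict \<tau> B) = \<phi> \<sigma>" "\<psi> (restrict \<tau> B) = \<psi> \<sigma>"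
      unfolding restrict_map[OF b(1)] restrict_map[OF b'(1)] m using b(2) b'(2) s by simp_all
    then show ?thesis using eq[OF \<tau>(1)] m(3) \<tau>(1) by (simp add: inflate_def)
  qed
  then show ?thesis using \<phi> \<psi> g unfolding cohomologous_def by blast
qed

text \<open>The value h(c, c') depends only on the codes \<open>f c\<close> and \<open>f c'\<close>,
  so \<open>h\<close> induces a definable function \<open>h'\<close> on codes. With
  \<open>e = f b\<close>, whose entries are in mcl(A), the cocycle becomes \<phi>(\<tau>) = h'(e,
  \<tau> e). It therefore depends only on the restriction of \<tau> to mcl(A) and is itself an
  inflation, without any change in its class.\<close>

lemma inflate_surj:
  assumes \<phi>: "\<phi> \<in> cocycles L S M A n G"
  shows "\<exists>\<psi>\<in>cocycles L S B A n G. inflate L S M B A \<psi> = \<phi>"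
proof -
  obtain b k \<Theta> h f l where b: "set b \<subseteq> M" and \<Theta>: "isolates A k \<Theta> b" and h\<Gamma>: "h ` (\<Theta> \<times> \<Theta>) \<subseteq> \<Gamma>"
    and dh: "dfn A (k + (k + n)) {c @ c' @ h (c, c') |c c'. c \<in> \<Theta> \<and> c' \<in> \<Theta>}"
    and \<phi>h': "\<forall>\<sigma>\<in>Aut L S M A. map \<sigma> b \<in> \<Theta> \<and> \<phi> \<sigma> = h (b, map \<sigma> b)"
    and hmul': "\<forall>a\<in>\<Theta>. \<forall>c\<in>\<Theta>. \<forall>c'\<in>\<Theta>. h (a, c') = h (a, c) \<otimes>\<^bsub>G\<^esub> h (c, c')"
    and f: "f ` \<Theta> \<subseteq> tuples l U" and df: "dfn A (k + l) {c @ f c |c. c \<in> \<Theta>}"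
    and fh': "\<forall>c\<in>\<Theta>. \<forall>c'\<in>\<Theta>. f c = f c' \<longleftrightarrow> h (c, c') = \<one>\<^bsub>G\<^esub>"
    and fB: "set (f b) \<subseteq> B"
    using torsor[OF normal_A AB \<phi>] .
  note \<phi>h = \<phi>h'[rule_format] and hmul = hmul'[rule_format] and fh = fh'[rule_format]
  define Hg Fg where "Hg = {c @ c' @ h (c, c') |c c'. c \<in> \<Theta> \<and> c' \<in> \<Theta>}" and "Fg = {c @ f c |c. c \<in> \<Theta>}"
  have dHg: "dfn A (k + (k + n)) Hg" and dFg: "dfn A (k + l) Fg" using dh df by (simp_all add: Hg_def Fg_def)
  have d\<Theta>: "dfn A k \<Theta>" and b\<Theta>: "b \<in> \<Theta>" using isolates_dfn[OF \<Theta>] by auto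
  have \<Theta>k: "c \<in> tuples k U" if "c \<in> \<Theta>" for c using definable_subset[OF d\<Theta>] that by blast
  have fl: "f c \<in> tuples l U" if "c \<in> \<Theta>" for c using f that by blast
  have inj: "c @ x = c' @ y \<longleftrightarrow> c = c' \<and> x = y" if "c \<in> \<Theta>" "c' \<in> \<Theta>" for c c' x y
    using append_tuples_inject[OF \<Theta>k[OF that(1)] \<Theta>k[OF that(2)]] .
  have inFg: "c @ y \<in> Fg \<longleftrightarrow> y = f c" if "c \<in> \<Theta>" for c y using that inj by (auto simp: Fg_def)
  have inHg: "c @ c' @ g \<in> Hg \<longleftrightarrow> g = h (c, c')" if "c \<in> \<Theta>" "c' \<in> \<Theta>" for c c' g
    using that inj by (auto simp: Hg_def)
  have hG: "h (c, c') \<in> \<Gamma>" if "c \<in> \<Theta>" "c' \<in> \<Theta>" for c c' using h\<Gamma> that by blast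
  have h_cong: "h (c, c') = h (d, d')" if c: "c \<in> \<Theta>" "c' \<in> \<Theta>" "d \<in> \<Theta>" "d' \<in> \<Theta>" "f c = f d" "f c' = f d'" for c c' d d'
  proof -
    have "h (c, d) = \<one>\<^bsub>G\<^esub>" "h (d', c') = \<one>\<^bsub>G\<^esub>" using fh c by metis+
    then show ?thesis
      using hmul[OF c(1,3,2)] hmul[OF c(3,4,2)] hG c by simp
  qed
  define D where "D = {f c @ f c' |c c'. c \<in> \<Theta> \<and> c' \<in> \<Theta>}"
  define h' where "h' w = (THE g. \<exists>c\<in>\<Theta>. \<exists>c'\<in>\<Theta>. w = f c @ f c' \<and> g = h (c, c'))" for w
  have finj: "f c @ f c' = f d @ f d' \<longleftrightarrow> f c = f d \<and> f c' = f d'" if "c \<in> \<Theta>" "d \<in> \<Theta>" for c c' d d'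
    using append_tuples_inject[OF fl[OF that(1)] fl[OF that(2)]] .
  have h': "h' (f c @ f c') = h (c, c')" if c: "c \<in> \<Theta>" "c' \<in> \<Theta>" for c c'
    unfolding h'_def
  proof (rule the_equality)
    show "\<exists>d\<in>\<Theta>. \<exists>d'\<in>\<Theta>. f c @ f c' = f d @ f d' \<and> h (c, c') = h (d, d')" using c by blast
    fix g assume "\<exists>d\<in>\<Theta>. \<exists>d'\<in>\<Theta>. f c @ f c' = f d @ f d' \<and> g = h (d, d')"
    then obtain d d' where d: "d \<in> \<Theta>" "d' \<in> \<Theta>" "f c @ f c' = f d @ f d'" "g = h (d, d')" by blast
    then have "f c = f d" "f c' = f d'" using finj[OF c(1) d(1)] by auto
    then show "g = h (c, c')" using h_cong[OF c d(1,2)] d(4) by simp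
  qed
  define Gr where "Gr = {w @ h' w |w. w \<in> D}"
  have inGr: "y @ y' @ g \<in> Gr \<longleftrightarrow> (\<exists>c\<in>\<Theta>. \<exists>c'\<in>\<Theta>. c @ y \<in> Fg \<and> c' @ y' \<in> Fg \<and> c @ c' @ g \<in> Hg)"
    if y: "y \<in> tuples l U" "y' \<in> tuples l U" "g \<in> tuples n U" for y y' g
  proof
    assume "y @ y' @ g \<in> Gr"
    then obtain c c' where c: "c \<in> \<Theta>" "c' \<in> \<Theta>" "y @ y' @ g = f c @ f c' @ h (c, c')"
      using h' by (auto simp: Gr_def D_def)
    then have "y = f c" "y' = f c'" "g = h (c, c')"
      using append_tuples_inject[OF y(1) fl[OF c(1)]] append_tuples_inject[OF y(2) fl[OF c(2)]] by auto
    then show "\<exists>c\<in>\<Theta>. \<exists>c'\<in>\<Theta>. c @ y \<in> Fg \<and> c' @ y' \<in> Fg \<and> c @ c' @ g \<in> Hg"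
      using c inFg inHg by blast
  next
    assume "\<exists>c\<in>\<Theta>. \<exists>c'\<in>\<Theta>. c @ y \<in> Fg \<and> c' @ y' \<in> Fg \<and> c @ c' @ g \<in> Hg"
    then obtain c c' where c: "c \<in> \<Theta>" "c' \<in> \<Theta>" "y = f c" "y' = f c'" "g = h (c, c')"
      using inFg inHg by blast
    have "(f c @ f c') @ h' (f c @ f c') \<in> Gr" unfolding Gr_def D_def using c by blast
    then show "y @ y' @ g \<in> Gr" using c h' by simp
  qed
  have GrU: "Gr \<subseteq> tuples (l + (l + n)) U"
  proof
    fix w assume "w \<in> Gr"
    then obtain c c' where c: "c \<in> \<Theta>" "c' \<in> \<Theta>" "w = f c @ f c' @ h (c, c')"
      using h' by (auto simp: Gr_def D_def)
    then show "w \<in> tuples (l + (l + n)) U" using fl carrier_tuples[OF hG] by (auto intro!: tuples_append)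
  qed
  have dGr: "dfn A (l + (l + n)) Gr"
    by (rule definable_Collect3[OF GrU refl inGr])
      (assumption+, (rule defintros defpred_mem[OF _ dFg] defpred_mem[OF _ dHg] d\<Theta> AU refl)+)
  define e where "e = f b"
  have el: "length e = l" using fl[OF b\<Theta>] by (simp add: e_def tuples_def)
  have eB: "set e \<subseteq> B" using fB by (simp add: e_def)
  have def_h': "definable_fun L S A (length e + length e) n D h'"
    unfolding definable_fun_def el
  proof (intro conjI)
    show "D \<subseteq> tuples (l + l) U" using fl by (auto simp: D_def intro!: tuples_append)
    show "h' ` D \<subseteq> tuples n U" using h' carrier_tuples[OF hG] by (auto simp: D_def)
    show "dfn A (l + l + n) {x @ h' x |x. x \<in> D}" using dGr by (simp add: Gr_def add.assoc)
  qed
  have f_Aut: "f (map \<tau> b) = map \<tau> e" if \<tau>: "\<tau> \<in> Aut L S M A" for \<tau>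
  proof -
    have sub: "set (b @ e) \<subseteq> M" using b eB BM by auto
    have "dfn A (length (b @ e)) Fg" using dFg el \<Theta>k[OF b\<Theta>] by (simp add: tuples_def)
    moreover have "b @ e \<in> Fg" using inFg[OF b\<Theta>] by (simp add: e_def)
    ultimately have "map \<tau> (b @ e) \<in> Fg" using Aut_same_type[OF \<tau> AM sub] by (auto simp: same_type_def)
    then show ?thesis using inFg \<phi>h[OF \<tau>] by simp
  qed
  have eD: "e @ map \<tau> e \<in> D \<and> \<phi> \<tau> = h' (e @ map \<tau> e)" if \<tau>: "\<tau> \<in> Aut L S M A" for \<tau>
  proof -
    have "e @ map \<tau> e = f b @ f (map \<tau> b)" using f_Aut[OF \<tau>] by (simp add: e_def)
    then show ?thesis using \<phi>h[OF \<tau>] b\<Theta> h' by (auto simp: D_def)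
  qed
  define \<psi> where "\<psi> = (\<lambda>\<sigma>\<in>Aut L S B A. h' (e @ map \<sigma> e))"
  have \<psi>\<phi>: "\<psi> \<sigma> = \<phi> \<tau>" if "\<sigma> \<in> Aut L S B A" "\<tau> \<in> Aut L S M A" "map \<tau> e = map \<sigma> e" for \<sigma> \<tau>
    using eD[OF that(2)] that by (simp add: \<psi>_def)
  have \<psi>B: "\<psi> \<sigma> \<in> points_in \<Gamma> B" if s: "\<sigma> \<in> Aut L S B A" for \<sigma>
  proof -
    obtain \<tau> where \<tau>: "\<tau> \<in> Aut L S M A" "map \<tau> e = map \<sigma> e" by (rule mcl_Aut_extends[OF s eB])
    then show ?thesis using \<psi>\<phi>[OF s \<tau>] cocyclesD(2)[OF \<phi> \<tau>(1)] points by simp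
  qed
  have "\<psi> \<in> cocycles L S B A n G" unfolding cocycles_def
  proof (intro CollectI conjI ballI)
    show "\<psi> \<in> Aut L S B A \<rightarrow>\<^sub>E points_in \<Gamma> B" using \<psi>B by (auto simp: \<psi>_def)
    fix \<sigma>1 \<sigma>2 assume s: "\<sigma>1 \<in> Aut L S B A" "\<sigma>2 \<in> Aut L S B A"
    obtain \<tau>2 where \<tau>2: "\<tau>2 \<in> Aut L S M A" "map \<tau>2 e = map \<sigma>2 e" by (rule mcl_Aut_extends[OF s(2) eB])
    \<comment> \<open>The cocycle equation applies \<sigma>1 to \<open>e\<close>, to \<sigma>2 e and
      to the value \<psi>(\<sigma>2); so \<tau>1 has to agree with \<sigma>1 on all three.\<close>
    have sub: "set (e @ map \<sigma>2 e @ \<psi> \<sigma>2) \<subseteq> B" using eB Aut_set[OF s(2) eB] \<psi>B[OF s(2)] by (auto simp: points_in_def)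
    obtain \<tau>1 where \<tau>1: "\<tau>1 \<in> Aut L S M A"
      "map \<tau>1 (e @ map \<sigma>2 e @ \<psi> \<sigma>2) = map \<sigma>1 (e @ map \<sigma>2 e @ \<psi> \<sigma>2)"
      by (rule mcl_Aut_extends[OF s(1) sub])
    then have m: "map \<tau>1 e = map \<sigma>1 e" "map \<tau>1 (map \<sigma>2 e) = map \<sigma>1 (map \<sigma>2 e)" "map \<tau>1 (\<psi> \<sigma>2) = map \<sigma>1 (\<psi> \<sigma>2)"
      by (auto simp del: map_map simp: append_eq_append_conv)
    have "map (compose M \<tau>1 \<tau>2) e = map \<tau>1 (map \<tau>2 e)" using eB BM by (auto simp: compose_def)
    also have "\<dots> = map (compose B \<sigma>1 \<sigma>2) e" using eB \<tau>2(2) m(2) by (auto simp: compose_def)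
    finally have "\<psi> (compose B \<sigma>1 \<sigma>2) = \<phi> (compose M \<tau>1 \<tau>2)"
      using \<psi>\<phi>[OF Aut_compose[OF s AB] Aut_compose[OF \<tau>1(1) \<tau>2(1) AM]] by simp
    also have "\<dots> = \<phi> \<tau>1 \<otimes>\<^bsub>G\<^esub> map \<tau>1 (\<phi> \<tau>2)" by (rule cocyclesD(3)[OF \<phi> \<tau>1(1) \<tau>2(1)])
    also have "\<dots> = \<psi> \<sigma>1 \<otimes>\<^bsub>G\<^esub> map \<sigma>1 (\<psi> \<sigma>2)"
      unfolding \<psi>\<phi>[OF s(1) \<tau>1(1) m(1)] \<psi>\<phi>[OF s(2) \<tau>2, symmetric] m(3) ..
    finally show "\<psi> (compose B \<sigma>1 \<sigma>2) = \<psi> \<sigma>1 \<otimes>\<^bsub>G\<^esub> map \<sigma>1 (\<psi> \<sigma>2)" .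
  next
    show "\<exists>b D h. set b \<subseteq> B \<and> definable_fun L S A (length b + length b) n D h \<and>
      (\<forall>\<sigma>\<in>Aut L S B A. b @ map \<sigma> b \<in> D \<and> \<psi> \<sigma> = h (b @ map \<sigma> b))"
    proof (intro exI conjI ballI)
      fix \<sigma> assume s: "\<sigma> \<in> Aut L S B A"
      obtain \<tau> where \<tau>: "\<tau> \<in> Aut L S M A" "map \<tau> e = map \<sigma> e" by (rule mcl_Aut_extends[OF s eB])
      show "e @ map \<sigma> e \<in> D" "\<psi> \<sigma> = h' (e @ map \<sigma> e)" using eD[OF \<tau>(1)] \<tau>(2) s by (simp_all add: \<psi>_def)
    qed (fact eB def_h')+
  qed
  moreover have "inflate L S M B A \<psi> = \<phi>"
  proof
    fix \<tau> show "inflate L S M B A \<psi> \<tau> = \<phi> \<tau>"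
    proof (cases "\<tau> \<in> Aut L S M A")
      case True
      then show ?thesis
        using \<psi>\<phi>[OF restrict_Aut[OF True normal_mcl] True] restrict_map[OF eB, of \<tau>] by (simp add: inflate_def)
    next
      case False
      then show ?thesis using cocyclesD(1)[OF \<phi>] by (simp add: inflate_def extensional_def)
    qed
  qed
  ultimately show ?thesis by blast
qed

lemma natural_map_bij:
  "bij_betw (natural_map L S M B A n G) (H1 L S B A n G) (H1 L S M A n G) \<and>
   natural_map L S M B A n G (trivial_class L S B A n G) = trivial_class L S M A n G"
proof -
  let ?ZB = "cocycles L S B A n G" and ?RB = "cohomologous L S B A n G"
  let ?ZM = "cocycles L S M A n G" and ?RM = "cohomologous L S M A n G"
  let ?i = "inflate L S M B A"
  have eB: "equiv ?ZB ?RB" by (rule cohomologous_equiv[OF dcl_closed_mcl order_refl AB])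
  have eM: "equiv ?ZM ?RM" by (rule cohomologous_equiv[OF dcl_closed_M order_refl AM])
  have nm: "natural_map L S M B A n G (?RB `` {\<phi>}) = ?RM `` {?i \<phi>}" if \<phi>: "\<phi> \<in> ?ZB" for \<phi>
  proof -
    have eq: "?RM `` {?i \<psi>} = ?RM `` {?i \<phi>}" if "(\<phi>, \<psi>) \<in> ?RB" for \<psi>
      using equiv_class_eq[OF eM inflate_cohomologous[OF that]] by simp
    have self: "(\<phi>, \<phi>) \<in> ?RB" using equiv_class_self[OF eB \<phi>] by blast
    show ?thesis unfolding natural_map_def
    proof (intro equalityI subsetI)
      fix \<chi> assume "\<chi> \<in> ?RM `` (?i ` (?RB `` {\<phi>}))"
      then obtain \<psi> where "(\<phi>, \<psi>) \<in> ?RB" "\<chi> \<in> ?RM `` {?i \<psi>}" by blast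
      then show "\<chi> \<in> ?RM `` {?i \<phi>}" using eq[of \<psi>] by simp
    next
      fix \<chi> assume "\<chi> \<in> ?RM `` {?i \<phi>}"
      then show "\<chi> \<in> ?RM `` (?i ` (?RB `` {\<phi>}))" using self by blast
    qed
  qed
  have "bij_betw (natural_map L S M B A n G) (H1 L S B A n G) (H1 L S M A n G)"
    unfolding H1_def
  proof (rule bij_betw_imageI)
    show "inj_on (natural_map L S M B A n G) (?ZB // ?RB)"
    proof (rule inj_onI)
      fix x y assume "x \<in> ?ZB // ?RB" "y \<in> ?ZB // ?RB"
        and eq: "natural_map L S M B A n G x = natural_map L S M B A n G y"
      then obtain \<phi> \<psi> where \<phi>: "\<phi> \<in> ?ZB" "x = ?RB `` {\<phi>}" and \<psi>: "\<psi> \<in> ?ZB" "y = ?RB `` {\<psi>}"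
        by (auto elim!: quotientE)
      have "?RM `` {?i \<phi>} = ?RM `` {?i \<psi>}" using eq nm \<phi> \<psi> by simp
      then have "(?i \<phi>, ?i \<psi>) \<in> ?RM" by (rule eq_equiv_class[OF _ eM inflate_cocycle[OF \<psi>(1)]])
      then show "x = y" using equiv_class_eq[OF eB inflate_cohomologous_inj[OF \<phi>(1) \<psi>(1)]] \<phi> \<psi> by simp
    qed
    show "natural_map L S M B A n G ` (?ZB // ?RB) = ?ZM // ?RM"
    proof (intro equalityI subsetI)
      fix z assume "z \<in> natural_map L S M B A n G ` (?ZB // ?RB)"
      then obtain \<phi> where "\<phi> \<in> ?ZB" "z = natural_map L S M B A n G (?RB `` {\<phi>})" by (auto elim!: quotientE)
      then show "z \<in> ?ZM // ?RM" using nm inflate_cocycle by (auto intro: quotientI)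
    next
      fix z assume "z \<in> ?ZM // ?RM"
      then obtain \<phi> where \<phi>: "\<phi> \<in> ?ZM" "z = ?RM `` {\<phi>}" by (auto elim!: quotientE)
      then obtain \<psi> where "\<psi> \<in> ?ZB" "?i \<psi> = \<phi>" using inflate_surj by blast
      then show "z \<in> natural_map L S M B A n G ` (?ZB // ?RB)"
        using nm[of \<psi>] \<phi> by (intro image_eqI[of _ _ "?RB `` {\<psi>}"]) (auto intro: quotientI)
    qed
  qed
  moreover have "?i (\<lambda>\<sigma>\<in>Aut L S B A. \<one>\<^bsub>G\<^esub>) = (\<lambda>\<sigma>\<in>Aut L S M A. \<one>\<^bsub>G\<^esub>)"
    using restrict_Aut[OF _ normal_mcl] by (auto simp: inflate_def)
  then have "natural_map L S M B A n G (trivial_class L S B A n G) = trivial_class L S M A n G"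
    using nm[OF trivial_cocycle[OF dcl_closed_mcl order_refl AB]] by (simp add: trivial_class_def)
  ultimately show ?thesis by blast
qed

section \<open>Galois extensions\<close>

text \<open>The parameters \<open>d\<close> from the group need not lie in \<open>M\<close>. What
  matters about them, that \<Phi> with these parameters defines \<open>x\<close> and that each is a
  certain coordinate of a point of the group, is a condition \<open>Q\<close> over \<open>M\<close>.
  A solution in \<open>M\<close> has its entries in mcl(A), hence in the image of \<gamma>, and
  \<open>x\<close> becomes definable over that image.\<close>

lemma embedding_over_mem:
  assumes b: "set b \<subseteq> M" and \<gamma>: "\<gamma> \<in> embeddings" and x: "x \<in> set b"
    and int: "x \<in> dcl L S (A \<union> coords \<Gamma> \<union> set (map \<gamma> b))"
  shows "x \<in> \<gamma> ` M"
proof -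
  define M' where "M' = \<gamma> ` M"
  have tv: "meets_definable M'" and M'U: "M' \<subseteq> U"
    using embeddings_meets_definable[OF \<gamma>] meets_definable_subset by (auto simp: M'_def)
  have AM': "A \<subseteq> M'" using AB mcl_sub_image[OF \<gamma>] by (auto simp: M'_def)
  have M'M: "M' \<subseteq> M" using \<gamma> by (auto simp: M'_def embeddings_def)
  have \<gamma>b: "set (map \<gamma> b) \<subseteq> M'" using b by (auto simp: M'_def)
  have xM: "x \<in> M" using x b by blast
  have coordsU: "coords \<Gamma> \<subseteq> U" using carrier_tuples by (auto simp: coords_def tuples_def)
  have M'G: "M' \<union> coords \<Gamma> \<subseteq> U" using M'U coordsU by blast
  have "dfn (M' \<union> coords \<Gamma>) 1 {[x]}"
    by (rule definable_mono[of L S "A \<union> coords \<Gamma> \<union> set (map \<gamma> b)"]) (use int AM' \<gamma>b in \<open>auto simp: dcl_def\<close>)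
  from definable_params[OF this M'G] obtain d \<Phi> where d: "set d \<subseteq> coords \<Gamma>"
    and \<Phi>: "dfn M' (1 + length d) \<Phi>" and x\<Phi>: "\<And>z. z \<in> tuples 1 U \<Longrightarrow> z \<in> {[x]} \<longleftrightarrow> z @ d \<in> \<Phi>" by blast
  text \<open>Each entry of \<open>d\<close> is a coordinate of a point of \<open>G\<close>; so \<open>d\<close> may be replaced by a tuple of
    coordinates of points of \<open>G(M)\<close>.\<close>
  define l where "l = length d"
  have "\<forall>y\<in>set d. \<exists>w i. w \<in> \<Gamma> \<and> i < n \<and> w ! i = y"
  proof
    fix y assume "y \<in> set d"
    then obtain w where "w \<in> \<Gamma>" "y \<in> set w" using d by (auto simp: coords_def)
    then show "\<exists>w i. w \<in> \<Gamma> \<and> i < n \<and> w ! i = y"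
      using carrier_tuples[of w] by (auto simp: in_set_conv_nth tuples_def)
  qed
  then obtain w i where wi: "\<And>y. y \<in> set d \<Longrightarrow> w y \<in> \<Gamma> \<and> i y < n \<and> w y ! i y = y" by metis
  define P where "P j = {y\<in>tuples 1 U. \<exists>g\<in>\<Gamma>. y = map ((!) g) [j]}" for j
  have dP: "dfn A 1 (P j)" if j: "j < n" for j
    unfolding P_def
    by (rule definable_Collect)
      (rule defpred_bex defpred_eq defterm_reindex defterm_fst defterm_snd defterm_id is_env_cons is_env_id
        dfn_carrier AU | simp add: j)+
  define Q where "Q = {z\<in>tuples l U. [x] @ z \<in> \<Phi> \<and> (\<forall>y\<in>tuples 1 U. y @ z \<in> \<Phi> \<longrightarrow> y = [x]) \<and>
    (\<forall>j<l. map ((!) z) [j] \<in> P (i (d ! j)))}"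
  have \<Phi>M: "dfn M (1 + l) \<Phi>" using definable_mono[OF \<Phi> M'M] by (simp add: l_def)
  have Qj: "dfn M l {z\<in>tuples l U. map ((!) z) [j] \<in> P (i (d ! j))}" if j: "j < l" for j
  proof -
    have "i (d ! j) < n" using wi j by (simp add: l_def)
    from definable_mono[OF dP[OF this] AM] have dPM: "dfn M 1 (P (i (d ! j)))" .
    show ?thesis
      by (rule definable_Collect) (rule defpred_mem[OF MU dPM] defterm_reindex defterm_id | simp add: j)+
  qed
  have xset: "set [x] \<subseteq> M" using xM by simp
  have Q0: "dfn M l {z\<in>tuples l U. [x] @ z \<in> \<Phi> \<and> (\<forall>y\<in>tuples 1 U. y @ z \<in> \<Phi> \<longrightarrow> y = [x])}"
    by (rule definable_Collect) (rule defintros defpred_mem[OF MU \<Phi>M] defpred_eq definable_UNIV MU xset | simp)+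
  have "Q = {z\<in>tuples l U. [x] @ z \<in> \<Phi> \<and> (\<forall>y\<in>tuples 1 U. y @ z \<in> \<Phi> \<longrightarrow> y = [x])} -
    \<Union>((\<lambda>j. tuples l U - {z\<in>tuples l U. map ((!) z) [j] \<in> P (i (d ! j))}) ` {..<l})"
    unfolding Q_def by auto
  moreover have "dfn M l (\<Union>((\<lambda>j. tuples l U - {z\<in>tuples l U. map ((!) z) [j] \<in> P (i (d ! j))}) ` {..<l}))"
    by (rule finite_Union_of_definables) (use Qj MU in \<open>auto intro: definable_Compl\<close>)
  ultimately have dQ: "dfn M l Q" using definable_Diff[OF Q0 _ MU] by simp
  have dU: "d \<in> tuples l U" using d coordsU by (auto simp: tuples_def l_def)
  have x1: "[x] \<in> tuples 1 U" using xM MU by (auto simp: tuples_def)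
  have "d \<in> Q" unfolding Q_def
  proof (intro CollectI conjI ballI allI impI)
    show "d \<in> tuples l U" by (rule dU)
    show "[x] @ d \<in> \<Phi>" using x\<Phi>[OF x1] by simp
    show "y = [x]" if "y \<in> tuples 1 U" "y @ d \<in> \<Phi>" for y using x\<Phi>[OF that(1)] that(2) by simp
    fix j assume j: "j < l"
    then have "d ! j \<in> set d" by (simp add: l_def)
    then show "map ((!) d) [j] \<in> P (i (d ! j))"
      using wi[of "d ! j"] d coordsU by (auto simp: P_def tuples_def intro!: bexI[of _ "w (d ! j)"])
  qed
  then have "Q \<noteq> {}" by blast
  then obtain z where z: "z \<in> Q" "set z \<subseteq> M" using meets_definable_point[OF tvM dQ order_refl] by blast
  have lz: "length z = l" using z by (simp add: Q_def tuples_def)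
  \<comment> \<open>The point of the group of which \<open>z ! j\<close> is a coordinate can be
    taken in \<open>M\<close>, as being such a point is a condition over \<open>M\<close>. Then it
    lies in G(M) = G(mcl(A)).\<close>
  have "z ! j \<in> M'" if j: "j < l" for j
  proof -
    define j' where "j' = i (d ! j)"
    have j': "j' < n" using wi j by (simp add: l_def j'_def)
    have zM: "[z ! j] \<in> tuples 1 U" "set [z ! j] \<subseteq> M" using z(2) lz j MU nth_mem by (fastforce simp: tuples_def)+
    have "[z ! j] \<in> P j'" using z(1) j by (auto simp: Q_def j'_def)
    then have ne: "{g\<in>tuples n U. g \<in> \<Gamma> \<and> [z ! j] = map ((!) g) [j']} \<noteq> {}"
      using carrier_tuples by (auto simp: P_def)
    have dM: "dfn M n \<Gamma>" by (rule definable_mono[OF dfn_carrier AM])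
    have "dfn M n {g\<in>tuples n U. g \<in> \<Gamma> \<and> [z ! j] = map ((!) g) [j']}"
      by (rule definable_Collect)
        (rule defpred_conj defpred_mem[OF MU dM] defpred_eq defterm_reindex defterm_id defterm_const is_env_id MU zM(2)
          | simp add: j')+
    from meets_definable_point[OF tvM this order_refl ne]
    obtain g where "g \<in> {g\<in>tuples n U. g \<in> \<Gamma> \<and> [z ! j] = map ((!) g) [j']}" "set g \<subseteq> M" .
    then have g: "g \<in> points_in \<Gamma> M" "z ! j = g ! j'" "length g = n" by (auto simp: points_in_def tuples_def)
    then have "set g \<subseteq> B" unfolding points by (simp add: points_in_def)
    then have "set g \<subseteq> M'" using mcl_sub_image[OF \<gamma>] by (auto simp: M'_def)
    then show ?thesis using g j' nth_mem by auto
  qed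
  then have zM': "set z \<subseteq> M'" using lz by (auto simp: in_set_conv_nth)
  have "[x] @ z \<in> \<Phi>" "\<forall>y\<in>tuples 1 U. y @ z \<in> \<Phi> \<longrightarrow> y = [x]" using z(1) by (simp_all add: Q_def)
  then have "{[x]} = {y\<in>tuples 1 U. y @ z \<in> \<Phi>}" using x1 by blast
  moreover have "dfn M' 1 {y\<in>tuples 1 U. y @ z \<in> \<Phi>}"
    by (rule definable_fiber[OF _ order_refl zM' M'U]) (use \<Phi> lz in \<open>simp add: l_def\<close>)
  ultimately have "set [x] \<subseteq> M'" using meets_definable_dcl[OF tv] by metis
  then show ?thesis by (simp add: M'_def)
qed

text \<open>For every embedding \<gamma> the tuple \<gamma> b realizes the same type over
  \<open>A\<close> as \<open>b\<close>. Strong internality then puts \<open>b\<close> into the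
  definable closure of \<open>A\<close>, the coordinates of the group and \<gamma> b, which is the
  hypothesis of \<open>embedding_over_mem\<close>.\<close>

lemma galois_extension_sub_mcl:
  assumes "galois_extension_in L S M A \<Gamma> E"
  shows "E \<subseteq> B"
proof -
  have "F \<subseteq> B" if F: "galois_extension_finite_type L S A \<Gamma> F" "F \<subseteq> M" for F
  proof -
    obtain m p b where b: "b \<in> realizations S m p" and p: "complete_type L S A m p"
      and int: "strongly_internal L S A \<Gamma> m p" and Feq: "F = dcl L S (A \<union> set b)"
      using F(1) unfolding galois_extension_finite_type_def by blast
    have bU: "b \<in> tuples m U" "realizes S p b" using b by (auto simp: realizations_def)
    have AbU: "A \<union> set b \<subseteq> U" using AU bU by (auto simp: tuples_def)
    have "x \<in> F" if "x \<in> set b" for x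
      using definable_singleton[of "[x]" "A \<union> set b" S L] that AbU by (simp add: Feq dcl_def)
    then have bM: "set b \<subseteq> M" using F(2) by blast
    have "set b \<subseteq> B" unfolding mcl_eq
    proof (intro INT_greatest subsetI)
      fix \<gamma> x assume \<gamma>: "\<gamma> \<in> embeddings" and x: "x \<in> set b"
      have g: "elementary_map L S S M \<gamma>" "\<And>a. a \<in> A \<Longrightarrow> \<gamma> a = a" using \<gamma> by (auto simp: embeddings_def)
      have st: "same_type L S A b (map \<gamma> b)" by (rule elementary_map_same_type[OF g(1) bM g(2) AM])
      have \<gamma>bU: "map \<gamma> b \<in> tuples m U"
        using same_type_tuples[OF st] bU by (simp add: tuples_def)
      have "sat S (map \<gamma> b @ c) \<phi>" if q: "(\<phi>, c) \<in> p" for \<phi> c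
      proof -
        have "(\<phi>, c) \<in> formulas_over L A m" using p q unfolding complete_type_def by blast
        then have "dfn A m {y\<in>tuples m U. sat S (y @ c) \<phi>}"
          by (auto simp: formulas_over_def intro!: definableI)
        moreover have "b \<in> {y\<in>tuples m U. sat S (y @ c) \<phi>}" using bU q by (auto simp: realizes_def)
        moreover have "length b = m" using bU by (simp add: tuples_def)
        ultimately have "map \<gamma> b \<in> {y\<in>tuples m U. sat S (y @ c) \<phi>}" using st unfolding same_type_def by blast
        then show ?thesis by simp
      qed
      then have "map \<gamma> b \<in> realizations S m p" using \<gamma>bU by (auto simp: realizations_def realizes_def)
      then have "set b \<subseteq> dcl L S (A \<union> coords \<Gamma> \<union> set (map \<gamma> b))"
        using int b unfolding strongly_internal_def by blast
      then show "x \<in> \<gamma> ` M" using embedding_over_mem[OF bM \<gamma> x] x by blast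
    qed
    then have "A \<union> set b \<subseteq> B" using AB by blast
    show "F \<subseteq> B"
    proof
      fix x assume "x \<in> F"
      then have "dfn (A \<union> set b) 1 {[x]}" by (simp add: Feq dcl_def)
      from mcl_dcl[OF definable_mono[OF this \<open>A \<union> set b \<subseteq> B\<close>]] show "x \<in> B" by simp
    qed
  qed
  then show ?thesis using assms unfolding galois_extension_in_def by blast
qed

end

theorem theorem1p10:
  fixes L :: "('f, 'r) lang"
    and T :: "('f, 'r) fm set"
    and \<kappa> :: "'k rel"
    and S :: "('f, 'r, 'm) struct"
    and A M :: "'m set"
    and n :: nat
    and G :: "'m list monoid"
  assumes "complete_theory TYPE('m) L T"
    and "totally_transcendental TYPE('m) L T"
    and "eliminates_imaginaries TYPE('m) L T"
    and "monster_model L T \<kappa> S"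
    and "A \<subseteq> univ S" and "|A| <o \<kappa>"
    and "elementary_substructure L S M"
    and "prime_over L (substruct S M) A"
    and "definable_group L S A n G"
    and "points_in (carrier G) M = points_in (carrier G) (mcl L S M A)"
  shows
    "H1 L S M (mcl L S M A) n G = {trivial_class L S M (mcl L S M A) n G} \<and>

     ((\<forall>\<phi>\<in>cocycles L S (mcl L S M A) A n G.
         inflate L S M (mcl L S M A) A \<phi> \<in> cocycles L S M A n G) \<and>
      (\<forall>(\<phi>, \<psi>)\<in>cohomologous L S (mcl L S M A) A n G.
         (inflate L S M (mcl L S M A) A \<phi>, inflate L S M (mcl L S M A) A \<psi>)
           \<in> cohomologous L S M A n G) \<and>
      bij_betw (natural_map L S M (mcl L S M A) A n G)
        (H1 L S (mcl L S M A) A n G) (H1 L S M A n G) \<and>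
      natural_map L S M (mcl L S M A) A n G (trivial_class L S (mcl L S M A) A n G)
        = trivial_class L S M A n G) \<and>

     (\<forall>E. galois_extension_in L S M A (carrier G) E \<longrightarrow> E \<subseteq> mcl L S M A)"
proof -
  interpret prime_model_group L T \<kappa> S A M n G
    by unfold_locales (fact assms)+
  show ?thesis
    using H1_mcl_trivial inflate_cocycle inflate_cohomologous natural_map_bij galois_extension_sub_mcl by blast
qed

end
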